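(* Let $v$ be a real number with $v\ge p+1$, let $\Sigma_0\in\mathcal{S}_p^+(\mathbb{R})$ and $T>0$. For $x\in\mathbb{R}$ let $\bar\eta_t(x)$ be the $\mathcal{S}_p^+(\mathbb{R})$-valued solution of $$d\bar\eta_t(x)=vf(x-t)I_p\,dt+g(x-t)\left(\sqrt{\bar\eta_t(x)}\,dW_t+dW_t'\sqrt{\bar\eta_t(x)}\right),\qquad \bar\eta_0(x)=\Sigma_0,$$ and set $u_t(x)=\bar\eta_t(x+t)$. Then $u_t(x)$ is a solution in $\mathcal{S}_p^+(\mathbb{R})$, for $t\in[0,T]$, of the SPDE $$du_t(x)=\left(\partial_xu_t(x)+vf(x)I_p\right)dt+g(x)\left(\sqrt{u_t(x)}\,dW_t+dW_t'\sqrt{u_t(x)}\right),\qquad x\in\mathbb{R},$$ with the initial condition $u_0(x)=\Sigma_0$. Furthermore, among solutions that are a semimartingale for each $x\in\mathbb{R}$ and are a.s. continuous in $(t,x)$ and $3$-times continuously differentiable in $x$, $u_t(x)$ is the unique solution in $\mathcal{S}_p^+(\mathbb{R})$ of this SPDE with this initial condition.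
   Context: $p\ge1$ is an integer, $\mathcal{S}_p^+(\mathbb{R})$ is the set of real symmetric positive definite $p\times p$ matrices, $\sqrt{\cdot}$ the positive definite square root, $X'$ the transpose. $W_t$ is a $p\times p$ Brownian matrix (independent one-dimensional Brownian motions as entries) on a filtered probability space satisfying the usual conditions; the same $W$ is used for all $x$. For the random field $\bar\eta_t(x)$ one uses the modification that is a.s. continuous in $(t,x)$ and three times continuously differentiable in $x$. A solution of the SPDE is understood in integrated form (Itô integrals) for each $x$. Fix $H\in(0,1)$, $\alpha=H-\frac12$ and $0<\varepsilon<1$. The functions $f,g:\mathbb{R}\to\mathbb{R}$ are $f=g^2$ and $$g(x)=\begin{cases}0,&x\le0;\\ \sum_{i=1}^5a_ix^{i+4},&0<x<\varepsilon;\\ \sqrt{2H}\,x^\alpha,&\varepsilon\le x\le1;\\ \sum_{i=1}^5b_i(x-2)^{i+4},&1<x<2;\\ 0,&x\ge2,\end{cases}$$ where the real constants $a_i$ (resp. $b_i$) are determined by requiring that the derivatives of orders $0,1,2,3,4$ of $\sum_{i=1}^5a_ix^{i+4}$ at $x=\varepsilon$ (resp. of $\sum_{i=1}^5b_i(x-2)^{i+4}$ at $x=1$) coincide with those of $\sqrt{2H}\,x^\alpha$. Thus $f$ and $g$ are $C^4$ with bounded derivatives of orders $0$ to $4$. *)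

theory Defs
  imports "HOL-Probability.Probability"
begin

section \<open>Positive definite matrices\<close>

definition SPD :: "(real ^ 'p ^ 'p) set" where
  "SPD = {A. transpose A = A \<and> (\<forall>x. x \<noteq> 0 \<longrightarrow> x \<bullet> (A *v x) > 0)}"

text \<open>The positive definite square root; it is used only on \<^const>\<open>SPD\<close>, where it exists
  and is unique.\<close>

definition msqrt :: "real ^ 'p ^ 'p \<Rightarrow> real ^ 'p ^ 'p" where
  "msqrt A = (THE B. B \<in> SPD \<and> B ** B = A)"


section \<open>Filtered probability spaces, Brownian motion and semimartingales\<close>

text \<open>The time axis is \<open>[0, \<infinity>)\<close>. The library locale \<^locale>\<open>filtration\<close> indexes by a
  whole type, here \<^typ>\<open>real\<close>; the \<open>\<sigma>\<close>-algebras at negative indices play no role (one may take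
  them equal to \<open>F 0\<close>). The last two assumptions together with completeness of \<open>M\<close> are the
  usual conditions.\<close>

locale filtered_prob_space_usual =
  prob_space M + complete_measure M + filtration "space M" F
  for M :: "'a measure" and F :: "real \<Rightarrow> 'a measure" +
  assumes subalg: "\<And>t. 0 \<le> t \<Longrightarrow> subalgebra M (F t)"
    and null_sets_F0: "null_sets M \<subseteq> sets (F 0)"
    and right_continuous: "\<And>t. 0 \<le> t \<Longrightarrow> (\<Inter>s\<in>{t<..}. sets (F s)) = sets (F t)"

text \<open>A matrix of independent standard Brownian motions relative to the filtration: the
  increment over \<open>[s, t]\<close> has independent \<open>N(0, t - s)\<close> entries and is (as a matrix)
  independent of \<open>F s\<close>.\<close>

definition brownian_matrix ::
  "'a measure \<Rightarrow> (real \<Rightarrow> 'a measure) \<Rightarrow> (real \<Rightarrow> 'a \<Rightarrow> real ^ 'p ^ 'p) \<Rightarrow> bool" where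
  "brownian_matrix M F W \<longleftrightarrow>
     (\<forall>t\<ge>0. W t \<in> borel_measurable (F t)) \<and>
     (AE \<omega> in M. W 0 \<omega> = 0) \<and>
     (AE \<omega> in M. continuous_on {0..} (\<lambda>t. W t \<omega>)) \<and>
     (\<forall>s t. 0 \<le> s \<longrightarrow> s < t \<longrightarrow>
        (\<forall>i j. distributed M lborel (\<lambda>\<omega>. (W t \<omega> - W s \<omega>) $ i $ j)
                 (\<lambda>x. ennreal (normal_density 0 (sqrt (t - s)) x))) \<and>
        prob_space.indep_vars M (\<lambda>_. borel) (\<lambda>(i, j) \<omega>. (W t \<omega> - W s \<omega>) $ i $ j) UNIV \<and>
        prob_space.indep_set M (sets (F s))
          (sets (vimage_algebra (space M) (\<lambda>\<omega>. W t \<omega> - W s \<omega>) borel)))"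

definition adapted_on ::
  "(real \<Rightarrow> 'a measure) \<Rightarrow> real \<Rightarrow> (real \<Rightarrow> 'a \<Rightarrow> 'b::topological_space) \<Rightarrow> bool" where
  "adapted_on F T X \<longleftrightarrow> (\<forall>t\<in>{0..T}. X t \<in> borel_measurable (F t))"

definition progressive_on ::
  "(real \<Rightarrow> 'a measure) \<Rightarrow> real \<Rightarrow> (real \<Rightarrow> 'a \<Rightarrow> real) \<Rightarrow> bool" where
  "progressive_on F T H \<longleftrightarrow>
     (\<forall>t\<in>{0..T}. (\<lambda>(s, \<omega>). H s \<omega>) \<in> borel_measurable (restrict_space borel {0..t} \<Otimes>\<^sub>M F t))"

definition cadlag_on :: "real \<Rightarrow> (real \<Rightarrow> real) \<Rightarrow> bool" where
  "cadlag_on T h \<longleftrightarrow>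
     (\<forall>t\<in>{0..<T}. (h \<longlongrightarrow> h t) (at_right t)) \<and>
     (\<forall>t\<in>{0<..T}. \<exists>l. (h \<longlongrightarrow> l) (at_left t))"

definition finite_variation_on :: "real \<Rightarrow> (real \<Rightarrow> real) \<Rightarrow> bool" where
  "finite_variation_on T h \<longleftrightarrow>
     (\<exists>C. \<forall>(n::nat) s. mono s \<longrightarrow> range s \<subseteq> {0..T} \<longrightarrow> (\<Sum>k<n. \<bar>h (s (Suc k)) - h (s k)\<bar>) \<le> C)"

definition martingale_on ::
  "'a measure \<Rightarrow> (real \<Rightarrow> 'a measure) \<Rightarrow> real \<Rightarrow> (real \<Rightarrow> 'a \<Rightarrow> real) \<Rightarrow> bool" where
  "martingale_on M F T X \<longleftrightarrow>
     adapted_on F T X \<and> (\<forall>t\<in>{0..T}. integrable M (X t)) \<and>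
     (\<forall>s t. 0 \<le> s \<longrightarrow> s \<le> t \<longrightarrow> t \<le> T \<longrightarrow> (AE \<omega> in M. real_cond_exp M (F s) (X t) \<omega> = X s \<omega>))"

definition local_martingale_on ::
  "'a measure \<Rightarrow> (real \<Rightarrow> 'a measure) \<Rightarrow> real \<Rightarrow> (real \<Rightarrow> 'a \<Rightarrow> real) \<Rightarrow> bool" where
  "local_martingale_on M F T X \<longleftrightarrow>
     adapted_on F T X \<and> (AE \<omega> in M. cadlag_on T (\<lambda>t. X t \<omega>)) \<and>
     (\<exists>\<tau> :: nat \<Rightarrow> 'a \<Rightarrow> real.
        (\<forall>n. stopping_time F (\<tau> n) \<and> (\<forall>\<omega>\<in>space M. 0 \<le> \<tau> n \<omega>)) \<and>
        (AE \<omega> in M. incseq (\<lambda>n. \<tau> n \<omega>) \<and> (\<exists>n. T \<le> \<tau> n \<omega>)) \<and>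
        (\<forall>n. martingale_on M F T (\<lambda>t \<omega>. X (min t (\<tau> n \<omega>)) \<omega> - X 0 \<omega>)))"

definition semimartingale_on ::
  "'a measure \<Rightarrow> (real \<Rightarrow> 'a measure) \<Rightarrow> real \<Rightarrow> (real \<Rightarrow> 'a \<Rightarrow> real) \<Rightarrow> bool" where
  "semimartingale_on M F T X \<longleftrightarrow>
     adapted_on F T X \<and>
     (\<exists>N A. local_martingale_on M F T N \<and> adapted_on F T A \<and>
        (AE \<omega> in M. N 0 \<omega> = 0 \<and> A 0 \<omega> = 0 \<and>
           cadlag_on T (\<lambda>t. A t \<omega>) \<and> finite_variation_on T (\<lambda>t. A t \<omega>) \<and>
           (\<forall>t\<in>{0..T}. X t \<omega> = X 0 \<omega> + N t \<omega> + A t \<omega>)))"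


section \<open>The It\^o integral\<close>

text \<open>A simple process is \<open>\<Sum>k<n. \<xi>\<^sub>k 1\<^bsub>(t\<^sub>k, t\<^sub>k\<^sub>+\<^sub>1]\<^esub>\<close> with bounded \<open>\<xi>\<^sub>k\<close> measurable at time \<open>t\<^sub>k\<close>.\<close>

definition simple_process ::
  "(real \<Rightarrow> 'a measure) \<Rightarrow> real \<Rightarrow> nat \<Rightarrow> (nat \<Rightarrow> real) \<Rightarrow> (nat \<Rightarrow> 'a \<Rightarrow> real) \<Rightarrow> bool" where
  "simple_process F T n \<tau> \<xi> \<longleftrightarrow>
     0 \<le> \<tau> 0 \<and> \<tau> n \<le> T \<and> (\<forall>k<n. \<tau> k \<le> \<tau> (Suc k)) \<and>
     (\<forall>k<n. \<xi> k \<in> borel_measurable (F (\<tau> k)) \<and> (\<exists>C. \<forall>\<omega>\<in>space (F (\<tau> k)). \<bar>\<xi> k \<omega>\<bar> \<le> C))"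

definition simple_value ::
  "nat \<Rightarrow> (nat \<Rightarrow> real) \<Rightarrow> (nat \<Rightarrow> 'a \<Rightarrow> real) \<Rightarrow> real \<Rightarrow> 'a \<Rightarrow> real" where
  "simple_value n \<tau> \<xi> s \<omega> = (\<Sum>k<n. \<xi> k \<omega> * indicator {\<tau> k<..\<tau> (Suc k)} s)"

definition simple_integral ::
  "nat \<Rightarrow> (nat \<Rightarrow> real) \<Rightarrow> (nat \<Rightarrow> 'a \<Rightarrow> real) \<Rightarrow> (real \<Rightarrow> 'a \<Rightarrow> real) \<Rightarrow> real \<Rightarrow> 'a \<Rightarrow> real" where
  "simple_integral n \<tau> \<xi> B t \<omega> =
     (\<Sum>k<n. \<xi> k \<omega> * (B (min (\<tau> (Suc k)) t) \<omega> - B (min (\<tau> k) t) \<omega>))"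

text \<open>\<open>is_ito_integral M F T B H I\<close>: the process \<open>I\<close> is (a version of) \<open>(\<integral>\<^sub>0\<^sup>t H dB)\<close> for
  \<open>t \<in> [0, T]\<close>, with \<open>B\<close> a one-dimensional Brownian motion. That is, \<open>I\<close> is adapted with a.s.
  continuous paths and is the limit in probability of the integrals of simple processes that
  converge to \<open>H\<close> in \<open>L\<^sup>2([0, T])\<close>, in probability. The limit \<open>I\<close> does not depend on the
  approximating sequence, up to indistinguishability. As the coefficients below are only controlled
  almost surely, \<open>H\<close> need only be indistinguishable from a progressively measurable process \<open>K\<close>.\<close>

definition is_ito_integral ::
  "'a measure \<Rightarrow> (real \<Rightarrow> 'a measure) \<Rightarrow> real \<Rightarrow> (real \<Rightarrow> 'a \<Rightarrow> real) \<Rightarrow>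
     (real \<Rightarrow> 'a \<Rightarrow> real) \<Rightarrow> (real \<Rightarrow> 'a \<Rightarrow> real) \<Rightarrow> bool" where
  "is_ito_integral M F T B H I \<longleftrightarrow>
     adapted_on F T I \<and> (AE \<omega> in M. continuous_on {0..T} (\<lambda>t. I t \<omega>)) \<and>
     (\<exists>K. progressive_on F T K \<and>
        (AE \<omega> in M. \<forall>s\<in>{0..T}. H s \<omega> = K s \<omega>) \<and>
        (AE \<omega> in M. (\<integral>\<^sup>+ s\<in>{0..T}. ennreal ((K s \<omega>)\<^sup>2) \<partial>lborel) < \<infinity>) \<and>
        (\<exists>n \<tau> \<xi>.
           (\<forall>m::nat. simple_process F T (n m) (\<tau> m) (\<xi> m)) \<and>
           (\<forall>e>0. (\<lambda>m. measure M {\<omega> \<in> space M. ennreal e <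
               (\<integral>\<^sup>+ s\<in>{0..T}. ennreal ((simple_value (n m) (\<tau> m) (\<xi> m) s \<omega> - K s \<omega>)\<^sup>2) \<partial>lborel)})
             \<longlonglongrightarrow> 0) \<and>
           (\<forall>t\<in>{0..T}. \<forall>e>0. (\<lambda>m. measure M {\<omega> \<in> space M.
               e < \<bar>simple_integral (n m) (\<tau> m) (\<xi> m) B t \<omega> - I t \<omega>\<bar>})
             \<longlonglongrightarrow> 0)))"

text \<open>Entrywise matrix integrals: \<open>\<integral> G dB\<close> and \<open>\<integral> dB G\<close>.\<close>

definition is_ito_integral_left ::
  "'a measure \<Rightarrow> (real \<Rightarrow> 'a measure) \<Rightarrow> real \<Rightarrow> (real \<Rightarrow> 'a \<Rightarrow> real ^ 'p ^ 'p) \<Rightarrow>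
     (real \<Rightarrow> 'a \<Rightarrow> real ^ 'p ^ 'p) \<Rightarrow> (real \<Rightarrow> 'a \<Rightarrow> real ^ 'p ^ 'p) \<Rightarrow> bool" where
  "is_ito_integral_left M F T G B I \<longleftrightarrow>
     (\<exists>J. (\<forall>i j k. is_ito_integral M F T (\<lambda>s \<omega>. B s \<omega> $ k $ j) (\<lambda>s \<omega>. G s \<omega> $ i $ k) (J i j k)) \<and>
          (AE \<omega> in M. \<forall>t\<in>{0..T}. I t \<omega> = (\<chi> i j. \<Sum>k\<in>UNIV. J i j k t \<omega>)))"

definition is_ito_integral_right ::
  "'a measure \<Rightarrow> (real \<Rightarrow> 'a measure) \<Rightarrow> real \<Rightarrow> (real \<Rightarrow> 'a \<Rightarrow> real ^ 'p ^ 'p) \<Rightarrow>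
     (real \<Rightarrow> 'a \<Rightarrow> real ^ 'p ^ 'p) \<Rightarrow> (real \<Rightarrow> 'a \<Rightarrow> real ^ 'p ^ 'p) \<Rightarrow> bool" where
  "is_ito_integral_right M F T B G I \<longleftrightarrow>
     (\<exists>J. (\<forall>i j k. is_ito_integral M F T (\<lambda>s \<omega>. B s \<omega> $ i $ k) (\<lambda>s \<omega>. G s \<omega> $ k $ j) (J i j k)) \<and>
          (AE \<omega> in M. \<forall>t\<in>{0..T}. I t \<omega> = (\<chi> i j. \<Sum>k\<in>UNIV. J i j k t \<omega>)))"


section \<open>The equations\<close>

text \<open>\<open>dX\<^sub>t = b\<^sub>t dt + h(t) (\<surd>X\<^sub>t dW\<^sub>t + dW\<^sub>t' \<surd>X\<^sub>t)\<close> on \<open>[0, T]\<close> in integrated form.\<close>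

definition solves_ito_equation ::
  "'a measure \<Rightarrow> (real \<Rightarrow> 'a measure) \<Rightarrow> real \<Rightarrow> (real \<Rightarrow> 'a \<Rightarrow> real ^ 'p ^ 'p) \<Rightarrow>
     (real \<Rightarrow> 'a \<Rightarrow> real ^ 'p ^ 'p) \<Rightarrow> (real \<Rightarrow> real) \<Rightarrow> (real \<Rightarrow> 'a \<Rightarrow> real ^ 'p ^ 'p) \<Rightarrow> bool" where
  "solves_ito_equation M F T W b h X \<longleftrightarrow>
     adapted_on F T X \<and>
     (AE \<omega> in M. set_integrable lborel {0..T} (\<lambda>s. b s \<omega>)) \<and>
     (\<exists>I J.
        is_ito_integral_left M F T (\<lambda>s \<omega>. h s *\<^sub>R msqrt (X s \<omega>)) W I \<and>
        is_ito_integral_right M F T (\<lambda>s \<omega>. transpose (W s \<omega>)) (\<lambda>s \<omega>. h s *\<^sub>R msqrt (X s \<omega>)) J \<and>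
        (AE \<omega> in M. \<forall>t\<in>{0..T}.
           X t \<omega> = X 0 \<omega> + (LINT s:{0..t}|lborel. b s \<omega>) + I t \<omega> + J t \<omega>))"

text \<open>Random fields are functions of \<open>t\<close>, \<open>x\<close> and \<open>\<omega>\<close>.\<close>

definition SPD_valued ::
  "'a measure \<Rightarrow> real \<Rightarrow> (real \<Rightarrow> real \<Rightarrow> 'a \<Rightarrow> real ^ 'p ^ 'p) \<Rightarrow> bool" where
  "SPD_valued M T u \<longleftrightarrow> (AE \<omega> in M. \<forall>t\<in>{0..T}. \<forall>x. u t x \<omega> \<in> SPD)"

definition eta_solution ::
  "'a measure \<Rightarrow> (real \<Rightarrow> 'a measure) \<Rightarrow> real \<Rightarrow> (real \<Rightarrow> 'a \<Rightarrow> real ^ 'p ^ 'p) \<Rightarrow> real \<Rightarrow>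
     (real \<Rightarrow> real) \<Rightarrow> (real \<Rightarrow> real) \<Rightarrow> real ^ 'p ^ 'p \<Rightarrow>
     (real \<Rightarrow> real \<Rightarrow> 'a \<Rightarrow> real ^ 'p ^ 'p) \<Rightarrow> bool" where
  "eta_solution M F T W v f g \<Sigma>\<^sub>0 \<eta> \<longleftrightarrow>
     SPD_valued M T \<eta> \<and>
     (\<forall>x. solves_ito_equation M F T W
            (\<lambda>t \<omega>. (v * f (x - t)) *\<^sub>R mat 1) (\<lambda>t. g (x - t)) (\<lambda>t \<omega>. \<eta> t x \<omega>) \<and>
          (AE \<omega> in M. \<eta> 0 x \<omega> = \<Sigma>\<^sub>0))"

definition spde_solution ::
  "'a measure \<Rightarrow> (real \<Rightarrow> 'a measure) \<Rightarrow> real \<Rightarrow> (real \<Rightarrow> 'a \<Rightarrow> real ^ 'p ^ 'p) \<Rightarrow> real \<Rightarrow>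
     (real \<Rightarrow> real) \<Rightarrow> (real \<Rightarrow> real) \<Rightarrow> real ^ 'p ^ 'p \<Rightarrow>
     (real \<Rightarrow> real \<Rightarrow> 'a \<Rightarrow> real ^ 'p ^ 'p) \<Rightarrow> bool" where
  "spde_solution M F T W v f g \<Sigma>\<^sub>0 u \<longleftrightarrow>
     SPD_valued M T u \<and>
     (AE \<omega> in M. \<forall>t\<in>{0..T}. \<forall>x. (\<lambda>y. u t y \<omega>) differentiable (at x)) \<and>
     (\<forall>x. solves_ito_equation M F T W
            (\<lambda>t \<omega>. vector_derivative (\<lambda>y. u t y \<omega>) (at x) + (v * f x) *\<^sub>R mat 1)
            (\<lambda>t. g x) (\<lambda>t \<omega>. u t x \<omega>) \<and>
          (AE \<omega> in M. u 0 x \<omega> = \<Sigma>\<^sub>0))"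

text \<open>The class \<open>C\<^bsup>0,3\<^esup>([0, T] \<times> \<real>)\<close>: continuous in \<open>(t, x)\<close> and three times continuously
  differentiable in \<open>x\<close>, where the \<open>x\<close>-derivatives are, as usual for this class, continuous in
  \<open>(t, x)\<close>. \<open>D k\<close> is the \<open>x\<close>-derivative of order \<open>k\<close>.\<close>

definition C03 :: "real \<Rightarrow> (real \<Rightarrow> real \<Rightarrow> 'b::real_normed_vector) \<Rightarrow> bool" where
  "C03 T \<phi> \<longleftrightarrow>
     (\<exists>D :: nat \<Rightarrow> real \<Rightarrow> real \<Rightarrow> 'b.
        (\<forall>t\<in>{0..T}. \<forall>x. D 0 t x = \<phi> t x) \<and>
        (\<forall>k<3. \<forall>t\<in>{0..T}. \<forall>x. (D k t has_vector_derivative D (Suc k) t x) (at x)) \<and>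
        (\<forall>k\<le>3. continuous_on ({0..T} \<times> UNIV) (\<lambda>(t, x). D k t x)))"

definition C03_field ::
  "'a measure \<Rightarrow> real \<Rightarrow> (real \<Rightarrow> real \<Rightarrow> 'a \<Rightarrow> 'b::real_normed_vector) \<Rightarrow> bool" where
  "C03_field M T u \<longleftrightarrow> (AE \<omega> in M. C03 T (\<lambda>t x. u t x \<omega>))"

definition regular_field ::
  "'a measure \<Rightarrow> (real \<Rightarrow> 'a measure) \<Rightarrow> real \<Rightarrow> (real \<Rightarrow> real \<Rightarrow> 'a \<Rightarrow> real ^ 'p ^ 'p) \<Rightarrow> bool" where
  "regular_field M F T u \<longleftrightarrow>
     (\<forall>x i j. semimartingale_on M F T (\<lambda>t \<omega>. u t x \<omega> $ i $ j)) \<and> C03_field M T u"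


section \<open>The coefficient functions\<close>

definition matching_coeffs :: "real \<Rightarrow> real \<Rightarrow> (nat \<Rightarrow> real) \<Rightarrow> (nat \<Rightarrow> real) \<Rightarrow> bool" where
  "matching_coeffs H \<epsilon> a b \<longleftrightarrow>
     (\<forall>m\<le>4. (deriv ^^ m) (\<lambda>x::real. \<Sum>i=1..5. a i * x ^ (i + 4)) \<epsilon> =
             (deriv ^^ m) (\<lambda>x. sqrt (2 * H) * x powr (H - 1 / 2)) \<epsilon>) \<and>
     (\<forall>m\<le>4. (deriv ^^ m) (\<lambda>x::real. \<Sum>i=1..5. b i * (x - 2) ^ (i + 4)) 1 =
             (deriv ^^ m) (\<lambda>x. sqrt (2 * H) * x powr (H - 1 / 2)) 1)"

definition g_fun :: "real \<Rightarrow> real \<Rightarrow> (nat \<Rightarrow> real) \<Rightarrow> (nat \<Rightarrow> real) \<Rightarrow> real \<Rightarrow> real" where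
  "g_fun H \<epsilon> a b x =
     (if x \<le> 0 then 0
      else if x < \<epsilon> then (\<Sum>i=1..5. a i * x ^ (i + 4))
      else if x \<le> 1 then sqrt (2 * H) * x powr (H - 1 / 2)
      else if x < 2 then (\<Sum>i=1..5. b i * (x - 2) ^ (i + 4))
      else 0)"

definition f_fun :: "real \<Rightarrow> real \<Rightarrow> (nat \<Rightarrow> real) \<Rightarrow> (nat \<Rightarrow> real) \<Rightarrow> real \<Rightarrow> real" where
  "f_fun H \<epsilon> a b x = (g_fun H \<epsilon> a b x)\<^sup>2"

end

theory Submission
  imports Defs
begin

text \<open>
  Fix a random field \<open>\<phi>\<close> each of whose sections \<open>t \<mapsto> \<phi>\<^sub>t(y)\<close> solves an Ito equation, and a line
  \<open>y = x + c t\<close>. On a uniform partition of \<open>[0, t]\<close>, each increment of \<open>s \<mapsto> \<phi>\<^sub>s(x + c s)\<close> splits into an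
  increment in time at a frozen \<open>y\<close>, given by the equation of \<open>\<phi>(y)\<close>, and an increment in space at a
  frozen time. As the mesh tends to \<open>0\<close>, the first ones sum up to the integrals of the coefficients
  along the line and the second ones to \<open>\<integral>\<^sub>0\<^sup>t c \<partial>\<^sub>x\<phi>\<^sub>s(x + c s) ds\<close>; there is no Ito correction, because the
  line is deterministic. With \<open>c = 1\<close> this turns \<open>\<eta>\<close> into a solution of the SPDE. With \<open>c = -1\<close> it turns any
  regular solution of the SPDE into a solution of the equation of \<open>\<eta>\<close>, where the transport term cancels.

  The equation of \<open>\<eta>\<close> has pathwise unique positive definite solutions: the square root is Lipschitz
  near a matrix whose least eigenvalue is bounded below, so that stopping a solution before its least
  eigenvalue gets small and Gronwall's inequality apply. Equality for all rational \<open>x\<close> extends to all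
  \<open>x\<close> by continuity.
\<close>

section \<open>Square roots of positive definite matrices\<close>

text \<open>No integrability is part of the notion of a solution: the coefficients
  \<open>msqrt (X s \<omega>)\<close> merely have continuous paths, and
  \<open>is_ito_integral\<close> is a limit in probability. So no isometry is available for the
  integrals that matter, and the tool is a tail estimate of Lenglart type, P(|Z| > c) \<le> P(sq_int
  K > \<delta>) + const \<delta> / c^2, where Z is the integral of K. It passes from simple
  integrands to limits and yields locality on events, convergence of integrals from pathwise
  convergence of integrands, and existence. Moments return after stopping, which cuts the integrand
  off at a constant; the L2 bound obtained there serves both the local martingale property and
  Gronwall's inequality. A second obstacle is that each y comes with its own integral and its own
  null set, so that y = x + c t cannot be substituted into the equation at y. The partitions use
  only countably many y, and the sums of frozen increments are evaluated twice: in probability, as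
  integrals of integrands frozen on cells, and almost surely, through the equation. Comparing the
  two limits gives the equation along the line.\<close>

lemma norm_matrix_vector_mult_le:
  fixes A :: "real ^ 'n ^ 'm"
  shows "norm (A *v x) \<le> norm A * norm x"
proof -
  have "(norm (A *v x))\<^sup>2 = (\<Sum>i\<in>UNIV. (A $ i \<bullet> x)\<^sup>2)"
    unfolding power2_norm_eq_inner inner_vec_def[of "A *v x"] by (simp add: matrix_vector_mult_def inner_vec_def power2_eq_square)
  also have "\<dots> \<le> (\<Sum>i\<in>UNIV. (norm (A $ i))\<^sup>2 * (norm x)\<^sup>2)"
    by (intro sum_mono) (simp only: power2_norm_eq_inner Cauchy_Schwarz_ineq)
  also have "\<dots> = (norm A * norm x)\<^sup>2"
    by (simp only: power_mult_distrib power2_norm_eq_inner inner_vec_def[of A A] sum_distrib_right)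
  finally show ?thesis
    by (rule power2_le_imp_le) auto
qed

text \<open>The Rayleigh quotient: for symmetric matrices this is the smallest eigenvalue. As an
  infimum of linear functions of the matrix it makes sense for every matrix without spectral theory,
  and it measures the distance from the boundary of \<open>SPD\<close>.\<close>

definition least_eigenvalue :: "real ^ 'n ^ 'n \<Rightarrow> real" where
  "least_eigenvalue A = (INF x\<in>sphere 0 1. x \<bullet> (A *v x))"

lemma quadratic_form_abs_le:
  fixes A :: "real ^ 'n ^ 'n"
  shows "\<bar>x \<bullet> (A *v x)\<bar> \<le> norm A * (norm x)\<^sup>2"
proof -
  have "\<bar>x \<bullet> (A *v x)\<bar> \<le> norm x * norm (A *v x)"
    by (rule Cauchy_Schwarz_ineq2)
  also have "\<dots> \<le> norm x * (norm A * norm x)"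
    by (intro mult_left_mono norm_matrix_vector_mult_le) auto
  finally show ?thesis by (simp add: power2_eq_square mult_ac)
qed

lemma bdd_below_quadratic_form:
  fixes A :: "real ^ 'n ^ 'n"
  shows "bdd_below ((\<lambda>x. x \<bullet> (A *v x)) ` sphere 0 1)"
proof (rule bdd_belowI2)
  fix x :: "real ^ 'n" assume "x \<in> sphere 0 1"
  then show "- norm A \<le> x \<bullet> (A *v x)"
    using quadratic_form_abs_le[of x A] by simp
qed

lemma sphere_vec_nonempty: "sphere (0 :: real ^ 'n) 1 \<noteq> {}"
  using vector_choose_size[of 1, where 'a = "real ^ 'n"] by auto

lemma least_eigenvalue_le:
  fixes A :: "real ^ 'n ^ 'n"
  shows "least_eigenvalue A * (norm x)\<^sup>2 \<le> x \<bullet> (A *v x)"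
proof (cases "x = 0")
  case False
  let ?y = "x /\<^sub>R norm x"
  have "least_eigenvalue A \<le> ?y \<bullet> (A *v ?y)"
    unfolding least_eigenvalue_def using False
    by (intro cINF_lower bdd_below_quadratic_form) auto
  also have "\<dots> = x \<bullet> (A *v x) / (norm x)\<^sup>2"
    by (simp add: matrix_vector_mult_scaleR power2_eq_square divide_simps)
  finally show ?thesis using False by (simp add: field_simps)
qed auto

text \<open>On the unit sphere each form in the infimum changes by at most
  \<open>norm (A - B)\<close>, hence so does the infimum.\<close>

lemma least_eigenvalue_lipschitz:
  fixes A B :: "real ^ 'n ^ 'n"
  shows "\<bar>least_eigenvalue A - least_eigenvalue B\<bar> \<le> norm (A - B)"
proof -
  have *: "least_eigenvalue A - norm (A - B) \<le> least_eigenvalue B" for A B :: "real ^ 'n ^ 'n"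
    unfolding least_eigenvalue_def[of B]
  proof (rule cINF_greatest[OF sphere_vec_nonempty])
    fix x :: "real ^ 'n" assume x: "x \<in> sphere 0 1"
    have "least_eigenvalue A \<le> x \<bullet> (A *v x)"
      using least_eigenvalue_le[of A x] x by simp
    moreover have "\<bar>x \<bullet> ((A - B) *v x)\<bar> \<le> norm (A - B)"
      using quadratic_form_abs_le[of x "A - B"] x by simp
    ultimately show "least_eigenvalue A - norm (A - B) \<le> x \<bullet> (B *v x)"
      by (simp add: matrix_vector_mult_diff_rdistrib inner_diff_right)
  qed
  from *[of A B] *[of B A] show ?thesis by (simp add: norm_minus_commute)
qed

lemma continuous_on_least_eigenvalue:
  "continuous_on S (least_eigenvalue :: real ^ 'n ^ 'n \<Rightarrow> real)"
proof (rule continuous_onI)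
  fix A :: "real ^ 'n ^ 'n" and e :: real assume "e > 0"
  then show "\<exists>d>0. \<forall>B\<in>S. dist B A < d \<longrightarrow> dist (least_eigenvalue B) (least_eigenvalue A) \<le> e"
    using least_eigenvalue_lipschitz by (intro exI[of _ e]) (auto simp: dist_norm dest!: less_imp_le intro: order_trans)
qed

text \<open>The form attains its minimum on the compact sphere, so pointwise positivity amounts to a
  positive lower bound. Membership in \<open>SPD\<close> becomes one quantity that can be followed
  along a path.\<close>

lemma SPD_iff: "A \<in> SPD \<longleftrightarrow> transpose A = A \<and> least_eigenvalue A > 0"
proof safe
  assume A: "A \<in> SPD"
  then show "transpose A = A" by (simp add: SPD_def)
  have "continuous_on (sphere 0 1) (\<lambda>x. x \<bullet> (A *v x))"
    by (intro continuous_intros)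
  then obtain x where x: "x \<in> sphere 0 1" "\<And>y. y \<in> sphere 0 1 \<Longrightarrow> x \<bullet> (A *v x) \<le> y \<bullet> (A *v y)"
    using continuous_attains_inf[OF compact_sphere sphere_vec_nonempty] by blast
  have "0 < x \<bullet> (A *v x)"
    using A x(1) by (cases "x = 0") (auto simp: SPD_def)
  also have "\<dots> \<le> least_eigenvalue A"
    unfolding least_eigenvalue_def by (intro cINF_greatest sphere_vec_nonempty x)
  finally show "least_eigenvalue A > 0" .
next
  assume "transpose A = A" "least_eigenvalue A > 0"
  moreover have "0 < x \<bullet> (A *v x)" if "x \<noteq> 0" for x
    by (rule less_le_trans[OF _ least_eigenvalue_le]) (use that \<open>least_eigenvalue A > 0\<close> in simp)
  ultimately show "A \<in> SPD" by (simp add: SPD_def)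
qed

lemma borel_SPD [measurable]:
  fixes S :: "(real ^ 'n ^ 'n) set"
  defines "S \<equiv> SPD"
  shows "S \<in> sets borel"
proof -
  have c: "closed {A :: real ^ 'n ^ 'n. transpose A = A}"
    unfolding transpose_def
    by (intro closed_Collect_eq continuous_intros)
  have o: "open {A :: real ^ 'n ^ 'n. 0 < least_eigenvalue A}"
    by (intro open_Collect_less continuous_on_least_eigenvalue continuous_on_const)
  have eq: "S = {A. transpose A = A} \<inter> {A. 0 < least_eigenvalue A}"
    by (auto simp: SPD_iff S_def)
  show ?thesis
    unfolding eq by (rule sets.Int[OF borel_closed[OF c] borel_open[OF o]])
qed

text \<open>The Frobenius inner product is the sum of the inner products of the columns, and left
  multiplication acts on each column by itself.\<close>

lemma inner_matrix_mult_left_ge: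
  fixes B D :: "real ^ 'n ^ 'n"
  shows "least_eigenvalue B * (norm D)\<^sup>2 \<le> D \<bullet> (B ** D)"
proof -
  have n: "(norm D)\<^sup>2 = (\<Sum>j\<in>UNIV. (norm (column j D))\<^sup>2)"
    unfolding power2_norm_eq_inner inner_vec_def
    by (subst sum.swap) (simp add: column_def)
  have "D \<bullet> (B ** D) = (\<Sum>j\<in>UNIV. column j D \<bullet> (B *v column j D))"
    unfolding inner_vec_def
    by (subst sum.swap) (simp add: column_def matrix_matrix_mult_def matrix_vector_mult_def)
  also have "\<dots> \<ge> (\<Sum>j\<in>UNIV. least_eigenvalue B * (norm (column j D))\<^sup>2)"
    by (intro sum_mono least_eigenvalue_le)
  finally show ?thesis by (simp add: n sum_distrib_left)
qed

text \<open>Transposition preserves the inner product and exchanges the two sides; symmetry of C is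
  what lets C survive it.\<close>

lemma inner_matrix_mult_right_ge:
  fixes C D :: "real ^ 'n ^ 'n"
  assumes "transpose C = C"
  shows "least_eigenvalue C * (norm D)\<^sup>2 \<le> D \<bullet> (D ** C)"
proof -
  have "transpose D \<bullet> transpose E = D \<bullet> E" for D E :: "real ^ 'n ^ 'n"
    unfolding inner_vec_def by (subst sum.swap) (simp add: transpose_def)
  from this[of D D] this[of D "D ** C"] inner_matrix_mult_left_ge[of C "transpose D"] assms
  show ?thesis by (simp add: matrix_transpose_mul power2_norm_eq_inner)
qed

text \<open>Pair the identity \<open>B ** B - C ** C = B ** (B - C) + (B - C) ** C\<close> with
  \<open>B - C\<close>. When the sum of the two eigenvalues is positive one may divide by it, which
  yields both uniqueness of the root and its local Lipschitz bound.\<close>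

lemma norm_diff_le_norm_square_diff:
  fixes B C :: "real ^ 'n ^ 'n"
  assumes "transpose C = C"
  shows "norm (B - C) * (least_eigenvalue B + least_eigenvalue C) \<le> norm (B ** B - C ** C)"
proof (cases "B = C")
  case False
  let ?D = "B - C"
  have eq: "B ** ?D + ?D ** C = B ** B - C ** C"
    by (simp add: vec_eq_iff matrix_matrix_mult_def sum.distrib[symmetric] sum_subtractf[symmetric] algebra_simps)
  have "(least_eigenvalue B + least_eigenvalue C) * (norm ?D)\<^sup>2 \<le> ?D \<bullet> (B ** ?D) + ?D \<bullet> (?D ** C)"
    using inner_matrix_mult_left_ge[of B ?D] inner_matrix_mult_right_ge[OF assms, of ?D]
    by (simp add: distrib_right)
  also have "\<dots> = ?D \<bullet> (B ** B - C ** C)"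
    by (simp only: inner_add_right[symmetric] eq)
  also have "\<dots> \<le> norm ?D * norm (B ** B - C ** C)"
    by (rule norm_cauchy_schwarz)
  finally have "norm ?D * (norm ?D * (least_eigenvalue B + least_eigenvalue C)) \<le> norm ?D * norm (B ** B - C ** C)"
    by (simp add: power2_eq_square mult_ac)
  then show ?thesis using False by simp
qed auto

lemma symmetric_matrixI:
  fixes B :: "real ^ 'n ^ 'n"
  assumes "\<And>x y. x \<bullet> (B *v y) = (B *v x) \<bullet> y"
  shows "transpose B = B"
proof -
  have "transpose B *v x = B *v x" for x
  proof (rule vector_eq_rdot[THEN iffD1], rule allI)
    fix y
    show "(transpose B *v x) \<bullet> y = (B *v x) \<bullet> y"
      using assms[of x y] by (simp add: dot_lmul_matrix)
  qed
  then show ?thesis by (simp add: matrix_eq)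
qed

text \<open>Write A = c (1 - E) and look for the root in the form sqrt c (1 - Y). The equation
  becomes Y = (E + Y^2) / 2, which Banach's fixed point theorem solves among the symmetric operators
  in a ball of radius r < 1; then 1 - Y is positive definite.\<close>

lemma SPD_sqrt_exists:
  fixes A :: "real ^ 'n ^ 'n"
  assumes "A \<in> SPD"
  shows "\<exists>B\<in>SPD. B ** B = A"
proof -
  define l where "l = least_eigenvalue A"
  define N where "N = norm A + l"
  have l: "l > 0" and sym: "transpose A = A" using assms by (auto simp: SPD_iff l_def)
  have N: "N > 0" "l \<le> N" and NA: "norm A \<le> N"
    using l by (auto simp: N_def intro: add_nonneg_pos)
  have A_sym: "x \<bullet> (A *v y) = (A *v x) \<bullet> y" for x y
    by (metis dot_lmul_matrix sym transpose_matrix_vector)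
  \<comment> \<open>The square of the operator norm of 1 - A / c is at most 1 - 2 l / c + N^2 / c^2.
    The choice c = N^2 / l minimizes this bound, and q is the minimum.\<close>
  define c where "c = N\<^sup>2 / l"
  have c: "c > 0" using l N by (simp add: c_def)
  define q where "q = 1 - l\<^sup>2 / N\<^sup>2"
  have q: "0 \<le> q" "q < 1" using l N by (auto simp: q_def power_mono divide_le_eq)
  \<comment> \<open>The smaller root of r = (sqrt q + r^2) / 2, so that the ball of radius r is
    mapped into itself; r is also the contraction constant there.\<close>
  define r where "r = 1 - sqrt (1 - sqrt q)"
  have sq: "0 \<le> sqrt q" "sqrt q < 1" using q by (auto simp: real_sqrt_lt_1_iff)
  have r: "0 \<le> r" "r < 1" "(sqrt q + r\<^sup>2) / 2 = r"
    using sq by (auto simp: r_def power2_eq_square algebra_simps add_divide_distrib diff_divide_distrib)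
  \<comment> \<open>Bounded linear maps replace matrices here because the operator norm of 1 - A / c
    is below 1, whereas its Frobenius norm need not be.\<close>
  define E where "E = Blinfun (\<lambda>x. x - (1 / c) *\<^sub>R (A *v x))"
  have "bounded_linear (\<lambda>x. x - (1 / c) *\<^sub>R (A *v x))"
    by (intro bounded_linear_sub bounded_linear_ident bounded_linear_const_scaleR matrix_vector_mul_bounded_linear)
  then have E: "blinfun_apply E x = x - (1 / c) *\<^sub>R (A *v x)" for x
    by (simp add: E_def bounded_linear_Blinfun_apply)
  have normE: "norm E \<le> sqrt q"
  proof (rule norm_blinfun_bound)
    fix x :: "real ^ 'n"
    have "(norm (blinfun_apply E x))\<^sup>2 = (norm x)\<^sup>2 - 2 / c * (x \<bullet> (A *v x)) + (norm (A *v x))\<^sup>2 / c\<^sup>2"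
      unfolding E power2_norm_eq_inner
      by (simp add: inner_diff_left inner_diff_right inner_commute power2_eq_square)
    also have "\<dots> \<le> (norm x)\<^sup>2 - 2 / c * (l * (norm x)\<^sup>2) + (N * norm x)\<^sup>2 / c\<^sup>2"
    proof (intro add_mono diff_mono mult_left_mono divide_right_mono power_mono order_refl)
      show "l * (norm x)\<^sup>2 \<le> x \<bullet> (A *v x)" unfolding l_def by (rule least_eigenvalue_le)
      show "norm (A *v x) \<le> N * norm x"
        by (rule order_trans[OF norm_matrix_vector_mult_le mult_right_mono[OF NA]]) auto
    qed (use c in auto)
    also have "\<dots> = q * (norm x)\<^sup>2"
    proof -
      have "2 / c * l = 2 * (l\<^sup>2 / N\<^sup>2)" "N\<^sup>2 / c\<^sup>2 = l\<^sup>2 / N\<^sup>2"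
        using l N by (simp_all add: c_def power2_eq_square)
      then show ?thesis
        by (simp add: q_def power_mult_distrib left_diff_distrib mult.assoc[symmetric] flip: times_divide_eq_left)
    qed
    also have "\<dots> = (sqrt q * norm x)\<^sup>2" using q by (simp add: power_mult_distrib)
    finally show "norm (blinfun_apply E x) \<le> sqrt q * norm x"
      by (rule power2_le_imp_le) (use sq in simp)
  qed (use sq in auto)
  define K where "K = {Y :: (real ^ 'n) \<Rightarrow>\<^sub>L (real ^ 'n). norm Y \<le> r \<and> (\<forall>x y. x \<bullet> blinfun_apply Y y = blinfun_apply Y x \<bullet> y)}"
  define \<Phi> where "\<Phi> Y = (1 / 2) *\<^sub>R (E + (Y o\<^sub>L Y))" for Y
  have "\<exists>!Y\<in>K. \<Phi> Y = Y"
  proof (rule Banach_fix)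
    have "K = {Y. norm Y \<le> r} \<inter> (\<Inter>x. \<Inter>y. {Y. x \<bullet> blinfun_apply Y y = blinfun_apply Y x \<bullet> y})"
      by (auto simp: K_def)
    moreover have "closed \<dots>"
      by (intro closed_Int closed_INT ballI closed_Collect_le closed_Collect_eq continuous_intros)
    ultimately show "Topological_Spaces.complete K" by (simp add: complete_eq_closed)
    have "0 \<in> K" using r by (simp add: K_def)
    then show "K \<noteq> {}" by auto
    show "0 \<le> r" "r < 1" using r by auto
    show "\<Phi> ` K \<subseteq> K"
    proof safe
      fix Y assume Y: "Y \<in> K"
      have "norm (\<Phi> Y) \<le> (1 / 2) * (norm E + norm (Y o\<^sub>L Y))"
        using norm_triangle_ineq[of E "Y o\<^sub>L Y"] by (simp add: \<Phi>_def)
      also have "\<dots> \<le> (1 / 2) * (sqrt q + norm Y * norm Y)"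
        using normE norm_blinfun_compose[of Y Y] by simp
      also have "\<dots> \<le> (1 / 2) * (sqrt q + r * r)"
        using Y r by (intro mult_left_mono add_mono mult_mono) (auto simp: K_def)
      also have "\<dots> = r" using r(3) by (simp add: power2_eq_square)
      finally have "norm (\<Phi> Y) \<le> r" .
      moreover have "x \<bullet> blinfun_apply (\<Phi> Y) y = blinfun_apply (\<Phi> Y) x \<bullet> y" for x y
        using Y A_sym[of x y]
        by (auto simp: \<Phi>_def K_def E blinfun.scaleR_left blinfun.add_left inner_add_left inner_add_right
            inner_diff_left inner_diff_right)
      ultimately show "\<Phi> Y \<in> K" by (simp add: K_def)
    qed
    show "dist (\<Phi> Y) (\<Phi> Z) \<le> r * dist Y Z" if "Y \<in> K" "Z \<in> K" for Y Z
    proof -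
      have "\<Phi> Y - \<Phi> Z = (1 / 2) *\<^sub>R ((Y o\<^sub>L (Y - Z)) + ((Y - Z) o\<^sub>L Z))"
        by (rule blinfun_eqI) (simp add: \<Phi>_def blinfun.bilinear_simps algebra_simps)
      then have "norm (\<Phi> Y - \<Phi> Z) \<le> (1 / 2) * (norm (Y o\<^sub>L (Y - Z)) + norm ((Y - Z) o\<^sub>L Z))"
        using norm_triangle_ineq[of "Y o\<^sub>L (Y - Z)" "(Y - Z) o\<^sub>L Z"] by simp
      also have "\<dots> \<le> (1 / 2) * (norm Y * norm (Y - Z) + norm (Y - Z) * norm Z)"
        by (intro mult_left_mono add_mono norm_blinfun_compose) auto
      also have "\<dots> \<le> (1 / 2) * (r * norm (Y - Z) + norm (Y - Z) * r)"
        using that by (intro mult_left_mono add_mono mult_mono) (use r in \<open>auto simp: K_def\<close>)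
      finally show ?thesis by (simp add: dist_norm)
    qed
  qed
  then obtain Y where Y: "Y \<in> K" "\<Phi> Y = Y" by auto
  define B where "B = sqrt c *\<^sub>R matrix (\<lambda>x. x - blinfun_apply Y x)"
  have "linear (\<lambda>x. x - blinfun_apply Y x)"
    by (intro bounded_linear.linear bounded_linear_sub bounded_linear_ident blinfun.bounded_linear_right)
  then have B: "B *v x = sqrt c *\<^sub>R (x - blinfun_apply Y x)" for x
    by (simp add: B_def scaleR_matrix_vector_assoc[symmetric] matrix_works linear_matrix_vector_mul_eq)
  have "transpose B = B"
    using Y(1) by (intro symmetric_matrixI) (auto simp: B K_def inner_diff_left inner_diff_right)
  moreover have "x \<bullet> (B *v x) > 0" if "x \<noteq> 0" for x
  proof -
    have "x \<bullet> blinfun_apply Y x \<le> norm x * norm (blinfun_apply Y x)" by (rule norm_cauchy_schwarz)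
    also have "\<dots> \<le> norm x * (norm Y * norm x)" by (intro mult_left_mono norm_blinfun) auto
    also have "\<dots> \<le> norm x * (r * norm x)" using Y(1) by (intro mult_left_mono mult_right_mono) (auto simp: K_def)
    also have "\<dots> = r * (norm x)\<^sup>2" by (simp add: power2_eq_square)
    also have "\<dots> < 1 * (norm x)\<^sup>2" using r that by (intro mult_strict_right_mono) auto
    finally show ?thesis using c by (simp add: B inner_diff_right power2_norm_eq_inner)
  qed
  ultimately have "B \<in> SPD" by (auto simp: SPD_def)
  moreover have "B ** B = A"
  proof -
    have Y2: "blinfun_apply Y (blinfun_apply Y x) = 2 *\<^sub>R blinfun_apply Y x - blinfun_apply E x" for x
    proof -
      have "blinfun_apply (\<Phi> Y) x = blinfun_apply Y x" using Y by simp
      then have "2 *\<^sub>R ((1 / 2) *\<^sub>R (blinfun_apply E x + blinfun_apply Y (blinfun_apply Y x))) = 2 *\<^sub>R blinfun_apply Y x"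
        by (simp add: \<Phi>_def blinfun.bilinear_simps)
      then show ?thesis by (simp add: algebra_simps)
    qed
    have "(B ** B) *v x = A *v x" for x
    proof -
      have "(B ** B) *v x = sqrt c *\<^sub>R (sqrt c *\<^sub>R (x - blinfun_apply Y x)
          - blinfun_apply Y (sqrt c *\<^sub>R (x - blinfun_apply Y x)))"
        by (simp add: matrix_vector_mul_assoc[symmetric] B)
      also have "\<dots> = (sqrt c * sqrt c) *\<^sub>R (x - blinfun_apply Y x - blinfun_apply Y (x - blinfun_apply Y x))"
        by (simp only: blinfun.scaleR_right blinfun.diff_right scaleR_diff_right scaleR_scaleR)
      also have "\<dots> = c *\<^sub>R (x - blinfun_apply Y x - (blinfun_apply Y x - blinfun_apply Y (blinfun_apply Y x)))"
        using c by (simp add: blinfun.diff_right)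
      also have "\<dots> = c *\<^sub>R (x - blinfun_apply E x)"
        unfolding Y2 by (simp add: scaleR_2)
      finally show ?thesis using c by (simp add: E)
    qed
    then show ?thesis by (simp add: matrix_eq)
  qed
  ultimately show ?thesis by auto
qed

text \<open>Uniqueness comes from \<open>norm_diff_le_norm_square_diff\<close>: equal squares force
  the roots to be equal.\<close>

lemma msqrt_SPD:
  assumes "A \<in> SPD"
  shows "msqrt A \<in> SPD" "msqrt A ** msqrt A = A"
proof -
  have "\<exists>!B. B \<in> SPD \<and> B ** B = A"
  proof (rule ex_ex1I)
    show "\<exists>B. B \<in> SPD \<and> B ** B = A" using SPD_sqrt_exists[OF assms] by auto
    fix B C assume "B \<in> SPD \<and> B ** B = A" "C \<in> SPD \<and> C ** C = A"
    then have "norm (B - C) * (least_eigenvalue B + least_eigenvalue C) \<le> 0"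
      "0 < least_eigenvalue B + least_eigenvalue C"
      using norm_diff_le_norm_square_diff[of C B] by (auto simp: SPD_iff)
    then show "B = C" by (simp add: mult_le_0_iff)
  qed
  from theI'[OF this] show "msqrt A \<in> SPD" "msqrt A ** msqrt A = A"
    by (auto simp: msqrt_def)
qed

text \<open>The Lipschitz constant involves A alone. In the uniqueness proof only one of the two
  solutions has to be kept away from the boundary of \<open>SPD\<close>.\<close>

lemma norm_msqrt_diff_le:
  assumes "A \<in> SPD" "B \<in> SPD"
  shows "norm (msqrt A - msqrt B) \<le> norm (A - B) / least_eigenvalue (msqrt A)"
proof -
  have p: "least_eigenvalue (msqrt A) > 0" "least_eigenvalue (msqrt B) > 0" "transpose (msqrt B) = msqrt B"
    using msqrt_SPD(1)[OF assms(1)] msqrt_SPD(1)[OF assms(2)] by (auto simp: SPD_iff)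
  have "norm (msqrt A - msqrt B) * least_eigenvalue (msqrt A)
      \<le> norm (msqrt A - msqrt B) * (least_eigenvalue (msqrt A) + least_eigenvalue (msqrt B))"
    using p by (intro mult_left_mono) auto
  also have "\<dots> \<le> norm (A - B)"
    using norm_diff_le_norm_square_diff[OF p(3), of "msqrt A"] assms by (simp add: msqrt_SPD)
  finally show ?thesis using p by (simp add: field_simps)
qed

lemma continuous_on_msqrt: "continuous_on SPD (msqrt :: real ^ 'n ^ 'n \<Rightarrow> _)"
proof (rule continuous_onI)
  fix A :: "real ^ 'n ^ 'n" and e :: real assume A: "A \<in> SPD" and e: "e > 0"
  have p: "least_eigenvalue (msqrt A) > 0"
    using msqrt_SPD(1)[OF A] by (auto simp: SPD_iff)
  show "\<exists>d>0. \<forall>B\<in>SPD. dist B A < d \<longrightarrow> dist (msqrt B) (msqrt A) \<le> e"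
  proof (intro exI conjI ballI impI)
    show "e * least_eigenvalue (msqrt A) > 0" using e p by simp
    fix B assume B: "B \<in> SPD" and d: "dist B A < e * least_eigenvalue (msqrt A)"
    have "dist (msqrt B) (msqrt A) \<le> norm (A - B) / least_eigenvalue (msqrt A)"
      using norm_msqrt_diff_le[OF A B] by (simp add: dist_norm norm_minus_commute)
    also have "\<dots> \<le> e" using d p by (simp add: dist_norm norm_minus_commute divide_le_eq)
    finally show "dist (msqrt B) (msqrt A) \<le> e" .
  qed
qed

lemma SPD_square:
  fixes B :: "real ^ 'n ^ 'n"
  assumes "B \<in> SPD"
  shows "B ** B \<in> SPD"
proof -
  have sym: "transpose B = B" using assms by (simp add: SPD_def)
  have "x \<bullet> ((B ** B) *v x) = (norm (B *v x))\<^sup>2" for x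
    by (metis dot_lmul_matrix matrix_vector_mul_assoc power2_norm_eq_inner sym transpose_matrix_vector)
  moreover have "B *v x \<noteq> 0" if "x \<noteq> 0" for x
    using assms that by (force simp: SPD_def)
  ultimately show ?thesis
    by (simp add: SPD_def matrix_transpose_mul sym)
qed

text \<open>Outside \<open>SPD\<close> there is no positive definite root, so \<open>msqrt\<close>
  is one unspecified constant there. Measurability on the whole space matters because solutions lie
  in \<open>SPD\<close> only almost surely.\<close>

lemma borel_measurable_msqrt [measurable]: "(msqrt :: real ^ 'n ^ 'n \<Rightarrow> _) \<in> borel_measurable borel"
proof -
  have "msqrt A = (THE B. False)" if "A \<notin> SPD" for A :: "real ^ 'n ^ 'n"
    unfolding msqrt_def using that SPD_square by (metis (no_types, lifting))
  then have "msqrt = (\<lambda>A :: real ^ 'n ^ 'n. if A \<in> SPD then indicator SPD A *\<^sub>R msqrt A else (THE B. False))"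
    by (auto simp: fun_eq_iff)
  moreover have "(\<lambda>A :: real ^ 'n ^ 'n. indicator SPD A *\<^sub>R msqrt A) \<in> borel_measurable borel"
    by (intro borel_measurable_continuous_on_indicator borel_SPD continuous_on_msqrt)
  then have "(\<lambda>A :: real ^ 'n ^ 'n. if A \<in> SPD then indicator SPD A *\<^sub>R msqrt A else (THE B. False)) \<in> borel_measurable borel"
    by (rule measurable_If) (auto intro: borel_SPD)
  ultimately show ?thesis by simp
qed

section \<open>Simple stochastic integrals\<close>

context filtered_prob_space_usual
begin

lemma subalgebra_F_mono: "s \<le> t \<Longrightarrow> subalgebra (F t) (F s)"
  using sets_F_mono by (auto simp: subalgebra_def space_F)

lemma measurable_F_mono:
  "X \<in> borel_measurable (F s) \<Longrightarrow> s \<le> t \<Longrightarrow> X \<in> borel_measurable (F t)"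
  using measurable_from_subalg[OF subalgebra_F_mono] by blast

lemma measurable_F_imp_M:
  "X \<in> borel_measurable (F t) \<Longrightarrow> 0 \<le> t \<Longrightarrow> X \<in> borel_measurable M"
  using measurable_from_subalg[OF subalg] by blast

end

text \<open>Only the first two conditional moments of the increments matter for the integral, so one locale
  covers all entries of \<open>W\<close>.\<close>

locale ito_integrator = filtered_prob_space_usual M F
  for M :: "'a measure" and F :: "real \<Rightarrow> 'a measure" +
  fixes B :: "real \<Rightarrow> 'a \<Rightarrow> real"
  assumes B_adapted: "0 \<le> t \<Longrightarrow> B t \<in> borel_measurable (F t)"
    and B_continuous: "AE \<omega> in M. continuous_on {0..} (\<lambda>t. B t \<omega>)"
    and B_increment: "0 \<le> s \<Longrightarrow> s \<le> t \<Longrightarrow> Z \<in> borel_measurable (F s) \<Longrightarrow> integrable M Z \<Longrightarrow>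
      integrable M (\<lambda>\<omega>. Z \<omega> * (B t \<omega> - B s \<omega>)) \<and>
      expectation (\<lambda>\<omega>. Z \<omega> * (B t \<omega> - B s \<omega>)) = 0"
    and B_increment_square: "0 \<le> s \<Longrightarrow> s \<le> t \<Longrightarrow> Z \<in> borel_measurable (F s) \<Longrightarrow> integrable M Z \<Longrightarrow>
      integrable M (\<lambda>\<omega>. Z \<omega> * (B t \<omega> - B s \<omega>)\<^sup>2) \<and>
      expectation (\<lambda>\<omega>. Z \<omega> * (B t \<omega> - B s \<omega>)\<^sup>2) = (t - s) * expectation Z"

text \<open>The pathwise part of Lenglart's inequality: switching the summands off once the quadratic
  variation exceeds \<open>\<delta>\<close> or the sum has left \<open>[-c, c]\<close> turns a maximum over \<open>k\<close> into a final value.\<close>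

lemma stopped_sum_exceeds:
  fixes z x d :: "nat \<Rightarrow> real" and c \<delta> :: real
  defines "S \<equiv> \<lambda>k. \<Sum>j<k. z j * x j" and "Q \<equiv> \<lambda>k. \<Sum>j<k. (z j)\<^sup>2 * d j"
  assumes d: "\<And>j. j < N \<Longrightarrow> 0 \<le> d j" and Q: "Q N \<le> \<delta>" and ex: "\<exists>k\<le>N. c < \<bar>S k\<bar>"
  shows "c < \<bar>\<Sum>j<N. (if Q (Suc j) \<le> \<delta> \<and> (\<forall>i\<in>{..j}. \<bar>S i\<bar> \<le> c) then z j else 0) * x j\<bar>"
proof -
  \<comment> \<open>The first index at which the sum leaves [-c, c]. Before K no term has been
    switched off, and from K on all of them are.\<close>
  define K where "K = (LEAST k. k \<le> N \<and> c < \<bar>S k\<bar>)"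
  have K: "K \<le> N" "c < \<bar>S K\<bar>"
    using LeastI_ex[of "\<lambda>k. k \<le> N \<and> c < \<bar>S k\<bar>"] ex by (auto simp: K_def)
  have less: "\<bar>S k\<bar> \<le> c" if "k < K" for k
    using not_less_Least[of k "\<lambda>k. k \<le> N \<and> c < \<bar>S k\<bar>"] that K(1) by (auto simp: K_def)
  have "Q (Suc j) \<le> \<delta>" if "j < N" for j
  proof -
    have "Q (Suc j) \<le> Q N"
      unfolding Q_def using that d by (intro sum_mono2) auto
    with Q show ?thesis by simp
  qed
  moreover have SK: "S K = (\<Sum>j<K. z j * x j)" by (simp add: S_def)
  ultimately have "(\<Sum>j<N. (if Q (Suc j) \<le> \<delta> \<and> (\<forall>i\<in>{..j}. \<bar>S i\<bar> \<le> c) then z j else 0) * x j) = S K"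
    unfolding SK
  proof (intro sum.mono_neutral_cong_right ballI)
    fix i assume "i \<in> {..<N} - {..<K}"
    then have "K \<in> {..i}" by auto
    with K(2) have "\<not> (\<forall>i\<in>{..i}. \<bar>S i\<bar> \<le> c)" by (meson not_le)
    then show "(if Q (Suc i) \<le> \<delta> \<and> (\<forall>i\<in>{..i}. \<bar>S i\<bar> \<le> c) then z i else 0) * x i = 0"
      by (simp only: simp_thms if_False mult_zero_left)
  next
    fix i assume "i \<in> {..<K}"
    with K(1) less have "Q (Suc i) \<le> \<delta> \<and> (\<forall>i\<in>{..i}. \<bar>S i\<bar> \<le> c)"
      using \<open>\<And>j. j < N \<Longrightarrow> Q (Suc j) \<le> \<delta>\<close> by auto
    then show "(if Q (Suc i) \<le> \<delta> \<and> (\<forall>i\<in>{..i}. \<bar>S i\<bar> \<le> c) then z i else 0) * x i = z i * x i"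
      by simp
  qed (use K in auto)
  with K show ?thesis by simp
qed

text \<open>A term that survives certifies that the full sum up to and including it is at most
  \<delta>; a term that does not survive adds nothing. The test involves \<open>Q (Suc j)\<close>,
  not \<open>Q j\<close>, because the term itself must be counted.\<close>

lemma truncated_square_sum_le:
  fixes z d :: "nat \<Rightarrow> real" and \<delta> :: real
  defines "Q \<equiv> \<lambda>k. \<Sum>j<k. (z j)\<^sup>2 * d j"
  assumes d: "\<And>j. j < N \<Longrightarrow> 0 \<le> d j" and "0 \<le> \<delta>"
  shows "(\<Sum>j<N. (if Q (Suc j) \<le> \<delta> \<and> P j then z j else 0)\<^sup>2 * d j) \<le> \<delta>"
proof -
  let ?Q = "\<lambda>k. \<Sum>j<k. (if Q (Suc j) \<le> \<delta> \<and> P j then z j else 0)\<^sup>2 * d j"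
  have le: "?Q k \<le> Q k" if "k \<le> N" for k
    unfolding Q_def using that d by (intro sum_mono) auto
  have "?Q k \<le> \<delta>" if "k \<le> N" for k
    using that
  proof (induction k)
    case (Suc k)
    then show ?case using le[of "Suc k"] by (cases "Q (Suc k) \<le> \<delta>") auto
  qed (use assms in auto)
  then show ?thesis by simp
qed

section \<open>Integrals in discrete time: isometry and maximal inequality\<close>

context ito_integrator
begin

context
  fixes \<sigma> :: "nat \<Rightarrow> real" and \<zeta> :: "nat \<Rightarrow> 'a \<Rightarrow> real" and N :: nat and C :: real
  assumes \<sigma>0: "0 \<le> \<sigma> 0" and \<sigma>: "\<And>j. j < N \<Longrightarrow> \<sigma> j \<le> \<sigma> (Suc j)"
    and \<zeta>: "\<And>j. j < N \<Longrightarrow> \<zeta> j \<in> borel_measurable (F (\<sigma> j))"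
      "\<And>j \<omega>. j < N \<Longrightarrow> \<omega> \<in> space M \<Longrightarrow> \<bar>\<zeta> j \<omega>\<bar> \<le> C"
begin

lemma grid_mono: "i \<le> j \<Longrightarrow> j \<le> N \<Longrightarrow> \<sigma> i \<le> \<sigma> j"
  by (induction rule: dec_induct) (use \<sigma> in \<open>auto intro: order_trans\<close>)

lemma grid_nonneg: "j \<le> N \<Longrightarrow> 0 \<le> \<sigma> j"
  using grid_mono[of 0 j] \<sigma>0 by auto

lemma discrete_sum_measurable:
  assumes "k \<le> N"
  shows "(\<lambda>\<omega>. \<Sum>j<k. \<zeta> j \<omega> * (B (\<sigma> (Suc j)) \<omega> - B (\<sigma> j) \<omega>)) \<in> borel_measurable (F (\<sigma> k))"
proof (intro borel_measurable_sum borel_measurable_times borel_measurable_diff)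
  fix j assume "j \<in> {..<k}"
  with assms have j: "j < N" "\<sigma> j \<le> \<sigma> k" "\<sigma> (Suc j) \<le> \<sigma> k" "0 \<le> \<sigma> j" "0 \<le> \<sigma> (Suc j)"
    by (auto intro: grid_mono grid_nonneg)
  then show "\<zeta> j \<in> borel_measurable (F (\<sigma> k))" "B (\<sigma> (Suc j)) \<in> borel_measurable (F (\<sigma> k))"
    "B (\<sigma> j) \<in> borel_measurable (F (\<sigma> k))"
    using \<zeta>(1) B_adapted measurable_F_mono by blast+
qed

text \<open>In the expanded square the cross term is an increment of B times a factor known at its
  left end, so it has mean zero by \<open>B_increment\<close>; the new square contributes the length
  of its interval by \<open>B_increment_square\<close>.\<close>

lemma discrete_isometry:
  assumes "k \<le> N"
  shows "integrable M (\<lambda>\<omega>. (\<Sum>j<k. \<zeta> j \<omega> * (B (\<sigma> (Suc j)) \<omega> - B (\<sigma> j) \<omega>))\<^sup>2) \<and>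
    expectation (\<lambda>\<omega>. (\<Sum>j<k. \<zeta> j \<omega> * (B (\<sigma> (Suc j)) \<omega> - B (\<sigma> j) \<omega>))\<^sup>2) =
      expectation (\<lambda>\<omega>. \<Sum>j<k. (\<zeta> j \<omega>)\<^sup>2 * (\<sigma> (Suc j) - \<sigma> j))"
  using assms
proof (induction k)
  case (Suc k)
  define S where "S = (\<lambda>\<omega>. \<Sum>j<k. \<zeta> j \<omega> * (B (\<sigma> (Suc j)) \<omega> - B (\<sigma> j) \<omega>))"
  have k: "k < N" "0 \<le> \<sigma> k" "\<sigma> k \<le> \<sigma> (Suc k)" using Suc grid_nonneg[of k] \<sigma> by auto
  have S_meas: "S \<in> borel_measurable (F (\<sigma> k))"
    unfolding S_def using k by (intro discrete_sum_measurable) auto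
  note [measurable] = measurable_F_imp_M[OF S_meas k(2)] measurable_F_imp_M[OF \<zeta>(1)[OF k(1)] k(2)]
  have S2: "integrable M (\<lambda>\<omega>. (S \<omega>)\<^sup>2)"
    and ES: "expectation (\<lambda>\<omega>. (S \<omega>)\<^sup>2) = expectation (\<lambda>\<omega>. \<Sum>j<k. (\<zeta> j \<omega>)\<^sup>2 * (\<sigma> (Suc j) - \<sigma> j))"
    using Suc by (auto simp: S_def)
  have zsq: "integrable M (\<lambda>\<omega>. (\<zeta> j \<omega>)\<^sup>2)" if "j \<le> k" for j
  proof (rule integrable_const_bound[where B = "C\<^sup>2"])
    show "AE \<omega> in M. norm ((\<zeta> j \<omega>)\<^sup>2) \<le> C\<^sup>2"
      using \<zeta>(2)[of j] that k by (intro AE_I2) (auto simp: abs_le_square_iff[symmetric] intro!: power_mono[of "\<bar>_\<bar>", simplified] order_trans[OF _ abs_ge_self])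
    show "(\<lambda>\<omega>. (\<zeta> j \<omega>)\<^sup>2) \<in> borel_measurable M"
      using that k by (intro borel_measurable_power measurable_F_imp_M[OF \<zeta>(1)] grid_nonneg) auto
  qed
  have Sz: "integrable M (\<lambda>\<omega>. S \<omega> * \<zeta> k \<omega>)"
  proof (rule Bochner_Integration.integrable_bound)
    show "integrable M (\<lambda>\<omega>. C * S \<omega>)"
      using square_integrable_imp_integrable[OF _ S2] by simp
    show "AE \<omega> in M. norm (S \<omega> * \<zeta> k \<omega>) \<le> norm (C * S \<omega>)"
    proof (rule AE_I2)
      fix \<omega> assume "\<omega> \<in> space M"
      then have "\<bar>\<zeta> k \<omega>\<bar> \<le> \<bar>C\<bar>" using \<zeta>(2)[OF k(1)] by force
      then show "norm (S \<omega> * \<zeta> k \<omega>) \<le> norm (C * S \<omega>)"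
        by (subst mult.commute[of C]) (simp add: abs_mult mult_left_mono)
    qed
  qed simp
  have X1: "integrable M (\<lambda>\<omega>. S \<omega> * \<zeta> k \<omega> * (B (\<sigma> (Suc k)) \<omega> - B (\<sigma> k) \<omega>))"
    "expectation (\<lambda>\<omega>. S \<omega> * \<zeta> k \<omega> * (B (\<sigma> (Suc k)) \<omega> - B (\<sigma> k) \<omega>)) = 0"
    using B_increment[OF k(2,3) borel_measurable_times[OF S_meas \<zeta>(1)[OF k(1)]] Sz] by auto
  have X2: "integrable M (\<lambda>\<omega>. (\<zeta> k \<omega>)\<^sup>2 * (B (\<sigma> (Suc k)) \<omega> - B (\<sigma> k) \<omega>)\<^sup>2)"
    "expectation (\<lambda>\<omega>. (\<zeta> k \<omega>)\<^sup>2 * (B (\<sigma> (Suc k)) \<omega> - B (\<sigma> k) \<omega>)\<^sup>2) = (\<sigma> (Suc k) - \<sigma> k) * expectation (\<lambda>\<omega>. (\<zeta> k \<omega>)\<^sup>2)"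
    using B_increment_square[OF k(2,3) borel_measurable_power[OF \<zeta>(1)[OF k(1)]] zsq[OF order_refl]] by auto
  have eq: "(\<lambda>\<omega>. (\<Sum>j<Suc k. \<zeta> j \<omega> * (B (\<sigma> (Suc j)) \<omega> - B (\<sigma> j) \<omega>))\<^sup>2) =
    (\<lambda>\<omega>. (S \<omega>)\<^sup>2 + 2 * (S \<omega> * \<zeta> k \<omega> * (B (\<sigma> (Suc k)) \<omega> - B (\<sigma> k) \<omega>)) + (\<zeta> k \<omega>)\<^sup>2 * (B (\<sigma> (Suc k)) \<omega> - B (\<sigma> k) \<omega>)\<^sup>2)"
    by (auto simp: S_def power2_sum power_mult_distrib mult_ac)
  have "integrable M (\<lambda>\<omega>. \<Sum>j<k. (\<zeta> j \<omega>)\<^sup>2 * (\<sigma> (Suc j) - \<sigma> j))"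
    using zsq by (intro Bochner_Integration.integrable_sum integrable_mult_left) auto
  then have E_Suc: "expectation (\<lambda>\<omega>. \<Sum>j<Suc k. (\<zeta> j \<omega>)\<^sup>2 * (\<sigma> (Suc j) - \<sigma> j)) =
      expectation (\<lambda>\<omega>. \<Sum>j<k. (\<zeta> j \<omega>)\<^sup>2 * (\<sigma> (Suc j) - \<sigma> j)) + (\<sigma> (Suc k) - \<sigma> k) * expectation (\<lambda>\<omega>. (\<zeta> k \<omega>)\<^sup>2)"
    unfolding sum.lessThan_Suc using zsq[of k]
    by (subst Bochner_Integration.integral_add) (auto simp: mult.commute)
  show ?case
    unfolding eq using S2 X1 X2 ES E_Suc by simp
qed simp

text \<open>Lenglart's inequality: the switched-off integrand \<zeta>' has square sum at most
  \<delta>, so Chebyshev's inequality for its final sum gives a bound free of C. The event A is an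
  arbitrary one; it enters through inclusions of events and later provides locality.\<close>

lemma discrete_maximal_inequality:
  assumes "0 < c" "0 \<le> \<delta>" and A: "A \<in> sets M"
  shows "prob (A \<inter> {\<omega> \<in> space M. \<exists>k\<le>N. c < \<bar>\<Sum>j<k. \<zeta> j \<omega> * (B (\<sigma> (Suc j)) \<omega> - B (\<sigma> j) \<omega>)\<bar>})
    \<le> prob (A \<inter> {\<omega> \<in> space M. \<delta> < (\<Sum>j<N. (\<zeta> j \<omega>)\<^sup>2 * (\<sigma> (Suc j) - \<sigma> j))}) + \<delta> / c\<^sup>2"
proof -
  define S where "S = (\<lambda>k \<omega>. \<Sum>j<k. \<zeta> j \<omega> * (B (\<sigma> (Suc j)) \<omega> - B (\<sigma> j) \<omega>))"
  define Q where "Q = (\<lambda>k \<omega>. \<Sum>j<k. (\<zeta> j \<omega>)\<^sup>2 * (\<sigma> (Suc j) - \<sigma> j))"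
  \<comment> \<open>\<open>Q (Suc j)\<close> contains \<zeta> only up to index j, and the sums
    \<open>S i\<close> with i \<le> j are known at \<open>\<sigma> j\<close>. So
    \<open>\<zeta>' j\<close> is still measurable at the left end of its interval.\<close>
  define \<zeta>' where "\<zeta>' = (\<lambda>j \<omega>. if Q (Suc j) \<omega> \<le> \<delta> \<and> (\<forall>i\<in>{..j}. \<bar>S i \<omega>\<bar> \<le> c) then \<zeta> j \<omega> else 0)"
  have \<zeta>'_meas: "\<zeta>' j \<in> borel_measurable (F (\<sigma> j))" if j: "j < N" for j
    unfolding \<zeta>'_def
  proof (rule measurable_If)
    have S: "S i \<in> borel_measurable (F (\<sigma> j))" if "i \<in> {..j}" for i
      unfolding S_def using that j
      by (intro measurable_F_mono[OF discrete_sum_measurable] grid_mono) auto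
    have Q: "Q (Suc j) \<in> borel_measurable (F (\<sigma> j))"
      unfolding Q_def using j
      by (intro borel_measurable_sum borel_measurable_times borel_measurable_power borel_measurable_const
          measurable_F_mono[OF \<zeta>(1)] grid_mono) auto
    have "{\<omega> \<in> space (F (\<sigma> j)). \<forall>i\<in>{..j}. \<bar>S i \<omega>\<bar> \<le> c} \<in> sets (F (\<sigma> j))"
    proof (rule sets.sets_Collect_finite_All)
      fix i assume "i \<in> {..j}"
      from S[OF this] show "{\<omega> \<in> space (F (\<sigma> j)). \<bar>S i \<omega>\<bar> \<le> c} \<in> sets (F (\<sigma> j))"
        by measurable
    qed simp
    moreover have "{\<omega> \<in> space (F (\<sigma> j)). Q (Suc j) \<omega> \<le> \<delta>} \<in> sets (F (\<sigma> j))"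
      using Q by measurable
    ultimately show "{\<omega> \<in> space (F (\<sigma> j)). Q (Suc j) \<omega> \<le> \<delta> \<and> (\<forall>i\<in>{..j}. \<bar>S i \<omega>\<bar> \<le> c)} \<in> sets (F (\<sigma> j))"
      by (intro sets.sets_Collect_conj)
  qed (use \<zeta>(1) j in auto)
  have \<zeta>'_bound: "\<bar>\<zeta>' j \<omega>\<bar> \<le> \<bar>C\<bar>" if "j < N" "\<omega> \<in> space M" for j \<omega>
    using \<zeta>(2)[OF that] by (auto simp: \<zeta>'_def)
  define S' where "S' = (\<lambda>\<omega>. \<Sum>j<N. \<zeta>' j \<omega> * (B (\<sigma> (Suc j)) \<omega> - B (\<sigma> j) \<omega>))"
  \<comment> \<open>Within this context \<open>discrete_isometry\<close> speaks of \<zeta>; the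
    qualified name makes it available for \<zeta>'.\<close>
  note d = ito_integrator.discrete_isometry[OF ito_integrator_axioms, of \<sigma> N \<zeta>', OF \<sigma>0 \<sigma> \<zeta>'_meas \<zeta>'_bound order_refl]
  have S'_meas: "S' \<in> borel_measurable M"
    unfolding S'_def using ito_integrator.discrete_sum_measurable[OF ito_integrator_axioms, of \<sigma> N \<zeta>', OF \<sigma>0 \<sigma> \<zeta>'_meas \<zeta>'_bound order_refl]
    by (rule measurable_F_imp_M) (auto intro: grid_nonneg)
  have \<zeta>'_sq: "integrable M (\<lambda>\<omega>. (\<zeta>' j \<omega>)\<^sup>2)" if j: "j < N" for j
  proof (rule integrable_const_bound[where B = "\<bar>C\<bar>\<^sup>2"])
    show "AE \<omega> in M. norm ((\<zeta>' j \<omega>)\<^sup>2) \<le> \<bar>C\<bar>\<^sup>2"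
      using \<zeta>'_bound[of j] j by (intro AE_I2) (simp add: abs_le_square_iff)
    show "(\<lambda>\<omega>. (\<zeta>' j \<omega>)\<^sup>2) \<in> borel_measurable M"
      using j by (intro borel_measurable_power measurable_F_imp_M[OF \<zeta>'_meas] grid_nonneg) auto
  qed
  have "expectation (\<lambda>\<omega>. \<Sum>j<N. (\<zeta>' j \<omega>)\<^sup>2 * (\<sigma> (Suc j) - \<sigma> j)) \<le> expectation (\<lambda>\<omega>. \<delta>)"
  proof (rule integral_mono)
    show "integrable M (\<lambda>\<omega>. \<Sum>j<N. (\<zeta>' j \<omega>)\<^sup>2 * (\<sigma> (Suc j) - \<sigma> j))"
      using \<zeta>'_sq by (auto intro!: Bochner_Integration.integrable_sum integrable_mult_left)
    fix \<omega>
    show "(\<Sum>j<N. (\<zeta>' j \<omega>)\<^sup>2 * (\<sigma> (Suc j) - \<sigma> j)) \<le> \<delta>"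
      unfolding \<zeta>'_def Q_def using assms \<sigma> by (intro truncated_square_sum_le) auto
  qed auto
  then have ES': "expectation (\<lambda>\<omega>. (S' \<omega>)\<^sup>2) \<le> \<delta>" using d by (simp add: prob_space S'_def)
  have S'_sq: "integrable M (\<lambda>\<omega>. (S' \<omega>)\<^sup>2)" using d by (simp add: S'_def)
  have meas_Q: "Q N \<in> borel_measurable M"
    unfolding Q_def
    by (intro borel_measurable_sum borel_measurable_times borel_measurable_power borel_measurable_const
        measurable_F_imp_M[OF \<zeta>(1)] grid_nonneg) auto
  note [measurable] = A meas_Q S'_meas
  have "prob (A \<inter> {\<omega> \<in> space M. \<exists>k\<le>N. c < \<bar>S k \<omega>\<bar>})
      \<le> prob ((A \<inter> {\<omega> \<in> space M. \<delta> < Q N \<omega>}) \<union> {\<omega> \<in> space M. c \<le> \<bar>S' \<omega>\<bar>})"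
  proof (rule finite_measure_mono)
    show "A \<inter> {\<omega> \<in> space M. \<exists>k\<le>N. c < \<bar>S k \<omega>\<bar>} \<subseteq> (A \<inter> {\<omega> \<in> space M. \<delta> < Q N \<omega>}) \<union> {\<omega> \<in> space M. c \<le> \<bar>S' \<omega>\<bar>}"
    proof safe
      fix \<omega> k assume *: "\<omega> \<in> A" "\<omega> \<in> space M" "k \<le> N" "c < \<bar>S k \<omega>\<bar>" "\<not> c \<le> \<bar>S' \<omega>\<bar>"
      show "\<delta> < Q N \<omega>"
      proof (rule ccontr)
        assume "\<not> \<delta> < Q N \<omega>"
        with * have "c < \<bar>S' \<omega>\<bar>"
          unfolding S'_def \<zeta>'_def S_def Q_def
          by (intro stopped_sum_exceeds) (auto simp: \<sigma>)
        with * show False by simp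
      qed
    qed
    show "(A \<inter> {\<omega> \<in> space M. \<delta> < Q N \<omega>}) \<union> {\<omega> \<in> space M. c \<le> \<bar>S' \<omega>\<bar>} \<in> events"
      by auto
  qed
  also have "\<dots> \<le> prob (A \<inter> {\<omega> \<in> space M. \<delta> < Q N \<omega>}) + prob {\<omega> \<in> space M. c \<le> \<bar>S' \<omega>\<bar>}"
    by (rule measure_Un_le) auto
  also have "prob {\<omega> \<in> space M. c \<le> \<bar>S' \<omega>\<bar>} \<le> expectation (\<lambda>\<omega>. (S' \<omega>)\<^sup>2) / c\<^sup>2"
    using S'_meas S'_sq assms by (intro second_moment_method) auto
  also have "\<dots> \<le> \<delta> / c\<^sup>2"
    using ES' by (intro divide_right_mono) auto
  finally show ?thesis by (simp add: S_def Q_def)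
qed

end

section \<open>Simple integrands and their integrals\<close>

text \<open>Simple integrands paired with their integrals. The intervals may overlap, in contrast to
  \<open>simple_process\<close>, which makes closure under sums immediate.\<close>

inductive elem :: "(real \<Rightarrow> 'a \<Rightarrow> real) \<Rightarrow> (real \<Rightarrow> 'a \<Rightarrow> real) \<Rightarrow> bool" where
  elem_zero: "elem (\<lambda>s \<omega>. 0) (\<lambda>t \<omega>. 0)"
| elem_step: "elem H S \<Longrightarrow> 0 \<le> a \<Longrightarrow> a \<le> b \<Longrightarrow> \<xi> \<in> borel_measurable (F a) \<Longrightarrow>
    (\<And>\<omega>. \<omega> \<in> space M \<Longrightarrow> \<bar>\<xi> \<omega>\<bar> \<le> C) \<Longrightarrow>
    elem (\<lambda>s \<omega>. H s \<omega> + \<xi> \<omega> * indicator {a<..b} s)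
         (\<lambda>t \<omega>. S t \<omega> + \<xi> \<omega> * (B (min b t) \<omega> - B (min a t) \<omega>))"

lemma elem_step':
  assumes "elem H S" "0 \<le> a" "a \<le> b" "\<xi> \<in> borel_measurable (F a)" "\<And>\<omega>. \<omega> \<in> space M \<Longrightarrow> \<bar>\<xi> \<omega>\<bar> \<le> C"
    "\<And>s \<omega>. H' s \<omega> = H s \<omega> + \<xi> \<omega> * indicator {a<..b} s"
    "\<And>t \<omega>. S' t \<omega> = S t \<omega> + \<xi> \<omega> * (B (min b t) \<omega> - B (min a t) \<omega>)"
  shows "elem H' S'"
proof -
  have "H' = (\<lambda>s \<omega>. H s \<omega> + \<xi> \<omega> * indicator {a<..b} s)"
    "S' = (\<lambda>t \<omega>. S t \<omega> + \<xi> \<omega> * (B (min b t) \<omega> - B (min a t) \<omega>))"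
    using assms(6,7) by (auto simp: fun_eq_iff)
  with elem_step[OF assms(1-5)] show ?thesis by simp
qed

lemma elem_add:
  assumes "elem H S" "elem H' S'"
  shows "elem (\<lambda>s \<omega>. H s \<omega> + H' s \<omega>) (\<lambda>t \<omega>. S t \<omega> + S' t \<omega>)"
  using assms(2)
proof induction
  case elem_zero
  then show ?case using assms(1) by simp
next
  case (elem_step H' S' a b \<xi> C)
  then show ?case
    by (intro elem_step'[OF elem_step.IH, of a b \<xi> C]) auto
qed

lemma elem_uminus:
  assumes "elem H S"
  shows "elem (\<lambda>s \<omega>. - H s \<omega>) (\<lambda>t \<omega>. - S t \<omega>)"
  using assms
proof induction
  case elem_zero
  then show ?case using elem.elem_zero by simp
next
  case (elem_step H S a b \<xi> C)
  then show ?case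
    by (intro elem_step'[OF elem_step.IH, of a b "\<lambda>\<omega>. - \<xi> \<omega>" C]) (auto simp: algebra_simps)
qed

lemma elem_diff:
  assumes "elem H S" "elem H' S'"
  shows "elem (\<lambda>s \<omega>. H s \<omega> - H' s \<omega>) (\<lambda>t \<omega>. S t \<omega> - S' t \<omega>)"
  using elem_add[OF assms(1) elem_uminus[OF assms(2)]] by simp

text \<open>Each interval of the sum is intersected with (a, b], and its value stays measurable at
  the later left end. In this way increments of an integral become integrals themselves.\<close>

lemma elem_restrict:
  assumes "elem H S" "0 \<le> a" "a \<le> b"
  shows "elem (\<lambda>s \<omega>. H s \<omega> * indicator {a<..b} s) (\<lambda>t \<omega>. S (min b t) \<omega> - S (min a t) \<omega>)"
  using assms(1)
proof induction
  case elem_zero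
  then show ?case using elem.elem_zero by simp
next
  case (elem_step H S a' b' \<xi> C)
  \<comment> \<open>The outer maximum turns an empty intersection into a degenerate interval at
    \<open>?a\<close>, which keeps the step rule applicable.\<close>
  let ?a = "max a a'" and ?b = "max (max a a') (min b b')"
  show ?case
  proof (rule elem_step'[OF elem_step.IH, of ?a ?b \<xi> C])
    show "\<xi> \<in> borel_measurable (F ?a)"
      by (rule measurable_F_mono[OF elem_step.hyps(4)]) simp
    have "indicator {a'<..b'} s * indicator {a<..b} s = (indicator {?a<..?b} s :: real)" for s
      by (auto simp: indicator_def)
    then show "(H s \<omega> + \<xi> \<omega> * indicator {a'<..b'} s) * indicator {a<..b} s =
        H s \<omega> * indicator {a<..b} s + \<xi> \<omega> * indicator {?a<..?b} s" for s \<omega>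
      by (simp add: distrib_right mult.assoc)
    \<comment> \<open>If the two intervals are disjoint, both sides are 0; otherwise
      \<open>?b\<close> is \<open>min b b'\<close> and the increments match end by end.\<close>
    have "(B (min b' (min b t)) \<omega> - B (min a' (min b t)) \<omega>) - (B (min b' (min a t)) \<omega> - B (min a' (min a t)) \<omega>)
        = B (min ?b t) \<omega> - B (min ?a t) \<omega>" for t \<omega>
    proof -
      consider "b' \<le> a" | "b \<le> a'" | "a < b'" "a' < b" by linarith
      then show ?thesis
      proof cases
        case 1
        then have "min b' b = b'" "min b' a = b'" "min a' b = a'" "min a' a = a'" "min b b' = b'" "b' \<le> max a a'"
          using \<open>a \<le> b\<close> \<open>a' \<le> b'\<close> by (simp_all add: min_def)
        then show ?thesis by (simp add: min.assoc[symmetric] max_absorb1)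
      next
        case 2
        then have "min b' b = b" "min b' a = a" "min a' b = b" "min a' a = a" "min b b' = b" "b \<le> max a a'"
          using \<open>a \<le> b\<close> \<open>a' \<le> b'\<close> by (simp_all add: min_def)
        then show ?thesis by (simp add: min.assoc[symmetric] max_absorb1)
      next
        case 3
        then have "max a a' \<le> min b b'" "min b' a = a" "min a' b = a'"
          using \<open>a \<le> b\<close> \<open>a' \<le> b'\<close> by simp_all
        then have "?b = min b b'" "min b' (min a t) = min a t" "min a' (min b t) = min a' t"
          by (simp_all add: min.assoc[symmetric] max_absorb2)
        moreover have "min b' (min b t) = min (min b b') t" by (simp add: ac_simps)
        moreover have "B (min a t) \<omega> - B (min a' (min a t)) \<omega> = B (min (max a a') t) \<omega> - B (min a' t) \<omega>"
        proof (cases "a \<le> a'")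
          case True
          then have "max a a' = a'" "min a' (min a t) = min a t" by (simp_all add: min.assoc[symmetric] min_absorb2)
          then show ?thesis by simp
        next
          case False
          then have "max a a' = a" "min a' (min a t) = min a' t" by (simp_all add: min.assoc[symmetric] min_absorb1)
          then show ?thesis by simp
        qed
        ultimately show ?thesis by simp
      qed
    qed
    then show "S (min b t) \<omega> + \<xi> \<omega> * (B (min b' (min b t)) \<omega> - B (min a' (min b t)) \<omega>) -
        (S (min a t) \<omega> + \<xi> \<omega> * (B (min b' (min a t)) \<omega> - B (min a' (min a t)) \<omega>)) =
      S (min b t) \<omega> - S (min a t) \<omega> + \<xi> \<omega> * (B (min ?b t) \<omega> - B (min ?a t) \<omega>)" for t \<omega>
      by (metis (no_types, opaque_lifting) add_diff_add right_diff_distrib)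
  qed (use elem_step.hyps assms in auto)
qed

lemma elem_at_zero: "elem H S \<Longrightarrow> S 0 \<omega> = 0"
  by (induction rule: elem.induct) (simp_all add: min_absorb2)

lemma elem_simple:
  assumes "simple_process F T n \<tau> \<xi>"
  shows "elem (simple_value n \<tau> \<xi>) (simple_integral n \<tau> \<xi> B)"
proof -
  have "elem (simple_value k \<tau> \<xi>) (simple_integral k \<tau> \<xi> B) \<and> 0 \<le> \<tau> k" if "k \<le> n" for k
    using that
  proof (induction k)
    case 0
    have "simple_value 0 \<tau> \<xi> = (\<lambda>s \<omega>. 0)" "simple_integral 0 \<tau> \<xi> B = (\<lambda>t \<omega>. 0)"
      by (auto simp: fun_eq_iff simple_value_def simple_integral_def)
    then show ?case using elem_zero assms by (simp add: simple_process_def)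
  next
    case (Suc k)
    then have k: "\<tau> k \<le> \<tau> (Suc k)" "\<xi> k \<in> borel_measurable (F (\<tau> k))"
      and "\<exists>C. \<forall>\<omega>\<in>space (F (\<tau> k)). \<bar>\<xi> k \<omega>\<bar> \<le> C"
      using assms by (auto simp: simple_process_def)
    then obtain C where C: "\<And>\<omega>. \<omega> \<in> space M \<Longrightarrow> \<bar>\<xi> k \<omega>\<bar> \<le> C"
      using space_F by metis
    have "elem (simple_value (Suc k) \<tau> \<xi>) (simple_integral (Suc k) \<tau> \<xi> B)"
    proof (rule elem_step')
      show "elem (simple_value k \<tau> \<xi>) (simple_integral k \<tau> \<xi> B)" "0 \<le> \<tau> k"
        using Suc by simp_all
    qed (fact k C | simp add: simple_value_def simple_integral_def)+
    with k Suc show ?case by simp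
  qed
  then show ?thesis by blast
qed

lemma elem_adapted: "elem H S \<Longrightarrow> 0 \<le> t \<Longrightarrow> S t \<in> borel_measurable (F t)"
proof (induction rule: elem.induct)
  case (elem_step H S a b \<xi> C)
  show ?case
  proof (cases "t \<le> a")
    case True
    then have "min b t = min a t" using elem_step.hyps by auto
    then show ?thesis using elem_step by simp
  next
    case False
    then have "\<xi> \<in> borel_measurable (F t)"
      by (intro measurable_F_mono[OF elem_step.hyps(4)]) simp
    moreover have "B (min x t) \<in> borel_measurable (F t)" if "0 \<le> x" for x
      by (rule measurable_F_mono[OF B_adapted]) (use that elem_step.prems in auto)
    ultimately show ?thesis using elem_step by simp
  qed
qed simp

lemma elem_measurable_M: "elem H S \<Longrightarrow> 0 \<le> t \<Longrightarrow> S t \<in> borel_measurable M"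
  using elem_adapted measurable_F_imp_M by blast

lemma elem_joint_measurable: "elem H S \<Longrightarrow> (\<lambda>(\<omega>, s). H s \<omega>) \<in> borel_measurable (M \<Otimes>\<^sub>M borel)"
proof (induction rule: elem.induct)
  case (elem_step H S a b \<xi> C)
  have [measurable]: "\<xi> \<in> borel_measurable M" using elem_step.hyps measurable_F_imp_M by blast
  note [measurable] = elem_step.IH
  have "(\<lambda>p. (case p of (\<omega>, s) \<Rightarrow> H s \<omega>) + \<xi> (fst p) * indicator {a<..b} (snd p)) \<in> borel_measurable (M \<Otimes>\<^sub>M borel)"
    by measurable
  then show ?case by (simp add: case_prod_beta')
qed simp

lemma elem_progressive: "elem H S \<Longrightarrow> progressive_on F T H"
proof (induction rule: elem.induct)
  case (elem_step H S a b \<xi> C)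
  show ?case
    unfolding progressive_on_def
  proof
    fix t assume t: "t \<in> {0..T}"
    then have [measurable]: "(\<lambda>(s, \<omega>). H s \<omega>) \<in> borel_measurable (restrict_space borel {0..t} \<Otimes>\<^sub>M F t)"
      using elem_step.IH by (auto simp: progressive_on_def)
    have [measurable]: "(\<lambda>p. fst p) \<in> borel_measurable (restrict_space borel {0..t} \<Otimes>\<^sub>M F t)"
      by (rule measurable_compose[OF measurable_fst]) (simp add: measurable_restrict_space1)
    show "(\<lambda>(s, \<omega>). H s \<omega> + \<xi> \<omega> * indicator {a<..b} s) \<in> borel_measurable (restrict_space borel {0..t} \<Otimes>\<^sub>M F t)"
    proof (cases "t \<le> a")
      case True
      have "(\<lambda>(s, \<omega>). H s \<omega> + \<xi> \<omega> * indicator {a<..b} s) \<in> borel_measurable (restrict_space borel {0..t} \<Otimes>\<^sub>M F t)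
          \<longleftrightarrow> (\<lambda>(s, \<omega>). H s \<omega>) \<in> borel_measurable (restrict_space borel {0..t} \<Otimes>\<^sub>M F t)"
        using True by (intro measurable_cong) (auto simp: space_pair_measure space_restrict_space)
      then show ?thesis by simp
    next
      case False
      then have [measurable]: "\<xi> \<in> borel_measurable (F t)"
        by (intro measurable_F_mono[OF elem_step.hyps(4)]) simp
      have "(\<lambda>p. (case p of (s, \<omega>) \<Rightarrow> H s \<omega>) + \<xi> (snd p) * indicator {a<..b} (fst p)) \<in> borel_measurable (restrict_space borel {0..t} \<Otimes>\<^sub>M F t)"
        by measurable
      then show ?thesis by (simp add: case_prod_beta')
    qed
  qed
qed (simp add: progressive_on_def)

lemma elem_bounded: "elem H S \<Longrightarrow> \<exists>C. \<forall>s. \<forall>\<omega>\<in>space M. \<bar>H s \<omega>\<bar> \<le> C"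
proof (induction rule: elem.induct)
  case (elem_step H S a b \<xi> C)
  then obtain D where D: "\<And>s \<omega>. \<omega> \<in> space M \<Longrightarrow> \<bar>H s \<omega>\<bar> \<le> D" by blast
  have "\<bar>H s \<omega> + \<xi> \<omega> * indicator {a<..b} s\<bar> \<le> D + C" if "\<omega> \<in> space M" for s \<omega>
    using D[OF that, of s] elem_step.hyps(5)[OF that] by (auto simp: indicator_def)
  then show ?case by blast
qed auto

lemma elem_continuous: "elem H S \<Longrightarrow> AE \<omega> in M. continuous_on {0..} (\<lambda>t. S t \<omega>)"
proof (induction rule: elem.induct)
  case (elem_step H S a b \<xi> C)
  show ?case
    using B_continuous elem_step.IH
  proof eventually_elim
    case (elim \<omega>)
    have "continuous_on {0..} (\<lambda>t. B (min x t) \<omega>)" if "0 \<le> x" for x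
      using that by (intro continuous_on_compose2[OF elim(1)] continuous_intros) auto
    then show ?case using elem_step.hyps elim by (intro continuous_intros) auto
  qed
qed simp

text \<open>A step interval (a, b] either misses (s, t], and then its increment cancels, or meets it
  in an interval with left end \<open>max a s\<close>, where both \<xi> and the indicator of A are
  known, so that \<open>B_increment\<close> applies. Integrals over events express the martingale
  property in a form that survives L1 limits.\<close>

lemma elem_martingale:
  assumes "elem H S" "0 \<le> s" "s \<le> t" "A \<in> sets (F s)"
  shows "integrable M (\<lambda>\<omega>. (S t \<omega> - S s \<omega>) * indicator A \<omega>) \<and>
    expectation (\<lambda>\<omega>. (S t \<omega> - S s \<omega>) * indicator A \<omega>) = 0"
  using assms(1)
proof (induction rule: elem.induct)
  case (elem_step H S a b \<xi> C)
  have A: "indicator A \<in> borel_measurable (F s)" using assms by simp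
  have "integrable M (\<lambda>\<omega>. \<xi> \<omega> * (B (min b t) \<omega> - B (min a t) \<omega> - (B (min b s) \<omega> - B (min a s) \<omega>)) * indicator A \<omega>) \<and>
    expectation (\<lambda>\<omega>. \<xi> \<omega> * (B (min b t) \<omega> - B (min a t) \<omega> - (B (min b s) \<omega> - B (min a s) \<omega>)) * indicator A \<omega>) = 0"
  proof (cases "t \<le> a \<or> b \<le> s")
    case True
    then have "(min b t = min a t \<and> min b s = min a s) \<or> (min b t = min b s \<and> min a t = min a s)"
      using elem_step.hyps assms by auto
    then have "(\<lambda>\<omega>. \<xi> \<omega> * (B (min b t) \<omega> - B (min a t) \<omega> - (B (min b s) \<omega> - B (min a s) \<omega>)) * indicator A \<omega>) = (\<lambda>\<omega>. 0)"
      by (auto simp: fun_eq_iff)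
    then show ?thesis by (simp only:) simp
  next
    case False
    let ?a = "max a s" and ?b = "min b t"
    have ab: "0 \<le> ?a" "?a \<le> ?b" using False elem_step.hyps assms by auto
    have Z: "(\<lambda>\<omega>. \<xi> \<omega> * indicator A \<omega>) \<in> borel_measurable (F ?a)"
      by (intro borel_measurable_times measurable_F_mono[OF elem_step.hyps(4)] measurable_F_mono[OF A]) auto
    have "integrable M (\<lambda>\<omega>. \<xi> \<omega> * indicator A \<omega>)"
      using elem_step.hyps(5) measurable_F_imp_M[OF Z ab(1)]
      by (intro integrable_const_bound[where B = "\<bar>C\<bar>"] AE_I2) (force simp: abs_mult indicator_def)+
    note * = B_increment[OF ab Z this]
    have B_eq: "B (min b t) \<omega> - B (min a t) \<omega> - (B (min b s) \<omega> - B (min a s) \<omega>) = B ?b \<omega> - B ?a \<omega>" for \<omega>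
      using False elem_step.hyps assms by (cases "a \<le> s") (auto simp: min_def max_def)
    show ?thesis unfolding B_eq using * by (simp add: mult_ac)
  qed
  moreover have "(S t \<omega> + \<xi> \<omega> * (B (min b t) \<omega> - B (min a t) \<omega>) - (S s \<omega> + \<xi> \<omega> * (B (min b s) \<omega> - B (min a s) \<omega>))) * indicator A \<omega>
    = (S t \<omega> - S s \<omega>) * indicator A \<omega> + \<xi> \<omega> * (B (min b t) \<omega> - B (min a t) \<omega> - (B (min b s) \<omega> - B (min a s) \<omega>)) * indicator A \<omega>" for \<omega>
    by (simp add: algebra_simps)
  ultimately show ?case using elem_step.IH by simp
qed simp

text \<open>The values of H are read off at the right ends \<open>\<sigma> (Suc j)\<close>, because
  the intervals are open on the left; yet they are known already at the left ends
  \<open>\<sigma> j\<close>.\<close>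

definition represented_on ::
  "nat \<Rightarrow> (nat \<Rightarrow> real) \<Rightarrow> (real \<Rightarrow> 'a \<Rightarrow> real) \<Rightarrow> (real \<Rightarrow> 'a \<Rightarrow> real) \<Rightarrow> bool" where
  "represented_on N \<sigma> H S \<longleftrightarrow>
     (\<forall>j<N. H (\<sigma> (Suc j)) \<in> borel_measurable (F (\<sigma> j))) \<and>
     (\<forall>s \<omega>. H s \<omega> = (\<Sum>j<N. H (\<sigma> (Suc j)) \<omega> * indicator {\<sigma> j<..\<sigma> (Suc j)} s)) \<and>
     (\<forall>t \<omega>. S t \<omega> = (\<Sum>j<N. H (\<sigma> (Suc j)) \<omega> * (B (min (\<sigma> (Suc j)) t) \<omega> - B (min (\<sigma> j) t) \<omega>)))"

lemma sum_telescope_of_bool: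
  fixes \<beta> :: "nat \<Rightarrow> real"
  assumes "p \<le> q" "q \<le> N"
  shows "(\<Sum>j<N. of_bool (p \<le> j \<and> j < q) * (\<beta> (Suc j) - \<beta> j)) = \<beta> q - \<beta> p"
proof -
  have "(\<Sum>j<N. of_bool (p \<le> j \<and> j < q) * (\<beta> (Suc j) - \<beta> j)) = (\<Sum>j\<in>{p..<q}. \<beta> (Suc j) - \<beta> j)"
    using assms by (intro sum.mono_neutral_cong_right) auto
  also have "\<dots> = \<beta> q - \<beta> p" using assms(1) by (rule sum_Suc_diff')
  finally show ?thesis .
qed

text \<open>The intervals may overlap, but on any grid through all their end points H is constant on
  cells. The quantification over all such grids, instead of a single one, allows further times to be
  inserted later.\<close>

lemma elem_represented:
  assumes "elem H S"
  shows "\<exists>P. finite P \<and> P \<subseteq> {0..} \<and>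
    (\<forall>N \<sigma>. (\<forall>i<N. \<sigma> i < \<sigma> (Suc i)) \<longrightarrow> P \<subseteq> \<sigma> ` {..N} \<longrightarrow> represented_on N \<sigma> H S)"
  using assms
proof (induction rule: elem.induct)
  case elem_zero
  then show ?case by (intro exI[of _ "{}"]) (auto simp: represented_on_def)
next
  case (elem_step H S a b \<xi> C)
  then obtain P where P: "finite P" "P \<subseteq> {0..}"
    "\<And>N \<sigma>. \<forall>i<N. \<sigma> i < \<sigma> (Suc i) \<Longrightarrow> P \<subseteq> \<sigma> ` {..N} \<Longrightarrow> represented_on N \<sigma> H S"
    by auto
  show ?case
  proof (intro exI[of _ "insert a (insert b P)"] conjI allI impI)
    fix N and \<sigma> :: "nat \<Rightarrow> real"
    assume \<sigma>: "\<forall>i<N. \<sigma> i < \<sigma> (Suc i)" and sub: "insert a (insert b P) \<subseteq> \<sigma> ` {..N}"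
    then obtain p q where pq: "p \<le> N" "q \<le> N" "a = \<sigma> p" "b = \<sigma> q" by auto
    have less: "\<sigma> i < \<sigma> j" if "i < j" "j \<le> N" for i j
      using that by (induction rule: less_Suc_induct[OF that(1), consumes 0]) (use \<sigma> in \<open>auto\<close>)
    have le_iff: "\<sigma> i \<le> \<sigma> j \<longleftrightarrow> i \<le> j" if "i \<le> N" "j \<le> N" for i j
      using less[of i j] less[of j i] that by (cases i j rule: linorder_cases) auto
    have pq': "p \<le> q" using elem_step.hyps(3) pq le_iff by simp
    \<comment> \<open>With a and b at the indices p and q, the right end of cell j lies in (a, b]
      exactly if the cell lies between these indices.\<close>
    have ind: "indicator {a<..b} (\<sigma> (Suc j)) = (of_bool (p \<le> j \<and> j < q) :: real)" if "j < N" for j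
    proof -
      have "a < \<sigma> (Suc j) \<longleftrightarrow> p \<le> j" "\<sigma> (Suc j) \<le> b \<longleftrightarrow> j < q"
        using le_iff[of "Suc j" p] le_iff[of "Suc j" q] pq that by (auto simp: not_le[symmetric])
      then show ?thesis by (simp add: indicator_def)
    qed
    from P(3)[OF \<sigma>] sub have rep: "represented_on N \<sigma> H S" by auto
    have rep1: "H (\<sigma> (Suc j)) \<in> borel_measurable (F (\<sigma> j))" if "j < N" for j
      using rep that unfolding represented_on_def by blast
    have rep2: "H s \<omega> = (\<Sum>j<N. H (\<sigma> (Suc j)) \<omega> * indicator {\<sigma> j<..\<sigma> (Suc j)} s)" for s \<omega>
      using rep unfolding represented_on_def by blast
    have rep3: "S t \<omega> = (\<Sum>j<N. H (\<sigma> (Suc j)) \<omega> * (B (min (\<sigma> (Suc j)) t) \<omega> - B (min (\<sigma> j) t) \<omega>))" for t \<omega>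
      using rep unfolding represented_on_def by blast
    let ?H = "\<lambda>s \<omega>. H s \<omega> + \<xi> \<omega> * indicator {a<..b} s"
    have H: "?H (\<sigma> (Suc j)) \<omega> * x = H (\<sigma> (Suc j)) \<omega> * x + \<xi> \<omega> * (of_bool (p \<le> j \<and> j < q) * x)" if "j < N" for j \<omega> x
      by (simp add: ind[OF that] distrib_right)
    show "represented_on N \<sigma> ?H (\<lambda>t \<omega>. S t \<omega> + \<xi> \<omega> * (B (min b t) \<omega> - B (min a t) \<omega>))"
      unfolding represented_on_def
    proof (intro conjI allI impI)
      fix j assume j: "j < N"
      show "?H (\<sigma> (Suc j)) \<in> borel_measurable (F (\<sigma> j))"
      proof (cases "p \<le> j")
        case True
        then have "\<xi> \<in> borel_measurable (F (\<sigma> j))"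
          using measurable_F_mono[OF elem_step.hyps(4), of "\<sigma> j"] pq le_iff[of p j] j by simp
        then show ?thesis using rep1[OF j] by simp
      next
        case False
        then show ?thesis using rep1[OF j] unfolding ind[OF j] by simp
      qed
    next
      fix s \<omega>
      have "indicator {\<sigma> j<..\<sigma> (Suc j)} s = of_bool (s \<le> \<sigma> (Suc j)) - (of_bool (s \<le> \<sigma> j) :: real)" if "j < N" for j
        using \<sigma> that by (auto simp: indicator_def)
      then have "(\<Sum>j<N. of_bool (p \<le> j \<and> j < q) * indicator {\<sigma> j<..\<sigma> (Suc j)} s) =
          (\<Sum>j<N. of_bool (p \<le> j \<and> j < q) * (of_bool (s \<le> \<sigma> (Suc j)) - (of_bool (s \<le> \<sigma> j) :: real)))"
        by (intro sum.cong) auto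
      also have "\<dots> = of_bool (s \<le> b) - of_bool (s \<le> a)"
        using sum_telescope_of_bool[OF pq' pq(2), of "\<lambda>j. of_bool (s \<le> \<sigma> j)"] pq by simp
      also have "\<dots> = indicator {a<..b} s"
        using elem_step.hyps by (auto simp: indicator_def)
      finally have "(\<Sum>j<N. of_bool (p \<le> j \<and> j < q) * indicator {\<sigma> j<..\<sigma> (Suc j)} s) = (indicator {a<..b} s :: real)" .
      moreover note rep2[of s \<omega>]
      moreover have "(\<Sum>j<N. ?H (\<sigma> (Suc j)) \<omega> * indicator {\<sigma> j<..\<sigma> (Suc j)} s) =
          (\<Sum>j<N. H (\<sigma> (Suc j)) \<omega> * indicator {\<sigma> j<..\<sigma> (Suc j)} s + \<xi> \<omega> * (of_bool (p \<le> j \<and> j < q) * indicator {\<sigma> j<..\<sigma> (Suc j)} s))"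
        by (intro sum.cong refl H) simp
      ultimately show "?H s \<omega> = (\<Sum>j<N. ?H (\<sigma> (Suc j)) \<omega> * indicator {\<sigma> j<..\<sigma> (Suc j)} s)"
        by (simp only: sum.distrib sum_distrib_left[symmetric])
    next
      fix t \<omega>
      have "(\<Sum>j<N. of_bool (p \<le> j \<and> j < q) * (B (min (\<sigma> (Suc j)) t) \<omega> - B (min (\<sigma> j) t) \<omega>)) = B (min b t) \<omega> - B (min a t) \<omega>"
        using sum_telescope_of_bool[OF pq' pq(2), of "\<lambda>j. B (min (\<sigma> j) t) \<omega>"] pq by simp
      moreover note rep3[of t \<omega>]
      moreover have "(\<Sum>j<N. ?H (\<sigma> (Suc j)) \<omega> * (B (min (\<sigma> (Suc j)) t) \<omega> - B (min (\<sigma> j) t) \<omega>)) =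
          (\<Sum>j<N. H (\<sigma> (Suc j)) \<omega> * (B (min (\<sigma> (Suc j)) t) \<omega> - B (min (\<sigma> j) t) \<omega>) + \<xi> \<omega> * (of_bool (p \<le> j \<and> j < q) * (B (min (\<sigma> (Suc j)) t) \<omega> - B (min (\<sigma> j) t) \<omega>)))"
        by (intro sum.cong refl H) simp
      ultimately show "S t \<omega> + \<xi> \<omega> * (B (min b t) \<omega> - B (min a t) \<omega>) =
          (\<Sum>j<N. ?H (\<sigma> (Suc j)) \<omega> * (B (min (\<sigma> (Suc j)) t) \<omega> - B (min (\<sigma> j) t) \<omega>))"
        by (simp only: sum.distrib sum_distrib_left[symmetric])
    qed
  qed (use P elem_step.hyps in auto)
qed

end

section \<open>The square integral of an integrand along a path\<close>

definition sq_int :: "real \<Rightarrow> (real \<Rightarrow> 'a \<Rightarrow> real) \<Rightarrow> 'a \<Rightarrow> ennreal" where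
  "sq_int t K \<omega> = (\<integral>\<^sup>+ s\<in>{0..t}. ennreal ((K s \<omega>)\<^sup>2) \<partial>lborel)"

lemma sum_indicator_grid:
  fixes \<sigma> :: "nat \<Rightarrow> real" and f :: "nat \<Rightarrow> 'b::comm_semiring_1"
  assumes \<sigma>: "\<And>i j. i < j \<Longrightarrow> j \<le> n \<Longrightarrow> \<sigma> i < \<sigma> j" and i: "i < n" "s \<in> {\<sigma> i<..\<sigma> (Suc i)}"
  shows "(\<Sum>j<n. f j * indicator {\<sigma> j<..\<sigma> (Suc j)} s) = f i"
proof -
  have "indicator {\<sigma> j<..\<sigma> (Suc j)} s = (if j = i then 1 else 0 :: 'b)" if "j < n" for j
  proof (cases i j rule: linorder_cases)
    case less
    then have "\<sigma> (Suc i) \<le> \<sigma> j" using \<sigma>[of "Suc i" j] that by (cases "Suc i = j") auto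
    then show ?thesis using less i by (auto simp: indicator_def)
  next
    case greater
    then have "\<sigma> (Suc j) \<le> \<sigma> i" using \<sigma>[of "Suc j" i] i by (cases "Suc j = i") auto
    then show ?thesis using greater i by (auto simp: indicator_def)
  qed (use i in auto)
  then have "(\<Sum>j<n. f j * indicator {\<sigma> j<..\<sigma> (Suc j)} s) = (\<Sum>j<n. if j = i then f j else 0)"
    by (intro sum.cong) auto
  then show ?thesis using i by simp
qed

lemma sorted_enumeration:
  fixes A :: "real set"
  assumes "finite A" "A \<noteq> {}"
  shows "\<exists>(N :: nat) (\<sigma> :: nat \<Rightarrow> real). (\<forall>i j. i < j \<longrightarrow> j \<le> N \<longrightarrow> \<sigma> i < \<sigma> j) \<and> \<sigma> ` {..N} = A"
proof -
  define L where "L = sorted_list_of_set A"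
  have L: "sorted L" "distinct L" "set L = A" "L \<noteq> []" using assms by (auto simp: L_def)
  have "L ! i < L ! j" if "i < j" "j \<le> length L - 1" for i j
  proof -
    have "j < length L" using that L(4) by (cases L) auto
    then have "L ! i \<le> L ! j" "L ! i \<noteq> L ! j"
      using that L by (auto simp: sorted_nth_mono nth_eq_iff_index_eq)
    then show ?thesis by simp
  qed
  moreover have "{..length L - 1} = {..<length L}" using L(4) by (cases L) auto
  then have "(!) L ` {..length L - 1} = A"
    using L(3) by (auto simp: set_conv_nth)
  ultimately show ?thesis by blast
qed

context filtered_prob_space_usual
begin

text \<open>Measurability with respect to M instead of the filtration, and with time as the second
  argument, as needed to integrate out the time and to apply Fubini's theorem. The indicator
  confines the condition to [0, t].\<close>

definition jointly_measurable :: "real \<Rightarrow> (real \<Rightarrow> 'a \<Rightarrow> real) \<Rightarrow> bool" where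
  "jointly_measurable t K \<longleftrightarrow> (\<lambda>(\<omega>, s). K s \<omega> * indicator {0..t} s) \<in> borel_measurable (M \<Otimes>\<^sub>M borel)"

lemma sq_int_alt: "sq_int t K \<omega> = (\<integral>\<^sup>+ s. ennreal ((K s \<omega> * indicator {0..t} s)\<^sup>2) \<partial>lborel)"
  unfolding sq_int_def by (intro nn_integral_cong) (auto simp: indicator_def)

lemma jointly_measurable_section:
  assumes "jointly_measurable t K" "\<omega> \<in> space M"
  shows "(\<lambda>s. K s \<omega> * indicator {0..t} s) \<in> borel_measurable borel"
  using measurable_compose[OF measurable_Pair1'[OF assms(2)] assms(1)[unfolded jointly_measurable_def]]
  by simp

lemma sq_int_measurable [measurable (raw)]:
  assumes "jointly_measurable t K"
  shows "sq_int t K \<in> borel_measurable M"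
proof -
  have [measurable]: "(\<lambda>(\<omega>, s). K s \<omega> * indicator {0..t} s) \<in> borel_measurable (M \<Otimes>\<^sub>M lborel)"
    using assms unfolding jointly_measurable_def by (simp cong: measurable_cong_sets)
  have "(\<lambda>(\<omega>, s). ennreal ((K s \<omega> * indicator {0..t} s)\<^sup>2)) \<in> borel_measurable (M \<Otimes>\<^sub>M lborel)"
    unfolding case_prod_beta' by measurable
  from lborel.borel_measurable_nn_integral[OF this] show ?thesis
    by (simp add: sq_int_alt[abs_def])
qed

lemma jointly_measurable_add:
  assumes "jointly_measurable t K" "jointly_measurable t K'"
  shows "jointly_measurable t (\<lambda>s \<omega>. K s \<omega> + K' s \<omega>)"
  using borel_measurable_add[OF assms[unfolded jointly_measurable_def]]
  by (simp add: jointly_measurable_def case_prod_beta' distrib_right)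

lemma jointly_measurable_uminus:
  assumes "jointly_measurable t K"
  shows "jointly_measurable t (\<lambda>s \<omega>. - K s \<omega>)"
  using borel_measurable_uminus[OF assms[unfolded jointly_measurable_def]]
  by (simp add: jointly_measurable_def case_prod_beta')

lemma jointly_measurable_diff:
  assumes "jointly_measurable t K" "jointly_measurable t K'"
  shows "jointly_measurable t (\<lambda>s \<omega>. K s \<omega> - K' s \<omega>)"
  using jointly_measurable_add[OF assms(1) jointly_measurable_uminus[OF assms(2)]] by simp

lemma jointly_measurable_zero: "jointly_measurable t (\<lambda>s \<omega>. 0)"
  by (simp add: jointly_measurable_def)

lemma jointly_measurable_restrict:
  assumes "jointly_measurable T K" "t \<le> T"
  shows "jointly_measurable t (\<lambda>s \<omega>. K s \<omega> * indicator {a<..b} s)"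
proof -
  have "(\<lambda>p. (case p of (\<omega>, s) \<Rightarrow> K s \<omega> * indicator {0..T} s) * (indicator {a<..b} (snd p) * indicator {0..t} (snd p)))
      \<in> borel_measurable (M \<Otimes>\<^sub>M borel)"
    using assms(1) unfolding jointly_measurable_def by measurable
  moreover have "(\<lambda>p. (case p of (\<omega>, s) \<Rightarrow> K s \<omega> * indicator {0..T} s) * (indicator {a<..b} (snd p) * indicator {0..t} (snd p)))
    = (\<lambda>(\<omega>, s). (K s \<omega> * indicator {a<..b} s) * indicator {0..t} s)"
    using assms(2) by (auto simp: fun_eq_iff indicator_def)
  ultimately show ?thesis by (simp add: jointly_measurable_def)
qed

lemma progressive_imp_jointly_measurable:
  assumes "progressive_on F T K" "0 \<le> t" "t \<le> T"
  shows "jointly_measurable t K"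
proof -
  let ?R = "restrict_space (M \<Otimes>\<^sub>M borel) (space M \<times> {0..t})"
  have K: "(\<lambda>(s, \<omega>). K s \<omega>) \<in> borel_measurable (restrict_space borel {0..t} \<Otimes>\<^sub>M F t)"
    using assms by (auto simp: progressive_on_def)
  have "(\<lambda>p. (snd p, fst p)) \<in> ?R \<rightarrow>\<^sub>M restrict_space borel {0..t} \<Otimes>\<^sub>M F t"
  proof (rule measurable_Pair)
    show "snd \<in> ?R \<rightarrow>\<^sub>M restrict_space borel {0..t}"
      by (rule measurable_restrict_space2) (auto simp: space_restrict_space intro: measurable_restrict_space1)
    have "(\<lambda>x. x) \<in> M \<rightarrow>\<^sub>M F t"
      using subalg[OF assms(2)] by (intro measurableI) (auto simp: subalgebra_def sets.Int_space_eq2)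
    from measurable_compose[OF measurable_fst this]
    show "fst \<in> ?R \<rightarrow>\<^sub>M F t" by (auto intro: measurable_restrict_space1)
  qed
  from measurable_compose[OF this K]
  have "(\<lambda>p. K (snd p) (fst p)) \<in> borel_measurable ?R" by simp
  then have "(\<lambda>p. indicator (space M \<times> {0..t}) p *\<^sub>R K (snd p) (fst p)) \<in> borel_measurable (M \<Otimes>\<^sub>M borel)"
    by (subst (asm) borel_measurable_restrict_space_iff) (auto simp: sets.Int_space_eq2)
  moreover have "(\<lambda>p. indicator (space M \<times> {0..t}) p *\<^sub>R K (snd p) (fst p)) \<in> borel_measurable (M \<Otimes>\<^sub>M borel) \<longleftrightarrow>
     (\<lambda>(\<omega>, s). K s \<omega> * indicator {0..t} s) \<in> borel_measurable (M \<Otimes>\<^sub>M borel)"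
    by (intro measurable_cong) (auto simp: space_pair_measure indicator_def)
  ultimately show ?thesis by (simp add: jointly_measurable_def)
qed

text \<open>The crude bound (a + b)^2 \<le> 2 a^2 + 2 b^2 replaces the triangle inequality in L2; it
  is the source of the factors 1/4 and 4 in the estimates below.\<close>

lemma sq_int_add_le:
  assumes "jointly_measurable t K" "jointly_measurable t K'" "\<omega> \<in> space M"
  shows "sq_int t (\<lambda>s \<omega>. K s \<omega> + K' s \<omega>) \<omega> \<le> 2 * sq_int t K \<omega> + 2 * sq_int t K' \<omega>"
proof -
  note [measurable] = jointly_measurable_section[OF assms(1,3)] jointly_measurable_section[OF assms(2,3)]
  have "sq_int t (\<lambda>s \<omega>. K s \<omega> + K' s \<omega>) \<omega> \<le> (\<integral>\<^sup>+ s. 2 * ennreal ((K s \<omega> * indicator {0..t} s)\<^sup>2) + 2 * ennreal ((K' s \<omega> * indicator {0..t} s)\<^sup>2) \<partial>lborel)"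
    unfolding sq_int_alt
  proof (rule nn_integral_mono)
    fix s
    have "((K s \<omega> + K' s \<omega>) * indicator {0..t} s)\<^sup>2 \<le> 2 * (K s \<omega> * indicator {0..t} s)\<^sup>2 + 2 * (K' s \<omega> * indicator {0..t} s)\<^sup>2"
      using sum_squares_bound[of "K s \<omega> * indicator {0..t} s" "K' s \<omega> * indicator {0..t} s"]
      by (simp add: power2_sum distrib_right)
    then have "ennreal (((K s \<omega> + K' s \<omega>) * indicator {0..t} s)\<^sup>2)
        \<le> ennreal (2 * (K s \<omega> * indicator {0..t} s)\<^sup>2 + 2 * (K' s \<omega> * indicator {0..t} s)\<^sup>2)"
      by (rule ennreal_leI)
    also have "\<dots> = 2 * ennreal ((K s \<omega> * indicator {0..t} s)\<^sup>2) + 2 * ennreal ((K' s \<omega> * indicator {0..t} s)\<^sup>2)"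
      by (simp add: ennreal_mult ennreal_plus)
    finally show "ennreal (((K s \<omega> + K' s \<omega>) * indicator {0..t} s)\<^sup>2)
        \<le> 2 * ennreal ((K s \<omega> * indicator {0..t} s)\<^sup>2) + 2 * ennreal ((K' s \<omega> * indicator {0..t} s)\<^sup>2)" .
  qed
  also have "\<dots> = 2 * sq_int t K \<omega> + 2 * sq_int t K' \<omega>"
    unfolding sq_int_alt by (simp add: nn_integral_add nn_integral_cmult)
  finally show ?thesis .
qed

lemma sq_int_uminus: "sq_int t (\<lambda>s \<omega>. - K s \<omega>) \<omega> = sq_int t K \<omega>"
  by (simp add: sq_int_def)

lemma sq_int_diff_le:
  assumes "jointly_measurable t K" "jointly_measurable t K'" "\<omega> \<in> space M"
  shows "sq_int t (\<lambda>s \<omega>. K s \<omega> - K' s \<omega>) \<omega> \<le> 2 * sq_int t K \<omega> + 2 * sq_int t K' \<omega>"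
  using sq_int_add_le[OF assms(1) jointly_measurable_uminus[OF assms(2)] assms(3)]
  by (simp add: sq_int_uminus)

lemma sq_int_mono:
  assumes "\<And>s. s \<in> {0..t} \<Longrightarrow> \<bar>K s \<omega>\<bar> \<le> \<bar>K' s \<omega>\<bar>" "t \<le> T"
  shows "sq_int t K \<omega> \<le> sq_int T K' \<omega>"
  unfolding sq_int_def
  using assms by (intro nn_integral_mono) (auto simp: indicator_def abs_le_square_iff intro!: ennreal_leI)

lemma sq_int_bounded:
  assumes "\<And>s. s \<in> {0..t} \<Longrightarrow> \<bar>K s \<omega>\<bar> \<le> C" "0 \<le> t" "0 \<le> C"
  shows "sq_int t K \<omega> \<le> ennreal (C\<^sup>2 * t)"
proof -
  have "sq_int t K \<omega> \<le> (\<integral>\<^sup>+ s. ennreal (C\<^sup>2) * indicator {0..t} s \<partial>lborel)"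
    unfolding sq_int_def using assms power_mono[of "\<bar>K _ \<omega>\<bar>" C 2]
    by (intro nn_integral_mono) (auto simp: indicator_def intro!: ennreal_leI)
  also have "\<dots> = ennreal (C\<^sup>2 * t)"
    using assms by (simp add: nn_integral_cmult_indicator ennreal_mult)
  finally show ?thesis .
qed

end

section \<open>Maximal inequality for simple integrands\<close>

context ito_integrator
begin

lemma elem_jointly_measurable: "elem H S \<Longrightarrow> jointly_measurable t H"
  using elem_joint_measurable[of H S] unfolding jointly_measurable_def
  by (simp add: case_prod_beta')

text \<open>One grid through D, t and all end points of intervals of H reduces the values of S on D
  and at t to partial sums of one discrete integral. The square sum is compared with
  \<open>sq_int\<close> in the direction that tail estimates use.\<close>

lemma elem_discretize:
  assumes "elem H S" "0 \<le> t" "finite D" "D \<subseteq> {0..t}"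
  obtains N \<sigma> \<zeta> C where "0 \<le> \<sigma> 0" "\<And>j. j < N \<Longrightarrow> \<sigma> j \<le> \<sigma> (Suc j)"
    "\<And>j. j < N \<Longrightarrow> \<zeta> j \<in> borel_measurable (F (\<sigma> j))"
    "\<And>j \<omega>. j < N \<Longrightarrow> \<omega> \<in> space M \<Longrightarrow> \<bar>\<zeta> j \<omega>\<bar> \<le> C"
    "D \<subseteq> \<sigma> ` {..N}" "\<sigma> N = t"
    "\<And>k \<omega>. k \<le> N \<Longrightarrow> S (\<sigma> k) \<omega> = (\<Sum>j<k. \<zeta> j \<omega> * (B (\<sigma> (Suc j)) \<omega> - B (\<sigma> j) \<omega>))"
    "\<And>\<omega>. ennreal (\<Sum>j<N. (\<zeta> j \<omega>)\<^sup>2 * (\<sigma> (Suc j) - \<sigma> j)) \<le> sq_int t H \<omega>"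
proof -
  obtain P where P: "finite P" "P \<subseteq> {0..}"
    "\<And>N \<sigma>. \<forall>i<N. \<sigma> i < \<sigma> (Suc i) \<Longrightarrow> P \<subseteq> \<sigma> ` {..N} \<Longrightarrow> represented_on N \<sigma> H S"
    using elem_represented[OF assms(1)] by auto
  have fin: "finite (P \<union> D \<union> {0, t})" and ne: "P \<union> D \<union> {0, t} \<noteq> {}"
    using P assms by auto
  obtain n :: nat and \<sigma> :: "nat \<Rightarrow> real"
    where n\<sigma>: "(\<forall>i j. i < j \<longrightarrow> j \<le> n \<longrightarrow> \<sigma> i < \<sigma> j) \<and> \<sigma> ` {..n} = P \<union> D \<union> {0, t}"
    using sorted_enumeration[OF fin ne] by (elim exE)
  then have less: "\<And>i j. i < j \<Longrightarrow> j \<le> n \<Longrightarrow> \<sigma> i < \<sigma> j" and im: "\<sigma> ` {..n} = P \<union> D \<union> {0, t}"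
    by simp_all
  have rep: "represented_on n \<sigma> H S" using P(3)[of n \<sigma>] less im by auto
  have rep2: "H s \<omega> = (\<Sum>j<n. H (\<sigma> (Suc j)) \<omega> * indicator {\<sigma> j<..\<sigma> (Suc j)} s)" for s \<omega>
    using rep unfolding represented_on_def by blast
  have rep3: "S t \<omega> = (\<Sum>j<n. H (\<sigma> (Suc j)) \<omega> * (B (min (\<sigma> (Suc j)) t) \<omega> - B (min (\<sigma> j) t) \<omega>))" for t \<omega>
    using rep unfolding represented_on_def by blast
  \<comment> \<open>The grid runs past t if intervals of H do; N is the index at which it reaches
    t.\<close>
  have "t \<in> \<sigma> ` {..n}" using im by auto
  then obtain N where N: "N \<le> n" "\<sigma> N = t" by auto
  have le: "\<sigma> i \<le> \<sigma> j" if "i \<le> j" "j \<le> n" for i j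
    using less[of i j] that by (cases "i = j") auto
  have nonneg: "0 \<le> \<sigma> i" if "i \<le> n" for i
  proof -
    have "\<sigma> i \<in> P \<union> D \<union> {0, t}" using im that by blast
    then show ?thesis using P assms by auto
  qed
  obtain C where C: "\<And>s \<omega>. \<omega> \<in> space M \<Longrightarrow> \<bar>H s \<omega>\<bar> \<le> C" using elem_bounded[OF assms(1)] by blast
  show thesis
  proof (rule that[of \<sigma> N "\<lambda>j. H (\<sigma> (Suc j))" C])
    show "0 \<le> \<sigma> 0" "\<And>j. j < N \<Longrightarrow> \<sigma> j \<le> \<sigma> (Suc j)" "\<sigma> N = t"
      using nonneg le N by auto
    show "\<And>j. j < N \<Longrightarrow> H (\<sigma> (Suc j)) \<in> borel_measurable (F (\<sigma> j))"
      using rep N unfolding represented_on_def by auto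
    show "\<bar>H (\<sigma> (Suc j)) \<omega>\<bar> \<le> C" if "\<omega> \<in> space M" for j \<omega> using C that by blast
    show "D \<subseteq> \<sigma> ` {..N}"
    proof
      fix r assume r: "r \<in> D"
      then have "r \<in> \<sigma> ` {..n}" using im by auto
      then obtain k where k: "k \<le> n" "r = \<sigma> k" by auto
      have "k \<le> N" using less[of N k] r k assms(4) N by (force simp: not_less[symmetric])
      then show "r \<in> \<sigma> ` {..N}" using k by auto
    qed
    show "S (\<sigma> k) \<omega> = (\<Sum>j<k. H (\<sigma> (Suc j)) \<omega> * (B (\<sigma> (Suc j)) \<omega> - B (\<sigma> j) \<omega>))" if "k \<le> N" for k \<omega>
      unfolding rep3[of "\<sigma> k" \<omega>]
    proof (rule sum.mono_neutral_cong_right, goal_cases)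
      case 3
      show ?case
      proof
        fix j assume "j \<in> {..<n} - {..<k}"
        then have "min (\<sigma> (Suc j)) (\<sigma> k) = \<sigma> k" "min (\<sigma> j) (\<sigma> k) = \<sigma> k"
          using le[of k j] le[of k "Suc j"] by (auto simp: min_def)
        then show "H (\<sigma> (Suc j)) \<omega> * (B (min (\<sigma> (Suc j)) (\<sigma> k)) \<omega> - B (min (\<sigma> j) (\<sigma> k)) \<omega>) = 0" by simp
      qed
    next
      case (4 j)
      then have "min (\<sigma> (Suc j)) (\<sigma> k) = \<sigma> (Suc j)" "min (\<sigma> j) (\<sigma> k) = \<sigma> j"
        using le[of j k] le[of "Suc j" k] that N by (auto simp: min_def)
      then show ?case by simp
    qed (use that N in auto)
    fix \<omega>
    have "ennreal (\<Sum>j<N. (H (\<sigma> (Suc j)) \<omega>)\<^sup>2 * (\<sigma> (Suc j) - \<sigma> j)) = (\<Sum>j<N. ennreal ((H (\<sigma> (Suc j)) \<omega>)\<^sup>2) * emeasure lborel {\<sigma> j<..\<sigma> (Suc j)})"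
      using le N by (subst sum_ennreal[symmetric]) (auto simp: ennreal_mult intro!: sum.cong)
    also have "\<dots> = (\<integral>\<^sup>+ s. (\<Sum>j<N. ennreal ((H (\<sigma> (Suc j)) \<omega>)\<^sup>2) * indicator {\<sigma> j<..\<sigma> (Suc j)} s) \<partial>lborel)"
      by (subst nn_integral_sum) (auto simp: nn_integral_cmult_indicator)
    also have "\<dots> \<le> sq_int t H \<omega>"
      unfolding sq_int_def
    proof (rule nn_integral_mono)
      fix s
      show "(\<Sum>j<N. ennreal ((H (\<sigma> (Suc j)) \<omega>)\<^sup>2) * indicator {\<sigma> j<..\<sigma> (Suc j)} s) \<le> ennreal ((H s \<omega>)\<^sup>2) * indicator {0..t} s"
      proof (cases "\<exists>i<N. s \<in> {\<sigma> i<..\<sigma> (Suc i)}")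
        case True
        then obtain i where i: "i < N" "s \<in> {\<sigma> i<..\<sigma> (Suc i)}" by auto
        have "(\<Sum>j<N. ennreal ((H (\<sigma> (Suc j)) \<omega>)\<^sup>2) * indicator {\<sigma> j<..\<sigma> (Suc j)} s) = ennreal ((H (\<sigma> (Suc i)) \<omega>)\<^sup>2)"
          using less N i by (intro sum_indicator_grid) auto
        moreover have "H s \<omega> = H (\<sigma> (Suc i)) \<omega>"
          unfolding rep2[of s \<omega>] using less N i by (intro sum_indicator_grid) auto
        moreover have "s \<in> {0..t}" using i nonneg[of i] le[of "Suc i" N] N by auto
        ultimately show ?thesis by simp
      next
        case False
        then have "(\<Sum>j<N. ennreal ((H (\<sigma> (Suc j)) \<omega>)\<^sup>2) * indicator {\<sigma> j<..\<sigma> (Suc j)} s) = 0"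
          by (intro sum.neutral) auto
        then show ?thesis by simp
      qed
    qed
    finally show "ennreal (\<Sum>j<N. (H (\<sigma> (Suc j)) \<omega>)\<^sup>2 * (\<sigma> (Suc j) - \<sigma> j)) \<le> sq_int t H \<omega>" .
  qed
qed

lemma elem_maximal_inequality_finite:
  assumes HS: "elem H S" and "0 \<le> t" "finite D" "D \<subseteq> {0..t}" "0 < c" "0 \<le> \<delta>" "A \<in> sets M"
  shows "prob (A \<inter> {\<omega> \<in> space M. \<exists>r\<in>D. c < \<bar>S r \<omega>\<bar>})
    \<le> prob (A \<inter> {\<omega> \<in> space M. ennreal \<delta> < sq_int t H \<omega>}) + \<delta> / c\<^sup>2"
proof -
  obtain N \<sigma> \<zeta> C where *: "0 \<le> \<sigma> 0" "\<And>j. j < N \<Longrightarrow> \<sigma> j \<le> \<sigma> (Suc j)"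
    "\<And>j. j < N \<Longrightarrow> \<zeta> j \<in> borel_measurable (F (\<sigma> j))"
    "\<And>j \<omega>. j < N \<Longrightarrow> \<omega> \<in> space M \<Longrightarrow> \<bar>\<zeta> j \<omega>\<bar> \<le> C"
    and D: "D \<subseteq> \<sigma> ` {..N}" "\<sigma> N = t"
    and S: "\<And>k \<omega>. k \<le> N \<Longrightarrow> S (\<sigma> k) \<omega> = (\<Sum>j<k. \<zeta> j \<omega> * (B (\<sigma> (Suc j)) \<omega> - B (\<sigma> j) \<omega>))"
    and Q: "\<And>\<omega>. ennreal (\<Sum>j<N. (\<zeta> j \<omega>)\<^sup>2 * (\<sigma> (Suc j) - \<sigma> j)) \<le> sq_int t H \<omega>"
    by (rule elem_discretize[OF assms(1-4)]) blast
  note [measurable] = \<open>A \<in> sets M\<close> sq_int_measurable[OF elem_jointly_measurable[OF HS]]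
  have [measurable]: "(\<lambda>\<omega>. \<Sum>j<k. \<zeta> j \<omega> * (B (\<sigma> (Suc j)) \<omega> - B (\<sigma> j) \<omega>)) \<in> borel_measurable M" if "k \<le> N" for k
    by (rule measurable_F_imp_M[OF discrete_sum_measurable[OF * that]]) (use grid_nonneg[OF * that] in auto)
  have ev: "{\<omega> \<in> space M. \<exists>k\<in>{..N}. c < \<bar>\<Sum>j<k. \<zeta> j \<omega> * (B (\<sigma> (Suc j)) \<omega> - B (\<sigma> j) \<omega>)\<bar>} \<in> sets M"
    by (rule sets.sets_Collect_finite_Ex) auto
  have "prob (A \<inter> {\<omega> \<in> space M. \<exists>r\<in>D. c < \<bar>S r \<omega>\<bar>})
      \<le> prob (A \<inter> {\<omega> \<in> space M. \<exists>k\<in>{..N}. c < \<bar>\<Sum>j<k. \<zeta> j \<omega> * (B (\<sigma> (Suc j)) \<omega> - B (\<sigma> j) \<omega>)\<bar>})"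
  proof (rule finite_measure_mono)
    show "A \<inter> {\<omega> \<in> space M. \<exists>r\<in>D. c < \<bar>S r \<omega>\<bar>}
        \<subseteq> A \<inter> {\<omega> \<in> space M. \<exists>k\<in>{..N}. c < \<bar>\<Sum>j<k. \<zeta> j \<omega> * (B (\<sigma> (Suc j)) \<omega> - B (\<sigma> j) \<omega>)\<bar>}"
    proof safe
      fix \<omega> r assume "r \<in> D" "c < \<bar>S r \<omega>\<bar>"
      moreover obtain k where "k \<le> N" "r = \<sigma> k" using D \<open>r \<in> D\<close> by auto
      ultimately show "\<exists>k\<in>{..N}. c < \<bar>\<Sum>j<k. \<zeta> j \<omega> * (B (\<sigma> (Suc j)) \<omega> - B (\<sigma> j) \<omega>)\<bar>"
        using S[of k \<omega>] by auto
    qed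
  qed (use ev in auto)
  also have "\<dots> \<le> prob (A \<inter> {\<omega> \<in> space M. \<delta> < (\<Sum>j<N. (\<zeta> j \<omega>)\<^sup>2 * (\<sigma> (Suc j) - \<sigma> j))}) + \<delta> / c\<^sup>2"
    using discrete_maximal_inequality[OF * \<open>0 < c\<close> \<open>0 \<le> \<delta>\<close> \<open>A \<in> sets M\<close>] by (simp add: Bex_def)
  also have "prob (A \<inter> {\<omega> \<in> space M. \<delta> < (\<Sum>j<N. (\<zeta> j \<omega>)\<^sup>2 * (\<sigma> (Suc j) - \<sigma> j))}) \<le>
      prob (A \<inter> {\<omega> \<in> space M. ennreal \<delta> < sq_int t H \<omega>})"
    using \<open>0 \<le> \<delta>\<close> by (intro finite_measure_mono) (auto intro!: less_le_trans[OF _ Q] ennreal_lessI)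
  finally show ?thesis by simp
qed

text \<open>The finite sets of times exhaust D, and the measure is continuous along increasing
  events. Rational times will suffice, as the paths are continuous.\<close>

lemma elem_maximal_inequality:
  assumes HS: "elem H S" and "0 \<le> t" "countable D" "D \<subseteq> {0..t}" "0 < c" "0 \<le> \<delta>" "A \<in> sets M"
  shows "prob (A \<inter> {\<omega> \<in> space M. \<exists>r\<in>D. c < \<bar>S r \<omega>\<bar>})
    \<le> prob (A \<inter> {\<omega> \<in> space M. ennreal \<delta> < sq_int t H \<omega>}) + \<delta> / c\<^sup>2"
proof (cases "D = {}")
  case True
  then show ?thesis using assms by simp
next
  case False
  define E where "E n = from_nat_into D ` {..n::nat}" for n
  have E: "finite (E n)" "E n \<subseteq> {0..t}" for n
    using False assms(4) from_nat_into[OF False] by (auto simp: E_def)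
  have D_eq: "D = (\<Union>n. E n)"
  proof
    show "D \<subseteq> (\<Union>n. E n)"
    proof
      fix x assume "x \<in> D"
      then obtain n where "x = from_nat_into D n"
        using range_from_nat_into[OF False \<open>countable D\<close>] by blast
      then show "x \<in> (\<Union>n. E n)" by (auto simp: E_def)
    qed
    show "(\<Union>n. E n) \<subseteq> D" using from_nat_into[OF False] by (auto simp: E_def)
  qed
  let ?A = "\<lambda>n. A \<inter> {\<omega> \<in> space M. \<exists>r\<in>E n. c < \<bar>S r \<omega>\<bar>}"
  have "(\<lambda>n. prob (?A n)) \<longlonglongrightarrow> prob (\<Union>n. ?A n)"
  proof (rule finite_Lim_measure_incseq)
    show "range ?A \<subseteq> events"
    proof safe
      fix n
      have "{\<omega> \<in> space M. c < \<bar>S r \<omega>\<bar>} \<in> events" if "r \<in> E n" for r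
      proof -
        have [measurable]: "S r \<in> borel_measurable M" using that E(2)[of n] by (intro elem_measurable_M[OF HS]) auto
        show ?thesis by measurable
      qed
      then have "{\<omega> \<in> space M. \<exists>r\<in>E n. c < \<bar>S r \<omega>\<bar>} \<in> events"
        using E by (intro sets.sets_Collect_finite_Ex) auto
      then show "?A n \<in> events" using assms by auto
    qed
    have "E n \<subseteq> E m" if "n \<le> m" for n m using that by (auto simp: E_def)
    then show "incseq ?A" unfolding incseq_def by blast
  qed
  moreover have "(\<Union>n. ?A n) = A \<inter> {\<omega> \<in> space M. \<exists>r\<in>D. c < \<bar>S r \<omega>\<bar>}"
    by (auto simp: D_eq)
  ultimately show ?thesis
    using elem_maximal_inequality_finite[OF HS \<open>0 \<le> t\<close> E \<open>0 < c\<close> \<open>0 \<le> \<delta>\<close> \<open>A \<in> sets M\<close>]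
    by (intro LIMSEQ_le_const2[of "\<lambda>n. prob (?A n)"]) auto
qed

text \<open>The isometry as an inequality between nonnegative integrals, so that finiteness of the
  right-hand side need not be discussed.\<close>

lemma elem_square_integral_le:
  assumes HS: "elem H S" and "0 \<le> t"
  shows "(\<integral>\<^sup>+ \<omega>. ennreal ((S t \<omega>)\<^sup>2) \<partial>M) \<le> (\<integral>\<^sup>+ \<omega>. sq_int t H \<omega> \<partial>M)"
proof -
  obtain N \<sigma> \<zeta> C where *: "0 \<le> \<sigma> 0" "\<And>j. j < N \<Longrightarrow> \<sigma> j \<le> \<sigma> (Suc j)"
    "\<And>j. j < N \<Longrightarrow> \<zeta> j \<in> borel_measurable (F (\<sigma> j))"
    "\<And>j \<omega>. j < N \<Longrightarrow> \<omega> \<in> space M \<Longrightarrow> \<bar>\<zeta> j \<omega>\<bar> \<le> C"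
    and D: "\<sigma> N = t"
    and S: "\<And>k \<omega>. k \<le> N \<Longrightarrow> S (\<sigma> k) \<omega> = (\<Sum>j<k. \<zeta> j \<omega> * (B (\<sigma> (Suc j)) \<omega> - B (\<sigma> j) \<omega>))"
    and Q: "\<And>\<omega>. ennreal (\<Sum>j<N. (\<zeta> j \<omega>)\<^sup>2 * (\<sigma> (Suc j) - \<sigma> j)) \<le> sq_int t H \<omega>"
    by (rule elem_discretize[OF assms(1-2), of "{}"]) auto
  have St: "S t = (\<lambda>\<omega>. \<Sum>j<N. \<zeta> j \<omega> * (B (\<sigma> (Suc j)) \<omega> - B (\<sigma> j) \<omega>))"
    using S[of N] D by auto
  have nn: "0 \<le> (\<Sum>j<N. (\<zeta> j \<omega>)\<^sup>2 * (\<sigma> (Suc j) - \<sigma> j))" for \<omega>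
    using *(2) by (intro sum_nonneg) auto
  have "(\<integral>\<^sup>+ \<omega>. ennreal ((S t \<omega>)\<^sup>2) \<partial>M) = ennreal (expectation (\<lambda>\<omega>. \<Sum>j<N. (\<zeta> j \<omega>)\<^sup>2 * (\<sigma> (Suc j) - \<sigma> j)))"
    using discrete_isometry[OF * order_refl] unfolding St by (simp add: nn_integral_eq_integral)
  also have "\<dots> \<le> (\<integral>\<^sup>+ \<omega>. ennreal (\<Sum>j<N. (\<zeta> j \<omega>)\<^sup>2 * (\<sigma> (Suc j) - \<sigma> j)) \<partial>M)"
  proof (cases "integrable M (\<lambda>\<omega>. \<Sum>j<N. (\<zeta> j \<omega>)\<^sup>2 * (\<sigma> (Suc j) - \<sigma> j))")
    case True
    then show ?thesis using nn by (simp add: nn_integral_eq_integral)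
  \<comment> \<open>If the square sum is not integrable, its Bochner integral is 0 by convention and
    the bound is trivial.\<close>
  qed (simp add: not_integrable_integral_eq)
  also have "\<dots> \<le> (\<integral>\<^sup>+ \<omega>. sq_int t H \<omega> \<partial>M)"
    by (intro nn_integral_mono Q)
  finally show ?thesis .
qed

end

section \<open>The Ito integral\<close>

context prob_space
begin

text \<open>The indicators tend to 0 almost surely and are dominated by 1. The value type is left
  general because the lemma serves both real differences and the extended values of
  \<open>sq_int\<close>.\<close>

lemma prob_tendsto_zero_of_AE:
  fixes X :: "nat \<Rightarrow> 'a \<Rightarrow> 'b :: {second_countable_topology, linorder_topology}"
  assumes [measurable]: "\<And>n. X n \<in> borel_measurable M"
    and lim: "AE \<omega> in M. (\<lambda>n. X n \<omega>) \<longlonglongrightarrow> l" and e: "l < e"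
  shows "(\<lambda>n. prob {\<omega> \<in> space M. e < X n \<omega>}) \<longlonglongrightarrow> 0"
proof -
  have "(\<lambda>n. expectation (indicator {\<omega> \<in> space M. e < X n \<omega>} :: 'a \<Rightarrow> real)) \<longlonglongrightarrow> expectation (\<lambda>\<omega>. 0)"
  proof (rule integral_dominated_convergence[where w = "\<lambda>_. 1"])
    show "AE \<omega> in M. (\<lambda>n. indicator {\<omega> \<in> space M. e < X n \<omega>} \<omega> :: real) \<longlonglongrightarrow> 0"
      using lim
    proof eventually_elim
      case (elim \<omega>)
      have "eventually (\<lambda>n. X n \<omega> < e) sequentially" using order_tendstoD(2)[OF elim e] .
      then have "eventually (\<lambda>n. indicator {\<omega> \<in> space M. e < X n \<omega>} \<omega> = (0 :: real)) sequentially"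
        by eventually_elim (auto simp: indicator_def dest: less_asym)
      then show ?case by (rule tendsto_eventually)
    qed
  qed (auto simp: indicator_def)
  then show ?thesis by simp
qed

lemma AE_zero_if_prob_zero:
  fixes Z :: "'a \<Rightarrow> real"
  assumes [measurable]: "Z \<in> borel_measurable M" "A \<in> sets M"
    and "\<And>c. 0 < c \<Longrightarrow> prob (A \<inter> {\<omega> \<in> space M. c < \<bar>Z \<omega>\<bar>}) = 0"
  shows "AE \<omega> in M. \<omega> \<in> A \<longrightarrow> Z \<omega> = 0"
proof -
  have "AE \<omega> in M. \<omega> \<notin> A \<inter> {\<omega> \<in> space M. inverse (Suc n) < \<bar>Z \<omega>\<bar>}" for n :: nat
    using assms(3)[of "inverse (Suc n)"] by (subst prob_eq_0[symmetric]) auto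
  then have "AE \<omega> in M. \<forall>n :: nat. \<omega> \<notin> A \<inter> {\<omega> \<in> space M. inverse (Suc n) < \<bar>Z \<omega>\<bar>}"
    unfolding AE_all_countable by blast
  then show ?thesis
  proof eventually_elim
    case (elim \<omega>)
    show ?case
    proof (rule impI, rule ccontr)
      assume *: "\<omega> \<in> A" "Z \<omega> \<noteq> 0"
      obtain n :: nat where "inverse (Suc n) < \<bar>Z \<omega>\<bar>"
        using reals_Archimedean[of "\<bar>Z \<omega>\<bar>"] *(2) by auto
      then show False using elim * sets.sets_into_space[OF assms(2)] by blast
    qed
  qed
qed

text \<open>Joins the two evaluations of the sums along a line: in probability through stochastic
  integrals, almost surely through the equation.\<close>

lemma AE_eq_if_limits:
  fixes X :: "nat \<Rightarrow> 'a \<Rightarrow> real"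
  assumes [measurable]: "\<And>n. X n \<in> borel_measurable M" "Y \<in> borel_measurable M" "Z \<in> borel_measurable M"
    and prob: "\<And>c. 0 < c \<Longrightarrow> (\<lambda>n. prob {\<omega> \<in> space M. c < \<bar>X n \<omega> - Z \<omega>\<bar>}) \<longlonglongrightarrow> 0"
    and AE: "AE \<omega> in M. (\<lambda>n. X n \<omega>) \<longlonglongrightarrow> Y \<omega>"
  shows "AE \<omega> in M. Z \<omega> = Y \<omega>"
proof -
  have "prob (space M \<inter> {\<omega> \<in> space M. c < \<bar>Z \<omega> - Y \<omega>\<bar>}) = 0" if c: "0 < c" for c
  proof -
    have "AE \<omega> in M. (\<lambda>n. \<bar>X n \<omega> - Y \<omega>\<bar>) \<longlonglongrightarrow> 0"
      using AE by eventually_elim (simp add: LIM_zero tendsto_rabs_zero)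
    then have "(\<lambda>n. prob {\<omega> \<in> space M. c / 2 < \<bar>X n \<omega> - Y \<omega>\<bar>}) \<longlonglongrightarrow> 0"
      using c by (intro prob_tendsto_zero_of_AE) auto
    from tendsto_add[OF prob[of "c / 2"] this]
    have "(\<lambda>n. prob {\<omega> \<in> space M. c / 2 < \<bar>X n \<omega> - Z \<omega>\<bar>} + prob {\<omega> \<in> space M. c / 2 < \<bar>X n \<omega> - Y \<omega>\<bar>}) \<longlonglongrightarrow> 0"
      using c by simp
    moreover have "prob (space M \<inter> {\<omega> \<in> space M. c < \<bar>Z \<omega> - Y \<omega>\<bar>}) \<le>
        prob {\<omega> \<in> space M. c / 2 < \<bar>X n \<omega> - Z \<omega>\<bar>} + prob {\<omega> \<in> space M. c / 2 < \<bar>X n \<omega> - Y \<omega>\<bar>}" for n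
    proof -
      have "prob (space M \<inter> {\<omega> \<in> space M. c < \<bar>Z \<omega> - Y \<omega>\<bar>}) \<le>
        prob ({\<omega> \<in> space M. c / 2 < \<bar>X n \<omega> - Z \<omega>\<bar>} \<union> {\<omega> \<in> space M. c / 2 < \<bar>X n \<omega> - Y \<omega>\<bar>})"
        by (rule finite_measure_mono) (auto simp: abs_if split: if_splits)
      also have "\<dots> \<le> prob {\<omega> \<in> space M. c / 2 < \<bar>X n \<omega> - Z \<omega>\<bar>} + prob {\<omega> \<in> space M. c / 2 < \<bar>X n \<omega> - Y \<omega>\<bar>}"
        by (rule measure_Un_le) auto
      finally show ?thesis .
    qed
    ultimately have "prob (space M \<inter> {\<omega> \<in> space M. c < \<bar>Z \<omega> - Y \<omega>\<bar>}) \<le> 0"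
      by (intro LIMSEQ_le_const) auto
    then show ?thesis using measure_nonneg[of M] by (intro antisym) auto
  qed
  from AE_zero_if_prob_zero[OF _ _ this] have "AE \<omega> in M. \<omega> \<in> space M \<longrightarrow> Z \<omega> - Y \<omega> = 0" by simp
  then show ?thesis by auto
qed

end

section \<open>Integrals as limits in probability of simple ones\<close>

context ito_integrator
begin

text \<open>\<open>Z\<close> is a version of \<open>\<integral>\<^sub>0\<^sup>t K dB\<close>.\<close>

definition ito_at :: "real \<Rightarrow> (real \<Rightarrow> 'a \<Rightarrow> real) \<Rightarrow> ('a \<Rightarrow> real) \<Rightarrow> bool" where
  "ito_at t K Z \<longleftrightarrow> jointly_measurable t K \<and> Z \<in> borel_measurable M \<and>
     (\<forall>e>0. \<exists>H S. elem H S \<and>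
        prob {\<omega> \<in> space M. ennreal e < sq_int t (\<lambda>s \<omega>. H s \<omega> - K s \<omega>) \<omega>} < e \<and>
        prob {\<omega> \<in> space M. e < \<bar>S t \<omega> - Z \<omega>\<bar>} < e)"

lemma ito_atD:
  assumes "ito_at t K Z"
  shows "jointly_measurable t K" "Z \<in> borel_measurable M"
    "0 < e \<Longrightarrow> \<exists>H S. elem H S \<and>
        prob {\<omega> \<in> space M. ennreal e < sq_int t (\<lambda>s \<omega>. H s \<omega> - K s \<omega>) \<omega>} < e \<and>
        prob {\<omega> \<in> space M. e < \<bar>S t \<omega> - Z \<omega>\<bar>} < e"
  using assms by (auto simp: ito_at_def)

lemma ito_at_zero: "ito_at t (\<lambda>s \<omega>. 0) (\<lambda>\<omega>. 0)"
  unfolding ito_at_def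
proof (intro conjI allI impI)
  fix e :: real assume "0 < e"
  then show "\<exists>H S. elem H S \<and>
        prob {\<omega> \<in> space M. ennreal e < sq_int t (\<lambda>s \<omega>. H s \<omega> - 0) \<omega>} < e \<and>
        prob {\<omega> \<in> space M. e < \<bar>S t \<omega> - 0\<bar>} < e"
    by (intro exI[of _ "\<lambda>s \<omega>. 0"] conjI elem_zero) (auto simp: sq_int_def)
qed (auto simp: jointly_measurable_zero)

lemma ito_at_uminus:
  assumes "ito_at t K Z"
  shows "ito_at t (\<lambda>s \<omega>. - K s \<omega>) (\<lambda>\<omega>. - Z \<omega>)"
  unfolding ito_at_def
proof (intro conjI allI impI)
  fix e :: real assume "0 < e"
  then obtain H S where HS: "elem H S" "prob {\<omega> \<in> space M. ennreal e < sq_int t (\<lambda>s \<omega>. H s \<omega> - K s \<omega>) \<omega>} < e"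
    "prob {\<omega> \<in> space M. e < \<bar>S t \<omega> - Z \<omega>\<bar>} < e"
    using ito_atD(3)[OF assms] by blast
  have "sq_int t (\<lambda>s \<omega>. - H s \<omega> - - K s \<omega>) = sq_int t (\<lambda>s \<omega>. H s \<omega> - K s \<omega>)"
    by (simp add: sq_int_def power2_commute fun_eq_iff)
  moreover have "\<bar>- S t \<omega> - - Z \<omega>\<bar> = \<bar>S t \<omega> - Z \<omega>\<bar>" for \<omega> by simp
  ultimately show "\<exists>H S. elem H S \<and>
        prob {\<omega> \<in> space M. ennreal e < sq_int t (\<lambda>s \<omega>. H s \<omega> - - K s \<omega>) \<omega>} < e \<and>
        prob {\<omega> \<in> space M. e < \<bar>S t \<omega> - - Z \<omega>\<bar>} < e"
    using HS elem_uminus[OF HS(1)] by (intro exI[of _ "\<lambda>s \<omega>. - H s \<omega>"] exI[of _ "\<lambda>s \<omega>. - S s \<omega>"]) (simp only:)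
qed (use ito_atD[OF assms] in \<open>auto intro: jointly_measurable_uminus\<close>)

lemma ito_at_add:
  assumes K: "ito_at t K Z" and K': "ito_at t K' Z'" and "0 \<le> t"
  shows "ito_at t (\<lambda>s \<omega>. K s \<omega> + K' s \<omega>) (\<lambda>\<omega>. Z \<omega> + Z' \<omega>)"
  unfolding ito_at_def
proof (intro conjI allI impI)
  fix e :: real assume "0 < e"
  \<comment> \<open>Quarters, because \<open>sq_int_add_le\<close> doubles each of two terms; the
    same choice keeps the sum of two exceptional probabilities below e.\<close>
  then have e: "0 < e / 4" by simp
  obtain H S where HS: "elem H S" "prob {\<omega> \<in> space M. ennreal (e / 4) < sq_int t (\<lambda>s \<omega>. H s \<omega> - K s \<omega>) \<omega>} < e / 4"
    "prob {\<omega> \<in> space M. e / 4 < \<bar>S t \<omega> - Z \<omega>\<bar>} < e / 4"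
    using ito_atD(3)[OF K e] by blast
  obtain H' S' where HS': "elem H' S'" "prob {\<omega> \<in> space M. ennreal (e / 4) < sq_int t (\<lambda>s \<omega>. H' s \<omega> - K' s \<omega>) \<omega>} < e / 4"
    "prob {\<omega> \<in> space M. e / 4 < \<bar>S' t \<omega> - Z' \<omega>\<bar>} < e / 4"
    using ito_atD(3)[OF K' e] by blast
  note jm = jointly_measurable_diff[OF elem_jointly_measurable[OF HS(1)] ito_atD(1)[OF K]]
    jointly_measurable_diff[OF elem_jointly_measurable[OF HS'(1)] ito_atD(1)[OF K']]
  note [measurable] = jm[THEN sq_int_measurable] ito_atD(2)[OF K] ito_atD(2)[OF K']
    elem_measurable_M[OF HS(1) \<open>0 \<le> t\<close>] elem_measurable_M[OF HS'(1) \<open>0 \<le> t\<close>]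
  have "prob {\<omega> \<in> space M. ennreal e < sq_int t (\<lambda>s \<omega>. H s \<omega> + H' s \<omega> - (K s \<omega> + K' s \<omega>)) \<omega>} \<le>
    prob ({\<omega> \<in> space M. ennreal (e / 4) < sq_int t (\<lambda>s \<omega>. H s \<omega> - K s \<omega>) \<omega>} \<union>
      {\<omega> \<in> space M. ennreal (e / 4) < sq_int t (\<lambda>s \<omega>. H' s \<omega> - K' s \<omega>) \<omega>})"
  proof (rule finite_measure_mono, safe)
    fix \<omega> assume *: "\<omega> \<in> space M" "ennreal e < sq_int t (\<lambda>s \<omega>. H s \<omega> + H' s \<omega> - (K s \<omega> + K' s \<omega>)) \<omega>"
      "\<not> ennreal (e / 4) < sq_int t (\<lambda>s \<omega>. H' s \<omega> - K' s \<omega>) \<omega>"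
    show "ennreal (e / 4) < sq_int t (\<lambda>s \<omega>. H s \<omega> - K s \<omega>) \<omega>"
    proof (rule ccontr)
      assume n: "\<not> ennreal (e / 4) < sq_int t (\<lambda>s \<omega>. H s \<omega> - K s \<omega>) \<omega>"
      have "sq_int t (\<lambda>s \<omega>. H s \<omega> + H' s \<omega> - (K s \<omega> + K' s \<omega>)) \<omega> = sq_int t (\<lambda>s \<omega>. (H s \<omega> - K s \<omega>) + (H' s \<omega> - K' s \<omega>)) \<omega>"
        by (simp add: sq_int_def algebra_simps)
      also have "\<dots> \<le> 2 * sq_int t (\<lambda>s \<omega>. H s \<omega> - K s \<omega>) \<omega> + 2 * sq_int t (\<lambda>s \<omega>. H' s \<omega> - K' s \<omega>) \<omega>"
        by (rule sq_int_add_le[OF jm *(1)])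
      also have "\<dots> \<le> 2 * ennreal (e / 4) + 2 * ennreal (e / 4)"
        using n *(3) by (intro add_mono mult_left_mono) (auto simp: not_less)
      also have "\<dots> = ennreal e"
        using \<open>0 < e\<close> by (simp add: ennreal_numeral[symmetric] ennreal_mult[symmetric] ennreal_plus[symmetric] del: ennreal_numeral ennreal_plus)
      finally show False using *(2) by simp
    qed
  qed auto
  also have "\<dots> \<le> prob {\<omega> \<in> space M. ennreal (e / 4) < sq_int t (\<lambda>s \<omega>. H s \<omega> - K s \<omega>) \<omega>} +
      prob {\<omega> \<in> space M. ennreal (e / 4) < sq_int t (\<lambda>s \<omega>. H' s \<omega> - K' s \<omega>) \<omega>}"
    by (rule measure_Un_le) auto
  finally have 1: "prob {\<omega> \<in> space M. ennreal e < sq_int t (\<lambda>s \<omega>. H s \<omega> + H' s \<omega> - (K s \<omega> + K' s \<omega>)) \<omega>} < e"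
    using HS HS' \<open>0 < e\<close> by simp
  have "prob {\<omega> \<in> space M. e < \<bar>S t \<omega> + S' t \<omega> - (Z \<omega> + Z' \<omega>)\<bar>} \<le>
    prob ({\<omega> \<in> space M. e / 4 < \<bar>S t \<omega> - Z \<omega>\<bar>} \<union> {\<omega> \<in> space M. e / 4 < \<bar>S' t \<omega> - Z' \<omega>\<bar>})"
    using \<open>0 < e\<close> by (intro finite_measure_mono) (auto simp: abs_if split: if_splits)
  also have "\<dots> \<le> prob {\<omega> \<in> space M. e / 4 < \<bar>S t \<omega> - Z \<omega>\<bar>} + prob {\<omega> \<in> space M. e / 4 < \<bar>S' t \<omega> - Z' \<omega>\<bar>}"
    by (rule measure_Un_le) auto
  finally have 2: "prob {\<omega> \<in> space M. e < \<bar>S t \<omega> + S' t \<omega> - (Z \<omega> + Z' \<omega>)\<bar>} < e"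
    using HS HS' \<open>0 < e\<close> by simp
  from elem_add[OF HS(1) HS'(1)] 1 2
  show "\<exists>H S. elem H S \<and>
        prob {\<omega> \<in> space M. ennreal e < sq_int t (\<lambda>s \<omega>. H s \<omega> - (K s \<omega> + K' s \<omega>)) \<omega>} < e \<and>
        prob {\<omega> \<in> space M. e < \<bar>S t \<omega> - (Z \<omega> + Z' \<omega>)\<bar>} < e"
    by (intro exI[of _ "\<lambda>s \<omega>. H s \<omega> + H' s \<omega>"] exI[of _ "\<lambda>s \<omega>. S s \<omega> + S' s \<omega>"]) simp
qed (use ito_atD[OF K] ito_atD[OF K'] in \<open>auto intro: jointly_measurable_add\<close>)

lemma ito_at_diff:
  assumes "ito_at t K Z" "ito_at t K' Z'" "0 \<le> t"
  shows "ito_at t (\<lambda>s \<omega>. K s \<omega> - K' s \<omega>) (\<lambda>\<omega>. Z \<omega> - Z' \<omega>)"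
  using ito_at_add[OF assms(1) ito_at_uminus[OF assms(2)] assms(3)] by simp

lemma ito_at_sum:
  assumes "finite L" "\<And>l. l \<in> L \<Longrightarrow> ito_at t (K l) (Z l)" "0 \<le> t"
  shows "ito_at t (\<lambda>s \<omega>. \<Sum>l\<in>L. K l s \<omega>) (\<lambda>\<omega>. \<Sum>l\<in>L. Z l \<omega>)"
  using assms(1,2)
  by (induction L rule: finite_induct) (auto intro: ito_at_zero ito_at_add[OF _ _ assms(3)])

text \<open>The maximal inequality is applied to an approximating H at level c / 2 and with 4
  \<delta>. One factor 4 comes from halving c, the other from passing between H and K by
  \<open>sq_int_add_le\<close>; together they make 16.\<close>

lemma ito_at_tail:
  assumes K: "ito_at t K Z" and "0 \<le> t" "A \<in> sets M" "0 < c" "0 < \<delta>"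
  shows "prob (A \<inter> {\<omega> \<in> space M. c < \<bar>Z \<omega>\<bar>})
    \<le> prob (A \<inter> {\<omega> \<in> space M. ennreal \<delta> < sq_int t K \<omega>}) + 16 * \<delta> / c\<^sup>2"
proof (rule field_le_epsilon)
  fix \<eta> :: real assume "0 < \<eta>"
  \<comment> \<open>The bound \<eta> / 2 controls the two exceptional probabilities, c / 2 the
    distance of \<open>S t\<close> from Z, and \<delta> the distance of H from K.\<close>
  define e where "e = min (\<eta> / 2) (min \<delta> (c / 2))"
  have e: "0 < e" "e \<le> \<eta> / 2" "e \<le> \<delta>" "e \<le> c / 2" using assms \<open>0 < \<eta>\<close> by (auto simp: e_def)
  obtain H S where HS: "elem H S" "prob {\<omega> \<in> space M. ennreal e < sq_int t (\<lambda>s \<omega>. H s \<omega> - K s \<omega>) \<omega>} < e"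
    "prob {\<omega> \<in> space M. e < \<bar>S t \<omega> - Z \<omega>\<bar>} < e"
    using ito_atD(3)[OF K e(1)] by blast
  note jm = jointly_measurable_diff[OF elem_jointly_measurable[OF HS(1)] ito_atD(1)[OF K]] ito_atD(1)[OF K]
  note [measurable] = jm[THEN sq_int_measurable] ito_atD(2)[OF K] \<open>A \<in> sets M\<close>
    elem_measurable_M[OF HS(1) \<open>0 \<le> t\<close>]
  have "prob (A \<inter> {\<omega> \<in> space M. c < \<bar>Z \<omega>\<bar>}) \<le>
      prob ((A \<inter> {\<omega> \<in> space M. \<exists>r\<in>{t}. c / 2 < \<bar>S r \<omega>\<bar>}) \<union> {\<omega> \<in> space M. e < \<bar>S t \<omega> - Z \<omega>\<bar>})"
    using e by (intro finite_measure_mono) auto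
  also have "\<dots> \<le> prob (A \<inter> {\<omega> \<in> space M. \<exists>r\<in>{t}. c / 2 < \<bar>S r \<omega>\<bar>}) + prob {\<omega> \<in> space M. e < \<bar>S t \<omega> - Z \<omega>\<bar>}"
    by (rule measure_Un_le) auto
  also have "\<dots> \<le> (prob (A \<inter> {\<omega> \<in> space M. ennreal (4 * \<delta>) < sq_int t H \<omega>}) + 4 * \<delta> / (c / 2)\<^sup>2) + \<eta> / 2"
    using HS(3) e assms
    by (intro add_mono elem_maximal_inequality_finite[OF HS(1)]) auto
  also have "prob (A \<inter> {\<omega> \<in> space M. ennreal (4 * \<delta>) < sq_int t H \<omega>}) \<le>
      prob ((A \<inter> {\<omega> \<in> space M. ennreal \<delta> < sq_int t K \<omega>}) \<union> {\<omega> \<in> space M. ennreal e < sq_int t (\<lambda>s \<omega>. H s \<omega> - K s \<omega>) \<omega>})"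
  proof (rule finite_measure_mono, safe)
    fix \<omega> assume *: "\<omega> \<in> space M" "ennreal (4 * \<delta>) < sq_int t H \<omega>"
      "\<not> ennreal e < sq_int t (\<lambda>s \<omega>. H s \<omega> - K s \<omega>) \<omega>"
    show "ennreal \<delta> < sq_int t K \<omega>"
    proof (rule ccontr)
      assume n: "\<not> ennreal \<delta> < sq_int t K \<omega>"
      have "sq_int t H \<omega> = sq_int t (\<lambda>s \<omega>. (H s \<omega> - K s \<omega>) + K s \<omega>) \<omega>" by simp
      also have "\<dots> \<le> 2 * sq_int t (\<lambda>s \<omega>. H s \<omega> - K s \<omega>) \<omega> + 2 * sq_int t K \<omega>"
        by (rule sq_int_add_le[OF jm *(1)])
      also have "\<dots> \<le> 2 * ennreal \<delta> + 2 * ennreal \<delta>"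
        using n *(3) ennreal_leI[OF e(3)] by (intro add_mono mult_left_mono) (auto simp: not_less)
      also have "\<dots> = ennreal (4 * \<delta>)"
        using \<open>0 < \<delta>\<close> by (simp add: ennreal_numeral[symmetric] ennreal_mult[symmetric] ennreal_plus[symmetric] del: ennreal_numeral ennreal_plus)
      finally show False using *(2) by simp
    qed
  qed auto
  also have "\<dots> \<le> prob (A \<inter> {\<omega> \<in> space M. ennreal \<delta> < sq_int t K \<omega>}) + prob {\<omega> \<in> space M. ennreal e < sq_int t (\<lambda>s \<omega>. H s \<omega> - K s \<omega>) \<omega>}"
    by (rule measure_Un_le) auto
  also have "\<dots> \<le> prob (A \<inter> {\<omega> \<in> space M. ennreal \<delta> < sq_int t K \<omega>}) + \<eta> / 2"
    using HS(2) e by simp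
  finally show "prob (A \<inter> {\<omega> \<in> space M. c < \<bar>Z \<omega>\<bar>})
    \<le> prob (A \<inter> {\<omega> \<in> space M. ennreal \<delta> < sq_int t K \<omega>}) + 16 * \<delta> / c\<^sup>2 + \<eta>"
    by (simp add: power_divide)
qed

text \<open>On A the integrand vanishes, so the first term of \<open>ito_at_tail\<close> is 0 for
  every \<delta>, and the second tends to 0 with \<delta>. As A may be any event, random times can
  be treated through events such as r \<le> \<tau>.\<close>

lemma ito_at_local:
  assumes K: "ito_at t K Z" and "0 \<le> t" and A: "A \<in> sets M"
    and zero: "AE \<omega> in M. \<omega> \<in> A \<longrightarrow> sq_int t K \<omega> = 0"
  shows "AE \<omega> in M. \<omega> \<in> A \<longrightarrow> Z \<omega> = 0"
proof (rule AE_zero_if_prob_zero[OF ito_atD(2)[OF K] A])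
  fix c :: real assume c: "0 < c"
  note [measurable] = sq_int_measurable[OF ito_atD(1)[OF K]] A
  have "prob (A \<inter> {\<omega> \<in> space M. c < \<bar>Z \<omega>\<bar>}) \<le> 0 + e" if "0 < e" for e
  proof -
    define \<delta> where "\<delta> = e * c\<^sup>2 / 16"
    have \<delta>: "0 < \<delta>" "16 * \<delta> / c\<^sup>2 = e" using c that by (auto simp: \<delta>_def)
    have "AE \<omega> in M. \<omega> \<notin> A \<inter> {\<omega> \<in> space M. ennreal \<delta> < sq_int t K \<omega>}"
      using zero by eventually_elim auto
    then have "prob (A \<inter> {\<omega> \<in> space M. ennreal \<delta> < sq_int t K \<omega>}) = 0"
      by (subst prob_eq_0) auto
    then show ?thesis using ito_at_tail[OF K \<open>0 \<le> t\<close> A c \<delta>(1)] \<delta> by simp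
  qed
  then have "prob (A \<inter> {\<omega> \<in> space M. c < \<bar>Z \<omega>\<bar>}) \<le> 0" by (rule field_le_epsilon)
  then show "prob (A \<inter> {\<omega> \<in> space M. c < \<bar>Z \<omega>\<bar>}) = 0" using measure_nonneg[of M] by (intro antisym) auto
qed

text \<open>The tail estimate turns pathwise convergence of the integrands into convergence of the
  integrals in probability, with no domination over \<omega>.\<close>

lemma ito_at_tendsto_zero:
  assumes K: "\<And>n. ito_at t (K n) (Z n)" and "0 \<le> t"
    and lim: "AE \<omega> in M. (\<lambda>n :: nat. sq_int t (K n) \<omega>) \<longlonglongrightarrow> 0" and c: "0 < c"
  shows "(\<lambda>n. prob {\<omega> \<in> space M. c < \<bar>Z n \<omega>\<bar>}) \<longlonglongrightarrow> 0"
proof (rule LIMSEQ_I)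
  fix e :: real assume e: "0 < e"
  define \<delta> where "\<delta> = e * c\<^sup>2 / 32"
  have \<delta>: "0 < \<delta>" "16 * \<delta> / c\<^sup>2 = e / 2" using c e by (auto simp: \<delta>_def)
  have "(\<lambda>n. prob {\<omega> \<in> space M. ennreal \<delta> < sq_int t (K n) \<omega>}) \<longlonglongrightarrow> 0"
    using lim \<delta> sq_int_measurable[OF ito_atD(1)[OF K]] by (intro prob_tendsto_zero_of_AE) auto
  then have "eventually (\<lambda>n. prob {\<omega> \<in> space M. ennreal \<delta> < sq_int t (K n) \<omega>} < e / 2) sequentially"
    using e by (intro order_tendstoD(2)) auto
  then obtain n0 where n0: "\<And>n. n \<ge> n0 \<Longrightarrow> prob {\<omega> \<in> space M. ennreal \<delta> < sq_int t (K n) \<omega>} < e / 2"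
    by (auto simp: eventually_sequentially)
  show "\<exists>n0. \<forall>n\<ge>n0. norm (prob {\<omega> \<in> space M. c < \<bar>Z n \<omega>\<bar>} - 0) < e"
  proof (intro exI allI impI)
    fix n assume "n \<ge> n0"
    have eq: "space M \<inter> {\<omega> \<in> space M. P \<omega>} = {\<omega> \<in> space M. P \<omega>}" for P by auto
    show "norm (prob {\<omega> \<in> space M. c < \<bar>Z n \<omega>\<bar>} - 0) < e"
      using ito_at_tail[OF K[of n] \<open>0 \<le> t\<close> sets.top c \<delta>(1)] n0[OF \<open>n \<ge> n0\<close>] \<delta>(2) unfolding eq by simp
  qed
qed

text \<open>Extracts from \<open>is_ito_integral\<close> one progressive K for all times, with the
  increment over [a, b] as the integral of K cut to (a, b], seen from any later time t. A common t
  is what allows increments over different cells to be added by \<open>ito_at_sum\<close>.\<close>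

lemma ito_integral_obtain:
  assumes I: "is_ito_integral M F T B H I" and "0 \<le> T"
  obtains K where "progressive_on F T K" "AE \<omega> in M. \<forall>s\<in>{0..T}. H s \<omega> = K s \<omega>"
    "\<And>a b t. 0 \<le> a \<Longrightarrow> a \<le> b \<Longrightarrow> b \<le> t \<Longrightarrow> t \<le> T \<Longrightarrow>
      ito_at t (\<lambda>s \<omega>. K s \<omega> * indicator {a<..b} s) (\<lambda>\<omega>. I b \<omega> - I a \<omega>)"
    "AE \<omega> in M. I 0 \<omega> = 0"
proof -
  from I obtain K n \<tau> \<xi> where K: "progressive_on F T K" "AE \<omega> in M. \<forall>s\<in>{0..T}. H s \<omega> = K s \<omega>"
    and sp: "\<And>m::nat. simple_process F T (n m) (\<tau> m) (\<xi> m)"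
    and l1: "\<And>e. e > 0 \<Longrightarrow> (\<lambda>m. prob {\<omega> \<in> space M. ennreal e <
               (\<integral>\<^sup>+ s\<in>{0..T}. ennreal ((simple_value (n m) (\<tau> m) (\<xi> m) s \<omega> - K s \<omega>)\<^sup>2) \<partial>lborel)}) \<longlonglongrightarrow> 0"
    and l2: "\<And>t e. t \<in> {0..T} \<Longrightarrow> e > 0 \<Longrightarrow> (\<lambda>m. prob {\<omega> \<in> space M.
               e < \<bar>simple_integral (n m) (\<tau> m) (\<xi> m) B t \<omega> - I t \<omega>\<bar>}) \<longlonglongrightarrow> 0"
    unfolding is_ito_integral_def by blast
  define V where "V m = simple_value (n m) (\<tau> m) (\<xi> m)" for m
  define S where "S m = simple_integral (n m) (\<tau> m) (\<xi> m) B" for m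
  have el: "elem (V m) (S m)" for m unfolding V_def S_def using elem_simple[OF sp] .
  have I_meas: "I t \<in> borel_measurable M" if "t \<in> {0..T}" for t
    using I that measurable_F_imp_M[of "I t" t] by (auto simp: is_ito_integral_def adapted_on_def)
  have jmK: "jointly_measurable T K" using progressive_imp_jointly_measurable[OF K(1)] \<open>0 \<le> T\<close> by simp
  have at: "ito_at t (\<lambda>s \<omega>. K s \<omega> * indicator {a<..b} s) (\<lambda>\<omega>. I b \<omega> - I a \<omega>)"
    if ab: "0 \<le> a" "a \<le> b" "b \<le> t" "t \<le> T" for a b t
    unfolding ito_at_def
  proof (intro conjI allI impI)
    show "jointly_measurable t (\<lambda>s \<omega>. K s \<omega> * indicator {a<..b} s)"
      using jointly_measurable_restrict[OF jmK] ab by simp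
    show "(\<lambda>\<omega>. I b \<omega> - I a \<omega>) \<in> borel_measurable M"
      using I_meas[of a] I_meas[of b] ab by simp
    fix e :: real assume e: "0 < e"
    have "eventually (\<lambda>m. prob {\<omega> \<in> space M. ennreal e < sq_int T (\<lambda>s \<omega>. V m s \<omega> - K s \<omega>) \<omega>} < e) sequentially"
      using order_tendstoD(2)[OF l1[OF e] e] by (simp add: sq_int_def V_def)
    moreover have "eventually (\<lambda>m. prob {\<omega> \<in> space M. e / 2 < \<bar>S m a \<omega> - I a \<omega>\<bar>} < e / 2) sequentially"
      "eventually (\<lambda>m. prob {\<omega> \<in> space M. e / 2 < \<bar>S m b \<omega> - I b \<omega>\<bar>} < e / 2) sequentially"
      using order_tendstoD(2)[OF l2[of a "e / 2"], of "e / 2"] order_tendstoD(2)[OF l2[of b "e / 2"], of "e / 2"] e ab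
      by (auto simp: S_def)
    ultimately have "eventually (\<lambda>m. prob {\<omega> \<in> space M. ennreal e < sq_int T (\<lambda>s \<omega>. V m s \<omega> - K s \<omega>) \<omega>} < e \<and>
        prob {\<omega> \<in> space M. e / 2 < \<bar>S m a \<omega> - I a \<omega>\<bar>} < e / 2 \<and>
        prob {\<omega> \<in> space M. e / 2 < \<bar>S m b \<omega> - I b \<omega>\<bar>} < e / 2) sequentially"
      by eventually_elim simp
    then obtain m where m: "prob {\<omega> \<in> space M. ennreal e < sq_int T (\<lambda>s \<omega>. V m s \<omega> - K s \<omega>) \<omega>} < e"
        "prob {\<omega> \<in> space M. e / 2 < \<bar>S m a \<omega> - I a \<omega>\<bar>} < e / 2"
        "prob {\<omega> \<in> space M. e / 2 < \<bar>S m b \<omega> - I b \<omega>\<bar>} < e / 2"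
      by (auto simp: eventually_sequentially)
    note [measurable] = sq_int_measurable[OF jointly_measurable_diff[OF elem_jointly_measurable[OF el[of m]] jmK]]
    have [measurable]: "I a \<in> borel_measurable M" "I b \<in> borel_measurable M" "S m a \<in> borel_measurable M" "S m b \<in> borel_measurable M"
      using I_meas ab elem_measurable_M[OF el[of m]] by auto
    show "\<exists>H S. elem H S \<and>
        prob {\<omega> \<in> space M. ennreal e < sq_int t (\<lambda>s \<omega>. H s \<omega> - K s \<omega> * indicator {a<..b} s) \<omega>} < e \<and>
        prob {\<omega> \<in> space M. e < \<bar>S t \<omega> - (I b \<omega> - I a \<omega>)\<bar>} < e"
    proof (intro exI conjI)
      show "elem (\<lambda>s \<omega>. V m s \<omega> * indicator {a<..b} s) (\<lambda>t \<omega>. S m (min b t) \<omega> - S m (min a t) \<omega>)"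
        using elem_restrict[OF el] ab by simp
      have "prob {\<omega> \<in> space M. ennreal e < sq_int t (\<lambda>s \<omega>. V m s \<omega> * indicator {a<..b} s - K s \<omega> * indicator {a<..b} s) \<omega>}
          \<le> prob {\<omega> \<in> space M. ennreal e < sq_int T (\<lambda>s \<omega>. V m s \<omega> - K s \<omega>) \<omega>}"
        by (rule finite_measure_mono)
           (auto intro!: less_le_trans[OF _ sq_int_mono[OF _ \<open>t \<le> T\<close>]] simp: indicator_def)
      with m show "prob {\<omega> \<in> space M. ennreal e < sq_int t (\<lambda>s \<omega>. V m s \<omega> * indicator {a<..b} s - K s \<omega> * indicator {a<..b} s) \<omega>} < e"
        by simp
      have mins: "min b t = b" "min a t = a" using ab by auto
      have "prob {\<omega> \<in> space M. e < \<bar>S m (min b t) \<omega> - S m (min a t) \<omega> - (I b \<omega> - I a \<omega>)\<bar>} \<le>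
        prob ({\<omega> \<in> space M. e / 2 < \<bar>S m a \<omega> - I a \<omega>\<bar>} \<union> {\<omega> \<in> space M. e / 2 < \<bar>S m b \<omega> - I b \<omega>\<bar>})"
        unfolding mins by (rule finite_measure_mono) (auto simp: abs_if split: if_splits)
      also have "\<dots> \<le> prob {\<omega> \<in> space M. e / 2 < \<bar>S m a \<omega> - I a \<omega>\<bar>} + prob {\<omega> \<in> space M. e / 2 < \<bar>S m b \<omega> - I b \<omega>\<bar>}"
        by (rule measure_Un_le) auto
      finally show "prob {\<omega> \<in> space M. e < \<bar>S m (min b t) \<omega> - S m (min a t) \<omega> - (I b \<omega> - I a \<omega>)\<bar>} < e"
        using m by simp
    qed
  qed
  have "AE \<omega> in M. \<omega> \<in> space M \<longrightarrow> I 0 \<omega> = 0"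
  proof (rule AE_zero_if_prob_zero)
    fix c :: real assume "0 < c"
    have "(\<lambda>m :: nat. prob {\<omega> \<in> space M. c < \<bar>I 0 \<omega>\<bar>}) \<longlonglongrightarrow> 0"
      using l2[of 0 c] \<open>0 < c\<close> \<open>0 \<le> T\<close> elem_at_zero[OF el] by (simp add: S_def)
    then have "prob {\<omega> \<in> space M. c < \<bar>I 0 \<omega>\<bar>} = 0" by (simp add: LIMSEQ_const_iff)
    moreover have "space M \<inter> {\<omega> \<in> space M. c < \<bar>I 0 \<omega>\<bar>} = {\<omega> \<in> space M. c < \<bar>I 0 \<omega>\<bar>}" by auto
    ultimately show "prob (space M \<inter> {\<omega> \<in> space M. c < \<bar>I 0 \<omega>\<bar>}) = 0" by simp
  qed (use I_meas[of 0] \<open>0 \<le> T\<close> in auto)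
  then have "AE \<omega> in M. I 0 \<omega> = 0" by auto
  from that[OF K at this] show thesis by blast
qed

end

section \<open>Existence of the integral of a left-continuous integrand\<close>

definition clip :: "real \<Rightarrow> real \<Rightarrow> real" where
  "clip c x = max (- c) (min c x)"

lemma abs_clip_le: "0 \<le> c \<Longrightarrow> \<bar>clip c x\<bar> \<le> c"
  by (auto simp: clip_def)

lemma abs_clip_le_abs: "0 \<le> c \<Longrightarrow> \<bar>clip c x\<bar> \<le> \<bar>x\<bar>"
  by (auto simp: clip_def min_def max_def)

lemma clip_eq: "\<bar>x\<bar> \<le> c \<Longrightarrow> clip c x = x"
  by (auto simp: clip_def)

lemma clip_measurable [measurable]: "clip c \<in> borel_measurable borel"
  unfolding clip_def[abs_def] by measurable

lemma tendsto_clip: "(f \<longlongrightarrow> l) G \<Longrightarrow> ((\<lambda>x. clip c (f x)) \<longlongrightarrow> clip c l) G"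
  unfolding clip_def by (intro tendsto_intros)

text \<open>Only rationals strictly inside are tested, so that end points, which may be values of
  random times, are reached by continuity.\<close>

lemma le_on_interval_if_le_on_rationals:
  fixes h :: "real \<Rightarrow> real"
  assumes h: "continuous_on {a..b} h" and ab: "a < b"
    and le: "\<And>r. r \<in> \<rat> \<Longrightarrow> a < r \<Longrightarrow> r < b \<Longrightarrow> h r \<le> c" and t: "t \<in> {a..b}"
  shows "h t \<le> c"
proof (rule ccontr)
  assume "\<not> h t \<le> c"
  then have "0 < h t - c" by simp
  then obtain d where d: "0 < d" "\<And>x. x \<in> {a..b} \<Longrightarrow> dist x t < d \<Longrightarrow> dist (h x) (h t) < h t - c"
    using h t unfolding continuous_on_iff by blast
  have "max a (t - d) < min b (t + d)" using d(1) ab t by auto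
  then obtain r where r: "r \<in> \<rat>" "max a (t - d) < r" "r < min b (t + d)"
    using Rats_dense_in_real by blast
  then have "dist (h r) (h t) < h t - c" by (intro d(2)) (auto simp: dist_real_def)
  with le[of r] r show False by (auto simp: dist_real_def)
qed

lemma eq_on_interval_if_eq_on_rationals:
  fixes f g :: "real \<Rightarrow> real"
  assumes "continuous_on {a..b} f" "continuous_on {a..b} g" "a < b"
    and "\<And>r. r \<in> \<rat> \<Longrightarrow> a < r \<Longrightarrow> r < b \<Longrightarrow> f r = g r" and "t \<in> {a..b}"
  shows "f t = g t"
proof -
  have "\<bar>f t - g t\<bar> \<le> 0"
    by (rule le_on_interval_if_le_on_rationals[of a b "\<lambda>t. \<bar>f t - g t\<bar>"])
       (use assms in \<open>auto intro!: continuous_intros\<close>)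
  then show ?thesis by simp
qed

lemma uniform_grid_interval:
  fixes s T :: real
  assumes "0 < s" "s \<le> T"
  obtains k where "k < Suc m" "s \<in> {T * real k / real (Suc m)<..T * real (Suc k) / real (Suc m)}"
proof -
  define y where "y = s * real (Suc m) / T"
  have T: "0 < T" using assms by simp
  have y: "0 < y" "y \<le> real (Suc m)" using assms T by (auto simp: y_def divide_simps)
  then have c: "1 \<le> \<lceil>y\<rceil>" "\<lceil>y\<rceil> \<le> int (Suc m)" by (auto simp: ceiling_le_iff)
  define k where "k = nat (\<lceil>y\<rceil> - 1)"
  have k: "real k = real_of_int \<lceil>y\<rceil> - 1" "k < Suc m" using c by (auto simp: k_def)
  have "real k < y" "y \<le> real (Suc k)" using k(1) by linarith+
  then have "s \<in> {T * real k / real (Suc m)<..T * real (Suc k) / real (Suc m)}"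
    using T by (auto simp: y_def field_simps)
  with k(2) show thesis by (rule that)
qed

lemma grid_point_mem:
  fixes T :: real
  assumes "0 < T" "k \<le> Suc m"
  shows "T * real k / real (Suc m) \<in> {0..T}"
proof -
  have "real k / real (Suc m) \<le> 1" using assms by simp
  from mult_left_mono[OF this, of T] show ?thesis using assms by simp
qed

context ito_integrator
begin

text \<open>The clipping makes the values bounded, as \<open>simple_process\<close> requires; on a bounded path it has no
  effect for large \<open>m\<close>.\<close>

definition grid_value :: "real \<Rightarrow> (real \<Rightarrow> 'a \<Rightarrow> real) \<Rightarrow> nat \<Rightarrow> nat \<Rightarrow> 'a \<Rightarrow> real" where
  "grid_value T K m k \<omega> = clip (real m) (K (T * real k / real (Suc m)) \<omega>)"

definition grid_step :: "real \<Rightarrow> (real \<Rightarrow> 'a \<Rightarrow> real) \<Rightarrow> nat \<Rightarrow> real \<Rightarrow> 'a \<Rightarrow> real" where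
  "grid_step T K m = simple_value (Suc m) (\<lambda>k. T * real k / real (Suc m)) (grid_value T K m)"

definition grid_sum :: "real \<Rightarrow> (real \<Rightarrow> 'a \<Rightarrow> real) \<Rightarrow> nat \<Rightarrow> real \<Rightarrow> 'a \<Rightarrow> real" where
  "grid_sum T K m = simple_integral (Suc m) (\<lambda>k. T * real k / real (Suc m)) (grid_value T K m) B"

lemma grid_simple_process:
  assumes "0 < T" "adapted_on F T K"
  shows "simple_process F T (Suc m) (\<lambda>k. T * real k / real (Suc m)) (grid_value T K m)"
  unfolding simple_process_def
proof (intro conjI allI impI)
  fix k assume k: "k < Suc m"
  have "T * real k / real (Suc m) \<in> {0..T}" using k assms by (intro grid_point_mem) auto
  then have "K (T * real k / real (Suc m)) \<in> borel_measurable (F (T * real k / real (Suc m)))"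
    using assms by (auto simp: adapted_on_def)
  then show "grid_value T K m k \<in> borel_measurable (F (T * real k / real (Suc m)))"
    unfolding grid_value_def[abs_def] by measurable
  show "\<exists>C. \<forall>\<omega>\<in>space (F (T * real k / real (Suc m))). \<bar>grid_value T K m k \<omega>\<bar> \<le> C"
    by (intro exI[of _ "real m"]) (auto simp: grid_value_def intro!: abs_clip_le)
qed (use assms in \<open>auto simp: field_simps\<close>)

lemma grid_elem:
  assumes "0 < T" "adapted_on F T K"
  shows "elem (grid_step T K m) (grid_sum T K m)"
  unfolding grid_step_def grid_sum_def by (rule elem_simple[OF grid_simple_process[OF assms]])

lemma grid_step_eq:
  assumes "0 < T" "k < Suc m" "s \<in> {T * real k / real (Suc m)<..T * real (Suc k) / real (Suc m)}"
  shows "grid_step T K m s \<omega> = grid_value T K m k \<omega>"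
  unfolding grid_step_def simple_value_def
  using assms by (intro sum_indicator_grid) (auto simp: divide_strict_right_mono)

lemma abs_grid_step_le:
  assumes T: "0 < T" and K: "\<forall>r\<in>{0..T}. \<bar>K r \<omega>\<bar> \<le> C" and C: "0 \<le> C"
  shows "\<bar>grid_step T K m s \<omega>\<bar> \<le> C"
proof (cases "\<exists>k<Suc m. s \<in> {T * real k / real (Suc m)<..T * real (Suc k) / real (Suc m)}")
  case True
  then obtain k where k: "k < Suc m" "s \<in> {T * real k / real (Suc m)<..T * real (Suc k) / real (Suc m)}" by blast
  have "T * real k / real (Suc m) \<in> {0..T}" using k(1) assms by (intro grid_point_mem) auto
  then have "\<bar>K (T * real k / real (Suc m)) \<omega>\<bar> \<le> C" using K by blast
  then show ?thesis
    unfolding grid_step_eq[OF T k] grid_value_def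
    by - (rule order_trans[OF abs_clip_le_abs], simp_all)
next
  case False
  then have "grid_step T K m s \<omega> = 0"
    unfolding grid_step_def simple_value_def by (intro sum.neutral) auto
  then show ?thesis using C by simp
qed

text \<open>The value used at s is taken at a grid point strictly before s and at distance at most T
  / (m + 1), so only the left limit of the path enters. The bound C makes the clipping disappear for
  large m.\<close>

lemma grid_step_tendsto:
  assumes s: "0 < s" "s \<le> T" and K: "\<forall>r\<in>{0..T}. \<bar>K r \<omega>\<bar> \<le> C"
    and left: "((\<lambda>r. K r \<omega>) \<longlongrightarrow> K s \<omega>) (at_left s)"
  shows "(\<lambda>m. grid_step T K m s \<omega>) \<longlonglongrightarrow> K s \<omega>"
proof -
  have T: "0 < T" using s by simp
  have "\<exists>k<Suc m. s \<in> {T * real k / real (Suc m)<..T * real (Suc k) / real (Suc m)}" for m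
    using uniform_grid_interval[OF s] by metis
  then obtain k where k: "\<And>m. k m < Suc m"
    "\<And>m. s \<in> {T * real (k m) / real (Suc m)<..T * real (Suc (k m)) / real (Suc m)}" by metis
  define g where "g m = T * real (k m) / real (Suc m)" for m
  have g: "g m < s" "s - T / real (Suc m) \<le> g m" "0 \<le> g m" for m
    using k(2)[of m] T by (auto simp: g_def add_divide_distrib distrib_left)
  have "(\<lambda>m. s - T / real (Suc m)) \<longlonglongrightarrow> s - 0"
    by (intro tendsto_diff tendsto_const LIMSEQ_Suc[OF lim_const_over_n])
  then have "g \<longlonglongrightarrow> s"
    using g by (intro tendsto_sandwich[of "\<lambda>m. s - T / real (Suc m)" g sequentially "\<lambda>_. s"]) (auto intro!: always_eventually less_imp_le)
  then have "filterlim g (at_left s) sequentially"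
    using g(1) by (auto simp: filterlim_at intro!: always_eventually less_imp_neq)
  from filterlim_compose[OF left this] have lim: "(\<lambda>m. K (g m) \<omega>) \<longlonglongrightarrow> K s \<omega>" .
  obtain m0 :: nat where m0: "C \<le> real m0" using real_arch_simple by blast
  have "eventually (\<lambda>m. grid_step T K m s \<omega> = K (g m) \<omega>) sequentially"
    using eventually_ge_at_top[of m0]
  proof eventually_elim
    case (elim m)
    have "\<bar>K (g m) \<omega>\<bar> \<le> real m" using K g[of m] s m0 elim by (intro order_trans[OF bspec[OF K]]) auto
    then show ?case
      unfolding grid_step_eq[OF T k] grid_value_def g_def by (rule clip_eq)
  qed
  then show ?thesis using lim by (simp add: tendsto_cong)
qed

text \<open>A limit of simple processes is progressive, whatever \<open>lim\<close> returns where
  there is no convergence. Time 0 is treated apart, since the cells are open on the left and never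
  contain it.\<close>

lemma left_limits_progressive_version:
  assumes T: "0 < T" and K: "adapted_on F T K"
  shows "progressive_on F T (\<lambda>s \<omega>. if s = 0 then K 0 \<omega> else lim (\<lambda>m. grid_step T K m s \<omega>))"
  unfolding progressive_on_def
proof
  fix t assume t: "t \<in> {0..T}"
  let ?N = "restrict_space borel {0..t} \<Otimes>\<^sub>M F t"
  have [measurable]: "fst \<in> borel_measurable ?N"
    by (rule measurable_compose[OF measurable_fst]) (simp add: measurable_restrict_space1)
  have "K 0 \<in> borel_measurable (F t)"
    by (rule measurable_F_mono[of _ 0]) (use K t T in \<open>auto simp: adapted_on_def\<close>)
  then have [measurable]: "(\<lambda>p. K 0 (snd p)) \<in> borel_measurable ?N"
    by measurable
  have "(\<lambda>p. grid_step T K m (fst p) (snd p)) \<in> borel_measurable ?N" for m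
    using elem_progressive[OF grid_elem[OF T K], of T m] t by (auto simp: progressive_on_def case_prod_beta')
  then have [measurable]: "(\<lambda>p. lim (\<lambda>m. grid_step T K m (fst p) (snd p))) \<in> borel_measurable ?N"
    by (rule borel_measurable_lim_metric)
  have "(\<lambda>p. if fst p = 0 then K 0 (snd p) else lim (\<lambda>m. grid_step T K m (fst p) (snd p))) \<in> borel_measurable ?N"
    by measurable
  then show "(\<lambda>(s, \<omega>). if s = 0 then K 0 \<omega> else lim (\<lambda>m. grid_step T K m s \<omega>)) \<in> borel_measurable ?N"
    by (simp add: case_prod_beta')
qed

text \<open>Left limits rather than continuity, because integrands stopped at a hitting time drop to
  0 right after it. Boundedness of each path provides the domination for the grid
  approximation.\<close>

definition left_regular :: "real \<Rightarrow> (real \<Rightarrow> 'a \<Rightarrow> real) \<Rightarrow> bool" where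
  "left_regular T K \<longleftrightarrow> adapted_on F T K \<and>
     (AE \<omega> in M. (\<exists>C. \<forall>s\<in>{0..T}. \<bar>K s \<omega>\<bar> \<le> C) \<and>
        (\<forall>s\<in>{0<..T}. ((\<lambda>r. K r \<omega>) \<longlongrightarrow> K s \<omega>) (at_left s)))"

lemma grid_step_sq_int_tendsto:
  assumes T: "0 < T" and K: "left_regular T K"
  defines "K' \<equiv> \<lambda>s \<omega>. if s = 0 then K 0 \<omega> else lim (\<lambda>m. grid_step T K m s \<omega>)"
  shows "AE \<omega> in M. (\<forall>s\<in>{0..T}. K s \<omega> = K' s \<omega>) \<and> sq_int T K' \<omega> < \<infinity> \<and>
    (\<lambda>m. sq_int T (\<lambda>s \<omega>. grid_step T K m s \<omega> - K' s \<omega>) \<omega>) \<longlonglongrightarrow> 0"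
proof -
  have ad: "adapted_on F T K" using K by (simp add: left_regular_def)
  have jm: "jointly_measurable T (\<lambda>s \<omega>. grid_step T K m s \<omega> - K' s \<omega>)" for m
    using progressive_imp_jointly_measurable[OF left_limits_progressive_version[OF T ad]] T
      elem_jointly_measurable[OF grid_elem[OF T ad]]
    unfolding K'_def by (intro jointly_measurable_diff) auto
  from K[unfolded left_regular_def, THEN conjunct2] AE_space show ?thesis
  proof eventually_elim
    case (elim \<omega>)
    then obtain C where C: "\<And>s. s \<in> {0..T} \<Longrightarrow> \<bar>K s \<omega>\<bar> \<le> C" by blast
    have C0: "0 \<le> C" using C[of 0] T by (intro order_trans[OF abs_ge_zero C[of 0]]) auto
    have lim: "(\<lambda>m. grid_step T K m s \<omega>) \<longlonglongrightarrow> K s \<omega>" if "0 < s" "s \<le> T" for s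
      using grid_step_tendsto[OF that] C elim that by auto
    have eq: "K s \<omega> = K' s \<omega>" if "s \<in> {0..T}" for s
      using lim[of s] that limI[OF lim[of s]] by (auto simp: K'_def)
    have "sq_int T K' \<omega> \<le> ennreal (C\<^sup>2 * T)"
      using C eq T C0 by (intro sq_int_bounded) auto
    then have fin: "sq_int T K' \<omega> < \<infinity>" by (auto intro: le_less_trans)
    have "(\<lambda>m. \<integral>\<^sup>+ s. ennreal (((grid_step T K m s \<omega> - K' s \<omega>) * indicator {0..T} s)\<^sup>2) \<partial>lborel) \<longlonglongrightarrow> (\<integral>\<^sup>+ s. 0 \<partial>(lborel :: real measure))"
    proof (rule nn_integral_dominated_convergence[where w = "\<lambda>s. ennreal ((2 * C)\<^sup>2) * indicator {0..T} s"])
      show "(\<lambda>s. ennreal (((grid_step T K m s \<omega> - K' s \<omega>) * indicator {0..T} s)\<^sup>2)) \<in> borel_measurable lborel" for m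
        using jointly_measurable_section[OF jm[of m] elim(2)] by measurable
      show "(\<integral>\<^sup>+ s. ennreal ((2 * C)\<^sup>2) * indicator {0..T} s \<partial>lborel) < \<infinity>"
        using T by (simp add: nn_integral_cmult_indicator ennreal_mult_less_top)
      show "AE s in lborel. ennreal (((grid_step T K m s \<omega> - K' s \<omega>) * indicator {0..T} s)\<^sup>2) \<le> ennreal ((2 * C)\<^sup>2) * indicator {0..T} s" for m
      proof (rule AE_I2)
        fix s
        show "ennreal (((grid_step T K m s \<omega> - K' s \<omega>) * indicator {0..T} s)\<^sup>2) \<le> ennreal ((2 * C)\<^sup>2) * indicator {0..T} s"
        proof (cases "s \<in> {0..T}")
          case True
          have "\<bar>grid_step T K m s \<omega> - K' s \<omega>\<bar> \<le> 2 * C"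
            using abs_grid_step_le[OF T _ C0, of K \<omega> m s] C eq[OF True] C[OF True] by fastforce
          then have "(grid_step T K m s \<omega> - K' s \<omega>)\<^sup>2 \<le> (2 * C)\<^sup>2"
            by (rule power2_le_iff_abs_le[THEN iffD2, rotated]) (use C0 in simp)
          then show ?thesis using True by (simp add: ennreal_leI)
        qed simp
      qed
      \<comment> \<open>The approximations vanish at time 0, where K need not; a single point is
        negligible.\<close>
      show "AE s in lborel. (\<lambda>m. ennreal (((grid_step T K m s \<omega> - K' s \<omega>) * indicator {0..T} s)\<^sup>2)) \<longlonglongrightarrow> 0"
        using AE_lborel_singleton[of 0]
      proof eventually_elim
        case (elim s)
        show ?case
        proof (cases "s \<in> {0..T}")
          case True
          then have "(\<lambda>m. (grid_step T K m s \<omega> - K' s \<omega>) * indicator {0..T} s) \<longlonglongrightarrow> (K s \<omega> - K' s \<omega>) * indicator {0..T} s"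
            using elim by (intro tendsto_intros lim) auto
          then have "(\<lambda>m. ((grid_step T K m s \<omega> - K' s \<omega>) * indicator {0..T} s)\<^sup>2) \<longlonglongrightarrow> ((K s \<omega> - K' s \<omega>) * indicator {0..T} s)\<^sup>2"
            by (rule tendsto_power)
          then have "(\<lambda>m. ennreal (((grid_step T K m s \<omega> - K' s \<omega>) * indicator {0..T} s)\<^sup>2)) \<longlonglongrightarrow> ennreal (((K s \<omega> - K' s \<omega>) * indicator {0..T} s)\<^sup>2)"
            by (rule tendsto_ennrealI)
          then show ?thesis using eq[OF True] by simp
        qed simp
      qed
    qed auto
    then show ?case using eq fin by (simp add: sq_int_alt)
  qed
qed

text \<open>The maximal inequality for the difference of two approximations gives one estimate for
  all rational times together, which is what uniform convergence of paths requires.\<close>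

lemma grid_sum_Cauchy_in_probability:
  assumes T: "0 < T" and K: "left_regular T K" and c: "0 < c" and e: "0 < e"
  shows "\<exists>n. \<forall>m\<ge>n. \<forall>m'\<ge>n. prob {\<omega> \<in> space M. \<exists>r\<in>\<rat> \<inter> {0..T}. c < \<bar>grid_sum T K m r \<omega> - grid_sum T K m' r \<omega>\<bar>} \<le> e"
proof -
  define K' where "K' = (\<lambda>s \<omega>. if s = 0 then K 0 \<omega> else lim (\<lambda>m. grid_step T K m s \<omega>))"
  have ad: "adapted_on F T K" using K by (simp add: left_regular_def)
  note el = grid_elem[OF T ad]
  have jm: "jointly_measurable T (\<lambda>s \<omega>. grid_step T K m s \<omega> - K' s \<omega>)" for m
    using progressive_imp_jointly_measurable[OF left_limits_progressive_version[OF T ad]] T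
      elem_jointly_measurable[OF el]
    unfolding K'_def by (intro jointly_measurable_diff) auto
  note [measurable] = sq_int_measurable[OF jm]
  \<comment> \<open>Makes \<delta> / c^2 equal to e / 2; the other half is shared by two events of
    probability below e / 4.\<close>
  define \<delta> where "\<delta> = e * c\<^sup>2 / 2"
  have \<delta>: "0 < \<delta>" "\<delta> / c\<^sup>2 = e / 2" using c e by (auto simp: \<delta>_def)
  have "AE \<omega> in M. (\<lambda>m. sq_int T (\<lambda>s \<omega>. grid_step T K m s \<omega> - K' s \<omega>) \<omega>) \<longlonglongrightarrow> 0"
    using grid_step_sq_int_tendsto[OF T K] unfolding K'_def by eventually_elim blast
  then have "(\<lambda>m. prob {\<omega> \<in> space M. ennreal (\<delta> / 4) < sq_int T (\<lambda>s \<omega>. grid_step T K m s \<omega> - K' s \<omega>) \<omega>}) \<longlonglongrightarrow> 0"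
    using \<delta> by (intro prob_tendsto_zero_of_AE) auto
  then have "eventually (\<lambda>m. prob {\<omega> \<in> space M. ennreal (\<delta> / 4) < sq_int T (\<lambda>s \<omega>. grid_step T K m s \<omega> - K' s \<omega>) \<omega>} < e / 4) sequentially"
    using e by (intro order_tendstoD(2)) auto
  then obtain n where n: "\<And>m. m \<ge> n \<Longrightarrow> prob {\<omega> \<in> space M. ennreal (\<delta> / 4) < sq_int T (\<lambda>s \<omega>. grid_step T K m s \<omega> - K' s \<omega>) \<omega>} < e / 4"
    by (auto simp: eventually_sequentially)
  show ?thesis
  proof (intro exI allI impI)
    fix m m' assume m: "n \<le> m" "n \<le> m'"
    let ?d = "\<lambda>m \<omega>. sq_int T (\<lambda>s \<omega>. grid_step T K m s \<omega> - K' s \<omega>) \<omega>"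
    have cD: "countable (\<rat> \<inter> {0..T})" using countable_rat by auto
    have eq: "space M \<inter> {\<omega> \<in> space M. P \<omega>} = {\<omega> \<in> space M. P \<omega>}" for P by auto
    have "prob {\<omega> \<in> space M. \<exists>r\<in>\<rat> \<inter> {0..T}. c < \<bar>grid_sum T K m r \<omega> - grid_sum T K m' r \<omega>\<bar>}
      \<le> prob {\<omega> \<in> space M. ennreal \<delta> < sq_int T (\<lambda>s \<omega>. grid_step T K m s \<omega> - grid_step T K m' s \<omega>) \<omega>} + \<delta> / c\<^sup>2"
      using elem_maximal_inequality[OF elem_diff[OF el el] _ cD _ c _ sets.top, of T \<delta> m m'] T \<delta>(1) unfolding eq by simp
    also have "prob {\<omega> \<in> space M. ennreal \<delta> < sq_int T (\<lambda>s \<omega>. grid_step T K m s \<omega> - grid_step T K m' s \<omega>) \<omega>}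
      \<le> prob ({\<omega> \<in> space M. ennreal (\<delta> / 4) < ?d m \<omega>} \<union> {\<omega> \<in> space M. ennreal (\<delta> / 4) < ?d m' \<omega>})"
    proof (rule finite_measure_mono, safe)
      fix \<omega> assume *: "\<omega> \<in> space M" "ennreal \<delta> < sq_int T (\<lambda>s \<omega>. grid_step T K m s \<omega> - grid_step T K m' s \<omega>) \<omega>"
        "\<not> ennreal (\<delta> / 4) < ?d m' \<omega>"
      show "ennreal (\<delta> / 4) < ?d m \<omega>"
      proof (rule ccontr)
        assume neg: "\<not> ennreal (\<delta> / 4) < ?d m \<omega>"
        have "sq_int T (\<lambda>s \<omega>. grid_step T K m s \<omega> - grid_step T K m' s \<omega>) \<omega> =
            sq_int T (\<lambda>s \<omega>. (grid_step T K m s \<omega> - K' s \<omega>) - (grid_step T K m' s \<omega> - K' s \<omega>)) \<omega>" by simp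
        also have "\<dots> \<le> 2 * ?d m \<omega> + 2 * ?d m' \<omega>" by (rule sq_int_diff_le[OF jm jm *(1)])
        also have "\<dots> \<le> 2 * ennreal (\<delta> / 4) + 2 * ennreal (\<delta> / 4)"
          using neg *(3) by (intro add_mono mult_left_mono) (auto simp: not_less)
        also have "\<dots> = ennreal \<delta>"
          using \<open>0 < \<delta>\<close> by (simp add: ennreal_numeral[symmetric] ennreal_mult[symmetric] ennreal_plus[symmetric] del: ennreal_numeral ennreal_plus)
        finally show False using *(2) by simp
      qed
    qed auto
    also have "\<dots> \<le> prob {\<omega> \<in> space M. ennreal (\<delta> / 4) < ?d m \<omega>} + prob {\<omega> \<in> space M. ennreal (\<delta> / 4) < ?d m' \<omega>}"
      by (rule measure_Un_le) auto
    finally show "prob {\<omega> \<in> space M. \<exists>r\<in>\<rat> \<inter> {0..T}. c < \<bar>grid_sum T K m r \<omega> - grid_sum T K m' r \<omega>\<bar>} \<le> e"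
      using n[OF m(1)] n[OF m(2)] \<delta>(2) by simp
  qed
qed

lemma grid_sum_subsequence:
  assumes T: "0 < T" and K: "left_regular T K"
  obtains \<phi> :: "nat \<Rightarrow> nat" where "filterlim \<phi> sequentially sequentially"
    "AE \<omega> in M. eventually (\<lambda>k. \<forall>r\<in>\<rat> \<inter> {0..T}. \<bar>grid_sum T K (\<phi> (Suc k)) r \<omega> - grid_sum T K (\<phi> k) r \<omega>\<bar> \<le> (1 / 2) ^ k) sequentially"
proof -
  have ad: "adapted_on F T K" using K by (simp add: left_regular_def)
  have "\<forall>k. \<exists>n. \<forall>m\<ge>n. \<forall>m'\<ge>n.
      prob {\<omega> \<in> space M. \<exists>r\<in>\<rat> \<inter> {0..T}. (1 / 2) ^ k < \<bar>grid_sum T K m r \<omega> - grid_sum T K m' r \<omega>\<bar>} \<le> (1 / 2) ^ k"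
    by (intro allI grid_sum_Cauchy_in_probability[OF T K]) simp_all
  from choice[OF this] obtain n where n: "\<And>k m m'. n k \<le> m \<Longrightarrow> n k \<le> m' \<Longrightarrow>
      prob {\<omega> \<in> space M. \<exists>r\<in>\<rat> \<inter> {0..T}. (1 / 2) ^ k < \<bar>grid_sum T K m r \<omega> - grid_sum T K m' r \<omega>\<bar>} \<le> (1 / 2) ^ k"
    by blast
  \<comment> \<open>Both \<open>\<phi> k\<close> and \<open>\<phi> (Suc k)\<close> must lie beyond
    \<open>n k\<close>, hence the sum; adding k drives \<phi> to infinity.\<close>
  define \<phi> where "\<phi> k = (\<Sum>i\<le>k. n i) + k" for k
  have \<phi>: "n k \<le> \<phi> k" "n k \<le> \<phi> (Suc k)" "k \<le> \<phi> k" for k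
    using member_le_sum[of k "{..k}" n] by (auto simp: \<phi>_def)
  have lim: "filterlim \<phi> sequentially sequentially"
    using \<phi>(3) by (intro filterlim_at_top_mono[OF filterlim_ident]) auto
  let ?A = "\<lambda>k. {\<omega> \<in> space M. \<exists>r\<in>\<rat> \<inter> {0..T}. (1 / 2) ^ k < \<bar>grid_sum T K (\<phi> (Suc k)) r \<omega> - grid_sum T K (\<phi> k) r \<omega>\<bar>}"
  have meas: "?A k \<in> events" for k
  proof (rule sets.sets_Collect_countable_Ex')
    show "countable (\<rat> \<inter> {0..T})" using countable_rat by auto
    fix r assume "r \<in> \<rat> \<inter> {0..T}"
    then have [measurable]: "grid_sum T K m r \<in> borel_measurable M" for m
      using elem_measurable_M[OF grid_elem[OF T ad]] by auto
    show "{\<omega> \<in> space M. (1 / 2) ^ k < \<bar>grid_sum T K (\<phi> (Suc k)) r \<omega> - grid_sum T K (\<phi> k) r \<omega>\<bar>} \<in> events"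
      by measurable
  qed
  have "AE \<omega> in M. eventually (\<lambda>k. \<omega> \<in> space M - ?A k) sequentially"
  proof (rule borel_cantelli_AE1[OF meas])
    show "summable (\<lambda>k. prob (?A k))"
      by (rule summable_comparison_test'[of "\<lambda>k. (1 / 2 :: real) ^ k" 0]) (use n \<phi> in auto)
  qed (auto simp: emeasure_eq_measure)
  then have "AE \<omega> in M. eventually (\<lambda>k. \<forall>r\<in>\<rat> \<inter> {0..T}. \<bar>grid_sum T K (\<phi> (Suc k)) r \<omega> - grid_sum T K (\<phi> k) r \<omega>\<bar> \<le> (1 / 2) ^ k) sequentially"
    by eventually_elim (erule eventually_mono, force simp: not_less)
  with lim show thesis by (rule that)
qed

text \<open>Along the fast subsequence the simple integrals are partial sums of a uniformly
  convergent series, so the limit has continuous paths; taking it pointwise by \<open>lim\<close>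
  keeps it adapted. The approximations are returned as well, because moments and the martingale
  property are later passed to the limit along them.\<close>

lemma ito_integral_exists:
  assumes T: "0 < T" and K: "left_regular T K"
  obtains I K' Hs Ss where "is_ito_integral M F T B K I"
    "progressive_on F T K'" "AE \<omega> in M. \<forall>s\<in>{0..T}. K s \<omega> = K' s \<omega>"
    "\<And>m :: nat. elem (Hs m) (Ss m)"
    "AE \<omega> in M. (\<lambda>m. sq_int T (\<lambda>s \<omega>. Hs m s \<omega> - K' s \<omega>) \<omega>) \<longlonglongrightarrow> 0"
    "AE \<omega> in M. \<forall>t\<in>{0..T}. (\<lambda>m. Ss m t \<omega>) \<longlonglongrightarrow> I t \<omega>"
    "\<And>m s \<omega> C. \<forall>r\<in>{0..T}. \<bar>K r \<omega>\<bar> \<le> C \<Longrightarrow> 0 \<le> C \<Longrightarrow> \<bar>Hs m s \<omega>\<bar> \<le> C"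
proof -
  obtain \<phi> :: "nat \<Rightarrow> nat" where \<phi>: "filterlim \<phi> sequentially sequentially"
    and close: "AE \<omega> in M. eventually (\<lambda>k. \<forall>r\<in>\<rat> \<inter> {0..T}. \<bar>grid_sum T K (\<phi> (Suc k)) r \<omega> - grid_sum T K (\<phi> k) r \<omega>\<bar> \<le> (1 / 2) ^ k) sequentially"
    using grid_sum_subsequence[OF T K] by blast
  have ad: "adapted_on F T K" using K by (simp add: left_regular_def)
  define K' where "K' = (\<lambda>s \<omega>. if s = 0 then K 0 \<omega> else lim (\<lambda>m. grid_step T K m s \<omega>))"
  define Hs where "Hs k = grid_step T K (\<phi> k)" for k
  define Ss where "Ss k = grid_sum T K (\<phi> k)" for k
  define I where "I t \<omega> = lim (\<lambda>k. Ss k t \<omega>)" for t \<omega>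
  have el: "elem (Hs k) (Ss k)" for k unfolding Hs_def Ss_def by (rule grid_elem[OF T ad])
  have K'_prog: "progressive_on F T K'" unfolding K'_def by (rule left_limits_progressive_version[OF T ad])
  have AE_K': "AE \<omega> in M. (\<forall>s\<in>{0..T}. K s \<omega> = K' s \<omega>) \<and> sq_int T K' \<omega> < \<infinity> \<and>
      (\<lambda>m. sq_int T (\<lambda>s \<omega>. grid_step T K m s \<omega> - K' s \<omega>) \<omega>) \<longlonglongrightarrow> 0"
    using grid_step_sq_int_tendsto[OF T K] unfolding K'_def .
  have lim_sq: "AE \<omega> in M. (\<lambda>m. sq_int T (\<lambda>s \<omega>. Hs m s \<omega> - K' s \<omega>) \<omega>) \<longlonglongrightarrow> 0"
    using AE_K'
  proof eventually_elim
    case (elim \<omega>)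
    then have "(\<lambda>m. sq_int T (\<lambda>s \<omega>. grid_step T K m s \<omega> - K' s \<omega>) \<omega>) \<longlonglongrightarrow> 0" by blast
    from filterlim_compose[OF this \<phi>] show ?case by (simp add: Hs_def)
  qed
  have I_adapted: "adapted_on F T I"
    unfolding adapted_on_def I_def[abs_def]
    using elem_adapted[OF el] by (auto intro!: borel_measurable_lim_metric)
  have "AE \<omega> in M. \<forall>k. continuous_on {0..} (\<lambda>t. Ss k t \<omega>)"
    unfolding AE_all_countable using elem_continuous[OF el] by blast
  with close have paths: "AE \<omega> in M. continuous_on {0..T} (\<lambda>t. I t \<omega>) \<and> (\<forall>t\<in>{0..T}. (\<lambda>k. Ss k t \<omega>) \<longlonglongrightarrow> I t \<omega>)"
  proof eventually_elim
    case (elim \<omega>)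
    have cont: "continuous_on {0..T} (\<lambda>t. Ss k t \<omega>)" for k
      using elim(2) by (auto intro: continuous_on_subset)
    have "eventually (\<lambda>k. \<forall>t\<in>{0..T}. norm (Ss (Suc k) t \<omega> - Ss k t \<omega>) \<le> (1 / 2) ^ k) sequentially"
      using elim(1)
    proof eventually_elim
      case (elim k)
      show ?case
      proof
        fix t assume t: "t \<in> {0..T}"
        show "norm (Ss (Suc k) t \<omega> - Ss k t \<omega>) \<le> (1 / 2) ^ k"
        proof (rule le_on_interval_if_le_on_rationals[OF _ T _ t])
          show "continuous_on {0..T} (\<lambda>t. norm (Ss (Suc k) t \<omega> - Ss k t \<omega>))"
            by (intro continuous_intros cont)
          show "norm (Ss (Suc k) r \<omega> - Ss k r \<omega>) \<le> (1 / 2) ^ k" if "r \<in> \<rat>" "0 < r" "r < T" for r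
            using elim that by (simp add: Ss_def)
        qed
      qed
    qed
    then have "uniform_limit {0..T} (\<lambda>n t. \<Sum>k<n. Ss (Suc k) t \<omega> - Ss k t \<omega>) (\<lambda>t. \<Sum>k. Ss (Suc k) t \<omega> - Ss k t \<omega>) sequentially"
      by (rule Weierstrass_m_test_ev) (simp add: summable_geometric)
    then have ul: "uniform_limit {0..T} (\<lambda>n t. Ss n t \<omega> - Ss 0 t \<omega>) (\<lambda>t. \<Sum>k. Ss (Suc k) t \<omega> - Ss k t \<omega>) sequentially"
      by (subst (asm) sum_lessThan_telescope)
    have lim: "(\<lambda>n. Ss n t \<omega>) \<longlonglongrightarrow> Ss 0 t \<omega> + (\<Sum>k. Ss (Suc k) t \<omega> - Ss k t \<omega>)" if "t \<in> {0..T}" for t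
      using tendsto_add[OF tendsto_const[of "Ss 0 t \<omega>"] tendsto_uniform_limitI[OF ul that]] by simp
    then have I: "I t \<omega> = Ss 0 t \<omega> + (\<Sum>k. Ss (Suc k) t \<omega> - Ss k t \<omega>)" if "t \<in> {0..T}" for t
      using that by (simp add: I_def limI)
    have "continuous_on {0..T} (\<lambda>t. \<Sum>k. Ss (Suc k) t \<omega> - Ss k t \<omega>)"
      by (rule uniform_limit_theorem[OF _ ul]) (auto intro!: continuous_intros cont always_eventually)
    then have "continuous_on {0..T} (\<lambda>t. I t \<omega>)"
      using cont[of 0] I by (subst continuous_on_cong[OF refl I]) (auto intro: continuous_intros)
    then show ?case using lim I by simp
  qed
  have "is_ito_integral M F T B K I"
    unfolding is_ito_integral_def
  proof (intro conjI exI allI impI ballI)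
    show "adapted_on F T I" by fact
    show "AE \<omega> in M. continuous_on {0..T} (\<lambda>t. I t \<omega>)" using paths by eventually_elim blast
    show "progressive_on F T K'" by fact
    show "AE \<omega> in M. \<forall>s\<in>{0..T}. K s \<omega> = K' s \<omega>" using AE_K' by eventually_elim blast
    show "AE \<omega> in M. (\<integral>\<^sup>+ s\<in>{0..T}. ennreal ((K' s \<omega>)\<^sup>2) \<partial>lborel) < \<infinity>"
      using AE_K' by eventually_elim (simp add: sq_int_def)
    show "simple_process F T (Suc (\<phi> m)) (\<lambda>k. T * real k / real (Suc (\<phi> m))) (grid_value T K (\<phi> m))" for m
      by (rule grid_simple_process[OF T ad])
    show "(\<lambda>m. prob {\<omega> \<in> space M. ennreal e <
        (\<integral>\<^sup>+ s\<in>{0..T}. ennreal ((simple_value (Suc (\<phi> m)) (\<lambda>k. T * real k / real (Suc (\<phi> m))) (grid_value T K (\<phi> m)) s \<omega> - K' s \<omega>)\<^sup>2) \<partial>lborel)}) \<longlonglongrightarrow> 0"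
      if "0 < e" for e
    proof -
      have "(\<lambda>m. prob {\<omega> \<in> space M. ennreal e < sq_int T (\<lambda>s \<omega>. Hs m s \<omega> - K' s \<omega>) \<omega>}) \<longlonglongrightarrow> 0"
        using that lim_sq T by (intro prob_tendsto_zero_of_AE[where l = 0] sq_int_measurable jointly_measurable_diff
          elem_jointly_measurable[OF el] progressive_imp_jointly_measurable[OF K'_prog]) auto
      then show ?thesis by (simp add: sq_int_def Hs_def grid_step_def)
    qed
    show "(\<lambda>m. prob {\<omega> \<in> space M. e <
        \<bar>simple_integral (Suc (\<phi> m)) (\<lambda>k. T * real k / real (Suc (\<phi> m))) (grid_value T K (\<phi> m)) B t \<omega> - I t \<omega>\<bar>}) \<longlonglongrightarrow> 0"
      if t: "t \<in> {0..T}" and "0 < e" for t e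
      unfolding grid_sum_def[symmetric] Ss_def[symmetric]
    proof (rule prob_tendsto_zero_of_AE)
      have "I t \<in> borel_measurable M" "Ss m t \<in> borel_measurable M" for m
        using I_adapted t measurable_F_imp_M[of "I t" t] elem_measurable_M[OF el] by (auto simp: adapted_on_def)
      then show "(\<lambda>\<omega>. \<bar>Ss m t \<omega> - I t \<omega>\<bar>) \<in> borel_measurable M" for m by measurable
      show "AE \<omega> in M. (\<lambda>m. \<bar>Ss m t \<omega> - I t \<omega>\<bar>) \<longlonglongrightarrow> 0"
        using paths
      proof eventually_elim
        case (elim \<omega>)
        then have "(\<lambda>m. Ss m t \<omega>) \<longlonglongrightarrow> I t \<omega>" using t by blast
        then show ?case by (intro tendsto_rabs_zero LIM_zero)
      qed
    qed fact
  qed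
  moreover have "AE \<omega> in M. \<forall>s\<in>{0..T}. K s \<omega> = K' s \<omega>" using AE_K' by eventually_elim blast
  moreover have "AE \<omega> in M. \<forall>t\<in>{0..T}. (\<lambda>m. Ss m t \<omega>) \<longlonglongrightarrow> I t \<omega>" using paths by eventually_elim blast
  ultimately show thesis
  proof (rule that[OF _ K'_prog _ el lim_sq])
    show "\<bar>Hs m s \<omega>\<bar> \<le> C" if "\<forall>r\<in>{0..T}. \<bar>K r \<omega>\<bar> \<le> C" "0 \<le> C" for m s \<omega> C
      unfolding Hs_def using that by (intro abs_grid_step_le T)
  qed
qed

end

section \<open>Localization by hitting times\<close>

text \<open>The variance of |X| is nonnegative. It turns L2 errors into L1 errors.\<close>

lemma (in prob_space) expectation_abs_le_sqrt:
  fixes X :: "'a \<Rightarrow> real"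
  assumes X: "X \<in> borel_measurable M" and sq: "integrable M (\<lambda>\<omega>. (X \<omega>)\<^sup>2)"
  shows "expectation (\<lambda>\<omega>. \<bar>X \<omega>\<bar>) \<le> sqrt (expectation (\<lambda>\<omega>. (X \<omega>)\<^sup>2))"
proof -
  have "integrable M X" using square_integrable_imp_integrable[OF X sq] .
  then have "variance (\<lambda>\<omega>. \<bar>X \<omega>\<bar>) = expectation (\<lambda>\<omega>. \<bar>X \<omega>\<bar>\<^sup>2) - (expectation (\<lambda>\<omega>. \<bar>X \<omega>\<bar>))\<^sup>2"
    using sq by (intro variance_eq) auto
  then have "(expectation (\<lambda>\<omega>. \<bar>X \<omega>\<bar>))\<^sup>2 \<le> expectation (\<lambda>\<omega>. (X \<omega>)\<^sup>2)"
    using variance_positive[of "\<lambda>\<omega>. \<bar>X \<omega>\<bar>"] by simp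
  then show ?thesis by (rule real_le_rsqrt)
qed

context filtered_prob_space_usual
begin

text \<open>By completeness and \<open>null_sets_F0\<close>, every subset of a null set belongs to
  each \<open>F t\<close> with t \<ge> 0. This transfers adaptedness to a process that is known only
  up to indistinguishability.\<close>

lemma measurable_F_AE_eq:
  fixes X Y :: "'a \<Rightarrow> 'b :: topological_space"
  assumes X: "X \<in> borel_measurable (F t)" and t: "0 \<le> t" and eq: "AE \<omega> in M. X \<omega> = Y \<omega>"
  shows "Y \<in> borel_measurable (F t)"
proof (rule measurableI)
  from eq obtain N where N: "{\<omega> \<in> space M. X \<omega> \<noteq> Y \<omega>} \<subseteq> N" "N \<in> null_sets M"
    by (auto simp: eventually_ae_filter)
  have null: "N' \<in> sets (F t)" if "N' \<subseteq> N" for N'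
  proof -
    have "N' \<in> sets M" using complete[OF that N(2)] .
    then have "N' \<in> null_sets M" using N(2) that by (auto intro: null_sets_subset)
    then show ?thesis using null_sets_F0 sets_F_mono[OF t] by blast
  qed
  fix S :: "'b set" assume S: "S \<in> sets borel"
  have "Y -` S \<inter> space (F t) = (X -` S \<inter> space (F t) - N) \<union> (Y -` S \<inter> space (F t) \<inter> N)"
    using N(1) by (auto simp: space_F)
  also have "\<dots> \<in> sets (F t)"
    using measurable_sets[OF X S] null[of N] null[of "Y -` S \<inter> space (F t) \<inter> N"] by auto
  finally show "Y -` S \<inter> space (F t) \<in> sets (F t)" .
qed auto

section \<open>Hitting times\<close>

text \<open>Rational times keep the set measurable without path regularity; for a continuous path this is
  the entry time of \<open>(c, \<infinity>)\<close>, capped at \<open>T\<close>. It is a stopping time because \<open>F\<close> is right-continuous.\<close>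

definition hitting_time :: "real \<Rightarrow> (real \<Rightarrow> 'a \<Rightarrow> real) \<Rightarrow> real \<Rightarrow> 'a \<Rightarrow> real" where
  "hitting_time T Y c \<omega> = Inf (insert T {r \<in> \<rat> \<inter> {0..T}. c < Y r \<omega>})"

context
  fixes T :: real and Y :: "real \<Rightarrow> 'a \<Rightarrow> real"
  assumes T: "0 < T" and Y: "adapted_on F T Y"
begin

lemma hitting_time_bdd_below: "bdd_below (insert T {r \<in> \<rat> \<inter> {0..T}. c < Y r \<omega>})"
  using T by (intro bdd_belowI[of _ 0]) auto

lemma hitting_time_range: "0 \<le> hitting_time T Y c \<omega>" "hitting_time T Y c \<omega> \<le> T"
  unfolding hitting_time_def using T
  by (auto intro!: cInf_greatest cInf_lower hitting_time_bdd_below)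

lemma hitting_time_less_iff:
  "hitting_time T Y c \<omega> < t \<longleftrightarrow> T < t \<or> (\<exists>r\<in>\<rat> \<inter> {0..T}. r < t \<and> c < Y r \<omega>)"
  unfolding hitting_time_def
  by (subst cInf_less_iff[OF _ hitting_time_bdd_below]) auto

lemma hitting_time_less_measurable:
  assumes t: "0 \<le> t" "t \<le> T"
  shows "{\<omega> \<in> space M. hitting_time T Y c \<omega> < t} \<in> sets (F t)"
proof -
  have "{\<omega> \<in> space (F t). \<exists>r\<in>\<rat> \<inter> {0..<t}. c < Y r \<omega>} \<in> sets (F t)"
  proof (rule sets.sets_Collect_countable_Ex')
    show "countable (\<rat> \<inter> {0..<t})" using countable_rat by auto
    fix r assume "r \<in> \<rat> \<inter> {0..<t}"
    then have [measurable]: "Y r \<in> borel_measurable (F t)"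
      using Y t by (intro measurable_F_mono[of "Y r" r t]) (auto simp: adapted_on_def)
    show "{\<omega> \<in> space (F t). c < Y r \<omega>} \<in> sets (F t)" by measurable
  qed
  moreover have "{\<omega> \<in> space M. hitting_time T Y c \<omega> < t} = {\<omega> \<in> space (F t). \<exists>r\<in>\<rat> \<inter> {0..<t}. c < Y r \<omega>}"
    using t by (auto simp: hitting_time_less_iff space_F)
  ultimately show ?thesis by simp
qed

lemma hitting_time_ge_measurable:
  assumes t: "0 \<le> t" "t \<le> T"
  shows "{\<omega> \<in> space M. t \<le> hitting_time T Y c \<omega>} \<in> sets (F t)"
proof -
  have "{\<omega> \<in> space M. t \<le> hitting_time T Y c \<omega>} = space (F t) - {\<omega> \<in> space M. hitting_time T Y c \<omega> < t}"
    by (auto simp: space_F)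
  then show ?thesis using hitting_time_less_measurable[OF t] by simp
qed

lemma hitting_time_stopping_time: "stopping_time F (hitting_time T Y c)"
  unfolding stopping_time_def
proof
  fix t
  let ?A = "\<lambda>t. {\<omega> \<in> space (F t). hitting_time T Y c \<omega> \<le> t}"
  have "?A t \<in> sets (F t)"
  proof -
    consider "t < 0" | "T \<le> t" | "0 \<le> t" "t < T" by linarith
    then show ?thesis
    proof cases
      case 1
      have "?A t = {}"
      proof safe
        fix \<omega> assume "hitting_time T Y c \<omega> \<le> t"
        with 1 hitting_time_range(1)[of c \<omega>] show "\<omega> \<in> {}" by simp
      qed
      then show ?thesis by (simp only: sets.empty_sets)
    next
      case 2
      then have "?A t = space (F t)" using hitting_time_range(2)[of c] order_trans by blast
      then show ?thesis by simp
    next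
      case 3
      have "?A t \<in> sets (F s)" if s: "t < s" for s
      proof -
        \<comment> \<open>The events \<tau> < t' are known to lie in \<open>F t'\<close> only for t'
          \<le> T, so the approximating times are kept below T as well as below s. As s > t is
          arbitrary, right-continuity of the filtration gives the claim at t.\<close>
        define S where "S = min s T"
        have S: "t < S" "S \<le> T" "S \<le> s" using s 3 by (auto simp: S_def)
        have eq: "?A t = (\<Inter>n. {\<omega> \<in> space M. hitting_time T Y c \<omega> < t + (S - t) / real (Suc n)})"
        proof safe
          fix \<omega> n assume "\<omega> \<in> space (F t)" "hitting_time T Y c \<omega> \<le> t"
          moreover have "0 < (S - t) / real (Suc n)" using S by simp
          ultimately show "\<omega> \<in> space M" "hitting_time T Y c \<omega> < t + (S - t) / real (Suc n)" by (auto simp: space_F)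
        next
          fix \<omega> assume *: "\<omega> \<in> (\<Inter>n. {\<omega> \<in> space M. hitting_time T Y c \<omega> < t + (S - t) / real (Suc n)})"
          then show "\<omega> \<in> space (F t)" by (auto simp: space_F)
          have "(\<lambda>n. t + (S - t) / real (Suc n)) \<longlonglongrightarrow> t + 0"
            by (intro tendsto_intros LIMSEQ_Suc[OF lim_const_over_n])
          then show "hitting_time T Y c \<omega> \<le> t"
            using * by (intro LIMSEQ_le_const[where X = "\<lambda>n. t + (S - t) / real (Suc n)"]) (auto intro: less_imp_le)
        qed
        have "{\<omega> \<in> space M. hitting_time T Y c \<omega> < t + (S - t) / real (Suc n)} \<in> sets (F s)" for n
        proof -
          have "(S - t) / real (Suc n) \<le> S - t" "0 \<le> (S - t) / real (Suc n)"
            using S divide_left_mono[of 1 "real (Suc n)" "S - t"] by simp_all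
          then have r: "0 \<le> t + (S - t) / real (Suc n)" "t + (S - t) / real (Suc n) \<le> S" using 3 by auto
          have "t + (S - t) / real (Suc n) \<le> T" "t + (S - t) / real (Suc n) \<le> s"
            using r(2) S(2,3) by linarith+
          then show ?thesis
            using hitting_time_less_measurable[OF r(1)] sets_F_mono by blast
        qed
        then show ?thesis unfolding eq by (intro sets.countable_INT) auto
      qed
      then show ?thesis using right_continuous[OF 3(1)] by blast
    qed
  qed
  then show "Measurable.pred (F t) (\<lambda>\<omega>. hitting_time T Y c \<omega> \<le> t)" by (simp add: pred_def)
qed

lemma hitting_time_mono: "c \<le> c' \<Longrightarrow> hitting_time T Y c \<omega> \<le> hitting_time T Y c' \<omega>"
  unfolding hitting_time_def
  by (rule cInf_superset_mono[OF _ hitting_time_bdd_below]) auto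

lemma hitting_time_eq_T:
  assumes "\<And>r. r \<in> {0..T} \<Longrightarrow> Y r \<omega> \<le> c"
  shows "hitting_time T Y c \<omega> = T"
proof -
  have "{r \<in> \<rat> \<inter> {0..T}. c < Y r \<omega>} = {}" using assms by (force simp: not_less)
  then show ?thesis by (simp only: hitting_time_def cInf_singleton)
qed

text \<open>Continuity extends the bound to the hitting time itself. At time 0 it may fail, since
  the process can start above c.\<close>

lemma le_before_hitting_time:
  assumes cont: "continuous_on {0..T} (\<lambda>t. Y t \<omega>)" and s: "0 < s" "s \<le> hitting_time T Y c \<omega>"
  shows "Y s \<omega> \<le> c"
proof (rule le_on_interval_if_le_on_rationals[of 0 s "\<lambda>t. Y t \<omega>"])
  have sT: "s \<le> T" using s hitting_time_range(2) order_trans by blast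
  show "continuous_on {0..s} (\<lambda>t. Y t \<omega>)" using cont sT by (auto intro: continuous_on_subset)
  show "Y r \<omega> \<le> c" if r: "r \<in> \<rat>" "0 < r" "r < s" for r
  proof -
    have "\<not> hitting_time T Y c \<omega> < s" using s by simp
    then show ?thesis unfolding hitting_time_less_iff using r sT by auto
  qed
qed (use s in auto)

text \<open>Where Y dominates |H|, the clipping changes nothing at positive times up to the hitting
  time. It makes the integrand bounded for every \<omega>, and also at time 0, where Y may already
  exceed c.\<close>

definition stopped_coefficient :: "real \<Rightarrow> (real \<Rightarrow> 'a \<Rightarrow> real) \<Rightarrow> real \<Rightarrow> 'a \<Rightarrow> real" where
  "stopped_coefficient c H s \<omega> = (if s \<le> hitting_time T Y c \<omega> then clip c (H s \<omega>) else 0)"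

end

end

section \<open>Bounded integrands: moments and the martingale property\<close>

context ito_integrator
begin

lemma stopped_coefficient_left_regular:
  assumes T: "0 < T" and Y: "adapted_on F T Y" and H: "adapted_on F T H"
    and cont: "AE \<omega> in M. continuous_on {0..T} (\<lambda>t. H t \<omega>)" and c: "0 \<le> c"
  shows "left_regular T (stopped_coefficient T Y c H)"
  unfolding left_regular_def
proof
  show "adapted_on F T (stopped_coefficient T Y c H)"
    unfolding adapted_on_def
  proof
    fix t assume t: "t \<in> {0..T}"
    then have [measurable]: "H t \<in> borel_measurable (F t)" using H by (auto simp: adapted_on_def)
    have "(\<lambda>\<omega>. clip c (H t \<omega>)) \<in> borel_measurable (F t)" by measurable
    moreover have "{\<omega> \<in> space (F t). t \<le> hitting_time T Y c \<omega>} \<in> sets (F t)"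
      using hitting_time_ge_measurable[OF T Y, of t c] t by (simp add: space_F)
    ultimately show "stopped_coefficient T Y c H t \<in> borel_measurable (F t)"
      unfolding stopped_coefficient_def[OF T Y, abs_def] by (intro measurable_If) auto
  qed
  show "AE \<omega> in M. (\<exists>C. \<forall>s\<in>{0..T}. \<bar>stopped_coefficient T Y c H s \<omega>\<bar> \<le> C) \<and>
      (\<forall>s\<in>{0<..T}. ((\<lambda>r. stopped_coefficient T Y c H r \<omega>) \<longlongrightarrow> stopped_coefficient T Y c H s \<omega>) (at_left s))"
    using cont
  proof eventually_elim
    case (elim \<omega>)
    have "((\<lambda>r. stopped_coefficient T Y c H r \<omega>) \<longlongrightarrow> stopped_coefficient T Y c H s \<omega>) (at_left s)" if s: "s \<in> {0<..T}" for s
    proof (cases "s \<le> hitting_time T Y c \<omega>")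
      case True
      have "((\<lambda>r. H r \<omega>) \<longlongrightarrow> H s \<omega>) (at s within {0..T})"
        using elim s by (auto simp: continuous_on_def)
      then have "((\<lambda>r. H r \<omega>) \<longlongrightarrow> H s \<omega>) (at s within {0..<s})"
        by (rule tendsto_within_subset) (use s in auto)
      moreover have "at s within {0..<s} = at_left s"
        by (rule at_within_nhd[of s "{0<..}"]) (use s in auto)
      ultimately have "((\<lambda>r. clip c (H r \<omega>)) \<longlongrightarrow> clip c (H s \<omega>)) (at_left s)"
        by (intro tendsto_clip) simp
      moreover have "eventually (\<lambda>r. stopped_coefficient T Y c H r \<omega> = clip c (H r \<omega>)) (at_left s)"
        using True by (auto simp: eventually_at_filter stopped_coefficient_def[OF T Y])
      ultimately show ?thesis
        using True by (simp add: tendsto_cong stopped_coefficient_def[OF T Y])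
    next
      case False
      have "eventually (\<lambda>r. r \<in> {hitting_time T Y c \<omega><..<s}) (at_left s)"
        using False by (intro eventually_at_leftI[of "hitting_time T Y c \<omega>"]) auto
      then have "eventually (\<lambda>r. stopped_coefficient T Y c H r \<omega> = stopped_coefficient T Y c H s \<omega>) (at_left s)"
        by eventually_elim (use False in \<open>auto simp: stopped_coefficient_def[OF T Y]\<close>)
      then show ?thesis by (rule tendsto_eventually)
    qed
    moreover have "\<bar>stopped_coefficient T Y c H s \<omega>\<bar> \<le> c" for s
      using c by (auto simp: stopped_coefficient_def[OF T Y] abs_clip_le)
    ultimately show ?case by blast
  qed
qed

text \<open>For bounded integrands the mean of \<open>sq_int\<close> of the approximation error
  tends to 0. Fatou's lemma then bounds the second moment with a factor 2 in place of an isometry,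
  which is enough for Gronwall's inequality.\<close>

lemma ito_integral_bounded_exists:
  assumes T: "0 < T" and K: "left_regular T K" and C: "0 \<le> C"
    and bound: "\<And>s \<omega>. s \<in> {0..T} \<Longrightarrow> \<omega> \<in> space M \<Longrightarrow> \<bar>K s \<omega>\<bar> \<le> C"
  shows "\<exists>I. is_ito_integral M F T B K I \<and>
    (\<forall>t\<in>{0..T}. (\<integral>\<^sup>+ \<omega>. ennreal ((I t \<omega>)\<^sup>2) \<partial>M) \<le> 2 * (\<integral>\<^sup>+ \<omega>. sq_int t K \<omega> \<partial>M)) \<and>
    (\<forall>t\<in>{0..T}. integrable M (I t)) \<and>
    (\<forall>s t. 0 \<le> s \<longrightarrow> s \<le> t \<longrightarrow> t \<le> T \<longrightarrow>
      (\<forall>A\<in>sets (F s). expectation (\<lambda>\<omega>. (I t \<omega> - I s \<omega>) * indicator A \<omega>) = 0))"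
proof -
  obtain I K' Hs Ss where I: "is_ito_integral M F T B K I"
    and K': "progressive_on F T K'" "AE \<omega> in M. \<forall>s\<in>{0..T}. K s \<omega> = K' s \<omega>"
    and el: "\<And>m :: nat. elem (Hs m) (Ss m)"
    and lim: "AE \<omega> in M. (\<lambda>m. sq_int T (\<lambda>s \<omega>. Hs m s \<omega> - K' s \<omega>) \<omega>) \<longlonglongrightarrow> 0"
    and lim_S: "AE \<omega> in M. \<forall>t\<in>{0..T}. (\<lambda>m. Ss m t \<omega>) \<longlonglongrightarrow> I t \<omega>"
    and Hs: "\<And>m s \<omega> C. \<forall>r\<in>{0..T}. \<bar>K r \<omega>\<bar> \<le> C \<Longrightarrow> 0 \<le> C \<Longrightarrow> \<bar>Hs m s \<omega>\<bar> \<le> C"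
    using ito_integral_exists[OF T K] by blast
  have jmK: "jointly_measurable t K'" if "t \<in> {0..T}" for t
    using progressive_imp_jointly_measurable[OF K'(1)] that by auto
  have T0: "T \<in> {0..T}" using T by simp
  have I_meas: "I t \<in> borel_measurable M" if "t \<in> {0..T}" for t
    using I that measurable_F_imp_M[of "I t" t] by (auto simp: is_ito_integral_def adapted_on_def)
  define a where "a m = (\<integral>\<^sup>+ \<omega>. sq_int T (\<lambda>s \<omega>. Hs m s \<omega> - K' s \<omega>) \<omega> \<partial>M)" for m
  have "(\<lambda>m. \<integral>\<^sup>+ \<omega>. sq_int T (\<lambda>s \<omega>. Hs m s \<omega> - K' s \<omega>) \<omega> \<partial>M) \<longlonglongrightarrow> (\<integral>\<^sup>+ \<omega>. 0 \<partial>M)"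
  proof (rule nn_integral_dominated_convergence[where w = "\<lambda>_. ennreal ((2 * C)\<^sup>2 * T)"])
    show "sq_int T (\<lambda>s \<omega>. Hs m s \<omega> - K' s \<omega>) \<in> borel_measurable M" for m
      by (intro sq_int_measurable jointly_measurable_diff elem_jointly_measurable[OF el] jmK T0)
    show "AE \<omega> in M. sq_int T (\<lambda>s \<omega>. Hs m s \<omega> - K' s \<omega>) \<omega> \<le> ennreal ((2 * C)\<^sup>2 * T)" for m
      using K'(2) AE_space
    proof eventually_elim
      case (elim \<omega>)
      show ?case
      proof (rule sq_int_bounded)
        fix s assume s: "s \<in> {0..T}"
        have "\<forall>r\<in>{0..T}. \<bar>K r \<omega>\<bar> \<le> C" using bound elim(2) by blast
        then have "\<bar>Hs m s \<omega>\<bar> \<le> C" by (rule Hs[OF _ C])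
        moreover have "\<bar>K' s \<omega>\<bar> \<le> C" using bound[OF s elim(2)] elim(1) s by auto
        ultimately show "\<bar>Hs m s \<omega> - K' s \<omega>\<bar> \<le> 2 * C" by simp
      qed (use T C in auto)
    qed
    show "(\<integral>\<^sup>+ \<omega>. ennreal ((2 * C)\<^sup>2 * T) \<partial>M) < \<infinity>" by (simp add: emeasure_space_1)
  qed (use lim in auto)
  then have a: "a \<longlonglongrightarrow> 0" by (simp add: a_def[abs_def])
  \<comment> \<open>The comparison with an arbitrary simple integrand is used twice: H0 = 0 gives
    the second moment bound, and H0 = \<open>Hs m\<close> shows that the simple integrals converge
    in L2.\<close>
  have key: "(\<integral>\<^sup>+ \<omega>. ennreal ((I t \<omega> - S0 t \<omega>)\<^sup>2) \<partial>M) \<le> 2 * (\<integral>\<^sup>+ \<omega>. sq_int t (\<lambda>s \<omega>. K' s \<omega> - H0 s \<omega>) \<omega> \<partial>M)"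
    if t: "t \<in> {0..T}" and el0: "elem H0 S0" for t H0 S0
  proof -
    have jm: "jointly_measurable t (\<lambda>s \<omega>. K' s \<omega> - H0 s \<omega>)" "jointly_measurable t (\<lambda>s \<omega>. Hs m s \<omega> - K' s \<omega>)" for m
      by (intro jointly_measurable_diff jmK elem_jointly_measurable[OF el0] elem_jointly_measurable[OF el] t)+
    let ?c = "\<integral>\<^sup>+ \<omega>. sq_int t (\<lambda>s \<omega>. K' s \<omega> - H0 s \<omega>) \<omega> \<partial>M"
    have meas: "Ss m t \<in> borel_measurable M" "S0 t \<in> borel_measurable M" for m
      using elem_measurable_M[OF el] elem_measurable_M[OF el0] t by auto
    have "(\<integral>\<^sup>+ \<omega>. ennreal ((I t \<omega> - S0 t \<omega>)\<^sup>2) \<partial>M) = (\<integral>\<^sup>+ \<omega>. liminf (\<lambda>m. ennreal ((Ss m t \<omega> - S0 t \<omega>)\<^sup>2)) \<partial>M)"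
    proof (rule nn_integral_cong_AE)
      show "AE \<omega> in M. ennreal ((I t \<omega> - S0 t \<omega>)\<^sup>2) = liminf (\<lambda>m. ennreal ((Ss m t \<omega> - S0 t \<omega>)\<^sup>2))"
        using lim_S
      proof eventually_elim
        case (elim \<omega>)
        then have "(\<lambda>m. ennreal ((Ss m t \<omega> - S0 t \<omega>)\<^sup>2)) \<longlonglongrightarrow> ennreal ((I t \<omega> - S0 t \<omega>)\<^sup>2)"
          using t by (intro tendsto_ennrealI tendsto_intros) auto
        from lim_imp_Liminf[OF _ this] show ?case by simp
      qed
    qed
    also have "\<dots> \<le> liminf (\<lambda>m. \<integral>\<^sup>+ \<omega>. ennreal ((Ss m t \<omega> - S0 t \<omega>)\<^sup>2) \<partial>M)"
      using meas by (intro nn_integral_liminf) measurable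
    also have "\<dots> \<le> liminf (\<lambda>m. 2 * ?c + 2 * a m)"
    proof (rule Liminf_mono, rule always_eventually, rule allI)
      fix m
      have "(\<integral>\<^sup>+ \<omega>. ennreal ((Ss m t \<omega> - S0 t \<omega>)\<^sup>2) \<partial>M) \<le> (\<integral>\<^sup>+ \<omega>. sq_int t (\<lambda>s \<omega>. Hs m s \<omega> - H0 s \<omega>) \<omega> \<partial>M)"
        using elem_square_integral_le[OF elem_diff[OF el el0]] t by simp
      also have "\<dots> \<le> (\<integral>\<^sup>+ \<omega>. 2 * sq_int t (\<lambda>s \<omega>. K' s \<omega> - H0 s \<omega>) \<omega> + 2 * sq_int t (\<lambda>s \<omega>. Hs m s \<omega> - K' s \<omega>) \<omega> \<partial>M)"
        using sq_int_add_le[OF jm] by (intro nn_integral_mono) (simp add: algebra_simps)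
      also have "\<dots> = 2 * ?c + 2 * (\<integral>\<^sup>+ \<omega>. sq_int t (\<lambda>s \<omega>. Hs m s \<omega> - K' s \<omega>) \<omega> \<partial>M)"
        using sq_int_measurable[OF jm(1)] sq_int_measurable[OF jm(2)]
        by (simp add: nn_integral_add nn_integral_cmult)
      also have "\<dots> \<le> 2 * ?c + 2 * a m"
        unfolding a_def using t by (intro add_mono mult_left_mono nn_integral_mono sq_int_mono) auto
      finally show "(\<integral>\<^sup>+ \<omega>. ennreal ((Ss m t \<omega> - S0 t \<omega>)\<^sup>2) \<partial>M) \<le> 2 * ?c + 2 * a m" .
    qed
    also have "\<dots> = 2 * ?c"
    proof -
      have "(\<lambda>m. 2 * ?c + 2 * a m) \<longlonglongrightarrow> 2 * ?c + 2 * 0"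
        by (intro tendsto_add tendsto_const ennreal_tendsto_cmult a) simp
      then show ?thesis using lim_imp_Liminf[OF sequentially_bot, of "\<lambda>m. 2 * ?c + 2 * a m"] by simp
    qed
    finally show ?thesis .
  qed
  have fin: "(\<integral>\<^sup>+ \<omega>. ennreal ((I t \<omega>)\<^sup>2) \<partial>M) \<le> 2 * (\<integral>\<^sup>+ \<omega>. sq_int t K \<omega> \<partial>M)" if t: "t \<in> {0..T}" for t
  proof -
    have "(\<integral>\<^sup>+ \<omega>. sq_int t K' \<omega> \<partial>M) = (\<integral>\<^sup>+ \<omega>. sq_int t K \<omega> \<partial>M)"
    proof (rule nn_integral_cong_AE)
      show "AE \<omega> in M. sq_int t K' \<omega> = sq_int t K \<omega>"
        using K'(2)
      proof eventually_elim
        case (elim \<omega>)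
        then show ?case
          unfolding sq_int_def using t by (intro nn_integral_cong) (auto simp: indicator_def)
      qed
    qed
    with key[OF t elem_zero] show ?thesis by simp
  qed
  have sq_integrable: "integrable M (\<lambda>\<omega>. (I t \<omega>)\<^sup>2)" if t: "t \<in> {0..T}" for t
  proof (rule integrableI_bounded)
    have "(\<integral>\<^sup>+ \<omega>. sq_int t K \<omega> \<partial>M) \<le> (\<integral>\<^sup>+ \<omega>. ennreal (C\<^sup>2 * T) \<partial>M)"
    proof (rule nn_integral_mono)
      fix \<omega> assume "\<omega> \<in> space M"
      then have "sq_int t K \<omega> \<le> ennreal (C\<^sup>2 * t)" using bound t C by (intro sq_int_bounded) auto
      also have "\<dots> \<le> ennreal (C\<^sup>2 * T)" using t by (intro ennreal_leI mult_left_mono) auto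
      finally show "sq_int t K \<omega> \<le> ennreal (C\<^sup>2 * T)" .
    qed
    also have "\<dots> < \<infinity>" by (simp add: emeasure_space_1)
    finally have "2 * (\<integral>\<^sup>+ \<omega>. sq_int t K \<omega> \<partial>M) < \<infinity>" by (simp add: ennreal_mult_less_top)
    with fin[OF t] have "(\<integral>\<^sup>+ \<omega>. ennreal ((I t \<omega>)\<^sup>2) \<partial>M) < \<infinity>" by (rule le_less_trans)
    then show "(\<integral>\<^sup>+ \<omega>. ennreal (norm ((I t \<omega>)\<^sup>2)) \<partial>M) < \<infinity>" by simp
  qed (use I_meas[OF t] in simp)
  have I_int: "integrable M (I t)" if "t \<in> {0..T}" for t
    using square_integrable_imp_integrable[OF I_meas[OF that] sq_integrable[OF that]] .
  have martingale: "expectation (\<lambda>\<omega>. (I t \<omega> - I s \<omega>) * indicator A \<omega>) = 0"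
    if st: "0 \<le> s" "s \<le> t" "t \<le> T" and A: "A \<in> sets (F s)" for s t A
  proof -
    have AM: "A \<in> sets M" using A subalg[OF st(1)] by (auto simp: subalgebra_def)
    \<comment> \<open>\<open>b m / 2\<close> bounds the L1 distance of \<open>Ss m r\<close> from
      \<open>I r\<close>; the times s and t contribute one half each.\<close>
    define b where "b m = 2 * sqrt (enn2real (2 * a m))" for m
    have est: "integrable M (\<lambda>\<omega>. I r \<omega> - Ss m r \<omega>) \<and> expectation (\<lambda>\<omega>. \<bar>I r \<omega> - Ss m r \<omega>\<bar>) \<le> b m / 2"
      if r: "r \<in> {0..T}" and am: "a m < \<infinity>" for r m
    proof -
      have meas: "(\<lambda>\<omega>. I r \<omega> - Ss m r \<omega>) \<in> borel_measurable M"
        using elem_measurable_M[OF el] I_meas[OF r] r by auto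
      have "(\<integral>\<^sup>+ \<omega>. sq_int r (\<lambda>s \<omega>. K' s \<omega> - Hs m s \<omega>) \<omega> \<partial>M) \<le> a m"
        unfolding a_def using r by (intro nn_integral_mono sq_int_mono) (auto simp: abs_minus_commute)
      then have le: "(\<integral>\<^sup>+ \<omega>. ennreal ((I r \<omega> - Ss m r \<omega>)\<^sup>2) \<partial>M) \<le> 2 * a m"
        by (intro order_trans[OF key[OF r el]] mult_left_mono) auto
      also have lt: "2 * a m < \<infinity>" using am by (simp add: ennreal_mult_less_top)
      finally have sq: "integrable M (\<lambda>\<omega>. (I r \<omega> - Ss m r \<omega>)\<^sup>2)"
        using meas by (intro integrableI_bounded) auto
      have "expectation (\<lambda>\<omega>. (I r \<omega> - Ss m r \<omega>)\<^sup>2) = enn2real (\<integral>\<^sup>+ \<omega>. ennreal ((I r \<omega> - Ss m r \<omega>)\<^sup>2) \<partial>M)"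
        using meas by (intro integral_eq_nn_integral) auto
      also have "\<dots> \<le> enn2real (2 * a m)"
        using le lt by (intro enn2real_mono) (auto simp: less_top)
      finally show ?thesis
        using expectation_abs_le_sqrt[OF meas sq] square_integrable_imp_integrable[OF meas sq]
        by (auto simp: b_def intro: order_trans)
    qed
    have "eventually (\<lambda>m. a m < \<infinity>) sequentially"
      using a by (intro order_tendstoD(2)) auto
    then have "eventually (\<lambda>m. \<bar>expectation (\<lambda>\<omega>. (I t \<omega> - I s \<omega>) * indicator A \<omega>)\<bar> \<le> b m) sequentially"
    proof eventually_elim
      case (elim m)
      have t0: "t \<in> {0..T}" and s0: "s \<in> {0..T}" using st by auto
      note mart = elem_martingale[OF el[of m] st(1,2) A]
      have int: "integrable M (\<lambda>\<omega>. (I t \<omega> - Ss m t \<omega>) * indicator A \<omega>)" "integrable M (\<lambda>\<omega>. (I s \<omega> - Ss m s \<omega>) * indicator A \<omega>)"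
        using est[OF t0 elim] est[OF s0 elim] AM by (auto intro: integrable_real_mult_indicator)
      have "(\<lambda>\<omega>. (I t \<omega> - I s \<omega>) * indicator A \<omega>) = (\<lambda>\<omega>. (I t \<omega> - Ss m t \<omega>) * indicator A \<omega>
          - (I s \<omega> - Ss m s \<omega>) * indicator A \<omega> + (Ss m t \<omega> - Ss m s \<omega>) * indicator A \<omega>)"
        by (auto simp: algebra_simps)
      then have "expectation (\<lambda>\<omega>. (I t \<omega> - I s \<omega>) * indicator A \<omega>) =
          expectation (\<lambda>\<omega>. (I t \<omega> - Ss m t \<omega>) * indicator A \<omega>) - expectation (\<lambda>\<omega>. (I s \<omega> - Ss m s \<omega>) * indicator A \<omega>)"
        using int mart by simp
      moreover have "\<bar>expectation (\<lambda>\<omega>. (I r \<omega> - Ss m r \<omega>) * indicator A \<omega>)\<bar> \<le> b m / 2"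
        if r: "r \<in> {0..T}" for r
      proof -
        have "\<bar>expectation (\<lambda>\<omega>. (I r \<omega> - Ss m r \<omega>) * indicator A \<omega>)\<bar> \<le> expectation (\<lambda>\<omega>. \<bar>(I r \<omega> - Ss m r \<omega>) * indicator A \<omega>\<bar>)"
          by (rule integral_abs_bound)
        also have "\<dots> \<le> expectation (\<lambda>\<omega>. \<bar>I r \<omega> - Ss m r \<omega>\<bar>)"
          using est[OF r elim] AM
          by (intro integral_mono integrable_abs integrable_real_mult_indicator) (auto simp: indicator_def)
        also have "\<dots> \<le> b m / 2" using est[OF r elim] by simp
        finally show ?thesis .
      qed
      from this[OF t0] this[OF s0] show ?case unfolding calculation by linarith
    qed
    moreover have "b \<longlonglongrightarrow> 0"
    proof -
      have "(\<lambda>m. 2 * a m) \<longlonglongrightarrow> 2 * 0" by (intro ennreal_tendsto_cmult a) simp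
      then have "(\<lambda>m. 2 * a m) \<longlonglongrightarrow> ennreal 0" by simp
      then have "(\<lambda>m. enn2real (2 * a m)) \<longlonglongrightarrow> 0" by (rule tendsto_enn2real) simp
      then have "(\<lambda>m. 2 * sqrt (enn2real (2 * a m))) \<longlonglongrightarrow> 2 * sqrt 0"
        by (intro tendsto_mult tendsto_const tendsto_real_sqrt)
      then show ?thesis by (simp add: b_def[abs_def])
    qed
    ultimately have "\<bar>expectation (\<lambda>\<omega>. (I t \<omega> - I s \<omega>) * indicator A \<omega>)\<bar> \<le> 0"
      by (intro tendsto_lowerbound[of b]) auto
    then show ?thesis by simp
  qed
  show ?thesis
    by (intro exI[of _ I] conjI ballI allI impI I fin I_int martingale)
qed

end

lemma cadlag_on_if_continuous_on:
  assumes "continuous_on {0..T} h"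
  shows "cadlag_on T h"
  unfolding cadlag_on_def
proof (intro conjI ballI exI)
  fix t assume "t \<in> {0..<T}"
  then show "(h \<longlongrightarrow> h t) (at_right t)"
    using assms by (intro continuous_on_Icc_at_rightD[of t T h]) (auto intro: continuous_on_subset)
next
  fix t assume "t \<in> {0<..T}"
  then show "(h \<longlongrightarrow> h t) (at_left t)"
    using assms by (intro continuous_on_Icc_at_leftD[of 0 t h]) (auto intro: continuous_on_subset)
qed

lemma finite_variation_on_if_lipschitz:
  assumes C: "0 \<le> C" and h: "\<And>s t. s \<in> {0..T} \<Longrightarrow> t \<in> {0..T} \<Longrightarrow> \<bar>h t - h s\<bar> \<le> C * \<bar>t - s\<bar>"
  shows "finite_variation_on T h"
  unfolding finite_variation_on_def
proof (intro exI allI impI)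
  fix n and s :: "nat \<Rightarrow> real" assume s: "mono s" "range s \<subseteq> {0..T}"
  have mem: "s k \<in> {0..T}" for k using subsetD[OF s(2) rangeI[of s k]] .
  have "(\<Sum>k<n. \<bar>h (s (Suc k)) - h (s k)\<bar>) \<le> (\<Sum>k<n. C * (s (Suc k) - s k))"
  proof (rule sum_mono)
    fix k
    have "s k \<le> s (Suc k)" using s(1) by (simp add: monoD)
    then show "\<bar>h (s (Suc k)) - h (s k)\<bar> \<le> C * (s (Suc k) - s k)"
      using h[OF mem mem, of "Suc k" k] by simp
  qed
  also have "\<dots> = C * (s n - s 0)" by (simp add: sum_distrib_left[symmetric] sum_lessThan_telescope)
  also have "\<dots> \<le> C * T" using mem[of n] mem[of 0] C by (intro mult_left_mono) auto
  finally show "(\<Sum>k<n. \<bar>h (s (Suc k)) - h (s k)\<bar>) \<le> C * T" .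
qed

section \<open>Stopping an Ito integral\<close>

context ito_integrator
begin

text \<open>A relaxation of \<open>is_ito_integral\<close> that keeps the increments but forgets the
  approximating partitions, so that differences of integrals are immediate and partitions need not
  be merged.\<close>

definition ito_process :: "real \<Rightarrow> (real \<Rightarrow> 'a \<Rightarrow> real) \<Rightarrow> (real \<Rightarrow> 'a \<Rightarrow> real) \<Rightarrow> bool" where
  "ito_process T H I \<longleftrightarrow>
     (AE \<omega> in M. continuous_on {0..T} (\<lambda>t. I t \<omega>)) \<and> (AE \<omega> in M. I 0 \<omega> = 0) \<and>
     (\<exists>K. jointly_measurable T K \<and> (AE \<omega> in M. \<forall>s\<in>{0..T}. H s \<omega> = K s \<omega>) \<and>
        (\<forall>a b t. 0 \<le> a \<longrightarrow> a \<le> b \<longrightarrow> b \<le> t \<longrightarrow> t \<le> T \<longrightarrow>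
           ito_at t (\<lambda>s \<omega>. K s \<omega> * indicator {a<..b} s) (\<lambda>\<omega>. I b \<omega> - I a \<omega>)))"

lemma ito_process_of_integral:
  assumes I: "is_ito_integral M F T B H I" and T: "0 \<le> T"
  shows "ito_process T H I"
proof -
  obtain K where K: "progressive_on F T K" "AE \<omega> in M. \<forall>s\<in>{0..T}. H s \<omega> = K s \<omega>"
    "\<And>a b t. 0 \<le> a \<Longrightarrow> a \<le> b \<Longrightarrow> b \<le> t \<Longrightarrow> t \<le> T \<Longrightarrow>
      ito_at t (\<lambda>s \<omega>. K s \<omega> * indicator {a<..b} s) (\<lambda>\<omega>. I b \<omega> - I a \<omega>)"
    "AE \<omega> in M. I 0 \<omega> = 0"
    using ito_integral_obtain[OF I T] by blast
  have "jointly_measurable T K" using progressive_imp_jointly_measurable[OF K(1) T] by simp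
  with K I show ?thesis unfolding ito_process_def is_ito_integral_def by blast
qed

lemma ito_process_diff:
  assumes "ito_process T H I" "ito_process T H' I'"
  shows "ito_process T (\<lambda>s \<omega>. H s \<omega> - H' s \<omega>) (\<lambda>t \<omega>. I t \<omega> - I' t \<omega>)"
proof -
  obtain K where K: "jointly_measurable T K" "AE \<omega> in M. \<forall>s\<in>{0..T}. H s \<omega> = K s \<omega>"
    "\<And>a b t. 0 \<le> a \<Longrightarrow> a \<le> b \<Longrightarrow> b \<le> t \<Longrightarrow> t \<le> T \<Longrightarrow>
           ito_at t (\<lambda>s \<omega>. K s \<omega> * indicator {a<..b} s) (\<lambda>\<omega>. I b \<omega> - I a \<omega>)"
    using assms(1) unfolding ito_process_def by blast
  obtain K' where K': "jointly_measurable T K'" "AE \<omega> in M. \<forall>s\<in>{0..T}. H' s \<omega> = K' s \<omega>"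
    "\<And>a b t. 0 \<le> a \<Longrightarrow> a \<le> b \<Longrightarrow> b \<le> t \<Longrightarrow> t \<le> T \<Longrightarrow>
           ito_at t (\<lambda>s \<omega>. K' s \<omega> * indicator {a<..b} s) (\<lambda>\<omega>. I' b \<omega> - I' a \<omega>)"
    using assms(2) unfolding ito_process_def by blast
  have c: "AE \<omega> in M. continuous_on {0..T} (\<lambda>t. I t \<omega>)" "AE \<omega> in M. continuous_on {0..T} (\<lambda>t. I' t \<omega>)"
    "AE \<omega> in M. I 0 \<omega> = 0" "AE \<omega> in M. I' 0 \<omega> = 0"
    using assms unfolding ito_process_def by blast+
  show ?thesis
    unfolding ito_process_def
  proof (intro conjI exI allI impI)
    show "AE \<omega> in M. continuous_on {0..T} (\<lambda>t. I t \<omega> - I' t \<omega>)"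
      using c(1,2) by eventually_elim (intro continuous_intros)
    show "AE \<omega> in M. I 0 \<omega> - I' 0 \<omega> = 0" using c(3,4) by eventually_elim simp
    show "jointly_measurable T (\<lambda>s \<omega>. K s \<omega> - K' s \<omega>)" by (rule jointly_measurable_diff[OF K(1) K'(1)])
    show "AE \<omega> in M. \<forall>s\<in>{0..T}. H s \<omega> - H' s \<omega> = K s \<omega> - K' s \<omega>"
      using K(2) K'(2) by eventually_elim simp
    fix a b t assume *: "0 \<le> a" "a \<le> b" "b \<le> t" "t \<le> T"
    have "0 \<le> t" using * by simp
    from ito_at_diff[OF K(3)[OF *] K'(3)[OF *] this]
    show "ito_at t (\<lambda>s \<omega>. (K s \<omega> - K' s \<omega>) * indicator {a<..b} s) (\<lambda>\<omega>. I b \<omega> - I' b \<omega> - (I a \<omega> - I' a \<omega>))"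
      by (simp add: algebra_simps)
  qed
qed

lemma ito_process_zero: "ito_process T (\<lambda>s \<omega>. 0) (\<lambda>t \<omega>. 0)"
  unfolding ito_process_def
  by (intro conjI exI[of _ "\<lambda>s \<omega>. 0"]) (auto intro: jointly_measurable_zero ito_at_zero)

text \<open>The difference of the integrands, cut to (a, b], vanishes on A;
  \<open>ito_at_local\<close> applies to the increment of the difference.\<close>

lemma ito_process_increment_eq:
  assumes I: "ito_process T H I" and I': "ito_process T H' I'"
    and A: "A \<in> sets M" and ab: "0 \<le> a" "a \<le> b" "b \<le> T"
    and eq: "AE \<omega> in M. \<omega> \<in> A \<longrightarrow> (\<forall>s\<in>{a<..b}. H s \<omega> = H' s \<omega>)"
  shows "AE \<omega> in M. \<omega> \<in> A \<longrightarrow> I b \<omega> - I a \<omega> = I' b \<omega> - I' a \<omega>"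
proof -
  obtain K where K: "AE \<omega> in M. \<forall>s\<in>{0..T}. H s \<omega> - H' s \<omega> = K s \<omega>"
    "\<And>a b t. 0 \<le> a \<Longrightarrow> a \<le> b \<Longrightarrow> b \<le> t \<Longrightarrow> t \<le> T \<Longrightarrow>
           ito_at t (\<lambda>s \<omega>. K s \<omega> * indicator {a<..b} s) (\<lambda>\<omega>. I b \<omega> - I' b \<omega> - (I a \<omega> - I' a \<omega>))"
    using ito_process_diff[OF I I'] unfolding ito_process_def by blast
  have "AE \<omega> in M. \<omega> \<in> A \<longrightarrow> I b \<omega> - I' b \<omega> - (I a \<omega> - I' a \<omega>) = 0"
  proof (rule ito_at_local[OF K(2)[OF ab(1,2) order_refl ab(3)] _ A])
    show "AE \<omega> in M. \<omega> \<in> A \<longrightarrow> sq_int b (\<lambda>s \<omega>. K s \<omega> * indicator {a<..b} s) \<omega> = 0"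
      using eq K(1)
    proof eventually_elim
      case (elim \<omega>)
      have z: "K s \<omega> * indicator {a<..b} s = 0" if "\<omega> \<in> A" for s
      proof (cases "s \<in> {a<..b}")
        case True
        then have "H s \<omega> = H' s \<omega>" using elim(1) that by blast
        moreover have "s \<in> {0..T}" using True ab by auto
        with elim(2) have "H s \<omega> - H' s \<omega> = K s \<omega>" by blast
        ultimately show ?thesis by simp
      qed simp
      show ?case
      proof
        assume "\<omega> \<in> A"
        then show "sq_int b (\<lambda>s \<omega>. K s \<omega> * indicator {a<..b} s) \<omega> = 0"
          unfolding sq_int_def z[OF \<open>\<omega> \<in> A\<close>] by simp
      qed
    qed
  qed (use ab in auto)
  then show ?thesis by eventually_elim auto
qed

text \<open>A random time cannot be inserted into statements that hold almost surely for each fixed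
  time. Instead, for fixed r the integrands agree up to r on the event r \<le> \<tau>, so I and J
  agree at r there; for fixed q the stopped integrand vanishes after q on the event \<tau> < q, so J
  is constant from q on. Rational times and continuity reach \<tau> itself.\<close>

lemma stopped_ito_process:
  assumes T: "0 < T" and Y: "adapted_on F T Y" and I: "ito_process T H I"
    and J: "ito_process T (stopped_coefficient T Y c H) J"
    and Y_cont: "AE \<omega> in M. continuous_on {0..T} (\<lambda>t. Y t \<omega>)"
    and bound: "AE \<omega> in M. \<forall>s\<in>{0..T}. \<bar>H s \<omega>\<bar> \<le> Y s \<omega>"
  shows "AE \<omega> in M. \<forall>t\<in>{0..T}. I (min t (hitting_time T Y c \<omega>)) \<omega> = J t \<omega>"
proof -
  define \<tau> where "\<tau> = hitting_time T Y c"
  have G: "stopped_coefficient T Y c H s \<omega> = (if s \<le> \<tau> \<omega> then clip c (H s \<omega>) else 0)" for s \<omega>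
    by (simp add: \<tau>_def stopped_coefficient_def[OF T Y])
  have before: "AE \<omega> in M. r \<le> \<tau> \<omega> \<longrightarrow> I r \<omega> = J r \<omega>" if r: "r \<in> {0..T}" for r
  proof -
    let ?A = "{\<omega> \<in> space M. r \<le> \<tau> \<omega>}"
    have "?A \<in> sets M"
      using hitting_time_ge_measurable[OF T Y, of r c] subalg[of r] r by (auto simp: \<tau>_def subalgebra_def)
    then have "AE \<omega> in M. \<omega> \<in> ?A \<longrightarrow> I r \<omega> - I 0 \<omega> = J r \<omega> - J 0 \<omega>"
    proof (rule ito_process_increment_eq[OF I J])
      show "AE \<omega> in M. \<omega> \<in> ?A \<longrightarrow> (\<forall>s\<in>{0<..r}. H s \<omega> = stopped_coefficient T Y c H s \<omega>)"
        using Y_cont bound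
      proof eventually_elim
        case (elim \<omega>)
        have "H s \<omega> = stopped_coefficient T Y c H s \<omega>" if s: "s \<in> {0<..r}" and "r \<le> \<tau> \<omega>" for s
        proof -
          have "Y s \<omega> \<le> c"
            by (rule le_before_hitting_time[OF T Y elim(1)]) (use that in \<open>auto simp: \<tau>_def\<close>)
          moreover have "s \<in> {0..T}" using s r by auto
          with elim(2) have "\<bar>H s \<omega>\<bar> \<le> Y s \<omega>" by blast
          ultimately have "\<bar>H s \<omega>\<bar> \<le> c" by simp
          then show ?thesis using that by (simp add: G clip_eq)
        qed
        then show ?case by auto
      qed
    qed (use r in auto)
    moreover have "AE \<omega> in M. I 0 \<omega> = 0" "AE \<omega> in M. J 0 \<omega> = 0"
      using I J unfolding ito_process_def by blast+
    ultimately show ?thesis using AE_space by eventually_elim auto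
  qed
  have after: "AE \<omega> in M. \<tau> \<omega> < q \<longrightarrow> J r \<omega> = J q \<omega>" if qr: "0 \<le> q" "q \<le> r" "r \<le> T" for q r
  proof -
    let ?A = "{\<omega> \<in> space M. \<tau> \<omega> < q}"
    have "?A \<in> sets M"
      using hitting_time_less_measurable[OF T Y, of q c] subalg[of q] qr by (auto simp: \<tau>_def subalgebra_def)
    then have "AE \<omega> in M. \<omega> \<in> ?A \<longrightarrow> J r \<omega> - J q \<omega> = 0 - 0"
      by (rule ito_process_increment_eq[OF J ito_process_zero]) (use qr in \<open>auto simp: G\<close>)
    then show ?thesis using AE_space by eventually_elim auto
  qed
  have cntb: "countable (\<rat> \<inter> {0..T})" using countable_rat by auto
  have "AE \<omega> in M. \<forall>r\<in>\<rat> \<inter> {0..T}. r \<le> \<tau> \<omega> \<longrightarrow> I r \<omega> = J r \<omega>"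
    using before by (subst AE_ball_countable[OF cntb]) auto
  moreover have "AE \<omega> in M. \<forall>q\<in>\<rat> \<inter> {0..T}. \<forall>r\<in>\<rat> \<inter> {0..T}. q \<le> r \<longrightarrow> \<tau> \<omega> < q \<longrightarrow> J r \<omega> = J q \<omega>"
  proof -
    let ?P = "{p \<in> (\<rat> \<inter> {0..T}) \<times> (\<rat> \<inter> {0..T}). fst p \<le> snd p}"
    have "countable ((\<rat> \<inter> {0..T}) \<times> (\<rat> \<inter> {0..T}))" using cntb by (intro countable_SIGMA)
    then have "countable ?P" by (rule countable_subset[rotated]) auto
    then have "AE \<omega> in M. \<forall>p\<in>?P. \<tau> \<omega> < fst p \<longrightarrow> J (snd p) \<omega> = J (fst p) \<omega>"
      using after by (subst AE_ball_countable) auto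
    then show ?thesis
    proof eventually_elim
      case (elim \<omega>)
      show ?case
      proof (intro ballI impI)
        fix q r assume "q \<in> \<rat> \<inter> {0..T}" "r \<in> \<rat> \<inter> {0..T}" "q \<le> r" "\<tau> \<omega> < q"
        then show "J r \<omega> = J q \<omega>" using elim[rule_format, of "(q, r)"] by simp
      qed
    qed
  qed
  moreover have "AE \<omega> in M. continuous_on {0..T} (\<lambda>t. I t \<omega>)" "AE \<omega> in M. continuous_on {0..T} (\<lambda>t. J t \<omega>)"
    "AE \<omega> in M. I 0 \<omega> = 0" "AE \<omega> in M. J 0 \<omega> = 0"
    using I J unfolding ito_process_def by blast+
  ultimately show ?thesis
  proof eventually_elim
    case (elim \<omega>)
    have \<tau>: "0 \<le> \<tau> \<omega>" "\<tau> \<omega> \<le> T"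
      using hitting_time_range[OF T Y] by (auto simp: \<tau>_def)
    have eq1: "I t \<omega> = J t \<omega>" if t: "0 \<le> t" "t \<le> \<tau> \<omega>" for t
    proof (cases "t = 0")
      case False
      show ?thesis
      proof (rule eq_on_interval_if_eq_on_rationals[of 0 t "\<lambda>t. I t \<omega>" "\<lambda>t. J t \<omega>"])
        show "continuous_on {0..t} (\<lambda>t. I t \<omega>)" "continuous_on {0..t} (\<lambda>t. J t \<omega>)"
          using elim(3,4) t \<tau> by (auto intro: continuous_on_subset)
        show "I r \<omega> = J r \<omega>" if "r \<in> \<rat>" "0 < r" "r < t" for r
          using elim(1) that t \<tau> by auto
      qed (use t False in auto)
    qed (use elim in simp)
    have eq2: "J t \<omega> = J (\<tau> \<omega>) \<omega>" if t: "\<tau> \<omega> < t" "t \<le> T" for t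
    proof -
      \<comment> \<open>A rational reference point: J agrees with \<open>J q\<close> at all
        rationals inside the interval, hence by continuity also at its left end
        \<open>\<tau> \<omega>\<close>.\<close>
      obtain q where q: "q \<in> \<rat>" "\<tau> \<omega> < q" "q < t" using Rats_dense_in_real[OF t(1)] by blast
      have const: "J s \<omega> = J q \<omega>" if s: "s \<in> {\<tau> \<omega>..t}" for s
      proof (rule eq_on_interval_if_eq_on_rationals[of "\<tau> \<omega>" t "\<lambda>t. J t \<omega>" "\<lambda>_. J q \<omega>"])
        show "continuous_on {\<tau> \<omega>..t} (\<lambda>t. J t \<omega>)"
          using elim(4) t \<tau> by (auto intro: continuous_on_subset)
        show "J r \<omega> = J q \<omega>" if r: "r \<in> \<rat>" "\<tau> \<omega> < r" "r < t" for r
        proof -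
          have mem: "r \<in> \<rat> \<inter> {0..T}" "q \<in> \<rat> \<inter> {0..T}" using q r \<tau> t by auto
          show ?thesis
          proof (cases "q \<le> r")
            case True
            then show ?thesis using elim(2) mem q(2) by blast
          next
            case False
            then have "J q \<omega> = J r \<omega>" using elim(2) mem r(2) by (meson linear)
            then show ?thesis by simp
          qed
        qed
      qed (use s t in auto)
      have "t \<in> {\<tau> \<omega>..t}" "\<tau> \<omega> \<in> {\<tau> \<omega>..t}" using t by auto
      then show ?thesis using const by metis
    qed
    show ?case
      unfolding \<tau>_def[symmetric]
    proof
      fix t assume t: "t \<in> {0..T}"
      show "I (min t (\<tau> \<omega>)) \<omega> = J t \<omega>"
      proof (cases "t \<le> \<tau> \<omega>")
        case True
        then show ?thesis using eq1[of t] t by (simp add: min_absorb1)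
      next
        case False
        then show ?thesis using eq1[OF \<tau>(1) order_refl] eq2[of t] t by (simp add: min_absorb2)
      qed
    qed
  qed
qed

text \<open>The stopped integral is indistinguishable from the integral J of a bounded integrand,
  for which the martingale property is known.\<close>

lemma stopped_ito_integral_martingale:
  assumes T: "0 < T" and I: "is_ito_integral M F T B H I"
    and H: "adapted_on F T H" "AE \<omega> in M. continuous_on {0..T} (\<lambda>t. H t \<omega>)"
    and Y: "adapted_on F T Y" "AE \<omega> in M. continuous_on {0..T} (\<lambda>t. Y t \<omega>)"
    and bound: "AE \<omega> in M. \<forall>s\<in>{0..T}. \<bar>H s \<omega>\<bar> \<le> Y s \<omega>" and c: "0 \<le> c"
  shows "martingale_on M F T (\<lambda>t \<omega>. I (min t (hitting_time T Y c \<omega>)) \<omega> - I 0 \<omega>)"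
proof -
  have reg: "left_regular T (stopped_coefficient T Y c H)"
    by (rule stopped_coefficient_left_regular[OF T Y(1) H c])
  have bd: "\<bar>stopped_coefficient T Y c H s \<omega>\<bar> \<le> c" for s \<omega>
    using c by (auto simp: stopped_coefficient_def[OF T Y(1)] abs_clip_le)
  obtain J where J0: "is_ito_integral M F T B (stopped_coefficient T Y c H) J \<and>
    (\<forall>t\<in>{0..T}. (\<integral>\<^sup>+ \<omega>. ennreal ((J t \<omega>)\<^sup>2) \<partial>M) \<le> 2 * (\<integral>\<^sup>+ \<omega>. sq_int t (stopped_coefficient T Y c H) \<omega> \<partial>M)) \<and>
    (\<forall>t\<in>{0..T}. integrable M (J t)) \<and>
    (\<forall>s t. 0 \<le> s \<longrightarrow> s \<le> t \<longrightarrow> t \<le> T \<longrightarrow>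
      (\<forall>A\<in>sets (F s). expectation (\<lambda>\<omega>. (J t \<omega> - J s \<omega>) * indicator A \<omega>) = 0))"
    using ito_integral_bounded_exists[OF T reg c bd] by (elim exE)
  have J: "is_ito_integral M F T B (stopped_coefficient T Y c H) J" "\<And>t. t \<in> {0..T} \<Longrightarrow> integrable M (J t)"
    "\<And>s t A. 0 \<le> s \<Longrightarrow> s \<le> t \<Longrightarrow> t \<le> T \<Longrightarrow> A \<in> sets (F s) \<Longrightarrow>
      expectation (\<lambda>\<omega>. (J t \<omega> - J s \<omega>) * indicator A \<omega>) = 0"
    using J0 by simp_all
  have ad: "adapted_on F T J" using J(1) by (simp add: is_ito_integral_def)
  let ?X = "\<lambda>t \<omega>. I (min t (hitting_time T Y c \<omega>)) \<omega> - I 0 \<omega>"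
  have IP: "ito_process T H I" using ito_process_of_integral[OF I] T by simp
  have JP: "ito_process T (stopped_coefficient T Y c H) J" using ito_process_of_integral[OF J(1)] T by simp
  have "AE \<omega> in M. \<forall>t\<in>{0..T}. I (min t (hitting_time T Y c \<omega>)) \<omega> = J t \<omega>"
    by (rule stopped_ito_process[OF T Y(1) IP JP Y(2) bound])
  moreover have "AE \<omega> in M. I 0 \<omega> = 0" using IP by (simp add: ito_process_def)
  ultimately have eq: "AE \<omega> in M. \<forall>t\<in>{0..T}. J t \<omega> = ?X t \<omega>" by eventually_elim simp
  have eqt: "AE \<omega> in M. J t \<omega> = ?X t \<omega>" if "t \<in> {0..T}" for t
    using eq by eventually_elim (use that in blast)
  \<comment> \<open>\<open>I\<close> is evaluated at a random time here; measurability is inherited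
    from the adapted J through completeness.\<close>
  have X_F: "?X t \<in> borel_measurable (F t)" if t: "t \<in> {0..T}" for t
    by (rule measurable_F_AE_eq[OF _ _ eqt[OF t]]) (use ad t in \<open>auto simp: adapted_on_def\<close>)
  have X_M: "?X t \<in> borel_measurable M" if t: "t \<in> {0..T}" for t
    by (rule measurable_F_imp_M[OF X_F[OF t]]) (use t in auto)
  have X_int: "integrable M (?X t)" if t: "t \<in> {0..T}" for t
    by (rule integrable_cong_AE_imp[OF J(2)[OF t] X_M[OF t]]) (use eqt[OF t] in \<open>eventually_elim, simp\<close>)
  show ?thesis
    unfolding martingale_on_def
  proof (intro conjI ballI allI impI)
    show "adapted_on F T ?X" using X_F by (simp add: adapted_on_def)
    show "integrable M (?X t)" if "t \<in> {0..T}" for t by (rule X_int[OF that])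
    fix s t assume st: "0 \<le> s" "s \<le> t" "t \<le> T"
    then have s: "s \<in> {0..T}" and t: "t \<in> {0..T}" by auto
    interpret sub: finite_measure_subalgebra M "F s"
      by unfold_locales (rule subalg[OF st(1)])
    show "AE \<omega> in M. real_cond_exp M (F s) (?X t) \<omega> = ?X s \<omega>"
    \<comment> \<open>Conditional expectations are characterized by integrals over events of
      \<open>F s\<close>, and these can be computed with J.\<close>
    proof (rule sub.real_cond_exp_charact)
      fix A assume A: "A \<in> sets (F s)"
      have AM: "A \<in> sets M" using A subalg[OF st(1)] by (auto simp: subalgebra_def)
      have int: "integrable M (\<lambda>\<omega>. J r \<omega> * indicator A \<omega>)" if "r \<in> {0..T}" for r
        using J(2)[OF that] AM by (rule integrable_real_mult_indicator[rotated])
      have eqs: "(\<integral>\<omega>\<in>A. ?X r \<omega> \<partial>M) = expectation (\<lambda>\<omega>. J r \<omega> * indicator A \<omega>)" if r: "r \<in> {0..T}" for r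
        unfolding set_lebesgue_integral_def
      proof (rule integral_cong_AE)
        show "(\<lambda>\<omega>. indicator A \<omega> *\<^sub>R ?X r \<omega>) \<in> borel_measurable M"
          using X_M[OF r] AM by measurable
        show "(\<lambda>\<omega>. J r \<omega> * indicator A \<omega>) \<in> borel_measurable M"
          using int[OF r] by (rule borel_measurable_integrable)
        show "AE \<omega> in M. indicator A \<omega> *\<^sub>R ?X r \<omega> = J r \<omega> * indicator A \<omega>"
          using eqt[OF r] by eventually_elim simp
      qed
      have "expectation (\<lambda>\<omega>. J t \<omega> * indicator A \<omega>) - expectation (\<lambda>\<omega>. J s \<omega> * indicator A \<omega>) = 0"
        using J(3)[OF st A] int[OF s] int[OF t] by (simp add: left_diff_distrib)
      then show "(\<integral>\<omega>\<in>A. ?X t \<omega> \<partial>M) = (\<integral>\<omega>\<in>A. ?X s \<omega> \<partial>M)"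
        unfolding eqs[OF s] eqs[OF t] by simp
    qed (use X_int[OF t] X_int[OF s] X_F[OF s] in auto)
  qed
qed

end

section \<open>Local martingales and semimartingales\<close>

context filtered_prob_space_usual
begin

lemma martingale_on_zero: "martingale_on M F T (\<lambda>t \<omega>. 0)"
  unfolding martingale_on_def
proof (intro conjI ballI allI impI)
  fix s t :: real assume "0 \<le> s"
  interpret sub: finite_measure_subalgebra M "F s"
    by unfold_locales (rule subalg[OF \<open>0 \<le> s\<close>])
  show "AE \<omega> in M. real_cond_exp M (F s) (\<lambda>\<omega>. 0) \<omega> = 0"
    by (rule sub.real_cond_exp_F_meas) auto
qed (auto simp: adapted_on_def)

lemma martingale_on_add:
  assumes X: "martingale_on M F T X" and Y: "martingale_on M F T Y"
  shows "martingale_on M F T (\<lambda>t \<omega>. X t \<omega> + Y t \<omega>)"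
  unfolding martingale_on_def
proof (intro conjI ballI allI impI)
  show "adapted_on F T (\<lambda>t \<omega>. X t \<omega> + Y t \<omega>)"
    unfolding adapted_on_def
    using X Y by (intro ballI borel_measurable_add) (auto simp: martingale_on_def adapted_on_def)
  show "integrable M (\<lambda>\<omega>. X t \<omega> + Y t \<omega>)" if "t \<in> {0..T}" for t
    using X Y that by (auto simp: martingale_on_def)
  fix s t :: real assume st: "0 \<le> s" "s \<le> t" "t \<le> T"
  interpret sub: finite_measure_subalgebra M "F s"
    by unfold_locales (rule subalg[OF \<open>0 \<le> s\<close>])
  have "AE \<omega> in M. real_cond_exp M (F s) (\<lambda>\<omega>. X t \<omega> + Y t \<omega>) \<omega> = real_cond_exp M (F s) (X t) \<omega> + real_cond_exp M (F s) (Y t) \<omega>"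
    using X Y st by (intro sub.real_cond_exp_add) (auto simp: martingale_on_def)
  moreover have "AE \<omega> in M. real_cond_exp M (F s) (X t) \<omega> = X s \<omega>" "AE \<omega> in M. real_cond_exp M (F s) (Y t) \<omega> = Y s \<omega>"
    using X Y st by (auto simp: martingale_on_def)
  ultimately show "AE \<omega> in M. real_cond_exp M (F s) (\<lambda>\<omega>. X t \<omega> + Y t \<omega>) \<omega> = X s \<omega> + Y s \<omega>"
    by eventually_elim simp
qed

lemma martingale_on_sum:
  assumes "finite L" "\<And>l. l \<in> L \<Longrightarrow> martingale_on M F T (X l)"
  shows "martingale_on M F T (\<lambda>t \<omega>. \<Sum>l\<in>L. X l t \<omega>)"
  using assms by (induction L rule: finite_induct) (auto intro: martingale_on_zero martingale_on_add)

text \<open>All integrals are stopped at the same time, the hitting time of the sum of all |H l|.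
  Separate localizing sequences would first have to be merged by optional stopping.\<close>

lemma local_martingale_sum_ito_integrals:
  assumes T: "0 < T" and L: "finite L"
    and B: "\<And>l. l \<in> L \<Longrightarrow> ito_integrator M F (B l)"
    and I: "\<And>l. l \<in> L \<Longrightarrow> is_ito_integral M F T (B l) (H l) (I l)"
    and H: "\<And>l. l \<in> L \<Longrightarrow> adapted_on F T (H l)"
      "\<And>l. l \<in> L \<Longrightarrow> AE \<omega> in M. continuous_on {0..T} (\<lambda>t. H l t \<omega>)"
  shows "local_martingale_on M F T (\<lambda>t \<omega>. \<Sum>l\<in>L. I l t \<omega>)"
  unfolding local_martingale_on_def
proof (intro conjI exI allI ballI)
  define Y where "Y t \<omega> = (\<Sum>l\<in>L. \<bar>H l t \<omega>\<bar>)" for t \<omega>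
  have Y: "adapted_on F T Y" unfolding adapted_on_def Y_def[abs_def]
    using H(1) by (intro ballI borel_measurable_sum borel_measurable_abs) (auto simp: adapted_on_def)
  have "AE \<omega> in M. \<forall>l\<in>L. continuous_on {0..T} (\<lambda>t. H l t \<omega>)"
    using H(2) L by (subst AE_ball_countable) (auto intro: countable_finite)
  then have Y_cont: "AE \<omega> in M. continuous_on {0..T} (\<lambda>t. Y t \<omega>)"
    unfolding Y_def by eventually_elim (auto intro!: continuous_intros)
  show "adapted_on F T (\<lambda>t \<omega>. \<Sum>l\<in>L. I l t \<omega>)"
    unfolding adapted_on_def
    using I by (intro ballI borel_measurable_sum) (auto simp: adapted_on_def is_ito_integral_def)
  have "AE \<omega> in M. \<forall>l\<in>L. continuous_on {0..T} (\<lambda>t. I l t \<omega>)"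
    using I L by (subst AE_ball_countable) (auto intro: countable_finite simp: is_ito_integral_def)
  then show "AE \<omega> in M. cadlag_on T (\<lambda>t. \<Sum>l\<in>L. I l t \<omega>)"
    by eventually_elim (auto intro!: continuous_intros cadlag_on_if_continuous_on)
  fix n :: nat
  show "stopping_time F (hitting_time T Y (real n))" by (rule hitting_time_stopping_time[OF T Y])
  show "0 \<le> hitting_time T Y (real n) \<omega>" for \<omega> by (rule hitting_time_range[OF T Y])
  have "martingale_on M F T (\<lambda>t \<omega>. \<Sum>l\<in>L. I l (min t (hitting_time T Y (real n) \<omega>)) \<omega> - I l 0 \<omega>)"
  proof (rule martingale_on_sum[OF L])
    fix l assume l: "l \<in> L"
    interpret ito_integrator M F "B l" by (rule B[OF l])
    have "\<bar>H l s \<omega>\<bar> \<le> Y s \<omega>" for s \<omega>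
      unfolding Y_def using l L by (intro member_le_sum[of l L "\<lambda>l. \<bar>H l s \<omega>\<bar>"]) auto
    then show "martingale_on M F T (\<lambda>t \<omega>. I l (min t (hitting_time T Y (real n) \<omega>)) \<omega> - I l 0 \<omega>)"
      using I[OF l] H(1)[OF l] H(2)[OF l] by (intro stopped_ito_integral_martingale[OF T _ _ _ Y Y_cont]) auto
  qed
  then show "martingale_on M F T (\<lambda>t \<omega>. (\<Sum>l\<in>L. I l (min t (hitting_time T Y (real n) \<omega>)) \<omega>) - (\<Sum>l\<in>L. I l 0 \<omega>))"
    by (simp add: sum_subtractf)
next
  define Y where "Y t \<omega> = (\<Sum>l\<in>L. \<bar>H l t \<omega>\<bar>)" for t \<omega>
  have Y: "adapted_on F T Y" unfolding adapted_on_def Y_def[abs_def]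
    using H(1) by (intro ballI borel_measurable_sum borel_measurable_abs) (auto simp: adapted_on_def)
  have "AE \<omega> in M. \<forall>l\<in>L. continuous_on {0..T} (\<lambda>t. H l t \<omega>)"
    using H(2) L by (subst AE_ball_countable) (auto intro: countable_finite)
  then have Y_cont: "AE \<omega> in M. continuous_on {0..T} (\<lambda>t. Y t \<omega>)"
    unfolding Y_def by eventually_elim (auto intro!: continuous_intros)
  then show "AE \<omega> in M. incseq (\<lambda>n. hitting_time T (\<lambda>t \<omega>. \<Sum>l\<in>L. \<bar>H l t \<omega>\<bar>) (real n) \<omega>) \<and>
      (\<exists>n. T \<le> hitting_time T (\<lambda>t \<omega>. \<Sum>l\<in>L. \<bar>H l t \<omega>\<bar>) (real n) \<omega>)"
    unfolding Y_def[abs_def, symmetric]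
  proof eventually_elim
    case (elim \<omega>)
    have "incseq (\<lambda>n. hitting_time T Y (real n) \<omega>)"
      by (auto simp: incseq_def intro: hitting_time_mono[OF T Y])
    moreover have "bounded ((\<lambda>t. Y t \<omega>) ` {0..T})"
      using elim by (intro compact_imp_bounded compact_continuous_image) auto
    then obtain C where C: "\<forall>t\<in>{0..T}. \<bar>Y t \<omega>\<bar> \<le> C"
      by (auto simp: bounded_iff)
    obtain n :: nat where n: "C \<le> real n" using real_arch_simple by blast
    have "hitting_time T Y (real n) \<omega> = T"
    proof (rule hitting_time_eq_T[OF T Y])
      fix r assume "r \<in> {0..T}"
      then have "\<bar>Y r \<omega>\<bar> \<le> C" using C by blast
      then show "Y r \<omega> \<le> real n" using n by linarith
    qed
    then have "\<exists>n. T \<le> hitting_time T Y (real n) \<omega>" by (intro exI[of _ n]) simp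
    ultimately show ?case ..
  qed
qed

text \<open>The finite variation part is what X leaves after its local martingale part; a pathwise
  Lipschitz bound gives it both regular paths and finite variation.\<close>

lemma semimartingale_onI:
  assumes X: "adapted_on F T X" and N: "local_martingale_on M F T N" and N0: "AE \<omega> in M. N 0 \<omega> = 0" and T: "0 < T"
    and lip: "AE \<omega> in M. \<exists>C\<ge>0. \<forall>s\<in>{0..T}. \<forall>t\<in>{0..T}. \<bar>(X t \<omega> - N t \<omega>) - (X s \<omega> - N s \<omega>)\<bar> \<le> C * \<bar>t - s\<bar>"
  shows "semimartingale_on M F T X"
  unfolding semimartingale_on_def
proof (intro conjI exI)
  define A where "A t \<omega> = X t \<omega> - X 0 \<omega> - N t \<omega>" for t \<omega>
  have N_ad: "adapted_on F T N" using N by (simp add: local_martingale_on_def)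
  show "adapted_on F T X" "local_martingale_on M F T N" by fact+
  show "adapted_on F T A"
    unfolding adapted_on_def A_def[abs_def]
  proof
    fix t assume t: "t \<in> {0..T}"
    have "X 0 \<in> borel_measurable (F t)"
      by (rule measurable_F_mono[of _ 0]) (use X T t in \<open>auto simp: adapted_on_def\<close>)
    then show "(\<lambda>\<omega>. X t \<omega> - X 0 \<omega> - N t \<omega>) \<in> borel_measurable (F t)"
      by (intro borel_measurable_diff) (use X N_ad t in \<open>auto simp: adapted_on_def\<close>)
  qed
  show "AE \<omega> in M. N 0 \<omega> = 0 \<and> A 0 \<omega> = 0 \<and> cadlag_on T (\<lambda>t. A t \<omega>) \<and> finite_variation_on T (\<lambda>t. A t \<omega>) \<and>
      (\<forall>t\<in>{0..T}. X t \<omega> = X 0 \<omega> + N t \<omega> + A t \<omega>)"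
    using N0 lip
  proof eventually_elim
    case (elim \<omega>)
    then obtain C where C: "0 \<le> C" "\<And>s t. s \<in> {0..T} \<Longrightarrow> t \<in> {0..T} \<Longrightarrow> \<bar>A t \<omega> - A s \<omega>\<bar> \<le> C * \<bar>t - s\<bar>"
      unfolding A_def by (auto simp: algebra_simps)
    have "C-lipschitz_on {0..T} (\<lambda>t. A t \<omega>)"
      using C by (intro lipschitz_onI) (auto simp: dist_real_def)
    then have "continuous_on {0..T} (\<lambda>t. A t \<omega>)" by (rule lipschitz_on_continuous_on)
    then show ?case
      using finite_variation_on_if_lipschitz[OF C] cadlag_on_if_continuous_on elim by (auto simp: A_def)
  qed
qed

end

section \<open>Ito equations and pathwise uniqueness\<close>

lemma borel_measurable_matrix_nth [measurable]:
  "(\<lambda>A :: real ^ 'n ^ 'm. A $ i $ j) \<in> borel_measurable borel"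
  by (intro borel_measurable_continuous_onI continuous_intros)

section \<open>Entries of the Brownian matrix as integrators\<close>

context filtered_prob_space_usual
begin

lemma brownian_increment_indep:
  fixes W :: "real \<Rightarrow> 'a \<Rightarrow> real ^ 'p ^ 'p" and \<phi> :: "real ^ 'p ^ 'p \<Rightarrow> real"
  assumes W: "brownian_matrix M F W" and st: "0 \<le> s" "s < t"
    and Z: "Z \<in> borel_measurable (F s)" and [measurable]: "\<phi> \<in> borel_measurable borel"
  shows "indep_var borel Z borel (\<lambda>\<omega>. \<phi> (W t \<omega> - W s \<omega>))"
proof -
  let ?D = "\<lambda>\<omega>. W t \<omega> - W s \<omega>"
  have "W r \<in> borel_measurable M" if "0 \<le> r" for r
    using W that measurable_from_subalg[OF subalg] by (auto simp: brownian_matrix_def)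
  then have [measurable]: "W s \<in> borel_measurable M" "W t \<in> borel_measurable M" using st by auto
  have D_meas: "(\<lambda>\<omega>. \<phi> (?D \<omega>)) \<in> borel_measurable M" by measurable
  have indep: "indep_set (sets (F s)) (sets (vimage_algebra (space M) ?D borel))"
    using W st by (simp add: brownian_matrix_def)
  have 1: "sigma_sets (space M) {Z -` A \<inter> space M |A. A \<in> sets borel} \<subseteq> sets (F s)"
    unfolding space_F[of s, symmetric]
    by (rule sets.sigma_sets_subset) (use measurable_sets[OF Z] in auto)
  have "{(\<lambda>\<omega>. \<phi> (?D \<omega>)) -` A \<inter> space M |A. A \<in> sets borel} \<subseteq> sets (vimage_algebra (space M) ?D borel)"
  proof safe
    fix A :: "real set" assume A: "A \<in> sets borel"
    have "\<phi> -` A \<in> sets borel" using measurable_sets[of \<phi> borel borel A] A by simp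
    from in_vimage_algebra[OF this, of ?D "space M"]
    show "(\<lambda>\<omega>. \<phi> (?D \<omega>)) -` A \<inter> space M \<in> sets (vimage_algebra (space M) ?D borel)"
      by (simp add: vimage_def)
  qed
  then have 2: "sigma_sets (space M) {(\<lambda>\<omega>. \<phi> (?D \<omega>)) -` A \<inter> space M |A. A \<in> sets borel} \<subseteq> sets (vimage_algebra (space M) ?D borel)"
    using sets.sigma_sets_subset[of _ "vimage_algebra (space M) ?D borel"] by simp
  have "indep_set (sigma_sets (space M) {Z -` A \<inter> space M |A. A \<in> sets borel})
      (sigma_sets (space M) {(\<lambda>\<omega>. \<phi> (?D \<omega>)) -` A \<inter> space M |A. A \<in> sets borel})"
    using indep unfolding indep_set_def
    by (rule indep_sets_mono_sets) (use 1 2 in \<open>auto split: bool.split\<close>)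
  then show ?thesis
    unfolding indep_var_eq using D_meas measurable_F_imp_M[OF Z st(1)] by simp
qed

text \<open>Independence of the increment from \<open>F s\<close> factorizes the expectations, and
  the normal law supplies the two moments. The case s = t is separate, as the normal density
  requires a positive deviation.\<close>

lemma brownian_ito_integrator:
  fixes W :: "real \<Rightarrow> 'a \<Rightarrow> real ^ 'p ^ 'p"
  assumes W: "brownian_matrix M F W"
  shows "ito_integrator M F (\<lambda>t \<omega>. W t \<omega> $ i $ j)"
proof
  fix t :: real assume "0 \<le> t"
  then have "W t \<in> borel_measurable (F t)" using W by (simp add: brownian_matrix_def)
  then show "(\<lambda>\<omega>. W t \<omega> $ i $ j) \<in> borel_measurable (F t)"
    by (rule measurable_compose) (rule borel_measurable_matrix_nth)
next
  have "AE \<omega> in M. continuous_on {0..} (\<lambda>t. W t \<omega>)" using W by (simp add: brownian_matrix_def)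
  then show "AE \<omega> in M. continuous_on {0..} (\<lambda>t. W t \<omega> $ i $ j)"
    by eventually_elim (intro continuous_intros)
next
  fix s t :: real and Z :: "'a \<Rightarrow> real"
  assume st: "0 \<le> s" "s \<le> t" and Z: "Z \<in> borel_measurable (F s)" "integrable M Z"
  let ?X = "\<lambda>\<omega>. W t \<omega> $ i $ j - W s \<omega> $ i $ j"
  have main: "(integrable M (\<lambda>\<omega>. Z \<omega> * ?X \<omega>) \<and> expectation (\<lambda>\<omega>. Z \<omega> * ?X \<omega>) = 0) \<and>
    (integrable M (\<lambda>\<omega>. Z \<omega> * (?X \<omega>)\<^sup>2) \<and> expectation (\<lambda>\<omega>. Z \<omega> * (?X \<omega>)\<^sup>2) = (t - s) * expectation Z)"
  proof (cases "s = t")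
    case False
    then have st': "s < t" using st by simp
    then have \<sigma>: "0 < sqrt (t - s)" by simp
    have D: "distributed M lborel ?X (\<lambda>x. ennreal (normal_density 0 (sqrt (t - s)) x))"
      using W st st' by (simp add: brownian_matrix_def)
    have X1: "expectation ?X = 0" by (rule normal_distributed_expectation[OF \<sigma> D])
    have X2: "expectation (\<lambda>\<omega>. (?X \<omega>)\<^sup>2) = t - s"
      using normal_distributed_variance[OF \<sigma> D] X1 st by simp
    have int: "integrable M (\<lambda>\<omega>. (?X \<omega>) ^ k)" for k
      using distributed_integrable[OF D, of "\<lambda>x. x ^ k"] integrable_normal_moment[OF \<sigma>, of 0 k] by simp
    have i1: "indep_var borel Z borel ?X"
      using brownian_increment_indep[OF W st(1) st' Z(1) borel_measurable_matrix_nth[of i j]] by simp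
    have i2: "indep_var borel Z borel (\<lambda>\<omega>. (?X \<omega>)\<^sup>2)"
      using brownian_increment_indep[OF W st(1) st' Z(1) borel_measurable_power[OF borel_measurable_matrix_nth[of i j], of 2]] by simp
    show ?thesis
      using indep_var_integrable[OF i1 Z(2)] indep_var_lebesgue_integral[OF i1 Z(2)] int[of 1] X1
        indep_var_integrable[OF i2 Z(2)] indep_var_lebesgue_integral[OF i2 Z(2)] int[of 2] X2
      by simp
  qed simp
  show "integrable M (\<lambda>\<omega>. Z \<omega> * ?X \<omega>) \<and> expectation (\<lambda>\<omega>. Z \<omega> * ?X \<omega>) = 0"
    "integrable M (\<lambda>\<omega>. Z \<omega> * (?X \<omega>)\<^sup>2) \<and> expectation (\<lambda>\<omega>. Z \<omega> * (?X \<omega>)\<^sup>2) = (t - s) * expectation Z"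
    using main by blast+
qed

end

section \<open>The matrix equation entry by entry\<close>

text \<open>The entry \<open>(i, j)\<close> of \<open>\<surd>X dW + dW' \<surd>X\<close> is the sum over \<open>k\<close> of \<open>(\<surd>X)\<^sub>i\<^sub>k dW\<^sub>k\<^sub>j\<close> and
  \<open>(\<surd>X)\<^sub>k\<^sub>j dW\<^sub>k\<^sub>i\<close>. The index \<open>l = (d, k)\<close> ranges over these terms, \<open>d\<close> marking the transposed ones.\<close>

definition noise_entry ::
  "(real \<Rightarrow> 'a \<Rightarrow> real ^ 'p ^ 'p) \<Rightarrow> 'p \<Rightarrow> 'p \<Rightarrow> bool \<times> 'p \<Rightarrow> real \<Rightarrow> 'a \<Rightarrow> real" where
  "noise_entry W i j l t \<omega> = (if fst l then W t \<omega> $ snd l $ i else W t \<omega> $ snd l $ j)"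

definition coefficient_entry ::
  "(real \<Rightarrow> real) \<Rightarrow> (real \<Rightarrow> 'a \<Rightarrow> real ^ 'p ^ 'p) \<Rightarrow> 'p \<Rightarrow> 'p \<Rightarrow> bool \<times> 'p \<Rightarrow> real \<Rightarrow> 'a \<Rightarrow> real" where
  "coefficient_entry h X i j l s \<omega> =
     h s * (if fst l then msqrt (X s \<omega>) $ snd l $ j else msqrt (X s \<omega>) $ i $ snd l)"

lemma sum_bool_pair:
  fixes f :: "bool \<times> 'p::finite \<Rightarrow> real"
  shows "(\<Sum>l\<in>UNIV. f l) = (\<Sum>k\<in>UNIV. f (False, k)) + (\<Sum>k\<in>UNIV. f (True, k))"
proof -
  have "(\<Sum>l\<in>UNIV. f l) = (\<Sum>d\<in>UNIV. \<Sum>k\<in>UNIV. f (d, k))"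
    by (simp add: sum.cartesian_product flip: UNIV_Times_UNIV)
  then show ?thesis by (simp add: UNIV_bool add.commute)
qed

text \<open>The left and the right matrix integral are merged into one sum over
  \<open>bool \<times> 'p\<close>, so that later arguments treat a single kind of scalar
  integral.\<close>

lemma solves_ito_equation_iff:
  fixes X :: "real \<Rightarrow> 'a \<Rightarrow> real ^ 'p ^ 'p"
  shows "solves_ito_equation M F T W b h X \<longleftrightarrow>
    adapted_on F T X \<and> (AE \<omega> in M. set_integrable lborel {0..T} (\<lambda>s. b s \<omega>)) \<and>
    (\<exists>J. (\<forall>i j l. is_ito_integral M F T (noise_entry W i j l) (coefficient_entry h X i j l) (J i j l)) \<and>
      (AE \<omega> in M. \<forall>t\<in>{0..T}. \<forall>i j. X t \<omega> $ i $ j =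
         X 0 \<omega> $ i $ j + (LINT s:{0..t}|lborel. b s \<omega>) $ i $ j + (\<Sum>l\<in>UNIV. J i j l t \<omega>)))"
    (is "?L \<longleftrightarrow> ?R")
proof
  assume ?L
  then have ad: "adapted_on F T X" "AE \<omega> in M. set_integrable lborel {0..T} (\<lambda>s. b s \<omega>)"
    by (auto simp: solves_ito_equation_def)
  from \<open>?L\<close> obtain I I' where I: "is_ito_integral_left M F T (\<lambda>s \<omega>. h s *\<^sub>R msqrt (X s \<omega>)) W I"
      "is_ito_integral_right M F T (\<lambda>s \<omega>. transpose (W s \<omega>)) (\<lambda>s \<omega>. h s *\<^sub>R msqrt (X s \<omega>)) I'"
      "AE \<omega> in M. \<forall>t\<in>{0..T}. X t \<omega> = X 0 \<omega> + (LINT s:{0..t}|lborel. b s \<omega>) + I t \<omega> + I' t \<omega>"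
    unfolding solves_ito_equation_def by blast
  obtain J where J: "\<And>i j k. is_ito_integral M F T (\<lambda>s \<omega>. W s \<omega> $ k $ j) (\<lambda>s \<omega>. (h s *\<^sub>R msqrt (X s \<omega>)) $ i $ k) (J i j k)"
    "AE \<omega> in M. \<forall>t\<in>{0..T}. I t \<omega> = (\<chi> i j. \<Sum>k\<in>UNIV. J i j k t \<omega>)"
    using I(1) unfolding is_ito_integral_left_def by blast
  obtain J' where J': "\<And>i j k. is_ito_integral M F T (\<lambda>s \<omega>. transpose (W s \<omega>) $ i $ k) (\<lambda>s \<omega>. (h s *\<^sub>R msqrt (X s \<omega>)) $ k $ j) (J' i j k)"
    "AE \<omega> in M. \<forall>t\<in>{0..T}. I' t \<omega> = (\<chi> i j. \<Sum>k\<in>UNIV. J' i j k t \<omega>)"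
    using I(2) unfolding is_ito_integral_right_def by blast
  define JJ where "JJ i j l = (if fst l then J' i j (snd l) else J i j (snd l))" for i j and l :: "bool \<times> 'p"
  have "is_ito_integral M F T (noise_entry W i j l) (coefficient_entry h X i j l) (JJ i j l)" for i j l
    using J(1)[of "snd l" j i] J'(1)[of i "snd l" j]
    by (cases "fst l") (simp_all add: JJ_def noise_entry_def[abs_def] coefficient_entry_def[abs_def] transpose_def)
  moreover have "AE \<omega> in M. \<forall>t\<in>{0..T}. \<forall>i j. X t \<omega> $ i $ j =
         X 0 \<omega> $ i $ j + (LINT s:{0..t}|lborel. b s \<omega>) $ i $ j + (\<Sum>l\<in>UNIV. JJ i j l t \<omega>)"
    using I(3) J(2) J'(2)
  proof eventually_elim
    case (elim \<omega>)
    show ?case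
    proof (intro ballI allI)
      fix t i j assume t: "t \<in> {0..T}"
      have "X t \<omega> $ i $ j = (X 0 \<omega> + (LINT s:{0..t}|lborel. b s \<omega>) + I t \<omega> + I' t \<omega>) $ i $ j"
        using elim(1) t by (metis (no_types, lifting))
      also have "I t \<omega> = (\<chi> i j. \<Sum>k\<in>UNIV. J i j k t \<omega>)" using elim(2) t by blast
      also have "I' t \<omega> = (\<chi> i j. \<Sum>k\<in>UNIV. J' i j k t \<omega>)" using elim(3) t by blast
      finally show "X t \<omega> $ i $ j =
         X 0 \<omega> $ i $ j + (LINT s:{0..t}|lborel. b s \<omega>) $ i $ j + (\<Sum>l\<in>UNIV. JJ i j l t \<omega>)"
        by (simp add: sum_bool_pair JJ_def)
    qed
  qed
  ultimately show ?R using ad by blast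
next
  assume ?R
  then obtain J where ad: "adapted_on F T X" "AE \<omega> in M. set_integrable lborel {0..T} (\<lambda>s. b s \<omega>)"
    and J: "\<And>i j l. is_ito_integral M F T (noise_entry W i j l) (coefficient_entry h X i j l) (J i j l)"
    and eq: "AE \<omega> in M. \<forall>t\<in>{0..T}. \<forall>i j. X t \<omega> $ i $ j =
         X 0 \<omega> $ i $ j + (LINT s:{0..t}|lborel. b s \<omega>) $ i $ j + (\<Sum>l\<in>UNIV. J i j l t \<omega>)"
    by blast
  show ?L
    unfolding solves_ito_equation_def
  proof (intro conjI exI)
    show "is_ito_integral_left M F T (\<lambda>s \<omega>. h s *\<^sub>R msqrt (X s \<omega>)) W (\<lambda>t \<omega>. \<chi> i j. \<Sum>k\<in>UNIV. J i j (False, k) t \<omega>)"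
      unfolding is_ito_integral_left_def
      using J[of _ _ "(False, _)"]
      by (intro exI[of _ "\<lambda>i j k. J i j (False, k)"]) (simp add: noise_entry_def[abs_def] coefficient_entry_def[abs_def])
    show "is_ito_integral_right M F T (\<lambda>s \<omega>. transpose (W s \<omega>)) (\<lambda>s \<omega>. h s *\<^sub>R msqrt (X s \<omega>)) (\<lambda>t \<omega>. \<chi> i j. \<Sum>k\<in>UNIV. J i j (True, k) t \<omega>)"
      unfolding is_ito_integral_right_def
      using J[of _ _ "(True, _)"]
      by (intro exI[of _ "\<lambda>i j k. J i j (True, k)"]) (simp add: noise_entry_def[abs_def] coefficient_entry_def[abs_def] transpose_def)
    show "AE \<omega> in M. \<forall>t\<in>{0..T}. X t \<omega> = X 0 \<omega> + (LINT s:{0..t}|lborel. b s \<omega>)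
        + (\<chi> i j. \<Sum>k\<in>UNIV. J i j (False, k) t \<omega>) + (\<chi> i j. \<Sum>k\<in>UNIV. J i j (True, k) t \<omega>)"
      using eq
    proof eventually_elim
      case (elim \<omega>)
      show ?case
      proof (intro ballI, subst vec_eq_iff, intro allI, subst vec_eq_iff, intro allI)
        fix t i j assume "t \<in> {0..T}"
        then have "X t \<omega> $ i $ j = X 0 \<omega> $ i $ j + (LINT s:{0..t}|lborel. b s \<omega>) $ i $ j + (\<Sum>l\<in>UNIV. J i j l t \<omega>)"
          using elim by blast
        then show "X t \<omega> $ i $ j = (X 0 \<omega> + (LINT s:{0..t}|lborel. b s \<omega>)
            + (\<chi> i j. \<Sum>k\<in>UNIV. J i j (False, k) t \<omega>) + (\<chi> i j. \<Sum>k\<in>UNIV. J i j (True, k) t \<omega>)) $ i $ j"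
          by (simp add: sum_bool_pair)
      qed
    qed
  qed (use ad in auto)
qed

context filtered_prob_space_usual
begin

lemma noise_entry_ito_integrator:
  "brownian_matrix M F W \<Longrightarrow> ito_integrator M F (noise_entry W i j l)"
  unfolding noise_entry_def[abs_def]
  by (cases "fst l") (simp_all add: brownian_ito_integrator)

lemma coefficient_entry_adapted:
  assumes X: "adapted_on F T X"
  shows "adapted_on F T (coefficient_entry h X i j l)"
  unfolding adapted_on_def
proof
  fix t assume "t \<in> {0..T}"
  then have [measurable]: "X t \<in> borel_measurable (F t)" using X by (auto simp: adapted_on_def)
  have "(\<lambda>\<omega>. msqrt (X t \<omega>) $ i $ j) \<in> borel_measurable (F t)" for i j
    by (rule measurable_compose[OF _ borel_measurable_matrix_nth]) measurable
  then show "coefficient_entry h X i j l t \<in> borel_measurable (F t)"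
    unfolding coefficient_entry_def[abs_def] by (cases "fst l") simp_all
qed

end

lemma coefficient_entry_continuous:
  assumes "continuous_on {0..T} (\<lambda>t. X t \<omega>)" "continuous_on {0..T} h" "\<forall>t\<in>{0..T}. X t \<omega> \<in> SPD"
  shows "continuous_on {0..T} (\<lambda>t. coefficient_entry h X i j l t \<omega>)"
proof -
  have "continuous_on {0..T} (\<lambda>t. msqrt (X t \<omega>))"
    by (rule continuous_on_compose2[OF continuous_on_msqrt assms(1)]) (use assms(3) in auto)
  then show ?thesis
    unfolding coefficient_entry_def by (cases "fst l") (auto intro!: continuous_intros assms(2))
qed

text \<open>Iterating the inequality n times gives the bound D (C t)^n / n!, which tends to 0. The
  argument suits a merely bounded \<phi> with extended values, such as a second moment.\<close>

lemma gronwall_zero: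
  fixes \<phi> :: "real \<Rightarrow> ennreal" and C D :: real
  assumes D: "0 \<le> D" and C: "0 \<le> C"
    and bound: "\<And>t. t \<in> {0..T} \<Longrightarrow> \<phi> t \<le> ennreal D"
    and le: "\<And>t. t \<in> {0..T} \<Longrightarrow> \<phi> t \<le> ennreal C * (\<integral>\<^sup>+ s\<in>{0..t}. \<phi> s \<partial>lborel)"
    and t: "t \<in> {0..T}"
  shows "\<phi> t = 0"
proof -
  have ind: "\<phi> t \<le> ennreal (D * (C * t) ^ n / fact n)" if "t \<in> {0..T}" for n t
    using that
  proof (induction n arbitrary: t)
    case (Suc n)
    then have t: "0 \<le> t" "t \<le> T" by auto
    let ?G = "\<lambda>s. D * C ^ n * s ^ Suc n / fact (Suc n)"
    have "(\<integral>\<^sup>+ s\<in>{0..t}. \<phi> s \<partial>lborel) \<le> (\<integral>\<^sup>+ s. ennreal (D * (C * s) ^ n / fact n) * indicator {0..t} s \<partial>lborel)"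
      using Suc.IH t by (intro nn_integral_mono) (auto simp: indicator_def)
    also have "\<dots> = ennreal (?G t - ?G 0)"
    proof (rule nn_integral_FTC_Icc)
      show "(?G has_real_derivative D * (C * s) ^ n / fact n) (at s)" for s
      proof -
        have "(?G has_real_derivative D * C ^ n * (real (Suc n) * s ^ n) / fact (Suc n)) (at s)"
          by (rule DERIV_cong[OF DERIV_cdivide[OF DERIV_cmult[OF DERIV_pow]]])
             (simp del: power_Suc of_nat_Suc fact_Suc)
        moreover have "D * C ^ n * (real (Suc n) * s ^ n) / fact (Suc n) = D * (C * s) ^ n / fact n"
          by (simp add: power_mult_distrib divide_simps)
        ultimately show ?thesis by (simp only:)
      qed
      show "0 \<le> D * (C * s) ^ n / fact n" if "s \<in> {0..t}" for s
        using that C D by simp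
    qed (use t in auto)
    finally have "ennreal C * (\<integral>\<^sup>+ s\<in>{0..t}. \<phi> s \<partial>lborel) \<le> ennreal C * ennreal (?G t)"
      by (intro mult_left_mono) auto
    also have "\<dots> = ennreal (C * ?G t)" using C D t by (intro ennreal_mult[symmetric]) simp_all
    also have "C * ?G t = D * (C * t) ^ Suc n / fact (Suc n)" by (simp add: power_mult_distrib)
    finally show ?case using le[OF Suc.prems] by (rule order_trans[rotated])
  qed (use bound in simp)
  have "(\<lambda>n. inverse (fact n) * (C * t) ^ n) \<longlonglongrightarrow> 0"
    by (rule summable_LIMSEQ_zero[OF summable_exp])
  then have "(\<lambda>n. D * (inverse (fact n) * (C * t) ^ n)) \<longlonglongrightarrow> D * 0" by (intro tendsto_intros)
  then have "(\<lambda>n. D * (C * t) ^ n / fact n) \<longlonglongrightarrow> 0" by (simp add: divide_inverse mult_ac)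
  then have "(\<lambda>n. ennreal (D * (C * t) ^ n / fact n)) \<longlonglongrightarrow> ennreal 0" by (rule tendsto_ennrealI)
  from LIMSEQ_le_const[OF this] have "\<phi> t \<le> ennreal 0" using ind[OF t] by blast
  then show ?thesis by simp
qed

lemma least_eigenvalue_measurable [measurable]:
  "(least_eigenvalue :: real ^ 'n ^ 'n \<Rightarrow> real) \<in> borel_measurable borel"
  by (intro borel_measurable_continuous_onI continuous_on_least_eigenvalue)

lemma norm_matrix_sq: "(norm (A :: real ^ 'n ^ 'm))\<^sup>2 = (\<Sum>i\<in>UNIV. \<Sum>j\<in>UNIV. (A $ i $ j)\<^sup>2)"
  unfolding power2_norm_eq_inner inner_vec_def by (simp add: power2_eq_square)

lemma abs_matrix_entry_le_norm: "\<bar>(A :: real ^ 'n ^ 'm) $ i $ j\<bar> \<le> norm A"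
  by (rule order_trans[OF component_le_norm_cart Finite_Cartesian_Product.norm_nth_le])

lemma (in ito_integrator) left_regular_if_continuous:
  assumes K: "adapted_on F T K" and cont: "AE \<omega> in M. continuous_on {0..T} (\<lambda>t. K t \<omega>)"
  shows "left_regular T K"
  unfolding left_regular_def
proof
  show "AE \<omega> in M. (\<exists>C. \<forall>s\<in>{0..T}. \<bar>K s \<omega>\<bar> \<le> C) \<and> (\<forall>s\<in>{0<..T}. ((\<lambda>r. K r \<omega>) \<longlongrightarrow> K s \<omega>) (at_left s))"
    using cont
  proof eventually_elim
    case (elim \<omega>)
    have "bounded ((\<lambda>t. K t \<omega>) ` {0..T})"
      using elim by (intro compact_imp_bounded compact_continuous_image) auto
    moreover have "((\<lambda>r. K r \<omega>) \<longlongrightarrow> K s \<omega>) (at_left s)" if "s \<in> {0<..T}" for s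
      using elim that by (intro continuous_on_Icc_at_leftD[of 0 s]) (auto intro: continuous_on_subset)
    ultimately show ?case by (auto simp: bounded_iff)
  qed
qed fact

text \<open>Prepares Fubini's theorem: a process with regular paths almost surely becomes jointly
  measurable after a change on a null set.\<close>

lemma (in ito_integrator) left_regular_progressive_version:
  assumes T: "0 < T" and K: "left_regular T K"
  shows "\<exists>K'. progressive_on F T K' \<and> (AE \<omega> in M. \<forall>s\<in>{0..T}. K s \<omega> = K' s \<omega>)"
proof (intro exI conjI)
  have "adapted_on F T K" using K by (simp add: left_regular_def)
  then show "progressive_on F T (\<lambda>s \<omega>. if s = 0 then K 0 \<omega> else lim (\<lambda>m. grid_step T K m s \<omega>))"
    by (rule left_limits_progressive_version[OF T])
  show "AE \<omega> in M. \<forall>s\<in>{0..T}. K s \<omega> = (if s = 0 then K 0 \<omega> else lim (\<lambda>m. grid_step T K m s \<omega>))"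
    using grid_step_sq_int_tendsto[OF T K] by eventually_elim blast
qed

section \<open>Pathwise uniqueness\<close>

context filtered_prob_space_usual
begin

text \<open>The drift is the same process in both equations and cancels, so the difference is a sum
  of stochastic integrals of \<Delta>. Stopped before P exceeds c, the integrand is bounded and, by
  \<open>norm_msqrt_diff_le\<close>, at most a constant times the norm of X - Y. Gronwall's
  inequality for the second moment gives equality up to the stopping time.\<close>

lemma ito_equation_unique:
  fixes W :: "real \<Rightarrow> 'a \<Rightarrow> real ^ 'p ^ 'p"
  assumes W: "brownian_matrix M F W" and T: "0 < T"
    and X: "solves_ito_equation M F T W b h X" and Y: "solves_ito_equation M F T W b h Y"
    and X_cont: "AE \<omega> in M. continuous_on {0..T} (\<lambda>t. X t \<omega>)"
    and Y_cont: "AE \<omega> in M. continuous_on {0..T} (\<lambda>t. Y t \<omega>)"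
    and X_SPD: "AE \<omega> in M. \<forall>t\<in>{0..T}. X t \<omega> \<in> SPD"
    and Y_SPD: "AE \<omega> in M. \<forall>t\<in>{0..T}. Y t \<omega> \<in> SPD"
    and h: "continuous_on {0..T} h" and init: "AE \<omega> in M. X 0 \<omega> = Y 0 \<omega>"
  shows "AE \<omega> in M. \<forall>t\<in>{0..T}. X t \<omega> = Y t \<omega>"
proof -
  note integrator = noise_entry_ito_integrator[OF W]
  obtain J where X_ad: "adapted_on F T X"
    and J: "\<forall>i j l. is_ito_integral M F T (noise_entry W i j l) (coefficient_entry h X i j l) (J i j l)"
    and X_eq: "AE \<omega> in M. \<forall>t\<in>{0..T}. \<forall>i j. X t \<omega> $ i $ j =
         X 0 \<omega> $ i $ j + (LINT s:{0..t}|lborel. b s \<omega>) $ i $ j + (\<Sum>l\<in>UNIV. J i j l t \<omega>)"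
    using X unfolding solves_ito_equation_iff by blast
  obtain J' where Y_ad: "adapted_on F T Y"
    and J': "\<forall>i j l. is_ito_integral M F T (noise_entry W i j l) (coefficient_entry h Y i j l) (J' i j l)"
    and Y_eq: "AE \<omega> in M. \<forall>t\<in>{0..T}. \<forall>i j. Y t \<omega> $ i $ j =
         Y 0 \<omega> $ i $ j + (LINT s:{0..t}|lborel. b s \<omega>) $ i $ j + (\<Sum>l\<in>UNIV. J' i j l t \<omega>)"
    using Y unfolding solves_ito_equation_iff by blast
  define \<Delta> where "\<Delta> i j l s \<omega> = coefficient_entry h X i j l s \<omega> - coefficient_entry h Y i j l s \<omega>" for i j l s \<omega>
  define D where "D i j t \<omega> = X t \<omega> $ i $ j - Y t \<omega> $ i $ j" for i j t \<omega>
  have D_eq: "AE \<omega> in M. \<forall>t\<in>{0..T}. \<forall>i j. D i j t \<omega> = (\<Sum>l\<in>UNIV. J i j l t \<omega> - J' i j l t \<omega>)"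
    using X_eq Y_eq init
  proof eventually_elim
    case (elim \<omega>)
    show ?case
    proof (intro ballI allI)
      fix t i j assume t: "t \<in> {0..T}"
      have "X t \<omega> $ i $ j = X 0 \<omega> $ i $ j + (LINT s:{0..t}|lborel. b s \<omega>) $ i $ j + (\<Sum>l\<in>UNIV. J i j l t \<omega>)"
        "Y t \<omega> $ i $ j = Y 0 \<omega> $ i $ j + (LINT s:{0..t}|lborel. b s \<omega>) $ i $ j + (\<Sum>l\<in>UNIV. J' i j l t \<omega>)"
        using elim(1,2) t by blast+
      then show "D i j t \<omega> = (\<Sum>l\<in>UNIV. J i j l t \<omega> - J' i j l t \<omega>)"
        using elim(3) by (simp add: D_def sum_subtractf)
    qed
  qed
  \<comment> \<open>One process controls two things: its first part bounds the integrands \<Delta>,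
    its second part is the Lipschitz constant of the square root at X.\<close>
  define P where "P t \<omega> = (\<Sum>i\<in>UNIV. \<Sum>j\<in>UNIV. \<Sum>l\<in>UNIV. \<bar>\<Delta> i j l t \<omega>\<bar>) + 1 / least_eigenvalue (msqrt (X t \<omega>))" for t \<omega>
  have \<Delta>_ad: "adapted_on F T (\<Delta> i j l)" for i j l
    using coefficient_entry_adapted[OF X_ad, of h i j l] coefficient_entry_adapted[OF Y_ad, of h i j l]
    unfolding adapted_on_def \<Delta>_def[abs_def] by (intro ballI borel_measurable_diff) auto
  have P_ad: "adapted_on F T P"
    unfolding adapted_on_def
  proof
    fix t assume t: "t \<in> {0..T}"
    have [measurable]: "\<Delta> i j l t \<in> borel_measurable (F t)" "X t \<in> borel_measurable (F t)" for i j l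
      using \<Delta>_ad X_ad t by (auto simp: adapted_on_def)
    show "P t \<in> borel_measurable (F t)" unfolding P_def[abs_def] by measurable
  qed
  have \<Delta>_cont: "AE \<omega> in M. \<forall>i j l. continuous_on {0..T} (\<lambda>t. \<Delta> i j l t \<omega>)"
    using X_cont Y_cont X_SPD Y_SPD unfolding \<Delta>_def
    by eventually_elim (auto intro!: continuous_intros coefficient_entry_continuous h)
  have pos: "AE \<omega> in M. \<forall>t\<in>{0..T}. 0 < least_eigenvalue (msqrt (X t \<omega>))"
    using X_SPD by eventually_elim (metis SPD_iff msqrt_SPD(1))
  have P_cont: "AE \<omega> in M. continuous_on {0..T} (\<lambda>t. P t \<omega>)"
    using \<Delta>_cont pos X_cont X_SPD
  proof eventually_elim
    case (elim \<omega>)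
    have "continuous_on {0..T} (\<lambda>t. msqrt (X t \<omega>))"
      by (rule continuous_on_compose2[OF continuous_on_msqrt elim(3)]) (use elim(4) in auto)
    then have "continuous_on {0..T} (\<lambda>t. least_eigenvalue (msqrt (X t \<omega>)))"
      by (rule continuous_on_compose2[OF continuous_on_least_eigenvalue[of UNIV]]) auto
    then show ?case
      unfolding P_def using elim(1,2) by (intro continuous_intros) (auto simp: less_imp_neq[symmetric] dest: bspec)
  qed
  have \<Delta>_P: "AE \<omega> in M. \<forall>s\<in>{0..T}. \<forall>i j l. \<bar>\<Delta> i j l s \<omega>\<bar> \<le> P s \<omega>"
    using pos
  proof eventually_elim
    case (elim \<omega>)
    show ?case
    proof (intro ballI allI)
      fix s i j and l :: "bool \<times> 'p" assume s: "s \<in> {0..T}"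
      have "\<bar>\<Delta> i j l s \<omega>\<bar> \<le> (\<Sum>l\<in>UNIV. \<bar>\<Delta> i j l s \<omega>\<bar>)"
        by (rule member_le_sum) auto
      also have "\<dots> \<le> (\<Sum>j\<in>UNIV. \<Sum>l\<in>UNIV. \<bar>\<Delta> i j l s \<omega>\<bar>)"
        by (rule member_le_sum[of j UNIV "\<lambda>j. \<Sum>l\<in>UNIV. \<bar>\<Delta> i j l s \<omega>\<bar>"]) (auto intro: sum_nonneg)
      also have "\<dots> \<le> (\<Sum>i\<in>UNIV. \<Sum>j\<in>UNIV. \<Sum>l\<in>UNIV. \<bar>\<Delta> i j l s \<omega>\<bar>)"
        by (rule member_le_sum[of i UNIV "\<lambda>i. \<Sum>j\<in>UNIV. \<Sum>l\<in>UNIV. \<bar>\<Delta> i j l s \<omega>\<bar>"]) (auto intro: sum_nonneg)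
      finally show "\<bar>\<Delta> i j l s \<omega>\<bar> \<le> P s \<omega>"
        using bspec[OF elim s] unfolding P_def by (simp add: add_increasing2)
    qed
  qed
  have "bounded (h ` {0..T})" using h by (intro compact_imp_bounded compact_continuous_image) auto
  then obtain Hm where Hm: "\<forall>t\<in>{0..T}. \<bar>h t\<bar> \<le> Hm" by (auto simp: bounded_iff)
  have Hm0: "0 \<le> Hm" using Hm T by (intro order_trans[OF abs_ge_zero[of "h 0"]]) auto
  have stopped: "AE \<omega> in M. \<forall>t\<in>{0..T}. \<forall>i j. D i j (min t (hitting_time T P (real n) \<omega>)) \<omega> = 0" for n :: nat
  proof -
    define c where "c = real n"
    have c: "0 \<le> c" by (simp add: c_def)
    define \<tau> where "\<tau> = hitting_time T P c"
    have \<tau>: "0 \<le> \<tau> \<omega>" "\<tau> \<omega> \<le> T" for \<omega> using hitting_time_range[OF T P_ad] by (auto simp: \<tau>_def)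
    define G where "G i j l = stopped_coefficient T P c (\<Delta> i j l)" for i j l
    have G_eq: "G i j l s \<omega> = (if s \<le> \<tau> \<omega> then clip c (\<Delta> i j l s \<omega>) else 0)" for i j l s \<omega>
      by (simp add: G_def \<tau>_def stopped_coefficient_def[OF T P_ad])
    have G_bound: "\<bar>G i j l s \<omega>\<bar> \<le> c" for i j l s \<omega> using c by (auto simp: G_eq abs_clip_le)
    have \<Delta>c: "AE \<omega> in M. continuous_on {0..T} (\<lambda>t. \<Delta> i j l t \<omega>)" for i j l
      using \<Delta>_cont by eventually_elim blast
    have "\<exists>I. is_ito_integral M F T (noise_entry W i j l) (G i j l) I \<and>
        (\<forall>t\<in>{0..T}. (\<integral>\<^sup>+ \<omega>. ennreal ((I t \<omega>)\<^sup>2) \<partial>M) \<le> 2 * (\<integral>\<^sup>+ \<omega>. sq_int t (G i j l) \<omega> \<partial>M))" for i j l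
    proof -
      interpret ito_integrator M F "noise_entry W i j l" by (rule integrator)
      have "left_regular T (G i j l)"
        unfolding G_def by (rule stopped_coefficient_left_regular[OF T P_ad \<Delta>_ad \<Delta>c c])
      from ito_integral_bounded_exists[OF T this c G_bound] show ?thesis by (elim exE conjE) (intro exI conjI)
    qed
    then obtain I where I: "\<And>i j l. is_ito_integral M F T (noise_entry W i j l) (G i j l) (I i j l)"
      and I_sq: "\<And>i j l t. t \<in> {0..T} \<Longrightarrow> (\<integral>\<^sup>+ \<omega>. ennreal ((I i j l t \<omega>)\<^sup>2) \<partial>M) \<le> 2 * (\<integral>\<^sup>+ \<omega>. sq_int t (G i j l) \<omega> \<partial>M)"
      by metis
    have stop: "AE \<omega> in M. \<forall>t\<in>{0..T}. J i j l (min t (\<tau> \<omega>)) \<omega> - J' i j l (min t (\<tau> \<omega>)) \<omega> = I i j l t \<omega>" for i j l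
    proof -
      interpret ito_integrator M F "noise_entry W i j l" by (rule integrator)
      have 1: "ito_process T (\<Delta> i j l) (\<lambda>t \<omega>. J i j l t \<omega> - J' i j l t \<omega>)"
        unfolding \<Delta>_def using T
        by (intro ito_process_diff ito_process_of_integral J[rule_format] J'[rule_format]) simp_all
      have 2: "ito_process T (stopped_coefficient T P c (\<Delta> i j l)) (I i j l)"
        using I[of i j l] T unfolding G_def by (intro ito_process_of_integral) auto
      show ?thesis
        unfolding \<tau>_def
        by (rule stopped_ito_process[OF T P_ad 1 2 P_cont]) (use \<Delta>_P in \<open>eventually_elim, blast\<close>)
    qed
    then have "AE \<omega> in M. \<forall>i j l. \<forall>t\<in>{0..T}. J i j l (min t (\<tau> \<omega>)) \<omega> - J' i j l (min t (\<tau> \<omega>)) \<omega> = I i j l t \<omega>"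
      by (simp add: AE_all_countable)
    then have D_I: "AE \<omega> in M. \<forall>t\<in>{0..T}. \<forall>i j. D i j (min t (\<tau> \<omega>)) \<omega> = (\<Sum>l\<in>UNIV. I i j l t \<omega>)"
      using D_eq
    proof eventually_elim
      case (elim \<omega>)
      show ?case
      proof (intro ballI allI)
        fix t i j assume t: "t \<in> {0..T}"
        then have "min t (\<tau> \<omega>) \<in> {0..T}" using \<tau> by (auto simp: min_def)
        then have "D i j (min t (\<tau> \<omega>)) \<omega> = (\<Sum>l\<in>UNIV. J i j l (min t (\<tau> \<omega>)) \<omega> - J' i j l (min t (\<tau> \<omega>)) \<omega>)"
          using elim(2) by blast
        also have "\<dots> = (\<Sum>l\<in>UNIV. I i j l t \<omega>)"
          using elim(1) t by (intro sum.cong) auto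
        finally show "D i j (min t (\<tau> \<omega>)) \<omega> = (\<Sum>l\<in>UNIV. I i j l t \<omega>)" .
      qed
    qed
    have ex_K: "\<exists>K. progressive_on F T K \<and> (AE \<omega> in M. \<forall>s\<in>{0..T}. I i j l s \<omega> = K s \<omega>)" for i j l
    proof -
      interpret ito_integrator M F "noise_entry W i j l" by (rule integrator)
      have reg: "left_regular T (I i j l)"
        using I[of i j l] by (intro left_regular_if_continuous) (auto simp: is_ito_integral_def)
      show ?thesis by (rule left_regular_progressive_version[OF T reg])
    qed
    define K where "K i j l = (SOME K. progressive_on F T K \<and> (AE \<omega> in M. \<forall>s\<in>{0..T}. I i j l s \<omega> = K s \<omega>))" for i j l
    have K: "progressive_on F T (K i j l)" "AE \<omega> in M. \<forall>s\<in>{0..T}. I i j l s \<omega> = K i j l s \<omega>" for i j l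
      unfolding K_def using someI_ex[OF ex_K[of i j l]] by (rule conjunct1, rule conjunct2)
    \<comment> \<open>A jointly measurable version of the squared norm of the stopped difference of
      X and Y.\<close>
    define U where "U s \<omega> = (\<Sum>i\<in>UNIV. \<Sum>j\<in>UNIV. (\<Sum>l\<in>UNIV. K i j l s \<omega>)\<^sup>2)" for s \<omega>
    have U0: "0 \<le> U s \<omega>" for s \<omega> unfolding U_def by (intro sum_nonneg) auto
    have IK: "AE \<omega> in M. \<forall>i j l. \<forall>s\<in>{0..T}. I i j l s \<omega> = K i j l s \<omega>"
      using K(2) by (simp add: AE_all_countable)
    then have U_D: "AE \<omega> in M. \<forall>s\<in>{0..T}. U s \<omega> = (\<Sum>i\<in>UNIV. \<Sum>j\<in>UNIV. (D i j (min s (\<tau> \<omega>)) \<omega>)\<^sup>2)"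
      using D_I
    proof eventually_elim
      case (elim \<omega>)
      show ?case
      proof
        fix s assume s: "s \<in> {0..T}"
        have "D i j (min s (\<tau> \<omega>)) \<omega> = (\<Sum>l\<in>UNIV. K i j l s \<omega>)" for i j
        proof -
          have "D i j (min s (\<tau> \<omega>)) \<omega> = (\<Sum>l\<in>UNIV. I i j l s \<omega>)" using elim(2) s by blast
          also have "\<dots> = (\<Sum>l\<in>UNIV. K i j l s \<omega>)"
          proof (rule sum.cong[OF refl])
            fix l
            show "I i j l s \<omega> = K i j l s \<omega>" using elim(1) s by blast
          qed
          finally show ?thesis .
        qed
        then show "U s \<omega> = (\<Sum>i\<in>UNIV. \<Sum>j\<in>UNIV. (D i j (min s (\<tau> \<omega>)) \<omega>)\<^sup>2)"
          unfolding U_def by (simp only:)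
      qed
    qed
    have "(\<lambda>(\<omega>, s). K i j l s \<omega> * indicator {0..T} s) \<in> borel_measurable (M \<Otimes>\<^sub>M borel)" for i j l
      using progressive_imp_jointly_measurable[OF K(1), of T] T by (simp add: jointly_measurable_def)
    then have K_meas: "(\<lambda>p. K i j l (snd p) (fst p) * indicator {0..T} (snd p)) \<in> borel_measurable (M \<Otimes>\<^sub>M lborel)" for i j l
      by (simp add: case_prod_beta' cong: measurable_cong_sets)
    have "(\<lambda>p. \<Sum>i\<in>UNIV. \<Sum>j\<in>UNIV. (\<Sum>l\<in>UNIV. K i j l (snd p) (fst p) * indicator {0..T} (snd p))\<^sup>2) \<in> borel_measurable (M \<Otimes>\<^sub>M lborel)"
      by (intro borel_measurable_sum borel_measurable_power K_meas)
    moreover have "(\<lambda>p. \<Sum>i\<in>UNIV. \<Sum>j\<in>UNIV. (\<Sum>l\<in>UNIV. K i j l (snd p) (fst p) * indicator {0..T} (snd p))\<^sup>2)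
        = (\<lambda>p. U (snd p) (fst p) * indicator {0..T} (snd p))"
      by (auto simp: U_def fun_eq_iff indicator_def)
    ultimately have U_meas: "(\<lambda>p. U (snd p) (fst p) * indicator {0..T} (snd p)) \<in> borel_measurable (M \<Otimes>\<^sub>M lborel)"
      by simp
    define \<phi> where "\<phi> t = (\<integral>\<^sup>+ \<omega>. ennreal (U t \<omega>) \<partial>M)" for t
    \<comment> \<open>The number of summands l: the square of their sum is at most m times the sum
      of their squares.\<close>
    define m where "m = real (card (UNIV :: (bool \<times> 'p) set))"
    have m: "0 \<le> m" by (simp add: m_def)
    \<comment> \<open>The square of the Lipschitz constant up to the stopping time:
      \<open>Hm\<close> bounds h, and c bounds the reciprocal of the least eigenvalue.\<close>
    define C1 where "C1 = (Hm * c)\<^sup>2"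
    have \<phi>_le: "\<phi> t \<le> (\<Sum>i\<in>UNIV. \<Sum>j\<in>UNIV. \<Sum>l\<in>UNIV. ennreal (2 * m) * (\<integral>\<^sup>+ \<omega>. sq_int t (G i j l) \<omega> \<partial>M))"
      if t: "t \<in> {0..T}" for t
    proof -
      have I_meas: "I i j l t \<in> borel_measurable M" for i j l
        using I[of i j l] t measurable_F_imp_M[of "I i j l t" t] by (auto simp: is_ito_integral_def adapted_on_def)
      have "\<phi> t \<le> (\<integral>\<^sup>+ \<omega>. (\<Sum>i\<in>UNIV. \<Sum>j\<in>UNIV. \<Sum>l\<in>UNIV. ennreal m * ennreal ((I i j l t \<omega>)\<^sup>2)) \<partial>M)"
        unfolding \<phi>_def
      proof (rule nn_integral_mono_AE)
        show "AE \<omega> in M. ennreal (U t \<omega>) \<le> (\<Sum>i\<in>UNIV. \<Sum>j\<in>UNIV. \<Sum>l\<in>UNIV. ennreal m * ennreal ((I i j l t \<omega>)\<^sup>2))"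
          using IK
        proof eventually_elim
          case (elim \<omega>)
          have "U t \<omega> = (\<Sum>i\<in>UNIV. \<Sum>j\<in>UNIV. (\<Sum>l\<in>UNIV. I i j l t \<omega>)\<^sup>2)"
          proof -
            have "I i j l t \<omega> = K i j l t \<omega>" for i j l using elim t by blast
            then show ?thesis by (simp only: U_def)
          qed
          also have "\<dots> \<le> (\<Sum>i\<in>UNIV. \<Sum>j\<in>UNIV. (\<Sum>l\<in>UNIV. (I i j l t \<omega>)\<^sup>2) * m)"
            unfolding m_def by (intro sum_mono sum_squared_le_sum_of_squares)
          also have "\<dots> = (\<Sum>i\<in>UNIV. \<Sum>j\<in>UNIV. \<Sum>l\<in>UNIV. m * (I i j l t \<omega>)\<^sup>2)"
            by (simp add: sum_distrib_left mult.commute)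
          finally have "ennreal (U t \<omega>) \<le> ennreal (\<Sum>i\<in>UNIV. \<Sum>j\<in>UNIV. \<Sum>l\<in>UNIV. m * (I i j l t \<omega>)\<^sup>2)"
            by (rule ennreal_leI)
          then show ?case using m by (simp add: sum_ennreal[symmetric] sum_nonneg ennreal_mult)
        qed
      qed
      also have "\<dots> = (\<Sum>i\<in>UNIV. \<Sum>j\<in>UNIV. \<Sum>l\<in>UNIV. ennreal m * (\<integral>\<^sup>+ \<omega>. ennreal ((I i j l t \<omega>)\<^sup>2) \<partial>M))"
        using I_meas by (simp add: nn_integral_sum nn_integral_cmult)
      also have "\<dots> \<le> (\<Sum>i\<in>UNIV. \<Sum>j\<in>UNIV. \<Sum>l\<in>UNIV. ennreal m * (2 * (\<integral>\<^sup>+ \<omega>. sq_int t (G i j l) \<omega> \<partial>M)))"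
        by (intro sum_mono mult_left_mono I_sq t) auto
      also have "\<dots> = (\<Sum>i\<in>UNIV. \<Sum>j\<in>UNIV. \<Sum>l\<in>UNIV. ennreal (2 * m) * (\<integral>\<^sup>+ \<omega>. sq_int t (G i j l) \<omega> \<partial>M))"
        using m by (simp add: ennreal_mult mult_ac)
      finally show ?thesis .
    qed
    have zero: "\<phi> t = 0" if t: "t \<in> {0..T}" for t
    proof (rule gronwall_zero[OF _ _ _ _ t])
      \<comment> \<open>\<open>?E\<close> is the a priori bound, finite because G is bounded by c;
        \<open>?C\<close> is the constant of the integral inequality. Both collect the factor 2 m
        over all index triples.\<close>
      let ?E = "\<Sum>i\<in>(UNIV :: 'p set). \<Sum>j\<in>(UNIV :: 'p set). \<Sum>l\<in>(UNIV :: (bool \<times> 'p) set). 2 * m * (c\<^sup>2 * T)"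
      let ?C = "\<Sum>i\<in>(UNIV :: 'p set). \<Sum>j\<in>(UNIV :: 'p set). \<Sum>l\<in>(UNIV :: (bool \<times> 'p) set). 2 * m * C1"
      show "0 \<le> ?E" using m T by (intro sum_nonneg) auto
      show "0 \<le> ?C" using m by (intro sum_nonneg) (auto simp: C1_def)
      fix t assume t: "t \<in> {0..T}"
      have sq_bound: "(\<integral>\<^sup>+ \<omega>. sq_int t (G i j l) \<omega> \<partial>M) \<le> ennreal (c\<^sup>2 * T)" for i j l
      proof -
        have "sq_int t (G i j l) \<omega> \<le> ennreal (c\<^sup>2 * T)" for \<omega>
        proof -
          have "sq_int t (G i j l) \<omega> \<le> ennreal (c\<^sup>2 * t)" using G_bound t c by (intro sq_int_bounded) auto
          also have "\<dots> \<le> ennreal (c\<^sup>2 * T)" using t by (intro ennreal_leI mult_left_mono) auto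
          finally show ?thesis .
        qed
        then have "(\<integral>\<^sup>+ \<omega>. sq_int t (G i j l) \<omega> \<partial>M) \<le> (\<integral>\<^sup>+ \<omega>. ennreal (c\<^sup>2 * T) \<partial>M)"
          by (intro nn_integral_mono)
        then show ?thesis by (simp add: emeasure_space_1)
      qed
      have "\<phi> t \<le> (\<Sum>i\<in>UNIV. \<Sum>j\<in>UNIV. \<Sum>l\<in>UNIV. ennreal (2 * m) * (\<integral>\<^sup>+ \<omega>. sq_int t (G i j l) \<omega> \<partial>M))"
        by (rule \<phi>_le[OF t])
      also have "\<dots> \<le> (\<Sum>i\<in>(UNIV :: 'p set). \<Sum>j\<in>(UNIV :: 'p set). \<Sum>l\<in>(UNIV :: (bool \<times> 'p) set). ennreal (2 * m) * ennreal (c\<^sup>2 * T))"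
        by (intro sum_mono mult_left_mono sq_bound) auto
      also have "\<dots> = ennreal ?E"
      proof -
        have nn: "0 \<le> 2 * m * (c\<^sup>2 * T)" using m T by simp
        have "ennreal (2 * m) * ennreal (c\<^sup>2 * T) = ennreal (2 * m * (c\<^sup>2 * T))"
          using m T by (intro ennreal_mult[symmetric]) auto
        then show ?thesis by (simp add: nn sum_nonneg sum_ennreal del: sum_constant)
      qed
      finally show "\<phi> t \<le> ennreal ?E" .
      have sq_le: "(\<integral>\<^sup>+ \<omega>. sq_int t (G i j l) \<omega> \<partial>M) \<le> ennreal C1 * (\<integral>\<^sup>+ s\<in>{0..t}. \<phi> s \<partial>lborel)" for i j l
      proof -
        interpret P: pair_sigma_finite M lborel ..
        let ?f = "\<lambda>\<omega> s. ennreal (U s \<omega> * indicator {0..T} s) * indicator {0..t} s"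
        have f_meas: "(\<lambda>(\<omega>, s). ?f \<omega> s) \<in> borel_measurable (M \<Otimes>\<^sub>M lborel)"
          using U_meas unfolding case_prod_beta' by measurable
        have "AE \<omega> in M. sq_int t (G i j l) \<omega> \<le> ennreal C1 * (\<integral>\<^sup>+ s. ?f \<omega> s \<partial>lborel)"
          using U_D X_SPD Y_SPD P_cont pos AE_space
        proof eventually_elim
          case (elim \<omega>)
          have sec: "(\<lambda>s. ?f \<omega> s) \<in> borel_measurable lborel"
            using measurable_compose[OF measurable_Pair1'[OF elim(6)] f_meas] by simp
          have "sq_int t (G i j l) \<omega> \<le> (\<integral>\<^sup>+ s. ennreal C1 * ?f \<omega> s \<partial>lborel)"
            unfolding sq_int_def
          proof (rule nn_integral_mono_AE)
            \<comment> \<open>Time 0 is left out, because P may exceed c at the start although 0 is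
              never after the hitting time.\<close>
            show "AE s in lborel. ennreal ((G i j l s \<omega>)\<^sup>2) * indicator {0..t} s \<le> ennreal C1 * ?f \<omega> s"
              using AE_lborel_singleton[of 0]
            proof eventually_elim
              case (elim s)
              show ?case
              proof (cases "s \<in> {0..t} \<and> s \<le> \<tau> \<omega>")
                case True
                then have s: "0 < s" "s \<in> {0..T}" "s \<le> \<tau> \<omega>" using elim t by auto
                have "P s \<omega> \<le> c"
                  by (rule le_before_hitting_time[OF T P_ad \<open>continuous_on {0..T} (\<lambda>t. P t \<omega>)\<close>]) (use s in \<open>auto simp: \<tau>_def\<close>)
                moreover have "0 \<le> (\<Sum>i\<in>UNIV. \<Sum>j\<in>UNIV. \<Sum>l\<in>UNIV. \<bar>\<Delta> i j l s \<omega>\<bar>)" by (intro sum_nonneg) auto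
                ultimately have lam_le: "1 / least_eigenvalue (msqrt (X s \<omega>)) \<le> c" unfolding P_def by linarith
                have "\<bar>G i j l s \<omega>\<bar> \<le> \<bar>\<Delta> i j l s \<omega>\<bar>" using c by (auto simp: G_eq abs_clip_le_abs)
                also have "\<bar>\<Delta> i j l s \<omega>\<bar> = \<bar>h s\<bar> * \<bar>if fst l then (msqrt (X s \<omega>) - msqrt (Y s \<omega>)) $ snd l $ j else (msqrt (X s \<omega>) - msqrt (Y s \<omega>)) $ i $ snd l\<bar>"
                  by (simp add: \<Delta>_def coefficient_entry_def abs_mult[symmetric] right_diff_distrib)
                also have "\<dots> \<le> Hm * norm (msqrt (X s \<omega>) - msqrt (Y s \<omega>))"
                  using Hm s Hm0 by (intro mult_mono) (auto simp del: vector_minus_component intro: abs_matrix_entry_le_norm)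
                also have "\<dots> \<le> Hm * (norm (X s \<omega> - Y s \<omega>) / least_eigenvalue (msqrt (X s \<omega>)))"
                  using \<open>\<forall>t\<in>{0..T}. X t \<omega> \<in> SPD\<close> \<open>\<forall>t\<in>{0..T}. Y t \<omega> \<in> SPD\<close> s Hm0
                  by (intro mult_left_mono norm_msqrt_diff_le) auto
                also have "\<dots> = Hm * ((1 / least_eigenvalue (msqrt (X s \<omega>))) * norm (X s \<omega> - Y s \<omega>))" by simp
                also have "\<dots> \<le> Hm * (c * norm (X s \<omega> - Y s \<omega>))"
                  using lam_le Hm0 by (intro mult_left_mono mult_right_mono) auto
                finally have "\<bar>G i j l s \<omega>\<bar> \<le> Hm * c * norm (X s \<omega> - Y s \<omega>)" by (simp add: mult.assoc)
                then have "\<bar>G i j l s \<omega>\<bar>\<^sup>2 \<le> (Hm * c * norm (X s \<omega> - Y s \<omega>))\<^sup>2" by (rule power_mono) auto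
                then have "(G i j l s \<omega>)\<^sup>2 \<le> C1 * (norm (X s \<omega> - Y s \<omega>))\<^sup>2" by (simp add: C1_def power_mult_distrib)
                also have "(norm (X s \<omega> - Y s \<omega>))\<^sup>2 = U s \<omega>"
                proof -
                  have "U s \<omega> = (\<Sum>i\<in>UNIV. \<Sum>j\<in>UNIV. (D i j (min s (\<tau> \<omega>)) \<omega>)\<^sup>2)"
                    using \<open>\<forall>s\<in>{0..T}. U s \<omega> = _ s\<close> s(2) by blast
                  then show ?thesis using s(3) by (simp add: norm_matrix_sq D_def min_absorb1)
                qed
                finally have "ennreal ((G i j l s \<omega>)\<^sup>2) \<le> ennreal (C1 * U s \<omega>)" by (rule ennreal_leI)
                then show ?thesis using True s U0 by (simp add: ennreal_mult C1_def)
              next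
                case False
                then have "(G i j l s \<omega>)\<^sup>2 * indicator {0..t} s = 0" by (auto simp: G_eq)
                then show ?thesis by (auto simp: G_eq indicator_def)
              qed
            qed
          qed
          also have "\<dots> = ennreal C1 * (\<integral>\<^sup>+ s. ?f \<omega> s \<partial>lborel)"
            by (rule nn_integral_cmult[OF sec])
          finally show ?case .
        qed
        then have "(\<integral>\<^sup>+ \<omega>. sq_int t (G i j l) \<omega> \<partial>M) \<le> (\<integral>\<^sup>+ \<omega>. ennreal C1 * (\<integral>\<^sup>+ s. ?f \<omega> s \<partial>lborel) \<partial>M)"
          by (rule nn_integral_mono_AE)
        also have "\<dots> = ennreal C1 * (\<integral>\<^sup>+ \<omega>. \<integral>\<^sup>+ s. ?f \<omega> s \<partial>lborel \<partial>M)"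
          by (rule nn_integral_cmult) (rule lborel.borel_measurable_nn_integral[OF f_meas])
        also have "(\<integral>\<^sup>+ \<omega>. \<integral>\<^sup>+ s. ?f \<omega> s \<partial>lborel \<partial>M) = (\<integral>\<^sup>+ s. \<integral>\<^sup>+ \<omega>. ?f \<omega> s \<partial>M \<partial>lborel)"
          using P.Fubini'[OF f_meas] by simp
        also have "\<dots> = (\<integral>\<^sup>+ s\<in>{0..t}. \<phi> s \<partial>lborel)"
        proof (rule nn_integral_cong)
          fix s
          show "(\<integral>\<^sup>+ \<omega>. ?f \<omega> s \<partial>M) = \<phi> s * indicator {0..t} s"
            using t by (cases "s \<in> {0..t}") (auto simp: \<phi>_def)
        qed
        finally show ?thesis .
      qed
      have "\<phi> t \<le> (\<Sum>i\<in>UNIV. \<Sum>j\<in>UNIV. \<Sum>l\<in>UNIV. ennreal (2 * m) * (\<integral>\<^sup>+ \<omega>. sq_int t (G i j l) \<omega> \<partial>M))"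
        by (rule \<phi>_le[OF t])
      also have "\<dots> \<le> (\<Sum>i\<in>(UNIV :: 'p set). \<Sum>j\<in>(UNIV :: 'p set). \<Sum>l\<in>(UNIV :: (bool \<times> 'p) set). ennreal (2 * m) * (ennreal C1 * (\<integral>\<^sup>+ s\<in>{0..t}. \<phi> s \<partial>lborel)))"
        by (intro sum_mono mult_left_mono sq_le) auto
      also have "\<dots> = (\<Sum>i\<in>(UNIV :: 'p set). \<Sum>j\<in>(UNIV :: 'p set). \<Sum>l\<in>(UNIV :: (bool \<times> 'p) set). ennreal (2 * m * C1)) * (\<integral>\<^sup>+ s\<in>{0..t}. \<phi> s \<partial>lborel)"
      proof -
        have "ennreal (2 * m) * ennreal C1 = ennreal (2 * m * C1)"
          using m by (intro ennreal_mult[symmetric]) (auto simp: C1_def)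
        then show ?thesis by (simp only: sum_distrib_right mult.assoc[symmetric])
      qed
      also have "(\<Sum>i\<in>(UNIV :: 'p set). \<Sum>j\<in>(UNIV :: 'p set). \<Sum>l\<in>(UNIV :: (bool \<times> 'p) set). ennreal (2 * m * C1)) = ennreal ?C"
      proof -
        have nn: "0 \<le> 2 * m * C1" using m by (simp add: C1_def)
        show ?thesis by (simp add: nn sum_nonneg sum_ennreal del: sum_constant)
      qed
      finally show "\<phi> t \<le> ennreal ?C * (\<integral>\<^sup>+ s\<in>{0..t}. \<phi> s \<partial>lborel)" .
    qed
    have D_t: "AE \<omega> in M. \<forall>i j. D i j (min t (\<tau> \<omega>)) \<omega> = 0" if t: "t \<in> {0..T}" for t
    proof -
      have "(\<lambda>\<omega>. U t \<omega>) \<in> borel_measurable M"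
      proof -
        have "(\<lambda>p. U (snd p) (fst p) * indicator {0..T} (snd p)) \<in> borel_measurable (M \<Otimes>\<^sub>M lborel)" by (rule U_meas)
        from measurable_compose[OF measurable_Pair2'[of t lborel M] this] show ?thesis using t by simp
      qed
      then have "AE \<omega> in M. ennreal (U t \<omega>) = 0"
        using zero[OF t] unfolding \<phi>_def by (subst (asm) nn_integral_0_iff_AE) auto
      then show ?thesis
        using U_D
      proof eventually_elim
        case (elim \<omega>)
        then have "(\<Sum>i\<in>UNIV. \<Sum>j\<in>UNIV. (D i j (min t (\<tau> \<omega>)) \<omega>)\<^sup>2) = 0"
          using U0[of t \<omega>] t by (auto simp: ennreal_eq_0_iff)
        then show ?case by (simp add: sum_nonneg_eq_0_iff sum_nonneg)
      qed
    qed
    have "countable (\<rat> \<inter> {0..T})" using countable_rat by auto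
    then have "AE \<omega> in M. \<forall>t\<in>\<rat> \<inter> {0..T}. \<forall>i j. D i j (min t (\<tau> \<omega>)) \<omega> = 0"
      using D_t by (subst AE_ball_countable) auto
    then have "AE \<omega> in M. \<forall>t\<in>{0..T}. \<forall>i j. D i j (min t (\<tau> \<omega>)) \<omega> = 0"
      using X_cont Y_cont
    proof eventually_elim
      case (elim \<omega>)
      have "continuous_on {0..T} (\<lambda>t. D i j t \<omega>)" for i j
        unfolding D_def using elim(2,3) by (intro continuous_intros)
      then have c: "continuous_on {0..T} (\<lambda>t. D i j (min t (\<tau> \<omega>)) \<omega>)" for i j
      proof (rule continuous_on_compose2)
        show "continuous_on {0..T} (\<lambda>t. min t (\<tau> \<omega>))" by (intro continuous_intros)
        show "(\<lambda>t. min t (\<tau> \<omega>)) ` {0..T} \<subseteq> {0..T}" using \<tau>[of \<omega>] by auto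
      qed
      show ?case
      proof (intro ballI allI)
        fix t i j assume t: "t \<in> {0..T}"
        show "D i j (min t (\<tau> \<omega>)) \<omega> = 0"
          by (rule eq_on_interval_if_eq_on_rationals[OF c continuous_on_const T _ t]) (use elim(1) in auto)
      qed
    qed
    then show ?thesis by (simp add: \<tau>_def c_def)
  qed
  then have "AE \<omega> in M. \<forall>n :: nat. \<forall>t\<in>{0..T}. \<forall>i j. D i j (min t (hitting_time T P (real n) \<omega>)) \<omega> = 0"
    unfolding AE_all_countable by blast
  then show ?thesis
    using P_cont
  proof eventually_elim
    case (elim \<omega>)
    have "bounded ((\<lambda>t. P t \<omega>) ` {0..T})"
      using elim(2) by (intro compact_imp_bounded compact_continuous_image) auto
    then obtain C where C: "\<forall>t\<in>{0..T}. \<bar>P t \<omega>\<bar> \<le> C" by (auto simp: bounded_iff)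
    obtain n :: nat where n: "C \<le> real n" using real_arch_simple by blast
    \<comment> \<open>For n above the maximum of P on this path, stopping has no effect on
      [0, T].\<close>
    have \<tau>T: "hitting_time T P (real n) \<omega> = T"
    proof (rule hitting_time_eq_T[OF T P_ad])
      fix r assume "r \<in> {0..T}"
      then have "\<bar>P r \<omega>\<bar> \<le> C" using C by blast
      then show "P r \<omega> \<le> real n" using n by linarith
    qed
    show ?case
    proof
      fix t assume t: "t \<in> {0..T}"
      then have "D i j (min t T) \<omega> = 0" for i j using elim(1) \<tau>T by metis
      then show "X t \<omega> = Y t \<omega>" using t by (simp add: D_def vec_eq_iff min_absorb1)
    qed
  qed
qed

end

section \<open>Solutions along lines\<close>

lemma C03_imp:
  assumes "C03 T \<phi>"
  shows "continuous_on ({0..T} \<times> UNIV) (\<lambda>(t, y). \<phi> t y)"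
    "continuous_on ({0..T} \<times> UNIV) (\<lambda>(t, y). vector_derivative (\<phi> t) (at y))"
    "t \<in> {0..T} \<Longrightarrow> (\<phi> t has_vector_derivative vector_derivative (\<phi> t) (at y)) (at y)"
proof -
  obtain D where D: "\<And>t x. t \<in> {0..T} \<Longrightarrow> D 0 t x = \<phi> t x"
    "\<And>k t x. k < 3 \<Longrightarrow> t \<in> {0..T} \<Longrightarrow> (D k t has_vector_derivative D (Suc k) t x) (at x)"
    "\<And>k. k \<le> 3 \<Longrightarrow> continuous_on ({0..T} \<times> UNIV) (\<lambda>(t, x). D k t x)"
    using assms unfolding C03_def by blast
  have D0: "D 0 t = \<phi> t" if "t \<in> {0..T}" for t using D(1)[OF that] by (simp add: fun_eq_iff)
  have der: "(\<phi> t has_vector_derivative D 1 t y) (at y)" if "t \<in> {0..T}" for t y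
    using D(2)[of 0 t y] D0[OF that] that by simp
  have vd: "vector_derivative (\<phi> t) (at y) = D 1 t y" if "t \<in> {0..T}" for t y
    by (rule vector_derivative_at[OF der[OF that]])
  have "continuous_on ({0..T} \<times> UNIV) (\<lambda>(t, x). \<phi> t x) \<longleftrightarrow> continuous_on ({0..T} \<times> UNIV) (\<lambda>(t, x). D 0 t x)"
    by (rule continuous_on_cong) (auto simp: D(1))
  then show "continuous_on ({0..T} \<times> UNIV) (\<lambda>(t, y). \<phi> t y)" using D(3)[of 0] by simp
  have "continuous_on ({0..T} \<times> UNIV) (\<lambda>(t, x). vector_derivative (\<phi> t) (at x)) \<longleftrightarrow> continuous_on ({0..T} \<times> UNIV) (\<lambda>(t, x). D 1 t x)"
    by (rule continuous_on_cong) (auto simp: vd)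
  then show "continuous_on ({0..T} \<times> UNIV) (\<lambda>(t, y). vector_derivative (\<phi> t) (at y))" using D(3)[of 1] by simp
  show "(\<phi> t has_vector_derivative vector_derivative (\<phi> t) (at y)) (at y)" if "t \<in> {0..T}"
    using der[OF that, of y] vd[OF that, of y] by simp
qed

section \<open>Riemann sums along a line\<close>

lemma integral_uniform_grid:
  fixes f :: "real \<Rightarrow> 'b :: euclidean_space"
  assumes t: "0 \<le> t" and f: "continuous_on {0..t} f"
  shows "(\<Sum>k<Suc n. integral {t * real k / real (Suc n)..t * real (Suc k) / real (Suc n)} f) = integral {0..t} f"
proof -
  have "(\<Sum>k<m. integral {t * real k / real (Suc n)..t * real (Suc k) / real (Suc n)} f) = integral {0..t * real m / real (Suc n)} f"
    if "m \<le> Suc n" for m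
    using that
  proof (induction m)
    case (Suc m)
    have le: "0 \<le> t * real m / real (Suc n)" "t * real m / real (Suc n) \<le> t * real (Suc m) / real (Suc n)"
      using t by (simp_all add: divide_right_mono mult_left_mono)
    have "t * real (Suc m) / real (Suc n) \<le> t"
    proof (cases "t = 0")
      case False
      then show ?thesis using grid_point_mem[of t "Suc m" n] Suc.prems t by simp
    qed simp
    then have "f integrable_on {0..t * real (Suc m) / real (Suc n)}"
      using f by (intro integrable_continuous_interval) (auto intro: continuous_on_subset)
    from Henstock_Kurzweil_Integration.integral_combine[OF le this] Suc show ?case by simp
  qed simp
  from this[of "Suc n"] show ?thesis by simp
qed

lemma sum_integral_tendsto_diagonal:
  fixes Q :: "real \<Rightarrow> real \<Rightarrow> 'b :: euclidean_space"
  assumes t: "0 < t" and Q: "continuous_on ({0..t} \<times> {0..t}) (\<lambda>(s, r). Q s r)"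
    and r: "\<And>n k. k < Suc n \<Longrightarrow> r n k \<in> {t * real k / real (Suc n)..t * real (Suc k) / real (Suc n)}"
  shows "(\<lambda>n. \<Sum>k<Suc n. integral {t * real k / real (Suc n)..t * real (Suc k) / real (Suc n)} (\<lambda>s. Q s (r n k)))
    \<longlonglongrightarrow> integral {0..t} (\<lambda>s. Q s s)"
proof (rule LIMSEQ_I)
  fix e :: real assume e: "0 < e"
  let ?e = "e / (2 * t)"
  have "uniformly_continuous_on ({0..t} \<times> {0..t}) (\<lambda>(s, r). Q s r)"
    by (rule compact_uniformly_continuous[OF Q]) (intro compact_Times compact_Icc)
  moreover have "0 < ?e" using e t by simp
  ultimately obtain d where d: "0 < d" "\<And>p q. p \<in> {0..t} \<times> {0..t} \<Longrightarrow> q \<in> {0..t} \<times> {0..t} \<Longrightarrow> dist q p < d \<Longrightarrow>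
      dist (case q of (s, r) \<Rightarrow> Q s r) (case p of (s, r) \<Rightarrow> Q s r) < ?e"
    unfolding uniformly_continuous_on_def by metis
  have "(\<lambda>n. t / real (Suc n)) \<longlonglongrightarrow> 0" by (rule LIMSEQ_Suc[OF lim_const_over_n])
  then have "eventually (\<lambda>n. t / real (Suc n) < d) sequentially" using d(1) by (rule order_tendstoD(2))
  then obtain n0 where n0: "\<And>n. n \<ge> n0 \<Longrightarrow> t / real (Suc n) < d" by (auto simp: eventually_sequentially)
  have diag: "continuous_on {0..t} (\<lambda>s. Q s s)"
  proof -
    have "continuous_on {0..t} (\<lambda>s. case (s, s) of (s, r) \<Rightarrow> Q s r)"
      by (rule continuous_on_compose2[OF Q]) (auto intro!: continuous_intros)
    then show ?thesis by simp
  qed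
  have row: "continuous_on {0..t} (\<lambda>s. Q s r)" if "r \<in> {0..t}" for r
  proof -
    have "continuous_on {0..t} (\<lambda>s. case (s, r) of (s, r) \<Rightarrow> Q s r)"
      by (rule continuous_on_compose2[OF Q]) (use that in \<open>auto intro!: continuous_intros\<close>)
    then show ?thesis by simp
  qed
  show "\<exists>n0. \<forall>n\<ge>n0. norm ((\<Sum>k<Suc n. integral {t * real k / real (Suc n)..t * real (Suc k) / real (Suc n)} (\<lambda>s. Q s (r n k)))
      - integral {0..t} (\<lambda>s. Q s s)) < e"
  proof (intro exI allI impI)
    fix n assume n: "n0 \<le> n"
    let ?I = "\<lambda>k. {t * real k / real (Suc n)..t * real (Suc k) / real (Suc n)}"
    have sub: "?I k \<subseteq> {0..t}" if "k < Suc n" for k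
      using grid_point_mem[OF t, of k n] grid_point_mem[OF t, of "Suc k" n] that by auto
    have len: "t * real (Suc k) / real (Suc n) - t * real k / real (Suc n) = t / real (Suc n)" for k
      by (simp add: diff_divide_distrib[symmetric] right_diff_distrib[symmetric])
    have le: "t * real k / real (Suc n) \<le> t * real (Suc k) / real (Suc n)" for k
      using len[of k] t by (smt (verit) divide_nonneg_nonneg of_nat_0_le_iff)
    have piece: "norm (integral (?I k) (\<lambda>s. Q s (r n k)) - integral (?I k) (\<lambda>s. Q s s)) \<le> ?e * (t / real (Suc n))"
      if k: "k < Suc n" for k
    proof -
      have c1: "continuous_on (?I k) (\<lambda>s. Q s (r n k))"
        by (rule continuous_on_subset[OF row sub[OF k]]) (use r[OF k] sub[OF k] in blast)
      have c2: "continuous_on (?I k) (\<lambda>s. Q s s)"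
        by (rule continuous_on_subset[OF diag sub[OF k]])
      have "integral (?I k) (\<lambda>s. Q s (r n k)) - integral (?I k) (\<lambda>s. Q s s) = integral (?I k) (\<lambda>s. Q s (r n k) - Q s s)"
        using integrable_continuous_interval[OF c1] integrable_continuous_interval[OF c2]
        by (rule Henstock_Kurzweil_Integration.integral_diff[symmetric])
      also have "norm \<dots> \<le> ?e * (t * real (Suc k) / real (Suc n) - t * real k / real (Suc n))"
      proof (rule integral_bound[OF le])
        show "continuous_on (?I k) (\<lambda>s. Q s (r n k) - Q s s)" by (intro continuous_on_diff c1 c2)
        fix s assume s: "s \<in> ?I k"
        have "dist (s, r n k) (s, s) = \<bar>r n k - s\<bar>" by (simp add: dist_Pair_Pair dist_real_def)
        also have "\<dots> \<le> t / real (Suc n)" using s r[OF k] len[of k] by (auto simp: abs_le_iff)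
        also have "\<dots> < d" by (rule n0[OF n])
        finally have "dist (Q s (r n k)) (Q s s) < ?e"
          using d(2)[of "(s, s)" "(s, r n k)"] s r[OF k] sub[OF k] by (simp add: subset_iff)
        then show "norm (Q s (r n k) - Q s s) \<le> ?e" by (simp add: dist_norm)
      qed
      finally show ?thesis unfolding len .
    qed
    have eq: "(\<Sum>k<Suc n. integral (?I k) (\<lambda>s. Q s (r n k))) - integral {0..t} (\<lambda>s. Q s s) =
        (\<Sum>k<Suc n. integral (?I k) (\<lambda>s. Q s (r n k)) - integral (?I k) (\<lambda>s. Q s s))"
      using integral_uniform_grid[OF less_imp_le[OF t] diag, of n] by (simp only: sum_subtractf)
    have "norm (\<Sum>k<Suc n. integral (?I k) (\<lambda>s. Q s (r n k)) - integral (?I k) (\<lambda>s. Q s s))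
        \<le> (\<Sum>k<Suc n. ?e * (t / real (Suc n)))"
      by (rule sum_norm_le) (use piece in blast)
    moreover have "(\<Sum>k<Suc n. ?e * (t / real (Suc n))) < e"
    proof -
      have "(\<Sum>k<Suc n. ?e * (t / real (Suc n))) = real (Suc n) * (?e * (t / real (Suc n)))"
        by (simp only: sum_constant card_lessThan)
      also have "\<dots> = e / 2" using t by (simp del: of_nat_Suc)
      finally show ?thesis using e by simp
    qed
    ultimately show "norm ((\<Sum>k<Suc n. integral (?I k) (\<lambda>s. Q s (r n k))) - integral {0..t} (\<lambda>s. Q s s)) < e"
      unfolding eq by (rule le_less_trans)
  qed
qed

lemma (in prob_space) prob_tendsto_zero_sum:
  fixes X :: "'l \<Rightarrow> nat \<Rightarrow> 'a \<Rightarrow> real"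
  assumes "finite L" and meas: "\<And>l n. l \<in> L \<Longrightarrow> X l n \<in> borel_measurable M"
    and lim: "\<And>l c. l \<in> L \<Longrightarrow> 0 < c \<Longrightarrow> (\<lambda>n. prob {\<omega> \<in> space M. c < \<bar>X l n \<omega>\<bar>}) \<longlonglongrightarrow> 0"
    and c: "0 < c"
  shows "(\<lambda>n. prob {\<omega> \<in> space M. c < \<bar>\<Sum>l\<in>L. X l n \<omega>\<bar>}) \<longlonglongrightarrow> 0"
  using assms(1) meas lim c
proof (induction L arbitrary: c rule: finite_induct)
  case (insert l L)
  have [measurable]: "X l n \<in> borel_measurable M" "(\<lambda>\<omega>. \<Sum>l\<in>L. X l n \<omega>) \<in> borel_measurable M" for n
    using insert.prems(1) by auto
  have le: "prob {\<omega> \<in> space M. c < \<bar>\<Sum>l\<in>insert l L. X l n \<omega>\<bar>} \<le>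
      prob {\<omega> \<in> space M. c / 2 < \<bar>X l n \<omega>\<bar>} + prob {\<omega> \<in> space M. c / 2 < \<bar>\<Sum>l\<in>L. X l n \<omega>\<bar>}" for n
  proof -
    have "prob {\<omega> \<in> space M. c < \<bar>\<Sum>l\<in>insert l L. X l n \<omega>\<bar>} \<le>
      prob ({\<omega> \<in> space M. c / 2 < \<bar>X l n \<omega>\<bar>} \<union> {\<omega> \<in> space M. c / 2 < \<bar>\<Sum>l\<in>L. X l n \<omega>\<bar>})"
      using insert.hyps by (intro finite_measure_mono) (auto simp: abs_if split: if_splits)
    also have "\<dots> \<le> prob {\<omega> \<in> space M. c / 2 < \<bar>X l n \<omega>\<bar>} + prob {\<omega> \<in> space M. c / 2 < \<bar>\<Sum>l\<in>L. X l n \<omega>\<bar>}"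
      by (rule measure_Un_le) auto
    finally show ?thesis .
  qed
  have "(\<lambda>n. prob {\<omega> \<in> space M. c / 2 < \<bar>\<Sum>l\<in>L. X l n \<omega>\<bar>}) \<longlonglongrightarrow> 0"
    using insert.prems by (intro insert.IH) auto
  moreover have "(\<lambda>n. prob {\<omega> \<in> space M. c / 2 < \<bar>X l n \<omega>\<bar>}) \<longlonglongrightarrow> 0"
    using insert.prems by (intro insert.prems(2)) auto
  ultimately have "(\<lambda>n. prob {\<omega> \<in> space M. c / 2 < \<bar>X l n \<omega>\<bar>} + prob {\<omega> \<in> space M. c / 2 < \<bar>\<Sum>l\<in>L. X l n \<omega>\<bar>}) \<longlonglongrightarrow> 0 + 0"
    by (intro tendsto_add)
  then have lim: "(\<lambda>n. prob {\<omega> \<in> space M. c / 2 < \<bar>X l n \<omega>\<bar>} + prob {\<omega> \<in> space M. c / 2 < \<bar>\<Sum>l\<in>L. X l n \<omega>\<bar>}) \<longlonglongrightarrow> 0"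
    by simp
  show ?case
    by (rule tendsto_sandwich[OF _ _ tendsto_const lim]) (intro always_eventually allI le measure_nonneg)+
qed simp

lemma (in filtered_prob_space_usual) sq_int_tendsto_zero:
  assumes t: "0 \<le> t" and small: "\<And>e. 0 < e \<Longrightarrow> eventually (\<lambda>n. \<forall>s\<in>{0..t}. \<bar>K n s \<omega>\<bar> \<le> e) sequentially"
  shows "(\<lambda>n. sq_int t (K n) \<omega>) \<longlonglongrightarrow> 0"
proof (rule order_tendstoI)
  fix a :: ennreal assume a: "0 < a"
  obtain r where r: "0 < r" "ennreal r < a"
  proof (cases a rule: ennreal_cases)
    case (real x)
    then have "0 < x" using a by simp
    then have "ennreal (x / 2) < a" unfolding real(2) by (intro ennreal_lessI) auto
    with \<open>0 < x\<close> show thesis by (intro that[of "x / 2"]) auto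
  next
    case top
    then show thesis by (intro that[of 1]) (auto simp: less_top)
  qed
  \<comment> \<open>Chosen so that e^2 t \<le> r; the denominator t + 1 also covers t = 0.\<close>
  define e where "e = sqrt (r / (t + 1))"
  have e: "0 < e" using r t by (simp add: e_def)
  have "e\<^sup>2 * t = r * (t / (t + 1))" using r t by (simp add: e_def)
  also have "\<dots> \<le> r * 1" using r t by (intro mult_left_mono) auto
  finally have le: "ennreal (e\<^sup>2 * t) \<le> ennreal r" by (intro ennreal_leI) simp
  show "eventually (\<lambda>n. sq_int t (K n) \<omega> < a) sequentially"
    using small[OF e]
  proof eventually_elim
    case (elim n)
    then have "sq_int t (K n) \<omega> \<le> ennreal (e\<^sup>2 * t)" using t e by (intro sq_int_bounded) auto
    with le r(2) show ?case by (meson le_less_trans order_trans)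
  qed
qed simp

context ito_integrator
begin

text \<open>On each cell the integral belongs to the place frozen at the left end, so the whole sum
  is one integral at time t, of q along a staircase. For a continuous path the staircase values
  approach those along the line uniformly, and \<open>ito_at_tendsto_zero\<close> concludes.\<close>

lemma shifted_integrals_tendsto:
  assumes t: "0 < t" "t \<le> T"
    and I: "\<And>y. ito_process T (q y) (I y)" and J: "ito_process T (\<lambda>s. q (x + c * s) s) J"
    and cont: "AE \<omega> in M. continuous_on ({0..T} \<times> UNIV) (\<lambda>(s, y). q y s \<omega>)" and a: "0 < a"
  defines "g \<equiv> \<lambda>n k. t * real k / real (Suc n)"
  shows "(\<lambda>n. prob {\<omega> \<in> space M. a <
      \<bar>(\<Sum>k<Suc n. I (x + c * g n k) (g n (Suc k)) \<omega> - I (x + c * g n k) (g n k) \<omega>) - (J t \<omega> - J 0 \<omega>)\<bar>}) \<longlonglongrightarrow> 0"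
proof -
  obtain KJ where KJ0: "AE \<omega> in M. \<forall>s\<in>{0..T}. q (x + c * s) s \<omega> = KJ s \<omega>"
    "\<forall>a b t. 0 \<le> a \<longrightarrow> a \<le> b \<longrightarrow> b \<le> t \<longrightarrow> t \<le> T \<longrightarrow>
      ito_at t (\<lambda>s \<omega>. KJ s \<omega> * indicator {a<..b} s) (\<lambda>\<omega>. J b \<omega> - J a \<omega>)"
    using J unfolding ito_process_def by blast
  have KJ: "ito_at t (\<lambda>s \<omega>. KJ s \<omega> * indicator {0<..t} s) (\<lambda>\<omega>. J t \<omega> - J 0 \<omega>)"
    using KJ0(2)[rule_format, of 0 t t] t by simp
  have "\<forall>y. \<exists>K. (AE \<omega> in M. \<forall>s\<in>{0..T}. q y s \<omega> = K s \<omega>) \<and>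
      (\<forall>a b t. 0 \<le> a \<longrightarrow> a \<le> b \<longrightarrow> b \<le> t \<longrightarrow> t \<le> T \<longrightarrow>
        ito_at t (\<lambda>s \<omega>. K s \<omega> * indicator {a<..b} s) (\<lambda>\<omega>. I y b \<omega> - I y a \<omega>))"
    using I unfolding ito_process_def by blast
  from choice[OF this] obtain K where K0: "\<forall>y. (AE \<omega> in M. \<forall>s\<in>{0..T}. q y s \<omega> = K y s \<omega>) \<and>
      (\<forall>a b t. 0 \<le> a \<longrightarrow> a \<le> b \<longrightarrow> b \<le> t \<longrightarrow> t \<le> T \<longrightarrow>
        ito_at t (\<lambda>s \<omega>. K y s \<omega> * indicator {a<..b} s) (\<lambda>\<omega>. I y b \<omega> - I y a \<omega>))"
    by (elim exE)
  have K: "AE \<omega> in M. \<forall>s\<in>{0..T}. q y s \<omega> = K y s \<omega>"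
    "0 \<le> a \<Longrightarrow> a \<le> b \<Longrightarrow> b \<le> t \<Longrightarrow> ito_at t (\<lambda>s \<omega>. K y s \<omega> * indicator {a<..b} s) (\<lambda>\<omega>. I y b \<omega> - I y a \<omega>)" for y a b
    using K0[rule_format, of y] t(2) by simp_all
  have g: "g n k \<in> {0..t}" if "k \<le> Suc n" for n k
    unfolding g_def by (rule grid_point_mem[OF t(1) that])
  have g_less: "g n i < g n j" if "i < j" for n i j
    unfolding g_def using t(1) that by (simp add: divide_strict_right_mono)
  have g_step: "g n (Suc k) - g n k = t / real (Suc n)" for n k
    unfolding g_def by (simp add: diff_divide_distrib[symmetric] right_diff_distrib[symmetric])
  let ?H = "\<lambda>n s \<omega>. (\<Sum>k<Suc n. K (x + c * g n k) s \<omega> * indicator {g n k<..g n (Suc k)} s) - KJ s \<omega> * indicator {0<..t} s"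
  have at: "ito_at t (?H n) (\<lambda>\<omega>. (\<Sum>k<Suc n. I (x + c * g n k) (g n (Suc k)) \<omega> - I (x + c * g n k) (g n k) \<omega>) - (J t \<omega> - J 0 \<omega>))" for n
  proof (rule ito_at_diff[OF ito_at_sum KJ])
    fix k assume "k \<in> {..<Suc n}"
    then show "ito_at t (\<lambda>s \<omega>. K (x + c * g n k) s \<omega> * indicator {g n k<..g n (Suc k)} s)
        (\<lambda>\<omega>. I (x + c * g n k) (g n (Suc k)) \<omega> - I (x + c * g n k) (g n k) \<omega>)"
      using g[of k n] g[of "Suc k" n] g_less[of k "Suc k" n] by (intro K(2)) auto
  qed (use t in auto)
  \<comment> \<open>All grids together have countably many points, so their exceptional null sets
    can be united.\<close>
  have "AE \<omega> in M. \<forall>n k. \<forall>s\<in>{0..T}. q (x + c * g n k) s \<omega> = K (x + c * g n k) s \<omega>"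
    using K(1) by (simp add: AE_all_countable)
  then have "AE \<omega> in M. (\<lambda>n. sq_int t (?H n) \<omega>) \<longlonglongrightarrow> 0"
    using KJ0(1) cont
  proof eventually_elim
    case (elim \<omega>)
    show ?case
    proof (rule sq_int_tendsto_zero)
      fix e :: real assume e: "0 < e"
      \<comment> \<open>A compact rectangle that contains the line and all staircases; q is
        uniformly continuous on it for this \<omega>.\<close>
      let ?R = "{0..T} \<times> {x - \<bar>c\<bar> * T..x + \<bar>c\<bar> * T}"
      have "uniformly_continuous_on ?R (\<lambda>(s, y). q y s \<omega>)"
        by (rule compact_uniformly_continuous[OF continuous_on_subset[OF elim(3)]])
           (auto intro!: compact_Times compact_Icc)
      then obtain d where d: "0 < d" "\<And>p p'. p \<in> ?R \<Longrightarrow> p' \<in> ?R \<Longrightarrow> dist p' p < d \<Longrightarrow>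
          dist (case p' of (s, y) \<Rightarrow> q y s \<omega>) (case p of (s, y) \<Rightarrow> q y s \<omega>) < e"
        unfolding uniformly_continuous_on_def using e by metis
      have "(\<lambda>n. \<bar>c\<bar> * (t / real (Suc n))) \<longlonglongrightarrow> \<bar>c\<bar> * 0"
        by (intro tendsto_mult tendsto_const LIMSEQ_Suc[OF lim_const_over_n])
      then have "(\<lambda>n. \<bar>c\<bar> * (t / real (Suc n))) \<longlonglongrightarrow> 0" by simp
      then have "eventually (\<lambda>n. \<bar>c\<bar> * (t / real (Suc n)) < d) sequentially"
        using d(1) by (rule order_tendstoD(2))
      then show "eventually (\<lambda>n. \<forall>s\<in>{0..t}. \<bar>?H n s \<omega>\<bar> \<le> e) sequentially"
      proof eventually_elim
        case n: (elim n)
        show ?case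
        proof
          fix s assume s: "s \<in> {0..t}"
          show "\<bar>?H n s \<omega>\<bar> \<le> e"
          proof (cases "s = 0")
            case True
            then have "indicator {g n k<..g n (Suc k)} s = (0 :: real)" if "k < Suc n" for k
              using g[of k n] that by (auto simp: indicator_def)
            then have "(\<Sum>k<Suc n. K (x + c * g n k) s \<omega> * indicator {g n k<..g n (Suc k)} s) = 0"
              by (intro sum.neutral) auto
            then show ?thesis using True e by simp
          next
            case False
            then have s0: "0 < s" "s \<le> t" "s \<in> {0..T}" using s t by auto
            obtain k where k: "k < Suc n" "s \<in> {g n k<..g n (Suc k)}"
              using uniform_grid_interval[OF s0(1,2)] unfolding g_def by metis
            have "(\<Sum>k<Suc n. K (x + c * g n k) s \<omega> * indicator {g n k<..g n (Suc k)} s) = K (x + c * g n k) s \<omega>"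
              by (rule sum_indicator_grid[OF _ k]) (use g_less in auto)
            also have "\<dots> = q (x + c * g n k) s \<omega>" using elim(1) s0(3) by metis
            finally have eq: "?H n s \<omega> = q (x + c * g n k) s \<omega> - q (x + c * s) s \<omega>"
              using elim(2) s0 by simp
            have r: "g n k \<in> {0..T}" using g[of k n] k t by auto
            have in_R: "(s, x + c * r) \<in> ?R" if "r \<in> {0..T}" for r
            proof -
              have "\<bar>c * r\<bar> \<le> \<bar>c\<bar> * T" using that by (simp add: abs_mult mult_left_mono)
              then show ?thesis using s0(3) by (auto simp: abs_le_iff)
            qed
            have "dist (s, x + c * g n k) (s, x + c * s) = \<bar>c\<bar> * \<bar>g n k - s\<bar>"
              by (simp add: dist_Pair_Pair dist_real_def abs_mult[symmetric] right_diff_distrib)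
            also have "\<dots> \<le> \<bar>c\<bar> * (t / real (Suc n))"
              using k(2) g_step[of n k] by (intro mult_left_mono) (auto simp: abs_le_iff)
            also have "\<dots> < d" by (rule n)
            finally have "dist (q (x + c * g n k) s \<omega>) (q (x + c * s) s \<omega>) < e"
              using d(2)[OF in_R[OF s0(3)] in_R[OF r]] by simp
            then show ?thesis unfolding eq by (simp add: dist_real_def)
          qed
        qed
      qed
    qed (use t in simp)
  qed
  from ito_at_tendsto_zero[OF at _ this a] t show ?thesis by simp
qed

end

lemma set_integral_Icc_eq_integral:
  fixes f :: "real \<Rightarrow> 'b :: euclidean_space"
  assumes "continuous_on {0..T} f" "r \<le> T"
  shows "(LINT s:{0..r}|lborel. f s) = integral {0..r} f" "set_integrable lborel {0..r} f"
proof -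
  have "set_integrable lborel {0..r} f"
    using assms by (intro borel_integrable_atLeastAtMost') (auto intro: continuous_on_subset)
  then show "(LINT s:{0..r}|lborel. f s) = integral {0..r} f" "set_integrable lborel {0..r} f"
    by (auto intro: set_borel_integral_eq_integral(2))
qed

lemma shifted_increments_tendsto:
  fixes \<phi> d\<phi> b :: "real \<Rightarrow> real \<Rightarrow> 'b :: euclidean_space"
  assumes t: "0 < t" "t \<le> T"
    and der: "\<And>s y. s \<in> {0..T} \<Longrightarrow> (\<phi> s has_vector_derivative d\<phi> s y) (at y)"
    and d_cont: "continuous_on ({0..T} \<times> UNIV) (\<lambda>(s, y). d\<phi> s y)"
    and b_cont: "continuous_on ({0..T} \<times> UNIV) (\<lambda>(s, y). b y s)"
  defines "g \<equiv> \<lambda>n k. t * real k / real (Suc n)"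
  shows "(\<lambda>n. \<Sum>k<Suc n. \<phi> (g n (Suc k)) (x + c * g n k) - \<phi> (g n k) (x + c * g n k)
      - integral {g n k..g n (Suc k)} (b (x + c * g n k)))
    \<longlonglongrightarrow> \<phi> t (x + c * t) - \<phi> 0 x - integral {0..t} (\<lambda>s. b (x + c * s) s + c *\<^sub>R d\<phi> s (x + c * s))"
proof -
  have g: "g n k \<in> {0..t}" if "k \<le> Suc n" for n k
    unfolding g_def by (rule grid_point_mem[OF t(1) that])
  have g_le: "g n k \<le> g n (Suc k)" for n k
    unfolding g_def using t(1) by (simp add: divide_right_mono mult_left_mono)
  have c1: "continuous_on ({0..t} \<times> {0..t}) (\<lambda>(s, r). b (x + c * r) s)"
  proof -
    have "continuous_on ({0..t} \<times> {0..t}) (\<lambda>p. case (fst p, x + c * snd p) of (s, y) \<Rightarrow> b y s)"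
      by (rule continuous_on_compose2[OF b_cont]) (use t in \<open>auto intro!: continuous_intros\<close>)
    then show ?thesis by (simp add: case_prod_beta')
  qed
  have c2: "continuous_on ({0..t} \<times> {0..t}) (\<lambda>(s, r). c *\<^sub>R d\<phi> r (x + c * s))"
  proof -
    have "continuous_on ({0..t} \<times> {0..t}) (\<lambda>p. case (snd p, x + c * fst p) of (s, y) \<Rightarrow> d\<phi> s y)"
      by (rule continuous_on_compose2[OF d_cont]) (use t in \<open>auto intro!: continuous_intros\<close>)
    then have "continuous_on ({0..t} \<times> {0..t}) (\<lambda>p. c *\<^sub>R (case (snd p, x + c * fst p) of (s, y) \<Rightarrow> d\<phi> s y))"
      by (intro continuous_on_scaleR continuous_on_const)
    then show ?thesis by (simp add: case_prod_beta')
  qed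
  have l1: "(\<lambda>n. \<Sum>k<Suc n. integral {g n k..g n (Suc k)} (\<lambda>s. b (x + c * g n k) s)) \<longlonglongrightarrow> integral {0..t} (\<lambda>s. b (x + c * s) s)"
    using sum_integral_tendsto_diagonal[OF t(1) c1, of g] g_le unfolding g_def by simp
  have l2: "(\<lambda>n. \<Sum>k<Suc n. integral {g n k..g n (Suc k)} (\<lambda>s. c *\<^sub>R d\<phi> (g n (Suc k)) (x + c * s))) \<longlonglongrightarrow> integral {0..t} (\<lambda>s. c *\<^sub>R d\<phi> s (x + c * s))"
    using sum_integral_tendsto_diagonal[OF t(1) c2, of "\<lambda>n k. g n (Suc k)"] g_le unfolding g_def by simp
  have d1: "continuous_on {0..t} (\<lambda>s. b (x + c * s) s)"
  proof -
    have "continuous_on {0..t} (\<lambda>s. case (s, s) of (s, r) \<Rightarrow> b (x + c * r) s)"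
      by (rule continuous_on_compose2[OF c1]) (auto intro!: continuous_intros)
    then show ?thesis by simp
  qed
  have d2: "continuous_on {0..t} (\<lambda>s. c *\<^sub>R d\<phi> s (x + c * s))"
  proof -
    have "continuous_on {0..t} (\<lambda>s. case (s, s) of (s, r) \<Rightarrow> c *\<^sub>R d\<phi> r (x + c * s))"
      by (rule continuous_on_compose2[OF c2]) (auto intro!: continuous_intros)
    then show ?thesis by simp
  qed
  have piece: "\<phi> (g n (Suc k)) (x + c * g n k) = \<phi> (g n (Suc k)) (x + c * g n (Suc k)) - integral {g n k..g n (Suc k)} (\<lambda>s. c *\<^sub>R d\<phi> (g n (Suc k)) (x + c * s))"
    if "k < Suc n" for n k
  proof -
    have r: "g n (Suc k) \<in> {0..T}" using g[of "Suc k" n] that t by auto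
    have "((\<lambda>s. c *\<^sub>R d\<phi> (g n (Suc k)) (x + c * s)) has_integral
        \<phi> (g n (Suc k)) (x + c * g n (Suc k)) - \<phi> (g n (Suc k)) (x + c * g n k)) {g n k..g n (Suc k)}"
    proof (rule fundamental_theorem_of_calculus[OF g_le])
      fix s
      have "((\<lambda>s. x + c * s) has_vector_derivative c) (at s within {g n k..g n (Suc k)})"
        by (auto intro!: derivative_eq_intros simp: has_real_derivative_iff_has_vector_derivative[symmetric])
      from vector_diff_chain_within[OF this has_vector_derivative_at_within[OF der[OF r, of "x + c * s"]]]
      show "((\<lambda>s. \<phi> (g n (Suc k)) (x + c * s)) has_vector_derivative c *\<^sub>R d\<phi> (g n (Suc k)) (x + c * s)) (at s within {g n k..g n (Suc k)})"
        by (simp add: o_def)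
    qed
    then show ?thesis by (simp only: integral_unique) simp
  qed
  have eq: "(\<Sum>k<Suc n. \<phi> (g n (Suc k)) (x + c * g n k) - \<phi> (g n k) (x + c * g n k) - integral {g n k..g n (Suc k)} (b (x + c * g n k)))
    = (\<phi> t (x + c * t) - \<phi> 0 x) - (\<Sum>k<Suc n. integral {g n k..g n (Suc k)} (\<lambda>s. c *\<^sub>R d\<phi> (g n (Suc k)) (x + c * s)))
      - (\<Sum>k<Suc n. integral {g n k..g n (Suc k)} (\<lambda>s. b (x + c * g n k) s))" for n
  proof -
    have "(\<Sum>k<Suc n. \<phi> (g n (Suc k)) (x + c * g n k) - \<phi> (g n k) (x + c * g n k) - integral {g n k..g n (Suc k)} (b (x + c * g n k)))
      = (\<Sum>k<Suc n. (\<phi> (g n (Suc k)) (x + c * g n (Suc k)) - \<phi> (g n k) (x + c * g n k))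
        - integral {g n k..g n (Suc k)} (\<lambda>s. c *\<^sub>R d\<phi> (g n (Suc k)) (x + c * s))
        - integral {g n k..g n (Suc k)} (\<lambda>s. b (x + c * g n k) s))"
    proof (rule sum.cong[OF refl])
      fix k assume "k \<in> {..<Suc n}"
      then have "k < Suc n" by simp
      from piece[OF this] show "\<phi> (g n (Suc k)) (x + c * g n k) - \<phi> (g n k) (x + c * g n k) - integral {g n k..g n (Suc k)} (b (x + c * g n k))
        = (\<phi> (g n (Suc k)) (x + c * g n (Suc k)) - \<phi> (g n k) (x + c * g n k))
        - integral {g n k..g n (Suc k)} (\<lambda>s. c *\<^sub>R d\<phi> (g n (Suc k)) (x + c * s))
        - integral {g n k..g n (Suc k)} (\<lambda>s. b (x + c * g n k) s)"
        by simp
    qed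
    also have "\<dots> = (\<Sum>k<Suc n. \<phi> (g n (Suc k)) (x + c * g n (Suc k)) - \<phi> (g n k) (x + c * g n k))
        - (\<Sum>k<Suc n. integral {g n k..g n (Suc k)} (\<lambda>s. c *\<^sub>R d\<phi> (g n (Suc k)) (x + c * s)))
        - (\<Sum>k<Suc n. integral {g n k..g n (Suc k)} (\<lambda>s. b (x + c * g n k) s))"
      by (simp only: sum_subtractf)
    also have "(\<Sum>k<Suc n. \<phi> (g n (Suc k)) (x + c * g n (Suc k)) - \<phi> (g n k) (x + c * g n k))
        = \<phi> (g n (Suc n)) (x + c * g n (Suc n)) - \<phi> (g n 0) (x + c * g n 0)"
      by (rule sum_lessThan_telescope)
    also have "\<dots> = \<phi> t (x + c * t) - \<phi> 0 x"
      by (simp add: g_def del: of_nat_Suc)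
    finally show ?thesis .
  qed
  have "(\<lambda>n. (\<phi> t (x + c * t) - \<phi> 0 x) - (\<Sum>k<Suc n. integral {g n k..g n (Suc k)} (\<lambda>s. c *\<^sub>R d\<phi> (g n (Suc k)) (x + c * s)))
      - (\<Sum>k<Suc n. integral {g n k..g n (Suc k)} (\<lambda>s. b (x + c * g n k) s)))
    \<longlonglongrightarrow> (\<phi> t (x + c * t) - \<phi> 0 x) - integral {0..t} (\<lambda>s. c *\<^sub>R d\<phi> s (x + c * s)) - integral {0..t} (\<lambda>s. b (x + c * s) s)"
    by (intro tendsto_diff tendsto_const l1 l2)
  moreover have "integral {0..t} (\<lambda>s. b (x + c * s) s + c *\<^sub>R d\<phi> s (x + c * s))
      = integral {0..t} (\<lambda>s. b (x + c * s) s) + integral {0..t} (\<lambda>s. c *\<^sub>R d\<phi> s (x + c * s))"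
    by (rule Henstock_Kurzweil_Integration.integral_add) (intro integrable_continuous_interval d1 d2)+
  ultimately show ?thesis unfolding eq by (simp add: algebra_simps)
qed

section \<open>The equation along a line\<close>

context filtered_prob_space_usual
begin

text \<open>The sums \<open>Z\<close> tend in probability to the integrals along the line by
  \<open>shifted_integrals_tendsto\<close>. Added over l, they are entries of the sums in
  \<open>shifted_increments_tendsto\<close>, by the equations at the grid points, and so converge
  almost surely. Equality of the limits is the claim at one time t.\<close>

lemma shifted_solution:
  fixes W :: "real \<Rightarrow> 'a \<Rightarrow> real ^ 'p ^ 'p" and \<phi> b :: "real \<Rightarrow> real \<Rightarrow> 'a \<Rightarrow> real ^ 'p ^ 'p"
    and h :: "real \<Rightarrow> real \<Rightarrow> real"
  assumes W: "brownian_matrix M F W" and T: "0 < T"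
    and C: "C03_field M T \<phi>" and SPD: "SPD_valued M T \<phi>"
    and sol: "\<And>y. solves_ito_equation M F T W (b y) (h y) (\<lambda>t \<omega>. \<phi> t y \<omega>)"
    and b_cont: "AE \<omega> in M. continuous_on ({0..T} \<times> UNIV) (\<lambda>(s, y). b y s \<omega>)"
    and h_cont: "continuous_on ({0..T} \<times> UNIV) (\<lambda>(s, y). h y s)"
  shows "solves_ito_equation M F T W
    (\<lambda>s \<omega>. b (x + c * s) s \<omega> + c *\<^sub>R vector_derivative (\<lambda>y. \<phi> s y \<omega>) (at (x + c * s)))
    (\<lambda>s. h (x + c * s) s) (\<lambda>t \<omega>. \<phi> t (x + c * t) \<omega>)"
proof -
  note integrator = noise_entry_ito_integrator[OF W]
  define X where "X = (\<lambda>t \<omega>. \<phi> t (x + c * t) \<omega>)"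
  define hx where "hx = (\<lambda>s. h (x + c * s) s)"
  define d\<phi> where "d\<phi> t y \<omega> = vector_derivative (\<lambda>y. \<phi> t y \<omega>) (at y)" for t y \<omega>
  define Bx where "Bx = (\<lambda>s \<omega>. b (x + c * s) s \<omega> + c *\<^sub>R d\<phi> s (x + c * s) \<omega>)"
  define q where "q i j l y = coefficient_entry (h y) (\<lambda>t \<omega>. \<phi> t y \<omega>) i j l" for i j l y
  have \<phi>_ad: "adapted_on F T (\<lambda>t \<omega>. \<phi> t y \<omega>)" for y
    using sol[of y] by (simp add: solves_ito_equation_def)
  have X_ad: "adapted_on F T X"
    unfolding adapted_on_def X_def using \<phi>_ad by (auto simp: adapted_on_def)
  have paths: "AE \<omega> in M. continuous_on ({0..T} \<times> UNIV) (\<lambda>(t, y). \<phi> t y \<omega>) \<and>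
      continuous_on ({0..T} \<times> UNIV) (\<lambda>(t, y). d\<phi> t y \<omega>) \<and>
      (\<forall>t\<in>{0..T}. \<forall>y. ((\<lambda>y. \<phi> t y \<omega>) has_vector_derivative d\<phi> t y \<omega>) (at y))"
    using C unfolding C03_field_def d\<phi>_def by eventually_elim (intro conjI ballI allI C03_imp)
  have X_cont: "AE \<omega> in M. continuous_on {0..T} (\<lambda>t. X t \<omega>)"
    using paths
  proof eventually_elim
    case (elim \<omega>)
    have "continuous_on {0..T} (\<lambda>t. case (t, x + c * t) of (t, y) \<Rightarrow> \<phi> t y \<omega>)"
      by (rule continuous_on_compose2[OF elim[THEN conjunct1]]) (auto intro!: continuous_intros)
    then show ?case by (simp add: X_def)
  qed
  have X_SPD: "AE \<omega> in M. \<forall>t\<in>{0..T}. X t \<omega> \<in> SPD"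
    using SPD unfolding SPD_valued_def X_def by eventually_elim blast
  have hx_cont: "continuous_on {0..T} hx"
  proof -
    have "continuous_on {0..T} (\<lambda>s. case (s, x + c * s) of (s, y) \<Rightarrow> h y s)"
      by (rule continuous_on_compose2[OF h_cont]) (auto intro!: continuous_intros)
    then show ?thesis by (simp add: hx_def)
  qed
  have q_shift: "coefficient_entry hx X i j l = (\<lambda>s. q i j l (x + c * s) s)" for i j l
    by (simp add: q_def coefficient_entry_def[abs_def] hx_def X_def fun_eq_iff)
  have q_cont: "AE \<omega> in M. \<forall>i j l. continuous_on ({0..T} \<times> UNIV) (\<lambda>(s, y). q i j l y s \<omega>)"
    using paths SPD[unfolded SPD_valued_def]
  proof eventually_elim
    case (elim \<omega>)
    have "continuous_on ({0..T} \<times> UNIV) (\<lambda>p. msqrt ((case p of (t, y) \<Rightarrow> \<phi> t y \<omega>)))"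
      by (rule continuous_on_compose2[OF continuous_on_msqrt elim(1)[THEN conjunct1]]) (use elim(2) in auto)
    then have m: "continuous_on ({0..T} \<times> UNIV) (\<lambda>p. msqrt (\<phi> (fst p) (snd p) \<omega>) $ i $ j)" for i j
      by (intro continuous_intros) (simp add: case_prod_beta')
    have hc: "continuous_on ({0..T} \<times> UNIV) (\<lambda>p. h (snd p) (fst p))"
      using h_cont by (simp add: case_prod_beta')
    have "continuous_on ({0..T} \<times> UNIV) (\<lambda>p. q i j l (snd p) (fst p) \<omega>)" for i j l
      unfolding q_def coefficient_entry_def by (cases "fst l") (auto intro!: continuous_on_mult hc m)
    then show ?case by (simp add: case_prod_beta')
  qed
  have "\<exists>I. is_ito_integral M F T (noise_entry W i j l) (coefficient_entry hx X i j l) I" for i j l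
  proof -
    interpret ito_integrator M F "noise_entry W i j l" by (rule integrator)
    have "AE \<omega> in M. continuous_on {0..T} (\<lambda>t. coefficient_entry hx X i j l t \<omega>)"
      using X_cont X_SPD by eventually_elim (rule coefficient_entry_continuous[OF _ hx_cont])
    then have "left_regular T (coefficient_entry hx X i j l)"
      by (rule left_regular_if_continuous[OF coefficient_entry_adapted[OF X_ad]])
    show ?thesis by (rule ito_integral_exists[OF T \<open>left_regular T _\<close>]) (rule exI)
  qed
  \<comment> \<open>The three indices are packed into one, because \<open>choice\<close> serves a
    single quantifier.\<close>
  then have "\<forall>l. \<exists>I. is_ito_integral M F T (noise_entry W (fst l) (fst (snd l)) (snd (snd l)))
      (coefficient_entry hx X (fst l) (fst (snd l)) (snd (snd l))) I" by blast
  from choice[OF this] obtain I' where I': "\<forall>l. is_ito_integral M F T (noise_entry W (fst l) (fst (snd l)) (snd (snd l)))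
      (coefficient_entry hx X (fst l) (fst (snd l)) (snd (snd l))) (I' l)" by (elim exE)
  define I where "I i j l = I' (i, j, l)" for i j l
  have I: "is_ito_integral M F T (noise_entry W i j l) (coefficient_entry hx X i j l) (I i j l)" for i j l
    using I'[rule_format, of "(i, j, l)"] by (simp add: I_def)
  have "\<forall>y. \<exists>J. (\<forall>i j l. is_ito_integral M F T (noise_entry W i j l) (q i j l y) (J i j l)) \<and>
      (AE \<omega> in M. \<forall>t\<in>{0..T}. \<forall>i j. \<phi> t y \<omega> $ i $ j =
         \<phi> 0 y \<omega> $ i $ j + (LINT s:{0..t}|lborel. b y s \<omega>) $ i $ j + (\<Sum>l\<in>UNIV. J i j l t \<omega>))"
    using sol unfolding solves_ito_equation_iff q_def by blast
  from choice[OF this] obtain J where J0: "\<forall>y. (\<forall>i j l. is_ito_integral M F T (noise_entry W i j l) (q i j l y) (J y i j l)) \<and>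
      (AE \<omega> in M. \<forall>t\<in>{0..T}. \<forall>i j. \<phi> t y \<omega> $ i $ j =
         \<phi> 0 y \<omega> $ i $ j + (LINT s:{0..t}|lborel. b y s \<omega>) $ i $ j + (\<Sum>l\<in>UNIV. J y i j l t \<omega>))"
    by (elim exE)
  have J: "is_ito_integral M F T (noise_entry W i j l) (q i j l y) (J y i j l)" for i j l y
    using J0 by blast
  have J_eq: "AE \<omega> in M. \<forall>t\<in>{0..T}. \<forall>i j. \<phi> t y \<omega> $ i $ j =
         \<phi> 0 y \<omega> $ i $ j + (LINT s:{0..t}|lborel. b y s \<omega>) $ i $ j + (\<Sum>l\<in>UNIV. J y i j l t \<omega>)" for y
    using J0 by blast
  have J_meas: "J y i j l r \<in> borel_measurable M" if "r \<in> {0..T}" for y i j l r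
    using J[of i j l y] that measurable_F_imp_M[of "J y i j l r" r] by (auto simp: is_ito_integral_def adapted_on_def)
  have I_meas: "I i j l r \<in> borel_measurable M" if "r \<in> {0..T}" for i j l r
    using I[of i j l] that measurable_F_imp_M[of "I i j l r" r] by (auto simp: is_ito_integral_def adapted_on_def)
  have I_zero: "AE \<omega> in M. \<forall>i j l. I i j l 0 \<omega> = 0"
  proof -
    have "AE \<omega> in M. I i j l 0 \<omega> = 0" for i j l
    proof -
      interpret ito_integrator M F "noise_entry W i j l" by (rule integrator)
      show ?thesis using ito_process_of_integral[OF I] T by (simp add: ito_process_def)
    qed
    then show ?thesis by (simp add: AE_all_countable)
  qed
  have Bx_cont: "AE \<omega> in M. continuous_on {0..T} (\<lambda>s. Bx s \<omega>)"
    using paths b_cont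
  proof eventually_elim
    case (elim \<omega>)
    have "continuous_on {0..T} (\<lambda>s. case (s, x + c * s) of (s, y) \<Rightarrow> b y s \<omega>)"
      by (rule continuous_on_compose2[OF elim(2)]) (auto intro!: continuous_intros)
    moreover have "continuous_on {0..T} (\<lambda>s. case (s, x + c * s) of (s, y) \<Rightarrow> d\<phi> s y \<omega>)"
      by (rule continuous_on_compose2[OF elim(1)[THEN conjunct2, THEN conjunct1]]) (auto intro!: continuous_intros)
    ultimately show ?case unfolding Bx_def by (auto intro!: continuous_intros)
  qed
  have at_t: "AE \<omega> in M. X t \<omega> $ i $ j = X 0 \<omega> $ i $ j + integral {0..t} (\<lambda>s. Bx s \<omega>) $ i $ j + (\<Sum>l\<in>UNIV. I i j l t \<omega>)"
    if t: "0 < t" "t \<le> T" for t i j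
  proof -
    define g where "g n k = t * real k / real (Suc n)" for n k
    have g: "g n k \<in> {0..T}" if "k \<le> Suc n" for n k
      using grid_point_mem[OF t(1) that] t(2) unfolding g_def by auto
    have g_le: "g n k \<le> g n (Suc k)" for n k
      unfolding g_def using t(1) by (simp add: divide_right_mono mult_left_mono)
    define Z where "Z l n \<omega> = (\<Sum>k<Suc n. J (x + c * g n k) i j l (g n (Suc k)) \<omega> - J (x + c * g n k) i j l (g n k) \<omega>)" for l n \<omega>
    have Z_meas: "Z l n \<in> borel_measurable M" for l n
      unfolding Z_def[abs_def]
      by (intro borel_measurable_sum borel_measurable_diff J_meas g) auto
    have Z_lim: "(\<lambda>n. prob {\<omega> \<in> space M. a < \<bar>Z l n \<omega> - (I i j l t \<omega> - I i j l 0 \<omega>)\<bar>}) \<longlonglongrightarrow> 0" if a: "0 < a" for l a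
    proof -
      interpret ito_integrator M F "noise_entry W i j l" by (rule integrator)
      have 1: "ito_process T (q i j l y) (J y i j l)" for y
        using ito_process_of_integral[OF J] T by simp
      have 2: "ito_process T (\<lambda>s. q i j l (x + c * s) s) (I i j l)"
        using ito_process_of_integral[OF I[of i j l]] T by (simp add: q_shift)
      have 3: "AE \<omega> in M. continuous_on ({0..T} \<times> UNIV) (\<lambda>(s, y). q i j l y s \<omega>)"
        using q_cont by eventually_elim blast
      show ?thesis
        using shifted_integrals_tendsto[OF t 1 2 3 a] unfolding Z_def g_def .
    qed
    have S_lim: "(\<lambda>n. prob {\<omega> \<in> space M. a < \<bar>(\<Sum>l\<in>UNIV. Z l n \<omega>) - (\<Sum>l\<in>UNIV. I i j l t \<omega> - I i j l 0 \<omega>)\<bar>}) \<longlonglongrightarrow> 0"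
      if a: "0 < a" for a
    proof -
      have "(\<lambda>n. prob {\<omega> \<in> space M. a < \<bar>\<Sum>l\<in>UNIV. Z l n \<omega> - (I i j l t \<omega> - I i j l 0 \<omega>)\<bar>}) \<longlonglongrightarrow> 0"
      proof (rule prob_tendsto_zero_sum[where X = "\<lambda>l n \<omega>. Z l n \<omega> - (I i j l t \<omega> - I i j l 0 \<omega>)"])
        show "(\<lambda>\<omega>. Z l n \<omega> - (I i j l t \<omega> - I i j l 0 \<omega>)) \<in> borel_measurable M" for l n
          using Z_meas I_meas[of t i j l] I_meas[of 0 i j l] t by (intro borel_measurable_diff) auto
      qed (use Z_lim a in auto)
      then show ?thesis by (simp only: sum_subtractf)
    qed
    define V where "V \<omega> = \<phi> t (x + c * t) \<omega> - \<phi> 0 x \<omega> - integral {0..t} (\<lambda>s. Bx s \<omega>)" for \<omega>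
    have "AE \<omega> in M. \<forall>n k. \<forall>r\<in>{0..T}. \<forall>i j. \<phi> r (x + c * g n k) \<omega> $ i $ j =
         \<phi> 0 (x + c * g n k) \<omega> $ i $ j + (LINT s:{0..r}|lborel. b (x + c * g n k) s \<omega>) $ i $ j + (\<Sum>l\<in>UNIV. J (x + c * g n k) i j l r \<omega>)"
      using J_eq by (simp add: AE_all_countable)
    then have S_V: "AE \<omega> in M. (\<lambda>n. \<Sum>l\<in>UNIV. Z l n \<omega>) \<longlonglongrightarrow> V \<omega> $ i $ j"
      using paths b_cont
    proof eventually_elim
      case (elim \<omega>)
      have by_cont: "continuous_on {0..T} (\<lambda>s. b y s \<omega>)" for y
      proof -
        have "continuous_on {0..T} (\<lambda>s. case (s, y) of (s, y) \<Rightarrow> b y s \<omega>)"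
          by (rule continuous_on_compose2[OF elim(3)]) (auto intro!: continuous_intros)
        then show ?thesis by simp
      qed
      have lim: "(\<lambda>n. \<Sum>k<Suc n. \<phi> (g n (Suc k)) (x + c * g n k) \<omega> - \<phi> (g n k) (x + c * g n k) \<omega>
          - integral {g n k..g n (Suc k)} (\<lambda>s. b (x + c * g n k) s \<omega>)) \<longlonglongrightarrow> V \<omega>"
        unfolding V_def Bx_def g_def
        by (rule shifted_increments_tendsto[OF t, of "\<lambda>s y. \<phi> s y \<omega>" "\<lambda>s y. d\<phi> s y \<omega>" "\<lambda>y s. b y s \<omega>"])
           (use elim in auto)
      have "(\<Sum>l\<in>UNIV. Z l n \<omega>) = (\<Sum>k<Suc n. \<phi> (g n (Suc k)) (x + c * g n k) \<omega> - \<phi> (g n k) (x + c * g n k) \<omega>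
          - integral {g n k..g n (Suc k)} (\<lambda>s. b (x + c * g n k) s \<omega>)) $ i $ j" for n
      proof -
        have "(\<Sum>l\<in>UNIV. Z l n \<omega>) = (\<Sum>k<Suc n. \<Sum>l\<in>UNIV. J (x + c * g n k) i j l (g n (Suc k)) \<omega> - J (x + c * g n k) i j l (g n k) \<omega>)"
          unfolding Z_def by (rule sum.swap)
        also have "\<dots> = (\<Sum>k<Suc n. (\<phi> (g n (Suc k)) (x + c * g n k) \<omega> - \<phi> (g n k) (x + c * g n k) \<omega>
          - integral {g n k..g n (Suc k)} (\<lambda>s. b (x + c * g n k) s \<omega>)) $ i $ j)"
        proof (rule sum.cong[OF refl])
          fix k assume "k \<in> {..<Suc n}"
          then have gk: "g n k \<in> {0..T}" "g n (Suc k) \<in> {0..T}" using g by auto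
          let ?y = "x + c * g n k"
          have e: "\<phi> r ?y \<omega> $ i $ j = \<phi> 0 ?y \<omega> $ i $ j + integral {0..r} (\<lambda>s. b ?y s \<omega>) $ i $ j + (\<Sum>l\<in>UNIV. J ?y i j l r \<omega>)"
            if "r \<in> {0..T}" for r
          proof -
            have "\<phi> r ?y \<omega> $ i $ j = \<phi> 0 ?y \<omega> $ i $ j + (LINT s:{0..r}|lborel. b ?y s \<omega>) $ i $ j + (\<Sum>l\<in>UNIV. J ?y i j l r \<omega>)"
              using elim(1) that by blast
            then show ?thesis using set_integral_Icc_eq_integral(1)[OF by_cont, of r ?y] that by simp
          qed
          have "integral {0..g n k} (\<lambda>s. b ?y s \<omega>) + integral {g n k..g n (Suc k)} (\<lambda>s. b ?y s \<omega>) = integral {0..g n (Suc k)} (\<lambda>s. b ?y s \<omega>)"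
            using gk g_le by (intro Henstock_Kurzweil_Integration.integral_combine integrable_continuous_interval continuous_on_subset[OF by_cont]) auto
          then have ic: "integral {g n k..g n (Suc k)} (\<lambda>s. b ?y s \<omega>) = integral {0..g n (Suc k)} (\<lambda>s. b ?y s \<omega>) - integral {0..g n k} (\<lambda>s. b ?y s \<omega>)"
            by (simp add: algebra_simps)
          show "(\<Sum>l\<in>UNIV. J ?y i j l (g n (Suc k)) \<omega> - J ?y i j l (g n k) \<omega>) =
            (\<phi> (g n (Suc k)) ?y \<omega> - \<phi> (g n k) ?y \<omega> - integral {g n k..g n (Suc k)} (\<lambda>s. b ?y s \<omega>)) $ i $ j"
            using e[OF gk(1)] e[OF gk(2)] unfolding ic by (simp add: sum_subtractf)
        qed
        also have "\<dots> = (\<Sum>k<Suc n. \<phi> (g n (Suc k)) (x + c * g n k) \<omega> - \<phi> (g n k) (x + c * g n k) \<omega>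
          - integral {g n k..g n (Suc k)} (\<lambda>s. b (x + c * g n k) s \<omega>)) $ i $ j"
          by (simp only: sum_component)
        finally show ?thesis .
      qed
      then show ?case using tendsto_vec_nth[OF tendsto_vec_nth[OF lim, of i], of j] by simp
    qed
    have S_meas: "(\<lambda>\<omega>. \<Sum>l\<in>UNIV. Z l n \<omega>) \<in> borel_measurable M" for n
      using Z_meas by (intro borel_measurable_sum)
    \<comment> \<open>The limit is written as \<open>lim\<close>, which is measurable as a limit of
      measurable functions; for V, which contains a pathwise integral, this is not evident.\<close>
    have "AE \<omega> in M. (\<Sum>l\<in>UNIV. I i j l t \<omega> - I i j l 0 \<omega>) = lim (\<lambda>n. \<Sum>l\<in>UNIV. Z l n \<omega>)"
    proof (rule AE_eq_if_limits[OF S_meas _ _ S_lim])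
      show "(\<lambda>\<omega>. lim (\<lambda>n. \<Sum>l\<in>UNIV. Z l n \<omega>)) \<in> borel_measurable M"
        by (rule borel_measurable_lim_metric[OF S_meas])
      show "(\<lambda>\<omega>. \<Sum>l\<in>UNIV. I i j l t \<omega> - I i j l 0 \<omega>) \<in> borel_measurable M"
        using I_meas t by (intro borel_measurable_sum borel_measurable_diff) auto
      show "AE \<omega> in M. (\<lambda>n. \<Sum>l\<in>UNIV. Z l n \<omega>) \<longlonglongrightarrow> lim (\<lambda>n. \<Sum>l\<in>UNIV. Z l n \<omega>)"
        using S_V by eventually_elim (metis limI)
    qed auto
    then show ?thesis
      using S_V I_zero
    proof eventually_elim
      case (elim \<omega>)
      have "lim (\<lambda>n. \<Sum>l\<in>UNIV. Z l n \<omega>) = V \<omega> $ i $ j" by (rule limI[OF elim(2)])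
      moreover have "(\<Sum>l\<in>UNIV. I i j l t \<omega> - I i j l 0 \<omega>) = (\<Sum>l\<in>UNIV. I i j l t \<omega>)"
      proof (rule sum.cong[OF refl])
        fix l
        have "I i j l 0 \<omega> = 0" using elim(3) by blast
        then show "I i j l t \<omega> - I i j l 0 \<omega> = I i j l t \<omega>" by simp
      qed
      ultimately show ?case using elim(1) by (simp add: V_def X_def)
    qed
  qed
  have cntb: "countable (\<rat> \<inter> {0<..<T})" using countable_rat by auto
  have "AE \<omega> in M. \<forall>t\<in>\<rat> \<inter> {0<..<T}. \<forall>i j. X t \<omega> $ i $ j = X 0 \<omega> $ i $ j + integral {0..t} (\<lambda>s. Bx s \<omega>) $ i $ j + (\<Sum>l\<in>UNIV. I i j l t \<omega>)"
    using at_t by (subst AE_ball_countable[OF cntb]) (simp add: AE_all_countable)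
  moreover have "AE \<omega> in M. \<forall>i j l. continuous_on {0..T} (\<lambda>t. I i j l t \<omega>)"
    using I by (simp add: AE_all_countable is_ito_integral_def)
  ultimately have eq: "AE \<omega> in M. \<forall>t\<in>{0..T}. \<forall>i j. X t \<omega> $ i $ j =
      X 0 \<omega> $ i $ j + (LINT s:{0..t}|lborel. Bx s \<omega>) $ i $ j + (\<Sum>l\<in>UNIV. I i j l t \<omega>)"
    using X_cont Bx_cont
  proof eventually_elim
    case (elim \<omega>)
    show ?case
    proof (intro ballI allI)
      fix t i j assume t: "t \<in> {0..T}"
      have c1: "continuous_on {0..T} (\<lambda>t. integral {0..t} (\<lambda>s. Bx s \<omega>))"
        by (rule indefinite_integral_continuous_1[OF integrable_continuous_interval[OF elim(4)]])
      have c2: "continuous_on {0..T} (\<lambda>t. I i j l t \<omega>)" for l using elim(2) by blast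
      have "X t \<omega> $ i $ j = X 0 \<omega> $ i $ j + integral {0..t} (\<lambda>s. Bx s \<omega>) $ i $ j + (\<Sum>l\<in>UNIV. I i j l t \<omega>)"
      proof (rule eq_on_interval_if_eq_on_rationals[OF _ _ T _ t])
        show "continuous_on {0..T} (\<lambda>t. X t \<omega> $ i $ j)" using elim(3) by (intro continuous_intros)
        show "continuous_on {0..T} (\<lambda>t. X 0 \<omega> $ i $ j + integral {0..t} (\<lambda>s. Bx s \<omega>) $ i $ j + (\<Sum>l\<in>UNIV. I i j l t \<omega>))"
          using c1 c2 by (intro continuous_intros)
        fix r assume "r \<in> \<rat>" "0 < r" "r < T"
        then show "X r \<omega> $ i $ j = X 0 \<omega> $ i $ j + integral {0..r} (\<lambda>s. Bx s \<omega>) $ i $ j + (\<Sum>l\<in>UNIV. I i j l r \<omega>)"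
          using elim(1) by simp
      qed
      then show "X t \<omega> $ i $ j = X 0 \<omega> $ i $ j + (LINT s:{0..t}|lborel. Bx s \<omega>) $ i $ j + (\<Sum>l\<in>UNIV. I i j l t \<omega>)"
        using set_integral_Icc_eq_integral(1)[OF elim(4), of t] t by simp
    qed
  qed
  have "solves_ito_equation M F T W Bx hx X"
    unfolding solves_ito_equation_iff
  proof (intro conjI exI allI)
    show "AE \<omega> in M. set_integrable lborel {0..T} (\<lambda>s. Bx s \<omega>)"
      using Bx_cont by eventually_elim (rule set_integral_Icc_eq_integral(2)[OF _ order_refl])
  qed (fact X_ad I eq)+
  then show ?thesis by (simp add: Bx_def hx_def X_def d\<phi>_def)
qed

end

section \<open>The transport equation\<close>

text \<open>The pieces fit by the matching of order 0 at \<epsilon> and at 1 and by the zeros of the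
  polynomials at 0 and 2. The power is continuous only away from 0, hence its piece begins at
  \<epsilon>.\<close>

lemma continuous_g_fun:
  assumes \<epsilon>: "0 < \<epsilon>" "\<epsilon> < 1" and coeffs: "matching_coeffs H \<epsilon> a b"
  shows "continuous_on UNIV (g_fun H \<epsilon> a b)"
proof -
  define l where "l x = (\<Sum>i=1..5. a i * x ^ (i + 4))" for x :: real
  define m where "m x = sqrt (2 * H) * x powr (H - 1 / 2)" for x
  define r where "r x = (\<Sum>i=1..5. b i * (x - 2) ^ (i + 4))" for x :: real
  have match: "l \<epsilon> = m \<epsilon>" "r 1 = m 1"
    using coeffs[unfolded matching_coeffs_def, THEN conjunct1, rule_format, of 0]
      coeffs[unfolded matching_coeffs_def, THEN conjunct2, rule_format, of 0]
    by (simp_all add: l_def m_def r_def)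
  have zero: "l 0 = 0" "r 2 = 0" by (auto simp: l_def r_def intro!: sum.neutral)
  have l_cont: "continuous_on A l" for A unfolding l_def[abs_def] by (intro continuous_intros)
  have r_cont: "continuous_on A r" for A unfolding r_def[abs_def] by (intro continuous_intros)
  have m_cont: "continuous_on A m" if "A \<subseteq> {0<..}" for A
    unfolding m_def[abs_def] using that by (auto intro!: continuous_intros)
  have "continuous_on A (\<lambda>x. if x \<le> 2 then r x else 0)" for A
    by (intro continuous_on_cases_le r_cont continuous_on_const continuous_on_id) (simp add: zero)
  then have "continuous_on {\<epsilon>..} (\<lambda>x. if x \<le> 1 then m x else if x \<le> 2 then r x else 0)"
    by (intro continuous_on_cases_le[OF m_cont _ continuous_on_id]) (use \<epsilon> in \<open>auto simp: match\<close>)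
  moreover have "{x. \<epsilon> \<le> x} = {\<epsilon>..}" by auto
  ultimately have "continuous_on UNIV (\<lambda>x. if x \<le> \<epsilon> then l x else if x \<le> 1 then m x else if x \<le> 2 then r x else 0)"
    by (intro continuous_on_cases_le[OF l_cont _ continuous_on_id]) (use \<epsilon> in \<open>simp_all add: match\<close>)
  then have "continuous_on UNIV (\<lambda>x. if x \<le> 0 then 0 else if x \<le> \<epsilon> then l x else if x \<le> 1 then m x else if x \<le> 2 then r x else 0)"
    by (intro continuous_on_cases_le[OF continuous_on_const _ continuous_on_id])
       (use \<epsilon> in \<open>auto simp: zero intro: continuous_on_subset\<close>)
  \<comment> \<open>\<open>g_fun\<close> has < at \<epsilon> and at 2 where the gluing has \<le>;
    the adjacent pieces agree at these points.\<close>
  moreover have "(\<lambda>x. if x \<le> 0 then 0 else if x \<le> \<epsilon> then l x else if x \<le> 1 then m x else if x \<le> 2 then r x else 0) = g_fun H \<epsilon> a b"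
  proof
    fix x :: real
    consider "x = \<epsilon>" | "x = 2" | "x \<noteq> \<epsilon>" "x \<noteq> 2" by blast
    then show "(if x \<le> 0 then 0 else if x \<le> \<epsilon> then l x else if x \<le> 1 then m x else if x \<le> 2 then r x else 0) = g_fun H \<epsilon> a b x"
    proof cases
      case 1
      then show ?thesis using \<epsilon> match(1) by (simp add: g_fun_def m_def)
    next
      case 2
      then show ?thesis using \<epsilon> zero(2) by (simp add: g_fun_def)
    next
      case 3
      then show ?thesis by (simp add: g_fun_def l_def m_def r_def)
    qed
  qed
  ultimately show ?thesis by (simp only:)
qed

lemma C03_shift:
  assumes "C03 T \<phi>"
  shows "C03 T (\<lambda>t x. \<phi> t (x + t))"
proof -
  obtain D where D: "\<And>t x. t \<in> {0..T} \<Longrightarrow> D 0 t x = \<phi> t x"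
    "\<And>k t x. k < 3 \<Longrightarrow> t \<in> {0..T} \<Longrightarrow> (D k t has_vector_derivative D (Suc k) t x) (at x)"
    "\<And>k. k \<le> 3 \<Longrightarrow> continuous_on ({0..T} \<times> UNIV) (\<lambda>(t, x). D k t x)"
    using assms unfolding C03_def by blast
  have der: "((\<lambda>y. D k t (y + t)) has_vector_derivative D (Suc k) t (x + t)) (at x)"
    if "k < 3" "t \<in> {0..T}" for k t x
  proof -
    have "((\<lambda>y. y + t) has_vector_derivative 1) (at x)"
      by (auto intro!: derivative_eq_intros simp: has_real_derivative_iff_has_vector_derivative[symmetric])
    from vector_diff_chain_at[OF this D(2)[OF that]] show ?thesis by (simp add: o_def)
  qed
  have cont: "continuous_on ({0..T} \<times> UNIV) (\<lambda>(t, x). D k t (x + t))" if "k \<le> 3" for k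
  proof -
    have "continuous_on ({0..T} \<times> UNIV) (\<lambda>p. case (fst p, snd p + fst p) of (t, x) \<Rightarrow> D k t x)"
      by (rule continuous_on_compose2[OF D(3)[OF that]]) (auto intro!: continuous_intros)
    then show ?thesis by (simp add: case_prod_beta')
  qed
  show ?thesis
    unfolding C03_def
    by (intro exI[of _ "\<lambda>k t x. D k t (x + t)"] conjI ballI allI impI) (simp_all add: D(1) der cont)
qed

lemma vector_derivative_shift:
  assumes "(f has_vector_derivative f') (at (x + c :: real))"
  shows "vector_derivative (\<lambda>y. f (y + c)) (at x) = f'"
proof -
  have "((\<lambda>y. y + c) has_vector_derivative 1) (at x)"
    by (auto intro!: derivative_eq_intros simp: has_real_derivative_iff_has_vector_derivative[symmetric])
  from vector_diff_chain_at[OF this assms] show ?thesis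
    by (intro vector_derivative_at) (simp add: o_def)
qed

lemma eq_UNIV_if_eq_on_rationals:
  fixes f g :: "real \<Rightarrow> 'b :: t2_space"
  assumes "continuous_on UNIV f" "continuous_on UNIV g" "\<And>x. x \<in> \<rat> \<Longrightarrow> f x = g x"
  shows "f = g"
proof
  fix x
  have "closed {x. f x = g x}" using assms(1,2) by (rule closed_Collect_eq)
  then have "closure (\<rat> :: real set) \<subseteq> {x. f x = g x}" using assms(3) by (intro closure_minimal) auto
  then show "f x = g x" using Rats_closure_real by auto
qed

section \<open>Passing between the two equations\<close>

context filtered_prob_space_usual
begin

lemma solves_ito_equation_cong_drift:
  fixes X :: "real \<Rightarrow> 'a \<Rightarrow> real ^ 'p ^ 'p"
  assumes sol: "solves_ito_equation M F T W b h X"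
    and eq: "AE \<omega> in M. \<forall>s\<in>{0..T}. b s \<omega> = b' s \<omega>"
  shows "solves_ito_equation M F T W b' h X"
proof -
  obtain I J where ad: "adapted_on F T X" and int: "AE \<omega> in M. set_integrable lborel {0..T} (\<lambda>s. b s \<omega>)"
    and I: "is_ito_integral_left M F T (\<lambda>s \<omega>. h s *\<^sub>R msqrt (X s \<omega>)) W I"
    and J: "is_ito_integral_right M F T (\<lambda>s \<omega>. transpose (W s \<omega>)) (\<lambda>s \<omega>. h s *\<^sub>R msqrt (X s \<omega>)) J"
    and X: "AE \<omega> in M. \<forall>t\<in>{0..T}. X t \<omega> = X 0 \<omega> + (LINT s:{0..t}|lborel. b s \<omega>) + I t \<omega> + J t \<omega>"
    using sol unfolding solves_ito_equation_def by blast
  have int': "AE \<omega> in M. set_integrable lborel {0..T} (\<lambda>s. b' s \<omega>)"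
    using int eq
  proof eventually_elim
    case (elim \<omega>)
    have "set_integrable lborel {0..T} (\<lambda>s. b s \<omega>) = set_integrable lborel {0..T} (\<lambda>s. b' s \<omega>)"
      by (rule set_integrable_cong) (use elim(2) in auto)
    then show ?case using elim(1) by simp
  qed
  have X': "AE \<omega> in M. \<forall>t\<in>{0..T}. X t \<omega> = X 0 \<omega> + (LINT s:{0..t}|lborel. b' s \<omega>) + I t \<omega> + J t \<omega>"
    using X eq
  proof eventually_elim
    case (elim \<omega>)
    show ?case
    proof
      fix t assume t: "t \<in> {0..T}"
      have "(LINT s:{0..t}|lborel. b s \<omega>) = (LINT s:{0..t}|lborel. b' s \<omega>)"
        by (rule set_lebesgue_integral_cong) (use elim(2) t in auto)
      moreover have "X t \<omega> = X 0 \<omega> + (LINT s:{0..t}|lborel. b s \<omega>) + I t \<omega> + J t \<omega>"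
        using elim(1) t by blast
      ultimately show "X t \<omega> = X 0 \<omega> + (LINT s:{0..t}|lborel. b' s \<omega>) + I t \<omega> + J t \<omega>"
        by simp
    qed
  qed
  show ?thesis
    unfolding solves_ito_equation_def
    by (intro conjI exI[of _ I] exI[of _ J]) (fact ad int' I J X')+
qed

text \<open>The sum of the integrals is the local martingale part. What remains is a time integral
  of a continuous path, which is bounded, so the remainder is Lipschitz in time.\<close>

lemma solution_semimartingale:
  fixes W X :: "real \<Rightarrow> 'a \<Rightarrow> real ^ 'p ^ 'p"
  assumes W: "brownian_matrix M F W" and T: "0 < T"
    and sol: "solves_ito_equation M F T W b h X"
    and X_cont: "AE \<omega> in M. continuous_on {0..T} (\<lambda>t. X t \<omega>)"
    and X_SPD: "AE \<omega> in M. \<forall>t\<in>{0..T}. X t \<omega> \<in> SPD"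
    and h: "continuous_on {0..T} h"
    and b_cont: "AE \<omega> in M. continuous_on {0..T} (\<lambda>s. b s \<omega>)"
  shows "semimartingale_on M F T (\<lambda>t \<omega>. X t \<omega> $ i $ j)"
proof -
  note integrator = noise_entry_ito_integrator[OF W]
  obtain J where X_ad: "adapted_on F T X"
    and J0: "\<forall>i j l. is_ito_integral M F T (noise_entry W i j l) (coefficient_entry h X i j l) (J i j l)"
    and X_eq: "AE \<omega> in M. \<forall>t\<in>{0..T}. \<forall>i j. X t \<omega> $ i $ j =
         X 0 \<omega> $ i $ j + (LINT s:{0..t}|lborel. b s \<omega>) $ i $ j + (\<Sum>l\<in>UNIV. J i j l t \<omega>)"
    using sol unfolding solves_ito_equation_iff by blast
  have J: "is_ito_integral M F T (noise_entry W i j l) (coefficient_entry h X i j l) (J i j l)" for i j l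
    using J0 by blast
  show ?thesis
  proof (rule semimartingale_onI[OF _ _ _ T])
    show "adapted_on F T (\<lambda>t \<omega>. X t \<omega> $ i $ j)"
      unfolding adapted_on_def
    proof
      fix t assume "t \<in> {0..T}"
      then have [measurable]: "X t \<in> borel_measurable (F t)" using X_ad by (auto simp: adapted_on_def)
      show "(\<lambda>\<omega>. X t \<omega> $ i $ j) \<in> borel_measurable (F t)" by measurable
    qed
    have T0: "0 \<le> T" using T by simp
    from coefficient_entry_adapted[OF X_ad]
    show "local_martingale_on M F T (\<lambda>t \<omega>. \<Sum>l\<in>UNIV. J i j l t \<omega>)"
    proof (intro local_martingale_sum_ito_integrals[OF T finite integrator J])
      show "AE \<omega> in M. continuous_on {0..T} (\<lambda>t. coefficient_entry h X i j l t \<omega>)" for l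
        using X_cont X_SPD by eventually_elim (rule coefficient_entry_continuous[OF _ h])
    qed
    have "AE \<omega> in M. J i j l 0 \<omega> = 0" for l
    proof -
      interpret ito_integrator M F "noise_entry W i j l" by (rule integrator)
      show ?thesis using ito_process_of_integral[OF J[of i j l] T0] by (simp add: ito_process_def)
    qed
    then have "AE \<omega> in M. \<forall>l. J i j l 0 \<omega> = 0" by (simp add: AE_all_countable)
    then show "AE \<omega> in M. (\<Sum>l\<in>UNIV. J i j l 0 \<omega>) = 0"
      by eventually_elim (rule sum.neutral, blast)
    show "AE \<omega> in M. \<exists>C\<ge>0. \<forall>s\<in>{0..T}. \<forall>t\<in>{0..T}.
        \<bar>(X t \<omega> $ i $ j - (\<Sum>l\<in>UNIV. J i j l t \<omega>)) - (X s \<omega> $ i $ j - (\<Sum>l\<in>UNIV. J i j l s \<omega>))\<bar> \<le> C * \<bar>t - s\<bar>"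
      using X_eq b_cont
    proof eventually_elim
      case (elim \<omega>)
      have "bounded ((\<lambda>s. b s \<omega>) ` {0..T})"
        using elim(2) by (intro compact_imp_bounded compact_continuous_image) auto
      then obtain C where C: "\<forall>s\<in>{0..T}. norm (b s \<omega>) \<le> C" by (auto simp: bounded_iff)
      have C0: "0 \<le> C" using C T by (intro order_trans[OF norm_ge_zero[of "b 0 \<omega>"]]) auto
      define A where "A t = X t \<omega> $ i $ j - (\<Sum>l\<in>UNIV. J i j l t \<omega>)" for t
      have A_eq: "A t = X 0 \<omega> $ i $ j + integral {0..t} (\<lambda>s. b s \<omega>) $ i $ j" if "t \<in> {0..T}" for t
      proof -
        have "X t \<omega> $ i $ j = X 0 \<omega> $ i $ j + (LINT s:{0..t}|lborel. b s \<omega>) $ i $ j + (\<Sum>l\<in>UNIV. J i j l t \<omega>)"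
          using elim(1) that by blast
        then show ?thesis using set_integral_Icc_eq_integral(1)[OF elim(2), of t] that by (simp add: A_def)
      qed
      have mono: "\<bar>A t - A s\<bar> \<le> C * (t - s)" if st: "0 \<le> s" "s \<le> t" "t \<le> T" for s t
      proof -
        have sub: "continuous_on {s..t} (\<lambda>s. b s \<omega>)" "continuous_on {0..t} (\<lambda>s. b s \<omega>)"
          using st by (auto intro: continuous_on_subset[OF elim(2)])
        have "integral {0..s} (\<lambda>s. b s \<omega>) + integral {s..t} (\<lambda>s. b s \<omega>) = integral {0..t} (\<lambda>s. b s \<omega>)"
          using st by (intro Henstock_Kurzweil_Integration.integral_combine integrable_continuous_interval sub) auto
        then have "integral {0..t} (\<lambda>s. b s \<omega>) - integral {0..s} (\<lambda>s. b s \<omega>) = integral {s..t} (\<lambda>s. b s \<omega>)"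
          by (simp add: algebra_simps)
        then have "(integral {0..t} (\<lambda>s. b s \<omega>) - integral {0..s} (\<lambda>s. b s \<omega>)) $ i $ j = integral {s..t} (\<lambda>s. b s \<omega>) $ i $ j"
          by simp
        then have "A t - A s = integral {s..t} (\<lambda>s. b s \<omega>) $ i $ j"
          using A_eq[of s] A_eq[of t] st by simp
        then have "\<bar>A t - A s\<bar> \<le> norm (integral {s..t} (\<lambda>s. b s \<omega>))"
          using abs_matrix_entry_le_norm by simp
        also have "\<dots> \<le> C * (t - s)"
          by (rule integral_bound[OF st(2) sub(1)]) (use C st in auto)
        finally show ?thesis .
      qed
      have "\<bar>A t - A s\<bar> \<le> C * \<bar>t - s\<bar>" if "s \<in> {0..T}" "t \<in> {0..T}" for s t
      proof (cases "s \<le> t")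
        case True
        then show ?thesis using mono[of s t] that by simp
      next
        case False
        then show ?thesis using mono[of t s] that by (simp add: abs_minus_commute)
      qed
      then show ?case using C0 unfolding A_def by blast
    qed
  qed
qed

text \<open>Along x + t the arguments of f and g collapse to x, so the noise coefficient no longer
  depends on time, and the derivative of \<eta> at x + t is that of the shifted field at x.\<close>

lemma transported_solution:
  fixes W :: "real \<Rightarrow> 'a \<Rightarrow> real ^ 'p ^ 'p" and \<eta> :: "real \<Rightarrow> real \<Rightarrow> 'a \<Rightarrow> real ^ 'p ^ 'p"
  assumes W: "brownian_matrix M F W" and T: "0 < T"
    and f: "continuous_on UNIV f" and g: "continuous_on UNIV g"
    and eta: "eta_solution M F T W v f g \<Sigma>\<^sub>0 \<eta>" and C: "C03_field M T \<eta>"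
  shows "spde_solution M F T W v f g \<Sigma>\<^sub>0 (\<lambda>t x. \<eta> t (x + t)) \<and> regular_field M F T (\<lambda>t x. \<eta> t (x + t))"
proof -
  define u where "u = (\<lambda>t x. \<eta> t (x + t))"
  have \<eta>_SPD: "SPD_valued M T \<eta>"
    and \<eta>_sol: "\<And>x. solves_ito_equation M F T W (\<lambda>t \<omega>. (v * f (x - t)) *\<^sub>R mat 1) (\<lambda>t. g (x - t)) (\<lambda>t \<omega>. \<eta> t x \<omega>)"
    and \<eta>_init: "\<And>x. AE \<omega> in M. \<eta> 0 x \<omega> = \<Sigma>\<^sub>0"
    using eta unfolding eta_solution_def by blast+
  have u_SPD: "SPD_valued M T u"
    using \<eta>_SPD unfolding SPD_valued_def u_def by eventually_elim blast
  have u_C03: "C03_field M T u"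
    using C unfolding C03_field_def u_def by eventually_elim (rule C03_shift)
  have u_paths: "AE \<omega> in M. continuous_on ({0..T} \<times> UNIV) (\<lambda>(t, x). u t x \<omega>) \<and>
      continuous_on ({0..T} \<times> UNIV) (\<lambda>(t, x). vector_derivative (\<lambda>y. u t y \<omega>) (at x)) \<and>
      (\<forall>t\<in>{0..T}. \<forall>x. ((\<lambda>y. u t y \<omega>) has_vector_derivative vector_derivative (\<lambda>y. u t y \<omega>) (at x)) (at x))"
    using u_C03 unfolding C03_field_def by eventually_elim (intro conjI ballI allI C03_imp)
  have f': "continuous_on A (\<lambda>p. f (k p))" if "continuous_on A k" for A and k :: "real \<times> real \<Rightarrow> real"
    by (rule continuous_on_compose2[OF f that]) auto
  have g': "continuous_on A (\<lambda>p. g (k p))" if "continuous_on A k" for A and k :: "real \<times> real \<Rightarrow> real"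
    by (rule continuous_on_compose2[OF g that]) auto
  have u_sol: "solves_ito_equation M F T W
      (\<lambda>t \<omega>. vector_derivative (\<lambda>y. u t y \<omega>) (at x) + (v * f x) *\<^sub>R mat 1) (\<lambda>t. g x) (\<lambda>t \<omega>. u t x \<omega>)" for x
  proof -
    have "solves_ito_equation M F T W
      (\<lambda>s \<omega>. (v * f (x + 1 * s - s)) *\<^sub>R mat 1 + 1 *\<^sub>R vector_derivative (\<lambda>y. \<eta> s y \<omega>) (at (x + 1 * s)))
      (\<lambda>s. g (x + 1 * s - s)) (\<lambda>t \<omega>. \<eta> t (x + 1 * t) \<omega>)"
    proof (rule shifted_solution[OF W T C \<eta>_SPD \<eta>_sol, where c = 1])
      have "continuous_on ({0..T} \<times> UNIV) (\<lambda>p. (v * f (snd p - fst p)) *\<^sub>R (mat 1 :: real ^ 'p ^ 'p))"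
        by (intro continuous_intros f')
      then show "AE \<omega> in M. continuous_on ({0..T} \<times> UNIV) (\<lambda>(s, y). (v * f (y - s)) *\<^sub>R (mat 1 :: real ^ 'p ^ 'p))"
        by (simp add: case_prod_beta')
      have "continuous_on ({0..T} \<times> UNIV) (\<lambda>p. g (snd p - fst p))"
        by (intro continuous_intros g')
      then show "continuous_on ({0..T} \<times> UNIV) (\<lambda>(s, y). g (y - s))"
        by (simp add: case_prod_beta')
    qed
    then have "solves_ito_equation M F T W
      (\<lambda>s \<omega>. (v * f x) *\<^sub>R mat 1 + vector_derivative (\<lambda>y. \<eta> s y \<omega>) (at (x + s))) (\<lambda>s. g x) (\<lambda>t \<omega>. u t x \<omega>)"
      by (simp add: u_def)
    then show ?thesis
    proof (rule solves_ito_equation_cong_drift)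
      show "AE \<omega> in M. \<forall>s\<in>{0..T}. (v * f x) *\<^sub>R mat 1 + vector_derivative (\<lambda>y. \<eta> s y \<omega>) (at (x + s)) =
          vector_derivative (\<lambda>y. u s y \<omega>) (at x) + (v * f x) *\<^sub>R mat 1"
        using C unfolding C03_field_def
      proof eventually_elim
        case (elim \<omega>)
        show ?case
        proof
          fix s assume "s \<in> {0..T}"
          from vector_derivative_shift[OF C03_imp(3)[OF elim this, of "x + s"]]
          show "(v * f x) *\<^sub>R mat 1 + vector_derivative (\<lambda>y. \<eta> s y \<omega>) (at (x + s)) =
            vector_derivative (\<lambda>y. u s y \<omega>) (at x) + (v * f x) *\<^sub>R mat 1"
            by (simp add: u_def)
        qed
      qed
    qed
  qed
  have "spde_solution M F T W v f g \<Sigma>\<^sub>0 u"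
    unfolding spde_solution_def
  proof (intro conjI allI)
    show "AE \<omega> in M. \<forall>t\<in>{0..T}. \<forall>x. (\<lambda>y. u t y \<omega>) differentiable at x"
      using u_paths by eventually_elim (blast intro: differentiableI_vector)
    show "AE \<omega> in M. u 0 x \<omega> = \<Sigma>\<^sub>0" for x using \<eta>_init[of x] by (simp add: u_def)
  qed (fact u_SPD u_sol)+
  moreover have "semimartingale_on M F T (\<lambda>t \<omega>. u t x \<omega> $ i $ j)" for x i j
  proof (rule solution_semimartingale[OF W T u_sol])
    show "AE \<omega> in M. continuous_on {0..T} (\<lambda>t. u t x \<omega>)"
      using u_paths
    proof eventually_elim
      case (elim \<omega>)
      have "continuous_on {0..T} (\<lambda>t. case (t, x) of (t, x) \<Rightarrow> u t x \<omega>)"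
        by (rule continuous_on_compose2[OF elim[THEN conjunct1]]) (auto intro!: continuous_intros)
      then show ?case by simp
    qed
    show "AE \<omega> in M. \<forall>t\<in>{0..T}. u t x \<omega> \<in> SPD"
      using u_SPD unfolding SPD_valued_def by eventually_elim blast
    show "AE \<omega> in M. continuous_on {0..T} (\<lambda>s. vector_derivative (\<lambda>y. u s y \<omega>) (at x) + (v * f x) *\<^sub>R mat 1)"
      using u_paths
    proof eventually_elim
      case (elim \<omega>)
      have "continuous_on {0..T} (\<lambda>t. case (t, x) of (t, x) \<Rightarrow> vector_derivative (\<lambda>y. u t y \<omega>) (at x))"
        by (rule continuous_on_compose2[OF elim[THEN conjunct2, THEN conjunct1]]) (auto intro!: continuous_intros)
      then show ?case by (auto intro!: continuous_intros)
    qed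
  qed auto
  ultimately show ?thesis using u_C03 unfolding regular_field_def u_def by blast
qed

lemma transported_solution_unique:
  fixes W :: "real \<Rightarrow> 'a \<Rightarrow> real ^ 'p ^ 'p" and \<eta> w :: "real \<Rightarrow> real \<Rightarrow> 'a \<Rightarrow> real ^ 'p ^ 'p"
  assumes W: "brownian_matrix M F W" and T: "0 < T"
    and f: "continuous_on UNIV f" and g: "continuous_on UNIV g"
    and eta: "eta_solution M F T W v f g \<Sigma>\<^sub>0 \<eta>" and \<eta>_C: "C03_field M T \<eta>"
    and spde: "spde_solution M F T W v f g \<Sigma>\<^sub>0 w" and w_C: "C03_field M T w"
  shows "AE \<omega> in M. \<forall>t\<in>{0..T}. \<forall>x. w t x \<omega> = \<eta> t (x + t) \<omega>"
proof -
  have \<eta>_SPD: "SPD_valued M T \<eta>"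
    and \<eta>_sol: "\<And>x. solves_ito_equation M F T W (\<lambda>t \<omega>. (v * f (x - t)) *\<^sub>R mat 1) (\<lambda>t. g (x - t)) (\<lambda>t \<omega>. \<eta> t x \<omega>)"
    and \<eta>_init: "\<And>x. AE \<omega> in M. \<eta> 0 x \<omega> = \<Sigma>\<^sub>0"
    using eta unfolding eta_solution_def by blast+
  have w_SPD: "SPD_valued M T w"
    and w_sol: "\<And>x. solves_ito_equation M F T W
            (\<lambda>t \<omega>. vector_derivative (\<lambda>y. w t y \<omega>) (at x) + (v * f x) *\<^sub>R mat 1)
            (\<lambda>t. g x) (\<lambda>t \<omega>. w t x \<omega>)"
    and w_init: "\<And>x. AE \<omega> in M. w 0 x \<omega> = \<Sigma>\<^sub>0"
    using spde unfolding spde_solution_def by blast+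
  have \<eta>_paths: "AE \<omega> in M. continuous_on ({0..T} \<times> UNIV) (\<lambda>(t, x). \<eta> t x \<omega>)"
    using \<eta>_C unfolding C03_field_def by eventually_elim (rule C03_imp)
  have w_paths: "AE \<omega> in M. continuous_on ({0..T} \<times> UNIV) (\<lambda>(t, x). w t x \<omega>)"
    using w_C unfolding C03_field_def by eventually_elim (rule C03_imp)
  have f': "continuous_on A (\<lambda>p. f (k p))" if "continuous_on A k" for A and k :: "real \<times> real \<Rightarrow> real"
    by (rule continuous_on_compose2[OF f that]) auto
  have g': "continuous_on A (\<lambda>p. g (k p))" if "continuous_on A k" for A and k :: "'c :: topological_space \<Rightarrow> real"
    by (rule continuous_on_compose2[OF g that]) auto
  \<comment> \<open>One statement for both fields: c = 1 follows w along its line, c = 0 keeps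
    \<eta> at a fixed place.\<close>
  have shifted: "continuous_on {0..T} (\<lambda>t. \<psi> t (x - c * t))"
    if "continuous_on ({0..T} \<times> UNIV) (\<lambda>(t, x). \<psi> t x)" for \<psi> :: "real \<Rightarrow> real \<Rightarrow> real ^ 'p ^ 'p" and x c
  proof -
    have "continuous_on {0..T} (\<lambda>t. case (t, x - c * t) of (t, x) \<Rightarrow> \<psi> t x)"
      by (rule continuous_on_compose2[OF that]) (auto intro!: continuous_intros)
    then show ?thesis by simp
  qed
  have eq: "AE \<omega> in M. \<forall>t\<in>{0..T}. w t (x - t) \<omega> = \<eta> t x \<omega>" for x
  proof (rule ito_equation_unique[OF W T _ \<eta>_sol])
    have "solves_ito_equation M F T W
      (\<lambda>s \<omega>. (vector_derivative (\<lambda>y. w s y \<omega>) (at (x + (-1) * s)) + (v * f (x + (-1) * s)) *\<^sub>R mat 1)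
        + (-1) *\<^sub>R vector_derivative (\<lambda>y. w s y \<omega>) (at (x + (-1) * s)))
      (\<lambda>s. g (x + (-1) * s)) (\<lambda>t \<omega>. w t (x + (-1) * t) \<omega>)"
    proof (rule shifted_solution[OF W T w_C w_SPD w_sol, where c = "-1"])
      show "AE \<omega> in M. continuous_on ({0..T} \<times> UNIV)
          (\<lambda>(s, y). vector_derivative (\<lambda>y. w s y \<omega>) (at y) + (v * f y) *\<^sub>R mat 1)"
        using w_C unfolding C03_field_def
      proof eventually_elim
        case (elim \<omega>)
        have "continuous_on ({0..T} \<times> UNIV) (\<lambda>p. (case p of (s, y) \<Rightarrow> vector_derivative (\<lambda>y. w s y \<omega>) (at y)) + (v * f (snd p)) *\<^sub>R mat 1)"
          by (intro continuous_intros f' C03_imp(2)[OF elim])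
        then show ?case by (simp add: case_prod_beta')
      qed
      have "continuous_on ({0..T} \<times> UNIV) (\<lambda>p. g (snd p))"
        by (intro continuous_intros g')
      then show "continuous_on ({0..T} \<times> UNIV) (\<lambda>(s, y). g y)"
        by (simp add: case_prod_beta')
    qed
    then show "solves_ito_equation M F T W (\<lambda>t \<omega>. (v * f (x - t)) *\<^sub>R mat 1) (\<lambda>t. g (x - t)) (\<lambda>t \<omega>. w t (x - t) \<omega>)"
      by simp
    show "AE \<omega> in M. continuous_on {0..T} (\<lambda>t. w t (x - t) \<omega>)"
      using w_paths by eventually_elim (use shifted[of _ x 1] in simp)
    show "AE \<omega> in M. continuous_on {0..T} (\<lambda>t. \<eta> t x \<omega>)"
      using \<eta>_paths by eventually_elim (use shifted[of _ x 0] in simp)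
    show "AE \<omega> in M. \<forall>t\<in>{0..T}. w t (x - t) \<omega> \<in> SPD"
      using w_SPD unfolding SPD_valued_def by eventually_elim blast
    show "AE \<omega> in M. \<forall>t\<in>{0..T}. \<eta> t x \<omega> \<in> SPD"
      using \<eta>_SPD unfolding SPD_valued_def by eventually_elim blast
    show "continuous_on {0..T} (\<lambda>t. g (x - t))" by (intro continuous_intros g')
    show "AE \<omega> in M. w 0 (x - 0) \<omega> = \<eta> 0 x \<omega>"
      using w_init[of x] \<eta>_init[of x] by eventually_elim simp
  qed
  have "AE \<omega> in M. \<forall>x\<in>\<rat>. \<forall>t\<in>{0..T}. w t (x - t) \<omega> = \<eta> t x \<omega>"
    using eq by (subst AE_ball_countable) (auto simp: countable_rat)
  then show ?thesis
    using \<eta>_paths w_paths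
  proof eventually_elim
    case (elim \<omega>)
    show ?case
    proof (intro ballI allI)
      fix t x assume t: "t \<in> {0..T}"
      have slice: "continuous_on UNIV (\<lambda>y. \<psi> t (y - c))"
        if "continuous_on ({0..T} \<times> UNIV) (\<lambda>(t, x). \<psi> t x)" for \<psi> :: "real \<Rightarrow> real \<Rightarrow> real ^ 'p ^ 'p" and c
      proof -
        have "continuous_on UNIV (\<lambda>y. case (t, y - c) of (t, x) \<Rightarrow> \<psi> t x)"
          by (rule continuous_on_compose2[OF that]) (use t in \<open>auto intro!: continuous_intros\<close>)
        then show ?thesis by simp
      qed
      \<comment> \<open>The variable y is the label of the line, for which the exceptional set is
        already uniform over rationals; y = x + t returns to the coordinates of w.\<close>
      have "(\<lambda>y. w t (y - t) \<omega>) = (\<lambda>y. \<eta> t (y - 0) \<omega>)"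
        by (rule eq_UNIV_if_eq_on_rationals) (use slice[OF elim(3), of t] slice[OF elim(2), of 0] elim(1) t in simp_all)
      from fun_cong[OF this, of "x + t"] show "w t x \<omega> = \<eta> t (x + t) \<omega>" by simp
    qed
  qed
qed

end

theorem theorem4p3:
  fixes M :: "'a measure" and F :: "real \<Rightarrow> 'a measure"
    and W :: "real \<Rightarrow> 'a \<Rightarrow> real ^ 'p ^ 'p"
    and H \<epsilon> v T :: real and a b :: "nat \<Rightarrow> real" and f g :: "real \<Rightarrow> real"
    and \<Sigma>\<^sub>0 :: "real ^ 'p ^ 'p"
    and \<eta> u :: "real \<Rightarrow> real \<Rightarrow> 'a \<Rightarrow> real ^ 'p ^ 'p"
  defines "f \<equiv> f_fun H \<epsilon> a b" and "g \<equiv> g_fun H \<epsilon> a b"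
    and "u \<equiv> \<lambda>t x. \<eta> t (x + t)"
  assumes "filtered_prob_space_usual M F"
    and "brownian_matrix M F W"
    and "0 < H" and "H < 1" and "0 < \<epsilon>" and "\<epsilon> < 1"
    and "matching_coeffs H \<epsilon> a b"
    and "v \<ge> real CARD('p) + 1"
    and "\<Sigma>\<^sub>0 \<in> SPD"
    and "T > 0"
    and "eta_solution M F T W v f g \<Sigma>\<^sub>0 \<eta>"
    and "C03_field M T \<eta>"
  shows "spde_solution M F T W v f g \<Sigma>\<^sub>0 u \<and>
    regular_field M F T u \<and>
    (\<forall>w. spde_solution M F T W v f g \<Sigma>\<^sub>0 w \<and> regular_field M F T w \<longrightarrow>
       (AE \<omega> in M. \<forall>t\<in>{0..T}. \<forall>x. w t x \<omega> = u t x \<omega>))"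
proof -
  interpret filtered_prob_space_usual M F by fact
  have g: "continuous_on UNIV g"
    unfolding g_def by (rule continuous_g_fun) fact+
  have f: "continuous_on UNIV f"
    using continuous_on_power[OF g, of 2] by (simp add: f_def f_fun_def[abs_def] g_def)
  note assumptions = \<open>brownian_matrix M F W\<close> \<open>T > 0\<close> f g \<open>eta_solution M F T W v f g \<Sigma>\<^sub>0 \<eta>\<close> \<open>C03_field M T \<eta>\<close>
  show ?thesis
    using transported_solution[OF assumptions] transported_solution_unique[OF assumptions]
    unfolding u_def regular_field_def by blast
qed

end
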